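(* Assume that $a_0,a_1$ are bounded on $V\times V$, that $a_0(v,v)\ge 0$ for all $v\in V$ (no positive lower bound is assumed), that $a_1(v,v)\ge\beta|v|_V^2$ for all $v\in V$ with some $\beta>0$, and that $0<M_0=\nu([0,\infty))<\infty$. For $u_0\in H$ and $f\in L^1(0,T;H)$ let $(u,\zeta)\in C([0,T];\mathcal W)$ be the mild solution of $X'=\mathcal AX+(f,0)$, $X(0)=(u_0,0)$ (zero initial memory). Then $(u,\zeta)\in\mathfrak G_\nu(0,T)$, and the data-to-solution map $$H\times L^1(0,T;H)\to\mathfrak G_\nu(0,T),\qquad (u_0,f)\mapsto(u,\zeta),$$ is Lipschitz continuous. More precisely, $$\|(u,\zeta)\|_{\mathfrak G_\nu(0,T)}\le\|u_0\|_H+\|f\|_{L^1(0,T;H)},$$ and for two data sets $(u_{0,1},f_1)$, $(u_{0,2},f_2)$ with solutions $(u_1,\zeta_1)$, $(u_2,\zeta_2)$, $$\|(u_1-u_2,\zeta_1-\zeta_2)\|_{\mathfrak G_\nu(0,T)}\le\|u_{0,1}-u_{0,2}\|_H+\|f_1-f_2\|_{L^1(0,T;H)}.$$ Hence the problem is well posed in the sense of Hadamard (existence, uniqueness, continuous dependence on the data) in the memory graph space.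
   Context: Setting. $\Omega\subset\mathbb R^d$, $d\in\{1,2,3\}$, is a bounded Lipschitz domain; $H=L^2(\Omega)$, $V=H^1_0(\Omega)$ (real spaces), $|v|_V=\|\nabla v\|_{L^2(\Omega)}$, $\|v\|_V^2=\|v\|_H^2+|v|_V^2$; $H$ is identified with a subspace of $V'$; $T>0$ is fixed. $A_0,A_1\in L^\infty(\Omega)^{d\times d}$ are symmetric matrix fields, $A_1$ pointwise positive semidefinite a.e., $a_i(w,v)=\int_\Omega A_i\nabla w\cdot\nabla v\,dx$, and $\mathsf A_i:V\to V'$ is given by $\langle\mathsf A_iw,v\rangle=a_i(w,v)$, $i=0,1$. $\nu$ is a non-zero non-negative Borel measure on $[0,\infty)$, the Bernstein representing measure of the completely monotone kernel $k(t)=\int_{[0,\infty)}e^{-\lambda t}\,d\nu(\lambda)$. Spaces and operators. $\mathcal K$ is the Hilbert space of strongly $\nu$-measurable $\zeta:[0,\infty)\to V$ with $\|\zeta\|_{\mathcal K}^2=\int_{[0,\infty)}a_1(\zeta(\lambda),\zeta(\lambda))\,d\nu(\lambda)<\infty$; $\mathcal W=H\times\mathcal K$ with $\|(u,\zeta)\|_{\mathcal W}^2=\|u\|_H^2+\|\zeta\|_{\mathcal K}^2$. $J:\mathcal K\to V$, $J\zeta=\int\zeta\,d\nu$; $E:V\to\mathcal K$, $(Eu)(\lambda)=u$; $(\Lambda\zeta)(\lambda)=\lambda\zeta(\lambda)$. $\mathcal A(u,\zeta)=(-\mathsf A_0u-\mathsf A_1J\zeta,\;Eu-\Lambda\zeta)$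 with domain $D(\mathcal A)=\{(u,\zeta)\in V\times\mathcal K:\ \mathsf A_0u+\mathsf A_1J\zeta\in H,\ Eu-\Lambda\zeta\in\mathcal K\}$; under the stated assumptions $\mathcal A$ generates a contraction $C_0$-semigroup $S(t)$ on $\mathcal W$, and the mild solution is $X(t)=S(t)(u_0,0)+\int_0^tS(t-s)(f(s),0)\,ds$. Memory graph space. $\mathcal H_\nu$ is the Hilbert space of strongly $\nu$-measurable $z:[0,\infty)\to H$ with $\|z\|_{\mathcal H_\nu}^2=\int_{[0,\infty)}\|z(\lambda)\|_H^2\,d\nu(\lambda)<\infty$ ($\mathcal K$ embeds continuously into $\mathcal H_\nu$). For $u\in C([0,T];H)$, $(\mathscr Ru)(t)(\lambda)=\int_0^te^{-\lambda(t-s)}u(s)\,ds$. Then $$\mathfrak G_\nu(0,T)=\{(u,\zeta)\in C([0,T];\mathcal W):\ \zeta(t)=(\mathscr Ru)(t)\text{ in }\mathcal H_\nu\text{ for every }t\in[0,T]\},$$ with norm $\|(u,\zeta)\|_{\mathfrak G_\nu(0,T)}=\sup_{0\le t\le T}\|(u(t),\zeta(t))\|_{\mathcal W}$. *)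

theory Defs
  imports "HOL-Analysis.Analysis" "HOL-Library.Function_Algebras"
begin

section \<open>The Hilbert space of square integrable functions on Euclidean space\<close>

definition square_integrable :: "('a::euclidean_space \<Rightarrow> 'b::euclidean_space) \<Rightarrow> bool" where
  "square_integrable f \<longleftrightarrow>
     f \<in> borel_measurable lebesgue \<and> integrable lebesgue (\<lambda>x. (norm (f x))\<^sup>2)"

definition L2_rel :: "('a::euclidean_space \<Rightarrow> 'b::euclidean_space) \<Rightarrow> ('a \<Rightarrow> 'b) \<Rightarrow> bool" where
  "L2_rel f g \<longleftrightarrow>
     square_integrable f \<and> square_integrable g \<and> (AE x in lebesgue. f x = g x)"

lemma square_integrable_zero: "square_integrable (\<lambda>_. 0)"
  by (simp add: square_integrable_def)

lemma square_integrable_add: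
  assumes "square_integrable f" "square_integrable g"
  shows "square_integrable (\<lambda>x. f x + g x)"
proof -
  have [measurable]: "f \<in> borel_measurable lebesgue" "g \<in> borel_measurable lebesgue"
    using assms by (auto simp: square_integrable_def)
  have "integrable lebesgue (\<lambda>x. 2 * (norm (f x))\<^sup>2 + 2 * (norm (g x))\<^sup>2)"
    using assms by (auto simp: square_integrable_def)
  then have "integrable lebesgue (\<lambda>x. (norm (f x + g x))\<^sup>2)"
  proof (rule Bochner_Integration.integrable_bound)
    show "AE x in lebesgue. norm ((norm (f x + g x))\<^sup>2) \<le> norm (2 * (norm (f x))\<^sup>2 + 2 * (norm (g x))\<^sup>2)"
    proof (rule AE_I2)
      fix x
      have "(norm (f x + g x))\<^sup>2 \<le> (norm (f x) + norm (g x))\<^sup>2"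
        by (intro power_mono norm_triangle_ineq) auto
      also have "\<dots> \<le> 2 * (norm (f x))\<^sup>2 + 2 * (norm (g x))\<^sup>2"
        using sum_squares_bound[of "norm (f x)" "norm (g x)"] by (simp add: power2_sum)
      finally show "norm ((norm (f x + g x))\<^sup>2) \<le> norm (2 * (norm (f x))\<^sup>2 + 2 * (norm (g x))\<^sup>2)"
        by simp
    qed
  qed measurable
  then show ?thesis
    unfolding square_integrable_def by simp
qed

lemma square_integrable_scaleR:
  assumes "square_integrable f"
  shows "square_integrable (\<lambda>x. c *\<^sub>R f x)"
proof -
  have [measurable]: "f \<in> borel_measurable lebesgue"
    using assms by (simp only: square_integrable_def)
  have "integrable lebesgue (\<lambda>x. c\<^sup>2 * (norm (f x))\<^sup>2)"
    using assms by (intro integrable_mult_right) (simp only: square_integrable_def)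
  then show ?thesis
    unfolding square_integrable_def by (simp add: power_mult_distrib)
qed

lemma square_integrable_inner:
  assumes "square_integrable f" "square_integrable g"
  shows "integrable lebesgue (\<lambda>x. f x \<bullet> g x)"
proof -
  have [measurable]: "f \<in> borel_measurable lebesgue" "g \<in> borel_measurable lebesgue"
    using assms by (auto simp: square_integrable_def)
  have "integrable lebesgue (\<lambda>x. (norm (f x))\<^sup>2 + (norm (g x))\<^sup>2)"
    using assms by (auto simp: square_integrable_def)
  then show ?thesis
  proof (rule Bochner_Integration.integrable_bound)
    show "AE x in lebesgue. norm (f x \<bullet> g x) \<le> norm ((norm (f x))\<^sup>2 + (norm (g x))\<^sup>2)"
    proof (rule AE_I2)
      fix x
      have "\<bar>f x \<bullet> g x\<bar> \<le> norm (f x) * norm (g x)"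
        by (rule Cauchy_Schwarz_ineq2)
      also have "\<dots> \<le> (norm (f x))\<^sup>2 + (norm (g x))\<^sup>2"
      proof -
        have "0 \<le> norm (f x) * norm (g x)"
          by simp
        then show ?thesis
          using sum_squares_bound[of "norm (f x)" "norm (g x)"] by linarith
      qed
      finally show "norm (f x \<bullet> g x) \<le> norm ((norm (f x))\<^sup>2 + (norm (g x))\<^sup>2)"
        by simp
    qed
  qed measurable
qed

lemma part_equivp_L2_rel: "part_equivp L2_rel"
proof (rule part_equivpI)
  show "\<exists>f. L2_rel f f"
    using square_integrable_zero by (auto simp: L2_rel_def)
  show "symp L2_rel"
    by (auto simp: L2_rel_def symp_def)
  show "transp L2_rel"
  proof (rule transpI)
    fix f g h
    assume fg: "L2_rel f g" and gh: "L2_rel g h"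
    have "AE x in lebesgue. f x = g x" "AE x in lebesgue. g x = h x"
      using fg gh by (auto simp: L2_rel_def)
    then have "AE x in lebesgue. f x = h x"
      by eventually_elim simp
    then show "L2_rel f h"
      using fg gh by (auto simp: L2_rel_def)
  qed
qed

quotient_type (overloaded) ('a, 'b) L2 =
  "'a::euclidean_space \<Rightarrow> 'b::euclidean_space" / partial: L2_rel
  by (rule part_equivp_L2_rel)

lemma L2_rel_refl: "L2_rel f f \<longleftrightarrow> square_integrable f"
  by (auto simp: L2_rel_def)

lemma square_integrable_rep_L2: "square_integrable (rep_L2 u)"
  using Quotient_rep_reflp[OF Quotient_L2, of u] by (simp add: L2_rel_refl)

lemma abs_rep_L2: "abs_L2 (rep_L2 u) = u"
  by (rule Quotient_abs_rep[OF Quotient_L2])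

lemma rep_abs_L2:
  assumes "square_integrable f"
  shows "AE x in lebesgue. rep_L2 (abs_L2 f) x = f x"
proof -
  have "L2_rel (rep_L2 (abs_L2 f)) f"
    using Quotient_rep_abs[OF Quotient_L2, of f] assms by (simp add: L2_rel_refl)
  then show ?thesis
    by (simp add: L2_rel_def)
qed

lemma abs_L2_eqI:
  assumes "square_integrable f" "square_integrable g" "AE x in lebesgue. f x = g x"
  shows "abs_L2 f = abs_L2 g"
  using Quotient_rel_abs[OF Quotient_L2, of f g] assms by (simp add: L2_rel_def)

lemma L2_eqI: "(AE x in lebesgue. rep_L2 u x = rep_L2 v x) \<Longrightarrow> u = v"
  using abs_L2_eqI[OF square_integrable_rep_L2 square_integrable_rep_L2, of u v]
  by (simp add: abs_rep_L2)

instantiation L2 :: (euclidean_space, euclidean_space) real_vector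
begin

definition zero_L2 :: "('a, 'b) L2" where
  "zero_L2 = abs_L2 (\<lambda>_. 0)"
definition plus_L2 :: "('a, 'b) L2 \<Rightarrow> ('a, 'b) L2 \<Rightarrow> ('a, 'b) L2" where
  "plus_L2 u v = abs_L2 (\<lambda>x. rep_L2 u x + rep_L2 v x)"
definition scaleR_L2 :: "real \<Rightarrow> ('a, 'b) L2 \<Rightarrow> ('a, 'b) L2" where
  "scaleR_L2 c u = abs_L2 (\<lambda>x. c *\<^sub>R rep_L2 u x)"
definition uminus_L2 :: "('a, 'b) L2 \<Rightarrow> ('a, 'b) L2" where
  "uminus_L2 u = (-1) *\<^sub>R u"
definition minus_L2 :: "('a, 'b) L2 \<Rightarrow> ('a, 'b) L2 \<Rightarrow> ('a, 'b) L2" where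
  "minus_L2 u v = u + (-1) *\<^sub>R v"

lemma rep_zero_L2: "AE x in lebesgue. rep_L2 (0 :: ('a, 'b) L2) x = 0"
  unfolding zero_L2_def by (intro rep_abs_L2 square_integrable_zero)

lemma rep_plus_L2:
  fixes u v :: "('a, 'b) L2"
  shows "AE x in lebesgue. rep_L2 (u + v) x = rep_L2 u x + rep_L2 v x"
  unfolding plus_L2_def
  by (intro rep_abs_L2 square_integrable_add square_integrable_rep_L2)

lemma rep_scaleR_L2:
  fixes u :: "('a, 'b) L2"
  shows "AE x in lebesgue. rep_L2 (c *\<^sub>R u) x = c *\<^sub>R rep_L2 u x"
  unfolding scaleR_L2_def
  by (intro rep_abs_L2 square_integrable_scaleR square_integrable_rep_L2)

lemma rep_uminus_L2:
  fixes u :: "('a, 'b) L2"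
  shows "AE x in lebesgue. rep_L2 (- u) x = - rep_L2 u x"
  using rep_scaleR_L2[of "-1" u] unfolding uminus_L2_def by simp

lemma rep_minus_L2:
  fixes u v :: "('a, 'b) L2"
  shows "AE x in lebesgue. rep_L2 (u - v) x = rep_L2 u x - rep_L2 v x"
  unfolding minus_L2_def
  using rep_plus_L2[of u "(-1) *\<^sub>R v"] rep_scaleR_L2[of "-1" v] by eventually_elim simp

instance
proof
  fix u v w :: "('a, 'b) L2" and a b :: real
  show "u + v + w = u + (v + w)"
  proof (rule L2_eqI)
    show "AE x in lebesgue. rep_L2 (u + v + w) x = rep_L2 (u + (v + w)) x"
      using rep_plus_L2[of "u + v" w] rep_plus_L2[of u v] rep_plus_L2[of u "v + w"] rep_plus_L2[of v w]
      by eventually_elim (simp add: add.assoc)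
  qed
  show "u + v = v + u"
    by (simp add: plus_L2_def add.commute)
  show "0 + u = u"
  proof (rule L2_eqI)
    show "AE x in lebesgue. rep_L2 (0 + u) x = rep_L2 u x"
      using rep_plus_L2[of 0 u] rep_zero_L2 by eventually_elim simp
  qed
  show "- u + u = 0"
  proof (rule L2_eqI)
    show "AE x in lebesgue. rep_L2 (- u + u) x = rep_L2 0 x"
      using rep_plus_L2[of "- u" u] rep_zero_L2 rep_uminus_L2[of u] by eventually_elim simp
  qed
  show "u - v = u + - v"
    by (simp add: minus_L2_def uminus_L2_def)
  show "a *\<^sub>R (u + v) = a *\<^sub>R u + a *\<^sub>R v"
  proof (rule L2_eqI)
    show "AE x in lebesgue. rep_L2 (a *\<^sub>R (u + v)) x = rep_L2 (a *\<^sub>R u + a *\<^sub>R v) x"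
      using rep_plus_L2[of u v] rep_plus_L2[of "a *\<^sub>R u" "a *\<^sub>R v"] rep_scaleR_L2[of a "u + v"]
        rep_scaleR_L2[of a u] rep_scaleR_L2[of a v]
      by eventually_elim (simp add: scaleR_add_right)
  qed
  show "(a + b) *\<^sub>R u = a *\<^sub>R u + b *\<^sub>R u"
  proof (rule L2_eqI)
    show "AE x in lebesgue. rep_L2 ((a + b) *\<^sub>R u) x = rep_L2 (a *\<^sub>R u + b *\<^sub>R u) x"
      using rep_plus_L2[of "a *\<^sub>R u" "b *\<^sub>R u"] rep_scaleR_L2[of "a + b" u]
        rep_scaleR_L2[of a u] rep_scaleR_L2[of b u]
      by eventually_elim (simp add: scaleR_add_left)
  qed
  show "a *\<^sub>R b *\<^sub>R u = (a * b) *\<^sub>R u"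
  proof (rule L2_eqI)
    show "AE x in lebesgue. rep_L2 (a *\<^sub>R b *\<^sub>R u) x = rep_L2 ((a * b) *\<^sub>R u) x"
      using rep_scaleR_L2[of a "b *\<^sub>R u"] rep_scaleR_L2[of b u] rep_scaleR_L2[of "a * b" u]
      by eventually_elim simp
  qed
  show "1 *\<^sub>R u = u"
  proof (rule L2_eqI)
    show "AE x in lebesgue. rep_L2 (1 *\<^sub>R u) x = rep_L2 u x"
      using rep_scaleR_L2[of 1 u] by eventually_elim simp
  qed
qed

end

instantiation L2 :: (euclidean_space, euclidean_space) real_inner
begin

definition inner_L2 :: "('a, 'b) L2 \<Rightarrow> ('a, 'b) L2 \<Rightarrow> real" where
  "inner_L2 u v = (\<integral>x. rep_L2 u x \<bullet> rep_L2 v x \<partial>lebesgue)"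
definition norm_L2 :: "('a, 'b) L2 \<Rightarrow> real" where
  "norm_L2 u = sqrt (u \<bullet> u)"
definition sgn_L2 :: "('a, 'b) L2 \<Rightarrow> ('a, 'b) L2" where
  "sgn_L2 u = inverse (norm u) *\<^sub>R u"
definition dist_L2 :: "('a, 'b) L2 \<Rightarrow> ('a, 'b) L2 \<Rightarrow> real" where
  "dist_L2 u v = norm (u - v)"
definition uniformity_L2 :: "(('a, 'b) L2 \<times> ('a, 'b) L2) filter" where
  "uniformity_L2 = (INF e\<in>{0 <..}. principal {(x, y). dist x y < e})"
definition open_L2 :: "('a, 'b) L2 set \<Rightarrow> bool" where
  "open_L2 U \<longleftrightarrow> (\<forall>x\<in>U. eventually (\<lambda>(x', y). x' = x \<longrightarrow> y \<in> U) uniformity)"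

lemma integrable_rep_inner_L2:
  fixes u v :: "('a, 'b) L2"
  shows "integrable lebesgue (\<lambda>x. rep_L2 u x \<bullet> rep_L2 v x)"
  by (intro square_integrable_inner square_integrable_rep_L2)

lemma borel_measurable_rep_L2 [measurable]:
  fixes u :: "('a, 'b) L2"
  shows "rep_L2 u \<in> borel_measurable lebesgue"
  using square_integrable_rep_L2[of u] by (simp add: square_integrable_def)

instance
proof
  fix u v w :: "('a, 'b) L2" and a b :: real and U :: "('a, 'b) L2 set"
  show "dist u v = norm (u - v)"
    by (simp add: dist_L2_def)
  show "sgn u = u /\<^sub>R norm u"
    by (simp add: sgn_L2_def)
  show "(uniformity :: (('a, 'b) L2 \<times> ('a, 'b) L2) filter) =
      (INF e\<in>{0 <..}. principal {(x, y). dist x y < e})"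
    by (simp add: uniformity_L2_def)
  show "open U \<longleftrightarrow> (\<forall>x\<in>U. eventually (\<lambda>(x', y). x' = x \<longrightarrow> y \<in> U) uniformity)"
    by (simp add: open_L2_def)
  show "u \<bullet> v = v \<bullet> u"
    by (simp add: inner_L2_def inner_commute)
  have "(u + v) \<bullet> w = (\<integral>x. rep_L2 u x \<bullet> rep_L2 w x + rep_L2 v x \<bullet> rep_L2 w x \<partial>lebesgue)"
    unfolding inner_L2_def
  proof (rule integral_cong_AE)
    show "AE x in lebesgue. rep_L2 (u + v) x \<bullet> rep_L2 w x =
        rep_L2 u x \<bullet> rep_L2 w x + rep_L2 v x \<bullet> rep_L2 w x"
      using rep_plus_L2[of u v] by eventually_elim (simp add: inner_add_left)
  qed measurable
  then show "(u + v) \<bullet> w = u \<bullet> w + v \<bullet> w"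
    by (simp add: inner_L2_def integrable_rep_inner_L2)
  have "(a *\<^sub>R u) \<bullet> v = (\<integral>x. a * (rep_L2 u x \<bullet> rep_L2 v x) \<partial>lebesgue)"
    unfolding inner_L2_def
  proof (rule integral_cong_AE)
    show "AE x in lebesgue. rep_L2 (a *\<^sub>R u) x \<bullet> rep_L2 v x = a * (rep_L2 u x \<bullet> rep_L2 v x)"
      using rep_scaleR_L2[of a u] by eventually_elim simp
  qed measurable
  then show "(a *\<^sub>R u) \<bullet> v = a * (u \<bullet> v)"
    by (simp add: inner_L2_def)
  show "0 \<le> u \<bullet> u"
    unfolding inner_L2_def by (rule Bochner_Integration.integral_nonneg) simp
  show "u \<bullet> u = 0 \<longleftrightarrow> u = 0"
  proof
    assume "u \<bullet> u = 0"
    then have "AE x in lebesgue. rep_L2 u x \<bullet> rep_L2 u x = 0"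
      unfolding inner_L2_def
      using integral_nonneg_eq_0_iff_AE[OF integrable_rep_inner_L2[of u u]] by simp
    then have "AE x in lebesgue. rep_L2 u x = rep_L2 0 x"
      using rep_zero_L2 by eventually_elim simp
    then show "u = 0"
      by (rule L2_eqI)
  next
    assume "u = 0"
    have "AE x in lebesgue. rep_L2 (0 :: ('a, 'b) L2) x \<bullet> rep_L2 (0 :: ('a, 'b) L2) x = 0"
      using rep_zero_L2 by eventually_elim simp
    then have "(0 :: ('a, 'b) L2) \<bullet> 0 = (\<integral>x. 0 \<partial>(lebesgue :: 'a measure))"
      unfolding inner_L2_def by (intro integral_cong_AE) (auto simp: borel_measurable_rep_L2)
    then show "u \<bullet> u = 0"
      using \<open>u = 0\<close> by simp
  qed
  show "norm u = sqrt (u \<bullet> u)"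
    by (simp add: norm_L2_def)
qed

end

lemma norm_abs_L2_diff:
  assumes f: "square_integrable f"
  shows "(norm (abs_L2 f - u))\<^sup>2 = (\<integral>x. (norm (f x - rep_L2 u x))\<^sup>2 \<partial>lebesgue)"
proof -
  have [measurable]: "f \<in> borel_measurable lebesgue"
    using f by (simp add: square_integrable_def)
  have "(norm (abs_L2 f - u))\<^sup>2 =
      (\<integral>x. rep_L2 (abs_L2 f - u) x \<bullet> rep_L2 (abs_L2 f - u) x \<partial>lebesgue)"
    by (simp add: power2_norm_eq_inner inner_L2_def)
  also have "\<dots> = (\<integral>x. (norm (f x - rep_L2 u x))\<^sup>2 \<partial>lebesgue)"
  proof (rule integral_cong_AE)
    show "AE x in lebesgue. rep_L2 (abs_L2 f - u) x \<bullet> rep_L2 (abs_L2 f - u) x =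
        (norm (f x - rep_L2 u x))\<^sup>2"
      using rep_minus_L2[of "abs_L2 f" u] rep_abs_L2[OF f]
      by eventually_elim (simp add: power2_norm_eq_inner)
  qed measurable
  finally show ?thesis .
qed

lemma norm_abs_L2:
  fixes f :: "'a::euclidean_space \<Rightarrow> 'b::euclidean_space"
  assumes f: "square_integrable f"
  shows "(norm (abs_L2 f))\<^sup>2 = (\<integral>x. (norm (f x))\<^sup>2 \<partial>lebesgue)"
proof -
  have [measurable]: "f \<in> borel_measurable lebesgue"
    using f by (simp add: square_integrable_def)
  have "(norm (abs_L2 f))\<^sup>2 = (\<integral>x. (norm (f x - rep_L2 0 x))\<^sup>2 \<partial>lebesgue)"
    using norm_abs_L2_diff[OF f, of 0] by simp
  also have "\<dots> = (\<integral>x. (norm (f x))\<^sup>2 \<partial>lebesgue)"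
  proof (rule integral_cong_AE)
    show "AE x in lebesgue. (norm (f x - rep_L2 0 x))\<^sup>2 = (norm (f x))\<^sup>2"
      using rep_zero_L2[where 'a='a and 'b='b] by eventually_elim simp
  qed measurable
  finally show ?thesis .
qed

lemma norm_L2_eq: "(norm u)\<^sup>2 = (\<integral>x. (norm (rep_L2 u x))\<^sup>2 \<partial>lebesgue)"
  using norm_abs_L2[OF square_integrable_rep_L2, of u] by (simp add: abs_rep_L2)

lemma abs_L2_add:
  assumes "square_integrable f" "square_integrable g"
  shows "abs_L2 (\<lambda>x. f x + g x) = abs_L2 f + abs_L2 g"
proof (rule L2_eqI)
  show "AE x in lebesgue. rep_L2 (abs_L2 (\<lambda>x. f x + g x)) x = rep_L2 (abs_L2 f + abs_L2 g) x"
    using rep_abs_L2[OF square_integrable_add[OF assms]] rep_plus_L2[of "abs_L2 f" "abs_L2 g"]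
      rep_abs_L2[OF assms(1)] rep_abs_L2[OF assms(2)]
    by eventually_elim simp
qed

lemma abs_L2_scaleR:
  assumes "square_integrable f"
  shows "abs_L2 (\<lambda>x. c *\<^sub>R f x) = c *\<^sub>R abs_L2 f"
proof (rule L2_eqI)
  show "AE x in lebesgue. rep_L2 (abs_L2 (\<lambda>x. c *\<^sub>R f x)) x = rep_L2 (c *\<^sub>R abs_L2 f) x"
    using rep_abs_L2[OF square_integrable_scaleR[OF assms, of c]] rep_scaleR_L2[of c "abs_L2 f"]
      rep_abs_L2[OF assms]
    by eventually_elim simp
qed

lemma L2_Cauchy_convergent:
  fixes X :: "nat \<Rightarrow> ('a::euclidean_space, 'b::euclidean_space) L2"
  assumes X: "Cauchy X"
  shows "convergent X"
proof -
  have "\<exists>M. \<forall>m\<ge>M. \<forall>n\<ge>M. dist (X m) (X n) < (1/2)^k" for k :: nat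
    using metric_CauchyD[OF X, of "(1/2)^k"] by simp
  then obtain M where M: "\<And>k m n. M k \<le> m \<Longrightarrow> M k \<le> n \<Longrightarrow> dist (X m) (X n) < (1/2)^k"
    by metis
  define r where "r k = (\<Sum>i\<le>k. M i) + k" for k
  have r_mono: "strict_mono r"
    by (rule strict_monoI_Suc) (simp add: r_def)
  have M_le: "M k \<le> r k" for k
    using member_le_sum[of k "{..k}" M] by (simp add: r_def)
  define Y where "Y k = X (r k)" for k
  have Y_step: "norm (Y (Suc k) - Y k) \<le> (1/2)^k" for k
  proof -
    have "r k \<le> r (Suc k)"
      using r_mono by (simp add: strict_mono_less_eq)
    then have "dist (Y (Suc k)) (Y k) < (1/2)^k"
      unfolding Y_def using M_le[of k] by (intro M) auto
    then show ?thesis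
      by (simp add: dist_norm)
  qed
  have YX: "Y = X \<circ> r"
    by (auto simp: Y_def)
  have Cauchy_Y: "Cauchy Y"
    unfolding YX by (rule Cauchy_subseq_Cauchy[OF X r_mono])

  define d where "d k x = norm (rep_L2 (Y (Suc k)) x - rep_L2 (Y k) x)" for k x
  define g where "g n x = (\<Sum>k<n. d k x)" for n x
  have sq_diff: "square_integrable (\<lambda>x. rep_L2 u x - rep_L2 v x)" for u v :: "('a, 'b) L2"
    using square_integrable_add[OF square_integrable_rep_L2[of u]
        square_integrable_scaleR[OF square_integrable_rep_L2[of v], of "-1"]] by simp
  have norm_diff: "(\<integral>x. (norm (rep_L2 u x - rep_L2 v x))\<^sup>2 \<partial>lebesgue) = (norm (u - v))\<^sup>2"
    for u v :: "('a, 'b) L2"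
    using norm_abs_L2_diff[OF square_integrable_rep_L2[of u], of v] by (simp add: abs_rep_L2)
  have d_sq: "square_integrable (d k)" for k
    using sq_diff[of "Y (Suc k)" "Y k"] unfolding square_integrable_def d_def by simp
  have d_norm: "norm (abs_L2 (d k)) \<le> (1/2)^k" for k
  proof -
    have "(norm (abs_L2 (d k)))\<^sup>2 = (norm (Y (Suc k) - Y k))\<^sup>2"
      using norm_abs_L2[OF d_sq[of k]] norm_diff[of "Y (Suc k)" "Y k"] by (simp add: d_def)
    then have "norm (abs_L2 (d k)) = norm (Y (Suc k) - Y k)"
      by simp
    then show ?thesis
      using Y_step[of k] by simp
  qed
  have g_sq: "square_integrable (g n) \<and> norm (abs_L2 (g n)) \<le> (\<Sum>k<n. (1/2)^k)" for n
  proof (induction n)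
    case 0
    have "g 0 = (\<lambda>_. 0)"
      by (simp add: g_def fun_eq_iff)
    then show ?case
      by (simp add: square_integrable_zero flip: zero_L2_def)
  next
    case (Suc n)
    have eq: "g (Suc n) = (\<lambda>x. g n x + d n x)"
      by (simp add: g_def fun_eq_iff)
    have "norm (abs_L2 (g n) + abs_L2 (d n)) \<le> norm (abs_L2 (g n)) + norm (abs_L2 (d n))"
      by (rule norm_triangle_ineq)
    also have "\<dots> \<le> (\<Sum>k<Suc n. (1/2)^k)"
      using Suc d_norm[of n] by simp
    finally show ?case
      using Suc d_sq[of n] unfolding eq by (simp add: square_integrable_add abs_L2_add)
  qed
  have g_int: "(\<integral>\<^sup>+x. ennreal ((g n x)\<^sup>2) \<partial>lebesgue) \<le> 4" for n
  proof -
    have "(\<Sum>k<n. (1/2::real)^k) \<le> 2"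
      using sum_le_suminf[of "\<lambda>k. (1/2::real)^k" "{..<n}"] by (simp add: suminf_geometric)
    then have "norm (abs_L2 (g n)) \<le> 2"
      using g_sq[of n] by linarith
    then have "(norm (abs_L2 (g n)))\<^sup>2 \<le> 2\<^sup>2"
      by (intro power_mono) auto
    then have le: "(\<integral>x. (g n x)\<^sup>2 \<partial>lebesgue) \<le> 4"
      using norm_abs_L2[of "g n"] g_sq[of n] by simp
    have "integrable lebesgue (\<lambda>x. (g n x)\<^sup>2)"
      using g_sq[of n] by (simp add: square_integrable_def)
    then have "(\<integral>\<^sup>+x. ennreal ((g n x)\<^sup>2) \<partial>lebesgue) = ennreal (\<integral>x. (g n x)\<^sup>2 \<partial>lebesgue)"
      by (intro nn_integral_eq_integral) auto
    also have "\<dots> \<le> ennreal 4"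
      using le by (rule ennreal_leI)
    finally show ?thesis
      by simp
  qed
  have d_nonneg: "0 \<le> d k x" for k x
    by (simp add: d_def)
  have g_nonneg: "0 \<le> g n x" for n x
    unfolding g_def by (intro sum_nonneg d_nonneg)
  have g_mono: "g n x \<le> g m x" if "n \<le> m" for n m x
    unfolding g_def using that d_nonneg by (intro sum_mono2) auto
  have [measurable]: "g n \<in> borel_measurable lebesgue" for n
    using g_sq[of n] by (simp add: square_integrable_def)
  have "(\<integral>\<^sup>+x. (SUP n. ennreal ((g n x)\<^sup>2)) \<partial>lebesgue) = (SUP n. \<integral>\<^sup>+x. ennreal ((g n x)\<^sup>2) \<partial>lebesgue)"
  proof (rule nn_integral_monotone_convergence_SUP)
    show "incseq (\<lambda>n x. ennreal ((g n x)\<^sup>2))"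
      by (auto simp: incseq_def le_fun_def intro!: ennreal_leI power_mono g_mono g_nonneg)
  qed measurable
  also have "\<dots> \<le> 4"
    by (intro SUP_least g_int)
  finally have "(\<integral>\<^sup>+x. (SUP n. ennreal ((g n x)\<^sup>2)) \<partial>lebesgue) \<le> 4" .
  then have "(\<integral>\<^sup>+x. (SUP n. ennreal ((g n x)\<^sup>2)) \<partial>lebesgue) \<noteq> \<infinity>"
    by (auto simp: top_unique)
  then have "AE x in lebesgue. (SUP n. ennreal ((g n x)\<^sup>2)) \<noteq> \<infinity>"
    by (intro nn_integral_PInf_AE) measurable
  then have conv: "AE x in lebesgue. convergent (\<lambda>n. rep_L2 (Y n) x)"
  proof eventually_elim
    fix x
    assume fin: "(SUP n. ennreal ((g n x)\<^sup>2)) \<noteq> \<infinity>"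
    define c where "c = enn2real (SUP n. ennreal ((g n x)\<^sup>2))"
    have c: "(SUP n. ennreal ((g n x)\<^sup>2)) = ennreal c" "0 \<le> c"
      unfolding c_def using fin by (simp_all only: ennreal_enn2real_if infinity_ennreal_def if_False enn2real_nonneg)
    have g_le: "g n x \<le> sqrt c" for n
    proof -
      have "ennreal ((g n x)\<^sup>2) \<le> ennreal c"
        unfolding c(1)[symmetric] by (rule SUP_upper) simp
      then show ?thesis
        using c(2) by (simp add: real_le_rsqrt)
    qed
    have "summable (\<lambda>k. d k x)"
    proof (rule bounded_imp_summable)
      show "0 \<le> d k x" for k
        by (rule d_nonneg)
      show "(\<Sum>k\<le>n. d k x) \<le> sqrt c" for n
        using g_le[of "Suc n"] by (simp only: g_def lessThan_Suc_atMost)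
    qed
    then have "summable (\<lambda>k. rep_L2 (Y (Suc k)) x - rep_L2 (Y k) x)"
      unfolding d_def by (rule summable_norm_cancel)
    then have "convergent (\<lambda>n. \<Sum>k<n. rep_L2 (Y (Suc k)) x - rep_L2 (Y k) x)"
      by (simp add: summable_iff_convergent)
    then have "convergent (\<lambda>n. rep_L2 (Y n) x - rep_L2 (Y 0) x)"
      by (simp add: sum_lessThan_telescope[of "\<lambda>n. rep_L2 (Y n) x"])
    then have "convergent (\<lambda>n. (rep_L2 (Y n) x - rep_L2 (Y 0) x) + rep_L2 (Y 0) x)"
      by (intro convergent_add convergent_const)
    then show "convergent (\<lambda>n. rep_L2 (Y n) x)"
      by simp
  qed
  define F where "F x = lim (\<lambda>n. rep_L2 (Y n) x)" for x
  have F_meas[measurable]: "F \<in> borel_measurable lebesgue"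
    unfolding F_def by measurable
  have F_lim: "AE x in lebesgue. (\<lambda>n. rep_L2 (Y n) x) \<longlonglongrightarrow> F x"
    using conv by eventually_elim (simp add: F_def convergent_LIMSEQ_iff)
  have Fatou: "(\<integral>\<^sup>+x. ennreal ((norm (F x - rep_L2 (Y k) x))\<^sup>2) \<partial>lebesgue) \<le> ennreal (e\<^sup>2)"
    if "0 \<le> e" and e: "\<And>m. m \<ge> K \<Longrightarrow> norm (Y m - Y k) \<le> e" for e k K
  proof -
    have "(\<integral>\<^sup>+x. ennreal ((norm (F x - rep_L2 (Y k) x))\<^sup>2) \<partial>lebesgue) =
        (\<integral>\<^sup>+x. liminf (\<lambda>m. ennreal ((norm (rep_L2 (Y m) x - rep_L2 (Y k) x))\<^sup>2)) \<partial>lebesgue)"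
    proof (rule nn_integral_cong_AE)
      show "AE x in lebesgue. ennreal ((norm (F x - rep_L2 (Y k) x))\<^sup>2) =
          liminf (\<lambda>m. ennreal ((norm (rep_L2 (Y m) x - rep_L2 (Y k) x))\<^sup>2))"
        using F_lim
      proof eventually_elim
        fix x
        assume "(\<lambda>n. rep_L2 (Y n) x) \<longlonglongrightarrow> F x"
        then have "(\<lambda>m. ennreal ((norm (rep_L2 (Y m) x - rep_L2 (Y k) x))\<^sup>2))
            \<longlonglongrightarrow> ennreal ((norm (F x - rep_L2 (Y k) x))\<^sup>2)"
          by (intro tendsto_intros tendsto_ennrealI)
        then show "ennreal ((norm (F x - rep_L2 (Y k) x))\<^sup>2) =
            liminf (\<lambda>m. ennreal ((norm (rep_L2 (Y m) x - rep_L2 (Y k) x))\<^sup>2))"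
          by (intro lim_imp_Liminf[symmetric]) auto
      qed
    qed
    also have "\<dots> \<le> liminf (\<lambda>m. \<integral>\<^sup>+x. ennreal ((norm (rep_L2 (Y m) x - rep_L2 (Y k) x))\<^sup>2) \<partial>lebesgue)"
      by (rule nn_integral_liminf) measurable
    also have "\<dots> \<le> liminf (\<lambda>m::nat. ennreal (e\<^sup>2))"
    proof (intro Liminf_mono eventually_sequentiallyI)
      fix m assume "K \<le> m"
      have "(\<integral>\<^sup>+x. ennreal ((norm (rep_L2 (Y m) x - rep_L2 (Y k) x))\<^sup>2) \<partial>lebesgue) =
          ennreal (\<integral>x. (norm (rep_L2 (Y m) x - rep_L2 (Y k) x))\<^sup>2 \<partial>lebesgue)"
        using sq_diff[of "Y m" "Y k"]
        by (intro nn_integral_eq_integral) (auto simp: square_integrable_def)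
      also have "\<dots> \<le> ennreal (e\<^sup>2)"
        unfolding norm_diff using e[OF \<open>K \<le> m\<close>] by (intro ennreal_leI power_mono) auto
      finally show "(\<integral>\<^sup>+x. ennreal ((norm (rep_L2 (Y m) x - rep_L2 (Y k) x))\<^sup>2) \<partial>lebesgue) \<le> ennreal (e\<^sup>2)" .
    qed
    also have "\<dots> = ennreal (e\<^sup>2)"
      by (simp add: Liminf_const)
    finally show ?thesis .
  qed
  have sq_F_diff: "square_integrable (\<lambda>x. F x - rep_L2 (Y k) x)"
    if "0 \<le> e" and e: "\<And>m. m \<ge> K \<Longrightarrow> norm (Y m - Y k) \<le> e" for e k K
  proof -
    have "integrable lebesgue (\<lambda>x. (norm (F x - rep_L2 (Y k) x))\<^sup>2)"
    proof (rule integrableI_bounded)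
      show "(\<integral>\<^sup>+x. ennreal (norm ((norm (F x - rep_L2 (Y k) x))\<^sup>2)) \<partial>lebesgue) < \<infinity>"
        using le_less_trans[OF Fatou[OF that] ennreal_less_top] by simp
    qed measurable
    moreover have "(\<lambda>x. F x - rep_L2 (Y k) x) \<in> borel_measurable lebesgue"
      by measurable
    ultimately show ?thesis
      by (simp add: square_integrable_def)
  qed
  have ev: "\<exists>K. \<forall>k\<ge>K. \<forall>m\<ge>K. norm (Y m - Y k) \<le> e" if "0 < e" for e
    using metric_CauchyD[OF Cauchy_Y that] by (fastforce simp: dist_norm intro: less_imp_le)
  have F_sq: "square_integrable F"
  proof -
    obtain K where "\<And>k m. k \<ge> K \<Longrightarrow> m \<ge> K \<Longrightarrow> norm (Y m - Y k) \<le> 1"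
      using ev[of 1] by auto
    then have "square_integrable (\<lambda>x. F x - rep_L2 (Y K) x)"
      by (intro sq_F_diff[of 1 K]) auto
    from square_integrable_add[OF this square_integrable_rep_L2[of "Y K"]] show ?thesis
      by simp
  qed
  have "Y \<longlonglongrightarrow> abs_L2 F"
  proof (rule LIMSEQ_I)
    fix e :: real assume "0 < e"
    then obtain K where K: "\<And>k m. k \<ge> K \<Longrightarrow> m \<ge> K \<Longrightarrow> norm (Y m - Y k) \<le> e / 2"
      using ev[of "e / 2"] by auto
    show "\<exists>K. \<forall>k\<ge>K. norm (Y k - abs_L2 F) < e"
    proof (intro exI allI impI)
      fix k assume k: "K \<le> k"
      have int: "integrable lebesgue (\<lambda>x. (norm (F x - rep_L2 (Y k) x))\<^sup>2)"
        using sq_F_diff[of "e / 2" K k] K[OF k] \<open>0 < e\<close> by (simp add: square_integrable_def)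
      have "ennreal ((norm (abs_L2 F - Y k))\<^sup>2) =
          (\<integral>\<^sup>+x. ennreal ((norm (F x - rep_L2 (Y k) x))\<^sup>2) \<partial>lebesgue)"
        unfolding norm_abs_L2_diff[OF F_sq] using int by (intro nn_integral_eq_integral[symmetric]) auto
      also have "\<dots> \<le> ennreal ((e / 2)\<^sup>2)"
        using K[OF k] \<open>0 < e\<close> by (intro Fatou[of _ K]) auto
      finally have "(norm (abs_L2 F - Y k))\<^sup>2 \<le> (e / 2)\<^sup>2"
        by (simp add: ennreal_le_iff)
      then have "norm (abs_L2 F - Y k) \<le> e / 2"
        using \<open>0 < e\<close> by (auto intro: power2_le_imp_le[of _ "e / 2"])
      then show "norm (Y k - abs_L2 F) < e"
        using \<open>0 < e\<close> by (simp add: norm_minus_commute)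
    qed
  qed
  then have "X \<longlonglongrightarrow> abs_L2 F"
    using Cauchy_converges_subseq[OF X r_mono] unfolding YX by blast
  then show ?thesis
    by (rule convergentI)
qed

instance L2 :: (euclidean_space, euclidean_space) complete_space
  by standard (rule L2_Cauchy_convergent)

instance L2 :: (euclidean_space, euclidean_space) banach ..

lemma subspace_closure_rational:
  fixes D :: "'v::real_normed_vector set"
  assumes zero: "0 \<in> D"
    and add: "\<And>x y. x \<in> D \<Longrightarrow> y \<in> D \<Longrightarrow> x + y \<in> D"
    and scale: "\<And>q x. q \<in> \<rat> \<Longrightarrow> x \<in> D \<Longrightarrow> q *\<^sub>R x \<in> D"
  shows "subspace (closure D)"
proof (rule subspaceI)
  show "0 \<in> closure D"
    using zero closure_subset by blast
next
  fix x y assume "x \<in> closure D" "y \<in> closure D"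
  then obtain f g where f: "\<And>n. f n \<in> D" "f \<longlonglongrightarrow> x" and g: "\<And>n. g n \<in> D" "g \<longlonglongrightarrow> y"
    unfolding closure_sequential by blast
  have "(\<lambda>n. f n + g n) \<longlonglongrightarrow> x + y"
    by (intro tendsto_add f g)
  then show "x + y \<in> closure D"
    unfolding closure_sequential using add[OF f(1) g(1)]
    by (intro exI[of _ "\<lambda>n. f n + g n"]) auto
next
  fix c :: real and x assume "x \<in> closure D"
  then obtain f where f: "\<And>n. f n \<in> D" "f \<longlonglongrightarrow> x"
    unfolding closure_sequential by blast
  have "c \<in> closure \<rat>"
    by (simp add: Rats_closure_real)
  then obtain q where q: "\<And>n. q n \<in> \<rat>" "q \<longlonglongrightarrow> c"
    unfolding closure_sequential by blast
  have "(\<lambda>n. q n *\<^sub>R f n) \<longlonglongrightarrow> c *\<^sub>R x"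
    by (intro tendsto_scaleR f q)
  then show "c *\<^sub>R x \<in> closure D"
    unfolding closure_sequential using scale[OF q(1) f(1)]
    by (intro exI[of _ "\<lambda>n. q n *\<^sub>R f n"]) auto
qed

lemma countable_subbasis_of_total:
  fixes G :: "'v::real_normed_vector set"
  assumes G: "countable G" and total: "closure (span G) = UNIV"
  shows "\<exists>B::'v set set. countable B \<and> open = generate_topology B"
proof -
  define D where "D = (\<lambda>ps. \<Sum>p\<leftarrow>ps. fst p *\<^sub>R snd p) ` lists (\<rat> \<times> G)"
  have "countable D"
    unfolding D_def by (intro countable_image countable_lists countable_SIGMA G countable_rat)
  have "subspace (closure D)"
  proof (rule subspace_closure_rational)
    show "0 \<in> D"
      unfolding D_def by (rule image_eqI[of _ _ "[]"]) auto
  next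
    fix x y assume "x \<in> D" "y \<in> D"
    then obtain ps qs where "ps \<in> lists (\<rat> \<times> G)" "x = (\<Sum>p\<leftarrow>ps. fst p *\<^sub>R snd p)"
        "qs \<in> lists (\<rat> \<times> G)" "y = (\<Sum>p\<leftarrow>qs. fst p *\<^sub>R snd p)"
      unfolding D_def by blast
    then show "x + y \<in> D"
      unfolding D_def by (intro image_eqI[of _ _ "ps @ qs"]) auto
  next
    fix q :: real and x assume q: "q \<in> \<rat>" and "x \<in> D"
    then obtain ps where ps: "ps \<in> lists (\<rat> \<times> G)" "x = (\<Sum>p\<leftarrow>ps. fst p *\<^sub>R snd p)"
      unfolding D_def by blast
    have "q *\<^sub>R (\<Sum>p\<leftarrow>ps. fst p *\<^sub>R snd p) =
        (\<Sum>p\<leftarrow>map (\<lambda>p. (q * fst p, snd p)) ps. fst p *\<^sub>R snd p)"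
      by (induction ps) (auto simp: scaleR_add_right)
    moreover have "map (\<lambda>p. (q * fst p, snd p)) ps \<in> lists (\<rat> \<times> G)"
      using ps(1) q by (auto simp: in_lists_conv_set)
    ultimately show "q *\<^sub>R x \<in> D"
      unfolding D_def ps(2) by (rule image_eqI)
  qed
  moreover have "G \<subseteq> closure D"
  proof
    fix x assume "x \<in> G"
    then have "x \<in> D"
      unfolding D_def by (intro image_eqI[of _ _ "[(1, x)]"]) auto
    then show "x \<in> closure D"
      using closure_subset by blast
  qed
  ultimately have "span G \<subseteq> closure D"
    by (intro span_minimal)
  then have D_dense: "closure D = UNIV"
    using closure_minimal[of "span G" "closure D"] total by auto

  define B where "B = (\<lambda>(x, n). ball x (inverse (Suc n))) ` (D \<times> (UNIV :: nat set))"
  have "countable B"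
    unfolding B_def using \<open>countable D\<close> by (intro countable_image countable_SIGMA) auto
  moreover have "topological_basis B"
  proof (rule topological_basisI)
    show "open b" if "b \<in> B" for b
      using that by (auto simp: B_def)
    fix U :: "'v set" and x assume "open U" "x \<in> U"
    then obtain e where e: "0 < e" "ball x e \<subseteq> U"
      by (auto simp: open_contains_ball)
    then obtain n where n: "inverse (real (Suc n)) < e / 2"
      using reals_Archimedean[of "e / 2"] by auto
    have "x \<in> closure D"
      by (simp add: D_dense)
    then obtain y where y: "y \<in> D" "dist y x < inverse (real (Suc n))"
      unfolding closure_approachable by (auto dest!: spec[of _ "inverse (real (Suc n))"])
    have "ball y (inverse (real (Suc n))) \<subseteq> U"
    proof
      fix z assume z: "z \<in> ball y (inverse (real (Suc n)))"
      have "dist x z \<le> dist y x + dist y z"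
        by (metis dist_commute dist_triangle)
      then have "dist x z < e"
        using z y(2) n unfolding mem_ball by linarith
      then show "z \<in> U"
        using e(2) by auto
    qed
    moreover have "x \<in> ball y (inverse (real (Suc n)))"
      using y(2) by simp
    moreover have "ball y (inverse (real (Suc n))) \<in> B"
      unfolding B_def using y(1) by (intro image_eqI[of _ _ "(y, n)"]) auto
    ultimately show "\<exists>b\<in>B. x \<in> b \<and> b \<subseteq> U"
      by blast
  qed
  then have "open = generate_topology B"
    by (rule topological_basis_imp_subbasis)
  ultimately show ?thesis
    by blast
qed

lemma square_integrable_indicator:
  fixes b :: "'b::euclidean_space"
  assumes E: "E \<in> lmeasurable"
  shows "square_integrable (\<lambda>x. indicator E x *\<^sub>R b)"
proof -
  have [measurable]: "E \<in> sets lebesgue" and fin: "emeasure lebesgue E < \<infinity>"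
    using fmeasurableD[OF E] fmeasurableD2[OF E] by (simp_all add: less_top)
  have "integrable lebesgue (\<lambda>x. (norm b)\<^sup>2 * indicator E x :: real)"
    using fin by (intro integrable_mult_right integrable_real_indicator) auto
  moreover have "(norm (indicator E x *\<^sub>R b))\<^sup>2 = (norm b)\<^sup>2 * indicator E x" for x
    by (simp add: indicator_def)
  ultimately show ?thesis
    unfolding square_integrable_def by simp
qed

lemma norm_indicator_diff:
  fixes b :: "'b::euclidean_space" and E F :: "'a::euclidean_space set"
  assumes E: "E \<in> lmeasurable" and F: "F \<in> lmeasurable" and sub: "F \<subseteq> E" and b: "norm b = 1"
  shows "(norm (abs_L2 (\<lambda>x. indicator E x *\<^sub>R b) - abs_L2 (\<lambda>x. indicator F x *\<^sub>R b)))\<^sup>2 =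
    measure lebesgue (E - F)"
proof -
  have EF: "E - F \<in> lmeasurable"
    using E fmeasurableD[OF F] by (rule fmeasurable_Diff)
  have "abs_L2 (\<lambda>x. indicator E x *\<^sub>R b) =
      abs_L2 (\<lambda>x. indicator (E - F) x *\<^sub>R b + indicator F x *\<^sub>R b)"
    by (rule arg_cong[of _ _ abs_L2]) (use sub in \<open>auto simp: indicator_def fun_eq_iff\<close>)
  also have "\<dots> = abs_L2 (\<lambda>x. indicator (E - F) x *\<^sub>R b) + abs_L2 (\<lambda>x. indicator F x *\<^sub>R b)"
    by (intro abs_L2_add square_integrable_indicator EF F)
  finally have "(norm (abs_L2 (\<lambda>x. indicator E x *\<^sub>R b) - abs_L2 (\<lambda>x. indicator F x *\<^sub>R b)))\<^sup>2 =
      (norm (abs_L2 (\<lambda>x. indicator (E - F) x *\<^sub>R b)))\<^sup>2"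
    by simp
  also have "\<dots> = (\<integral>x. (norm (indicator (E - F) x *\<^sub>R b))\<^sup>2 \<partial>lebesgue)"
    by (intro norm_abs_L2 square_integrable_indicator EF)
  also have "\<dots> = (\<integral>x. indicator (E - F) x \<partial>lebesgue)"
    by (rule Bochner_Integration.integral_cong) (auto simp: indicator_def b)
  also have "\<dots> = measure lebesgue (E - F)"
    by simp
  finally show ?thesis .
qed

lemma ex_total_countable_L2:
  "\<exists>G :: ('a::euclidean_space, 'b::euclidean_space) L2 set. countable G \<and> closure (span G) = UNIV"
proof -
  obtain \<B> :: "'a set set" where \<B>: "countable \<B>" "topological_basis \<B>"
    using ex_countable_basis by blast
  have \<B>_open: "open (\<Union>\<F>)" if "\<F> \<subseteq> \<B>" for \<F>
    using that \<B>(2) by (auto simp: topological_basis_def)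
  define Q where "Q = {\<F>. finite \<F> \<and> \<F> \<subseteq> \<B>}"
  define G where "G = (\<lambda>(\<F>, b). abs_L2 (\<lambda>x. indicator (\<Union>\<F>) x *\<^sub>R b) :: ('a, 'b) L2) `
    ({\<F> \<in> Q. \<Union>\<F> \<in> lmeasurable} \<times> Basis)"
  have "countable Q"
    unfolding Q_def by (rule countable_Collect_finite_subset[OF \<B>(1)])
  then have "countable {\<F> \<in> Q. \<Union>\<F> \<in> lmeasurable}"
    by (rule countable_subset[rotated]) blast
  then have G_countable: "countable G"
    unfolding G_def by (intro countable_image countable_SIGMA) (auto intro: countable_finite)
  define S where "S = closure (span G)"
  have S_subspace: "subspace S"
    unfolding S_def
    by (intro subspace_closure_rational span_zero span_add span_scale)
  have S_closed: "closed S"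
    by (simp add: S_def)
  have S_limit: "u \<in> S" if "\<And>e. 0 < e \<Longrightarrow> \<exists>v\<in>S. norm (u - v) < e" for u
  proof -
    have "u \<in> closure S"
      unfolding closure_approachable using that by (fastforce simp: dist_norm norm_minus_commute)
    then show ?thesis
      using S_closed by simp
  qed

  have indicator_open: "abs_L2 (\<lambda>x. indicator U x *\<^sub>R b) \<in> S"
    if U: "open U" "U \<in> lmeasurable" and b: "b \<in> Basis" for U and b :: 'b
  proof -
    obtain C where C: "C \<subseteq> \<B>" "\<Union>C = U"
      using \<B>(2) U(1) unfolding topological_basis_def by blast
    define C' where "C' = insert {} C"
    have C': "countable C'" "C' \<noteq> {}" "\<Union>C' = U"
      using C countable_subset[OF _ \<B>(1)] by (auto simp: C'_def)
    define c where "c = from_nat_into C'"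
    have range_c: "range c = C'"
      unfolding c_def using C' by (simp add: range_from_nat_into)
    define E where "E n = (\<Union>i\<le>n. c i)" for n :: nat
    have E_U: "E n \<subseteq> U" for n
      using range_c C'(3) by (auto simp: E_def)
    have E_Union: "\<exists>\<F>\<in>Q. E n = \<Union>\<F>" for n
    proof (intro bexI)
      show "E n = \<Union>(c ` {..n} - {{}})"
        by (auto simp: E_def)
      have "c ` {..n} \<subseteq> insert {} \<B>"
        using range_c C(1) unfolding C'_def by blast
      then show "c ` {..n} - {{}} \<in> Q"
        by (auto simp: Q_def)
    qed
    have E_open: "open (E n)" for n
    proof -
      obtain \<F> where "\<F> \<in> Q" "E n = \<Union>\<F>"
        using E_Union[of n] by blast
      then show ?thesis
        using \<B>_open[of \<F>] by (simp add: Q_def)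
    qed
    have E_lm: "E n \<in> lmeasurable" for n
      using fmeasurableI2[OF U(2) E_U] E_open[of n] by simp
    have E_S: "abs_L2 (\<lambda>x. indicator (E n) x *\<^sub>R b) \<in> S" for n
    proof -
      obtain \<F> where \<F>: "\<F> \<in> Q" "E n = \<Union>\<F>"
        using E_Union by blast
      have "abs_L2 (\<lambda>x. indicator (E n) x *\<^sub>R b) \<in> G"
        unfolding G_def using \<F> E_lm[of n] b by (intro image_eqI[of _ _ "(\<F>, b)"]) auto
      then show ?thesis
        unfolding S_def using span_superset closure_subset by blast
    qed
    have UN_E: "(\<Union>n. E n) = U"
      using range_c C'(3) by (auto simp: E_def)
    have "(\<lambda>n. measure lebesgue (E n)) \<longlonglongrightarrow> measure lebesgue (\<Union>n. E n)"
    proof (rule Lim_measure_incseq)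
      show "range E \<subseteq> sets lebesgue"
        using E_lm by (auto dest: fmeasurableD)
      show "incseq E"
        by (force simp: incseq_def E_def)
      show "emeasure lebesgue (\<Union>n. E n) \<noteq> \<infinity>"
        unfolding UN_E using fmeasurableD2[OF U(2)] by simp
    qed
    then have lim: "(\<lambda>n. measure lebesgue (E n)) \<longlonglongrightarrow> measure lebesgue U"
      by (simp add: UN_E)
    show ?thesis
    proof (rule S_limit)
      fix e :: real assume "0 < e"
      then have "0 < e\<^sup>2" by simp
      then obtain n where n: "\<bar>measure lebesgue (E n) - measure lebesgue U\<bar> < e\<^sup>2"
        using LIMSEQ_D[OF lim, of "e\<^sup>2"] by (auto simp del: zero_less_power2)
      have "measure lebesgue (U - E n) = measure lebesgue U - measure lebesgue (E n)"
        using U(2) E_lm[of n] E_U[of n] by (intro measurable_measure_Diff) (auto dest: fmeasurableD)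
      then have "(norm (abs_L2 (\<lambda>x. indicator U x *\<^sub>R b) - abs_L2 (\<lambda>x. indicator (E n) x *\<^sub>R b)))\<^sup>2 < e\<^sup>2"
        using n norm_indicator_diff[OF U(2) E_lm E_U, of b n] b by simp
      then have "norm (abs_L2 (\<lambda>x. indicator U x *\<^sub>R b) - abs_L2 (\<lambda>x. indicator (E n) x *\<^sub>R b)) < e"
        using power2_less_imp_less[of _ e] \<open>0 < e\<close> by (simp add: norm_minus_commute)
      then show "\<exists>v\<in>S. norm (abs_L2 (\<lambda>x. indicator U x *\<^sub>R b) - v) < e"
        using E_S by blast
    qed
  qed
  have indicator_lmeasurable: "abs_L2 (\<lambda>x. indicator E x *\<^sub>R b) \<in> S"
    if E: "E \<in> lmeasurable" and b: "b \<in> Basis" for E and b :: 'b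
  proof (rule S_limit)
    fix e :: real assume "0 < e"
    then have e2: "0 < e\<^sup>2" by simp
    obtain T where T: "open T" "E \<subseteq> T" "T - E \<in> lmeasurable" "emeasure lebesgue (T - E) < ennreal (e\<^sup>2)"
      using sets_lebesgue_outer_open[OF fmeasurableD[OF E] e2] by blast
    have T_lm: "T \<in> lmeasurable"
      using fmeasurable.Un[OF E T(3)] T(2) by (simp add: Un_absorb1)
    have "measure lebesgue (T - E) < e\<^sup>2"
      using T(3,4) e2 by (simp add: emeasure_eq_measure2 ennreal_less_iff)
    then have "(norm (abs_L2 (\<lambda>x. indicator T x *\<^sub>R b) - abs_L2 (\<lambda>x. indicator E x *\<^sub>R b)))\<^sup>2 < e\<^sup>2"
      using norm_indicator_diff[OF T_lm E T(2), of b] b by simp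
    then have "norm (abs_L2 (\<lambda>x. indicator E x *\<^sub>R b) - abs_L2 (\<lambda>x. indicator T x *\<^sub>R b)) < e"
      using power2_less_imp_less[of _ e] \<open>0 < e\<close> by (simp add: norm_minus_commute)
    then show "\<exists>v\<in>S. norm (abs_L2 (\<lambda>x. indicator E x *\<^sub>R b) - v) < e"
      using indicator_open[OF T(1) T_lm b] by blast
  qed
  have sum_S: "square_integrable (\<lambda>x. \<Sum>i\<in>I. h i x) \<and> abs_L2 (\<lambda>x. \<Sum>i\<in>I. h i x) \<in> S"
    if "finite I" "\<And>i. i \<in> I \<Longrightarrow> square_integrable (h i) \<and> abs_L2 (h i) \<in> S"
    for I :: "'b set" and h :: "'b \<Rightarrow> 'a \<Rightarrow> 'b"
    using that
  proof (induction I rule: finite_induct)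
    case empty
    then show ?case
      using subspace_0[OF S_subspace] by (simp add: square_integrable_zero flip: zero_L2_def)
  next
    case (insert i I)
    then show ?case
      using subspace_add[OF S_subspace]
      by (simp add: square_integrable_add abs_L2_add)
  qed
  have indicator_any: "abs_L2 (\<lambda>x. indicator E x *\<^sub>R y) \<in> S" if E: "E \<in> lmeasurable" for E and y :: 'b
  proof -
    have "abs_L2 (\<lambda>x. \<Sum>b\<in>Basis. (y \<bullet> b) *\<^sub>R (indicator E x *\<^sub>R b)) \<in> S"
    proof (intro sum_S[THEN conjunct2] conjI)
      fix b :: 'b assume b: "b \<in> Basis"
      show "square_integrable (\<lambda>x. (y \<bullet> b) *\<^sub>R (indicator E x *\<^sub>R b))"
        by (intro square_integrable_scaleR square_integrable_indicator E)
      show "abs_L2 (\<lambda>x. (y \<bullet> b) *\<^sub>R (indicator E x *\<^sub>R b)) \<in> S"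
        unfolding abs_L2_scaleR[OF square_integrable_indicator[OF E]]
        by (intro subspace_scale[OF S_subspace] indicator_lmeasurable E b)
    qed simp
    moreover have "(\<Sum>b\<in>Basis. (y \<bullet> b) *\<^sub>R (indicator E x *\<^sub>R b)) = indicator E x *\<^sub>R y" for x
      using euclidean_representation[of y] by (simp add: indicator_def)
    ultimately show ?thesis
      by simp
  qed
  have simple_S: "abs_L2 s \<in> S"
    if s: "simple_function lebesgue s" "square_integrable s" for s :: "'a \<Rightarrow> 'b"
  proof -
    define E where "E y = s -` {y}" for y
    have fin: "finite (range s)"
      using simple_functionD(1)[OF s(1)] by simp
    have E_sets: "E y \<in> sets lebesgue" for y
      using simple_functionD(2)[OF s(1), of "{y}"] by (simp add: E_def)
    have E_lm: "E y \<in> lmeasurable" if "y \<noteq> 0" for y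
    proof (rule fmeasurableI)
      have "(\<integral>\<^sup>+x. ennreal ((norm y)\<^sup>2) * indicator (E y) x \<partial>lebesgue) \<le>
          (\<integral>\<^sup>+x. ennreal ((norm (s x))\<^sup>2) \<partial>lebesgue)"
        by (intro nn_integral_mono) (auto simp: E_def indicator_def)
      also have "\<dots> = ennreal (\<integral>x. (norm (s x))\<^sup>2 \<partial>lebesgue)"
        using s(2) by (intro nn_integral_eq_integral) (auto simp: square_integrable_def)
      also have "\<dots> < \<infinity>"
        by simp
      finally have "ennreal ((norm y)\<^sup>2) * emeasure lebesgue (E y) < \<infinity>"
        using E_sets by (simp add: nn_integral_cmult_indicator)
      then show "emeasure lebesgue (E y) < \<infinity>"
        using that by (auto simp: ennreal_mult_less_top)
    qed (rule E_sets)
    have "abs_L2 (\<lambda>x. \<Sum>y\<in>range s - {0}. indicator (E y) x *\<^sub>R y) \<in> S"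
      by (intro sum_S[THEN conjunct2] conjI square_integrable_indicator indicator_any E_lm)
         (use fin in auto)
    moreover have "(\<Sum>y\<in>range s - {0}. indicator (E y) x *\<^sub>R y) = s x" for x
    proof -
      have "(\<Sum>y\<in>range s - {0}. indicator (E y) x *\<^sub>R y) = (\<Sum>y\<in>range s - {0}. if y = s x then y else 0)"
        by (intro sum.cong) (auto simp: E_def indicator_def)
      also have "\<dots> = s x"
        using fin by (simp add: sum.delta')
      finally show ?thesis .
    qed
    ultimately show ?thesis
      by simp
  qed
  have "u \<in> S" for u
  proof (rule S_limit)
    fix e :: real assume "0 < e"
    have "\<exists>F. (\<forall>i. simple_function lebesgue (F i)) \<and>
        (\<forall>x\<in>space lebesgue. (\<lambda>i. F i x) \<longlonglongrightarrow> rep_L2 u x) \<and>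
        (\<forall>i. \<forall>x\<in>space lebesgue. dist (F i x) 0 \<le> 2 * dist (rep_L2 u x) 0)"
      by (rule borel_measurable_implies_sequence_metric) measurable
    then obtain F where F: "\<And>i. simple_function lebesgue (F i)"
        "\<And>x. (\<lambda>i. F i x) \<longlonglongrightarrow> rep_L2 u x" "\<And>i x. norm (F i x) \<le> 2 * norm (rep_L2 u x)"
      by auto
    have F_meas[measurable]: "F i \<in> borel_measurable lebesgue" for i
      using F(1) by (rule borel_measurable_simple_function)
    have u_int: "integrable lebesgue (\<lambda>x. (norm (rep_L2 u x))\<^sup>2)"
      using square_integrable_rep_L2[of u] by (simp add: square_integrable_def)
    have F_sq: "square_integrable (F i)" for i
    proof -
      have "integrable lebesgue (\<lambda>x. 4 * (norm (rep_L2 u x))\<^sup>2)"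
        using u_int by (rule integrable_mult_right)
      then have "integrable lebesgue (\<lambda>x. (norm (F i x))\<^sup>2)"
      proof (rule Bochner_Integration.integrable_bound)
        have "(norm (F i x))\<^sup>2 \<le> 4 * (norm (rep_L2 u x))\<^sup>2" for x
          using power_mono[OF F(3)[of i x] norm_ge_zero, of 2] by (simp add: power_mult_distrib)
        then show "AE x in lebesgue. norm ((norm (F i x))\<^sup>2) \<le> norm (4 * (norm (rep_L2 u x))\<^sup>2)"
          by simp
      qed measurable
      then show ?thesis
        unfolding square_integrable_def using F_meas by simp
    qed
    have "(\<lambda>i. \<integral>x. (norm (F i x - rep_L2 u x))\<^sup>2 \<partial>lebesgue) \<longlonglongrightarrow> (\<integral>x. 0 \<partial>(lebesgue :: 'a measure))"
    proof (rule integral_dominated_convergence)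
      show "integrable lebesgue (\<lambda>x. 9 * (norm (rep_L2 u x))\<^sup>2)"
        using u_int by (rule integrable_mult_right)
      show "AE x in lebesgue. (\<lambda>i. (norm (F i x - rep_L2 u x))\<^sup>2) \<longlonglongrightarrow> 0"
      proof (rule AE_I2)
        fix x
        have "(\<lambda>i. (norm (F i x - rep_L2 u x))\<^sup>2) \<longlonglongrightarrow> (norm (rep_L2 u x - rep_L2 u x))\<^sup>2"
          by (intro tendsto_intros F(2))
        then show "(\<lambda>i. (norm (F i x - rep_L2 u x))\<^sup>2) \<longlonglongrightarrow> 0"
          by simp
      qed
      show "AE x in lebesgue. norm ((norm (F i x - rep_L2 u x))\<^sup>2) \<le> 9 * (norm (rep_L2 u x))\<^sup>2" for i
      proof (rule AE_I2)
        fix x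
        have "norm (F i x - rep_L2 u x) \<le> 3 * norm (rep_L2 u x)"
          using norm_triangle_ineq4[of "F i x" "rep_L2 u x"] F(3)[of i x] by linarith
        then have "(norm (F i x - rep_L2 u x))\<^sup>2 \<le> (3 * norm (rep_L2 u x))\<^sup>2"
          by (rule power_mono) simp
        then show "norm ((norm (F i x - rep_L2 u x))\<^sup>2) \<le> 9 * (norm (rep_L2 u x))\<^sup>2"
          by (simp add: power_mult_distrib)
      qed
    qed measurable
    then have lim: "(\<lambda>i. \<integral>x. (norm (F i x - rep_L2 u x))\<^sup>2 \<partial>lebesgue) \<longlonglongrightarrow> 0"
      by simp
    have "0 < e\<^sup>2"
      using \<open>0 < e\<close> by simp
    then obtain i where "\<bar>\<integral>x. (norm (F i x - rep_L2 u x))\<^sup>2 \<partial>lebesgue\<bar> < e\<^sup>2"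
      using LIMSEQ_D[OF lim, of "e\<^sup>2"] by auto
    then have "(norm (abs_L2 (F i) - u))\<^sup>2 < e\<^sup>2"
      unfolding norm_abs_L2_diff[OF F_sq] by simp
    then have "norm (u - abs_L2 (F i)) < e"
      using power2_less_imp_less[of _ e] \<open>0 < e\<close> by (simp add: norm_minus_commute)
    then show "\<exists>v\<in>S. norm (u - v) < e"
      using simple_S[OF F(1) F_sq] by blast
  qed
  then show ?thesis
    using G_countable unfolding S_def by blast
qed

instance L2 :: (euclidean_space, euclidean_space) second_countable_topology
proof
  obtain G :: "('a, 'b) L2 set" where "countable G" "closure (span G) = UNIV"
    using ex_total_countable_L2 by blast
  then show "\<exists>B :: ('a, 'b) L2 set set. countable B \<and> open = generate_topology B"
    by (rule countable_subbasis_of_total)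
qed

section \<open>Lipschitz domains, \<open>L\<^sup>2(\<Omega>)\<close> and \<open>H\<^sup>1\<^sub>0(\<Omega>)\<close>\<close>

text \<open>Near every boundary point the domain is the strict epigraph, in some direction \<open>n\<close>, of a
  Lipschitz function of the projection onto the hyperplane orthogonal to \<open>n\<close>.\<close>

definition bounded_Lipschitz_domain :: "'a::euclidean_space set \<Rightarrow> bool" where
  "bounded_Lipschitz_domain \<Omega> \<longleftrightarrow>
     open \<Omega> \<and> connected \<Omega> \<and> \<Omega> \<noteq> {} \<and> bounded \<Omega> \<and>
     (\<forall>x\<in>frontier \<Omega>. \<exists>n r L. \<exists>\<gamma> :: 'a \<Rightarrow> real.
        norm n = 1 \<and> 0 < r \<and> L-lipschitz_on UNIV \<gamma> \<and>
        \<Omega> \<inter> ball x r = {y \<in> ball x r. \<gamma> (y - (y \<bullet> n) *\<^sub>R n) < y \<bullet> n})"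

primrec Ck :: "nat \<Rightarrow> ('a::euclidean_space \<Rightarrow> real) \<Rightarrow> bool" where
  "Ck 0 f \<longleftrightarrow> continuous_on UNIV f"
| "Ck (Suc k) f \<longleftrightarrow>
     (\<forall>x. f differentiable (at x)) \<and> (\<forall>b\<in>Basis. Ck k (\<lambda>x. frechet_derivative f (at x) b))"

definition test_function :: "'a::euclidean_space set \<Rightarrow> ('a \<Rightarrow> real) \<Rightarrow> bool" where
  "test_function \<Omega> \<phi> \<longleftrightarrow>
     (\<forall>k. Ck k \<phi>) \<and> compact (closure {x. \<phi> x \<noteq> 0}) \<and> closure {x. \<phi> x \<noteq> 0} \<subseteq> \<Omega>"

definition gradient :: "('a::euclidean_space \<Rightarrow> real) \<Rightarrow> 'a \<Rightarrow> 'a" where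
  "gradient \<phi> x = (\<Sum>b\<in>Basis. frechet_derivative \<phi> (at x) b *\<^sub>R b)"

text \<open>Functions on \<open>\<Omega>\<close> are identified with their extensions by zero.\<close>

definition L2_on :: "'a::euclidean_space set \<Rightarrow> ('a, 'b::euclidean_space) L2 set" where
  "L2_on \<Omega> = {u. AE x in lebesgue. x \<notin> \<Omega> \<longrightarrow> rep_L2 u x = 0}"

text \<open>A Sobolev function \<open>v\<close> is represented by the pair \<open>(v, \<nabla>v)\<close> of \<open>L\<^sup>2\<close> classes, so that the norm of the
  product type is the \<open>H\<^sup>1\<close> norm, \<open>norm (snd v)\<close> is the gradient seminorm, and \<open>fst\<close> is the embedding
  into \<open>L\<^sup>2\<close>.\<close>

definition H10 :: "'a::euclidean_space set \<Rightarrow> (('a, real) L2 \<times> ('a, 'a) L2) set" where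
  "H10 \<Omega> = closure {(abs_L2 \<phi>, abs_L2 (gradient \<phi>)) | \<phi>. test_function \<Omega> \<phi>}"

type_synonym 'd H = "(real ^ 'd, real) L2"
type_synonym 'd V = "(real ^ 'd, real) L2 \<times> (real ^ 'd, real ^ 'd) L2"

section \<open>The bilinear forms\<close>

definition symmetric_Linfty :: "(real ^ 'd) set \<Rightarrow> (real ^ 'd \<Rightarrow> real ^ 'd ^ 'd) \<Rightarrow> bool" where
  "symmetric_Linfty \<Omega> A \<longleftrightarrow>
     A \<in> borel_measurable (lebesgue_on \<Omega>) \<and>
     (\<exists>C. AE x in lebesgue_on \<Omega>. norm (A x) \<le> C) \<and>
     (AE x in lebesgue_on \<Omega>. transpose (A x) = A x)"

definition form :: "(real ^ 'd) set \<Rightarrow> (real ^ 'd \<Rightarrow> real ^ 'd ^ 'd) \<Rightarrow> 'd V \<Rightarrow> 'd V \<Rightarrow> real" where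
  "form \<Omega> A w v = (\<integral>x. (A x *v rep_L2 (snd w) x) \<bullet> rep_L2 (snd v) x \<partial>lebesgue_on \<Omega>)"

text \<open>The functional \<open>l\<close> on \<open>V = H\<^sup>1\<^sub>0(\<Omega>)\<close> belongs to \<open>H = L\<^sup>2(\<Omega>) \<subseteq> V'\<close> and equals \<open>h\<close>.\<close>

definition dual_is :: "(real ^ 'd) set \<Rightarrow> ('d V \<Rightarrow> real) \<Rightarrow> 'd H \<Rightarrow> bool" where
  "dual_is \<Omega> l h \<longleftrightarrow> h \<in> L2_on \<Omega> \<and> (\<forall>v\<in>H10 \<Omega>. l v = h \<bullet> fst v)"

section \<open>Functions as vectors, and vector spaces with a seminorm\<close>

instantiation "fun" :: (type, real_vector) real_vector
begin

definition scaleR_fun :: "real \<Rightarrow> ('a \<Rightarrow> 'b) \<Rightarrow> 'a \<Rightarrow> 'b" where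
  "scaleR_fun c f = (\<lambda>x. c *\<^sub>R f x)"

instance
  by standard (simp_all add: scaleR_fun_def fun_eq_iff scaleR_add_right scaleR_add_left)

end

text \<open>The norms of \<open>\<K>\<close> and \<open>\<W>\<close> below depend on \<open>A\<^sub>1\<close> and \<open>\<nu>\<close>, so these spaces cannot be types. A normed
  space is given here by a set \<open>C\<close> of representatives with a seminorm \<open>N\<close>; two elements \<open>x, y\<close> of
  \<open>C\<close> are the same vector iff \<open>N (x - y) = 0\<close>.\<close>

definition C0_semigroup_on ::
  "'w::real_vector set \<Rightarrow> ('w \<Rightarrow> real) \<Rightarrow> (real \<Rightarrow> 'w \<Rightarrow> 'w) \<Rightarrow> bool" where
  "C0_semigroup_on C N S \<longleftrightarrow>
     (\<forall>t\<ge>0. \<forall>x\<in>C. S t x \<in> C) \<and>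
     (\<forall>t\<ge>0. \<forall>x\<in>C. \<forall>y\<in>C. \<forall>a b.
        N (S t (a *\<^sub>R x + b *\<^sub>R y) - (a *\<^sub>R S t x + b *\<^sub>R S t y)) = 0) \<and>
     (\<forall>t\<ge>0. \<exists>B. \<forall>x\<in>C. N (S t x) \<le> B * N x) \<and>
     (\<forall>x\<in>C. N (S 0 x - x) = 0) \<and>
     (\<forall>s\<ge>0. \<forall>t\<ge>0. \<forall>x\<in>C. N (S (s + t) x - S s (S t x)) = 0) \<and>
     (\<forall>x\<in>C. ((\<lambda>t. N (S t x - x)) \<longlongrightarrow> 0) (at_right 0))"

text \<open>The graph of the infinitesimal generator.\<close>

definition generator_on ::
  "'w::real_vector set \<Rightarrow> ('w \<Rightarrow> real) \<Rightarrow> (real \<Rightarrow> 'w \<Rightarrow> 'w) \<Rightarrow> ('w \<times> 'w) set" where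
  "generator_on C N S =
     {(x, y). x \<in> C \<and> y \<in> C \<and> ((\<lambda>h. N ((S h x - x) /\<^sub>R h - y)) \<longlongrightarrow> 0) (at_right 0)}"

text \<open>Approximation by simple functions, as in \<open>has_bochner_integral\<close>, but with respect to \<open>N\<close>.\<close>

definition has_bochner_integral_on ::
  "'w::real_vector set \<Rightarrow> ('w \<Rightarrow> real) \<Rightarrow> 's measure \<Rightarrow> ('s \<Rightarrow> 'w) \<Rightarrow> 'w \<Rightarrow> bool" where
  "has_bochner_integral_on C N M f I \<longleftrightarrow>
     f \<in> space M \<rightarrow> C \<and> I \<in> C \<and>
     (\<exists>s. (\<forall>i. Bochner_Integration.simple_bochner_integrable M (s i) \<and> s i \<in> space M \<rightarrow> C \<and>
               (\<lambda>x. N (f x - s i x)) \<in> borel_measurable M) \<and>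
          (\<lambda>i. \<integral>\<^sup>+x. ennreal (N (f x - s i x)) \<partial>M) \<longlonglongrightarrow> 0 \<and>
          (\<lambda>i. N (Bochner_Integration.simple_bochner_integral M (s i) - I)) \<longlonglongrightarrow> 0)"

definition continuous_paths ::
  "'w::real_vector set \<Rightarrow> ('w \<Rightarrow> real) \<Rightarrow> real \<Rightarrow> (real \<Rightarrow> 'w) set" where
  "continuous_paths C N T =
     {X. \<forall>t\<in>{0..T}. X t \<in> C \<and> ((\<lambda>s. N (X s - X t)) \<longlongrightarrow> 0) (at t within {0..T})}"

section \<open>Memory space, extended state space and the extended generator\<close>

text \<open>\<open>\<nu>\<close> is a measure with \<open>space \<nu> = {0..}\<close>; values of \<open>\<zeta>\<close> at negative relaxation rates \<open>r\<close> are
  irrelevant. As \<open>V\<close> is separable, Borel measurability is strong measurability.\<close>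

type_synonym 'd state = "'d H \<times> (real \<Rightarrow> 'd V)"

definition memory_space ::
  "(real ^ 'd) set \<Rightarrow> (real ^ 'd \<Rightarrow> real ^ 'd ^ 'd) \<Rightarrow> real measure \<Rightarrow> (real \<Rightarrow> 'd V) set" where
  "memory_space \<Omega> A1 \<nu> =
     {\<zeta> \<in> borel_measurable \<nu>. (\<forall>r\<in>space \<nu>. \<zeta> r \<in> H10 \<Omega>) \<and>
        integrable \<nu> (\<lambda>r. form \<Omega> A1 (\<zeta> r) (\<zeta> r))}"

definition memory_norm ::
  "(real ^ 'd) set \<Rightarrow> (real ^ 'd \<Rightarrow> real ^ 'd ^ 'd) \<Rightarrow> real measure \<Rightarrow> (real \<Rightarrow> 'd V) \<Rightarrow> real" where
  "memory_norm \<Omega> A1 \<nu> \<zeta> = sqrt (\<integral>r. form \<Omega> A1 (\<zeta> r) (\<zeta> r) \<partial>\<nu>)"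

definition state_space ::
  "(real ^ 'd) set \<Rightarrow> (real ^ 'd \<Rightarrow> real ^ 'd ^ 'd) \<Rightarrow> real measure \<Rightarrow> 'd state set" where
  "state_space \<Omega> A1 \<nu> = L2_on \<Omega> \<times> memory_space \<Omega> A1 \<nu>"

definition state_norm ::
  "(real ^ 'd) set \<Rightarrow> (real ^ 'd \<Rightarrow> real ^ 'd ^ 'd) \<Rightarrow> real measure \<Rightarrow> 'd state \<Rightarrow> real" where
  "state_norm \<Omega> A1 \<nu> x = sqrt ((norm (fst x))\<^sup>2 + (memory_norm \<Omega> A1 \<nu> (snd x))\<^sup>2)"

definition state_eq :: "real measure \<Rightarrow> 'd::finite state \<Rightarrow> 'd state \<Rightarrow> bool" where
  "state_eq \<nu> x y \<longleftrightarrow> fst x = fst y \<and> (AE r in \<nu>. snd x r = snd y r)"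

definition memory_integral :: "real measure \<Rightarrow> (real \<Rightarrow> 'd::finite V) \<Rightarrow> 'd V" where
  "memory_integral \<nu> \<zeta> = (\<integral>r. \<zeta> r \<partial>\<nu>)"

text \<open>The graph of \<open>\<A>(u, \<zeta>) = (-A\<^sub>0 u - A\<^sub>1 J \<zeta>, E u - \<Lambda> \<zeta>)\<close>. Here \<open>w\<close> is \<open>u \<in> V\<close> and \<open>fst w\<close> is \<open>u\<close> as an
  element of \<open>H\<close>; \<open>(h, \<eta>)\<close> is the value of \<open>\<A>\<close>.\<close>

definition memory_generator ::
  "(real ^ 'd) set \<Rightarrow> (real ^ 'd \<Rightarrow> real ^ 'd ^ 'd) \<Rightarrow> (real ^ 'd \<Rightarrow> real ^ 'd ^ 'd) \<Rightarrow> real measure \<Rightarrow>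
   ('d state \<times> 'd state) set" where
  "memory_generator \<Omega> A0 A1 \<nu> =
     {((fst w, \<zeta>), (h, \<eta>)) | w \<zeta> h \<eta>.
        w \<in> H10 \<Omega> \<and> \<zeta> \<in> memory_space \<Omega> A1 \<nu> \<and>
        dual_is \<Omega> (\<lambda>v. - form \<Omega> A0 w v - form \<Omega> A1 (memory_integral \<nu> \<zeta>) v) h \<and>
        \<eta> \<in> memory_space \<Omega> A1 \<nu> \<and> (AE r in \<nu>. \<eta> r = w - r *\<^sub>R \<zeta> r)}"

section \<open>Mild solutions\<close>

definition L1_data :: "(real ^ 'd) set \<Rightarrow> real \<Rightarrow> (real \<Rightarrow> 'd H) set" where
  "L1_data \<Omega> T = {f. integrable (lebesgue_on {0..T}) f \<and> (\<forall>t\<in>{0..T}. f t \<in> L2_on \<Omega>)}"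

definition L1_norm :: "real \<Rightarrow> (real \<Rightarrow> 'd::finite H) \<Rightarrow> real" where
  "L1_norm T f = (\<integral>t. norm (f t) \<partial>lebesgue_on {0..T})"

text \<open>\<open>X(t) = S(t)(u\<^sub>0, 0) + \<integral>\<^sub>0\<^sup>t S(t - s)(f(s), 0) ds\<close> for all \<open>t \<in> [0, T]\<close>, the integral being a Bochner
  integral in the state space and the equality one of its elements.\<close>

definition mild_solution ::
  "(real ^ 'd) set \<Rightarrow> (real ^ 'd \<Rightarrow> real ^ 'd ^ 'd) \<Rightarrow> real measure \<Rightarrow>
   (real \<Rightarrow> 'd state \<Rightarrow> 'd state) \<Rightarrow> real \<Rightarrow> 'd H \<Rightarrow> (real \<Rightarrow> 'd H) \<Rightarrow> (real \<Rightarrow> 'd state) \<Rightarrow> bool" where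
  "mild_solution \<Omega> A1 \<nu> S T u0 f X \<longleftrightarrow>
     (\<forall>t\<in>{0..T}. X t \<in> state_space \<Omega> A1 \<nu> \<and>
        (\<exists>I. has_bochner_integral_on (state_space \<Omega> A1 \<nu>) (state_norm \<Omega> A1 \<nu>)
               (lebesgue_on {0..t}) (\<lambda>s. S (t - s) (f s, 0)) I \<and>
             state_eq \<nu> (X t) (S t (u0, 0) + I)))"

section \<open>The memory graph space\<close>

definition H_nu :: "(real ^ 'd) set \<Rightarrow> real measure \<Rightarrow> (real \<Rightarrow> 'd H) set" where
  "H_nu \<Omega> \<nu> =
     {z \<in> borel_measurable \<nu>. (\<forall>r\<in>space \<nu>. z r \<in> L2_on \<Omega>) \<and>
        integrable \<nu> (\<lambda>r. (norm (z r))\<^sup>2)}"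

definition H_nu_eq :: "(real ^ 'd) set \<Rightarrow> real measure \<Rightarrow> (real \<Rightarrow> 'd H) \<Rightarrow> (real \<Rightarrow> 'd H) \<Rightarrow> bool" where
  "H_nu_eq \<Omega> \<nu> y z \<longleftrightarrow> y \<in> H_nu \<Omega> \<nu> \<and> z \<in> H_nu \<Omega> \<nu> \<and> (AE r in \<nu>. y r = z r)"

definition memory_response :: "(real \<Rightarrow> 'd::finite H) \<Rightarrow> real \<Rightarrow> real \<Rightarrow> 'd H" where
  "memory_response u t r = (\<integral>s. exp (- r * (t - s)) *\<^sub>R u s \<partial>lebesgue_on {0..t})"

definition memory_graph_space ::
  "(real ^ 'd) set \<Rightarrow> (real ^ 'd \<Rightarrow> real ^ 'd ^ 'd) \<Rightarrow> real measure \<Rightarrow> real \<Rightarrow> (real \<Rightarrow> 'd state) set" where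
  "memory_graph_space \<Omega> A1 \<nu> T =
     {X \<in> continuous_paths (state_space \<Omega> A1 \<nu>) (state_norm \<Omega> A1 \<nu>) T.
        \<forall>t\<in>{0..T}. H_nu_eq \<Omega> \<nu> (\<lambda>r. fst (snd (X t) r)) (memory_response (\<lambda>s. fst (X s)) t)}"

definition memory_graph_norm ::
  "(real ^ 'd) set \<Rightarrow> (real ^ 'd \<Rightarrow> real ^ 'd ^ 'd) \<Rightarrow> real measure \<Rightarrow> real \<Rightarrow> (real \<Rightarrow> 'd state) \<Rightarrow> real" where
  "memory_graph_norm \<Omega> A1 \<nu> T X = (SUP t\<in>{0..T}. state_norm \<Omega> A1 \<nu> (X t))"

end

theory Submission
  imports Defs
begin

text \<open>
  Write \<open>\<W>\<close> for the state space and \<open>N\<close> for its seminorm. The stability estimate comes from dissipativity. In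
  \<open>\<langle>\<A>(u, \<zeta>), (u, \<zeta>)\<rangle>\<close> the coupling terms \<open>- a\<^sub>1(J \<zeta>, u)\<close> and \<open>\<integral> a\<^sub>1(u, \<zeta>) d\<nu>\<close> cancel by symmetry of \<open>a\<^sub>1\<close>, and
  what is left, \<open>- a\<^sub>0(u, u) - \<integral> \<lambda> a\<^sub>1(\<zeta>, \<zeta>) d\<nu>\<close>, is nonpositive (\<open>memory_generator_dissipative\<close>). Hence
  \<open>N (S t x)\<close> does not increase in \<open>t\<close> for \<open>x\<close> in the domain, thus for every \<open>x\<close>, since the domain is dense
  (\<open>S_contraction\<close>). In the variation of constants formula this gives
  \<open>N (X t) \<le> \<parallel>u\<^sub>0\<parallel> + \<integral> \<parallel>f\<parallel>\<close>. The difference of two mild solutions is a mild solution for the difference of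
  the data (\<open>mild_solution_diff\<close>), so this estimate is also the Lipschitz estimate.

  The memory identity \<open>\<zeta>(t)(\<lambda>) = \<integral>\<^sub>0\<^sup>t e\<^bsup>-\<lambda>(t - s)\<^esup> u(s) ds\<close> is tested with \<open>h \<in> H\<close> and a bounded set \<open>A\<close> of relaxation
  rates. Along an orbit in the domain, \<open>s \<mapsto> \<integral>\<^sub>A e\<^bsup>-\<lambda>(t - s)\<^esup> \<langle>\<zeta>(s)(\<lambda>), h\<rangle> d\<nu>\<close> has the right derivative
  \<open>k\<^sub>A(t - s) \<langle>u(s), h\<rangle>\<close> with \<open>k\<^sub>A(\<tau>) = \<integral>\<^sub>A e\<^bsup>-\<lambda>\<tau>\<^esup> d\<nu>\<close>, because \<open>\<zeta>' = u - \<lambda> \<zeta>\<close> and the term \<open>\<lambda> \<zeta>\<close> is absorbed by the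
  weight (\<open>orbit_memory_right_derivative\<close>). Integrating in \<open>s\<close> gives the tested identity, and density and
  contractivity extend it to all initial states (\<open>memory_defect_eq_0\<close>). Fubini's theorem carries it over to
  the Duhamel integral (\<open>duhamel_memory_identity\<close>) and identifies its right-hand side with the tested
  convolution (\<open>memory_response_weak\<close>); as \<open>A\<close> and \<open>h\<close> are arbitrary, the identity holds \<open>\<nu>\<close>-almost everywhere
  (\<open>H_nu_eqI\<close>).

  Two facts about the spaces enter. By Poincare's inequality \<open>a\<^sub>1\<close> controls the full norm of \<open>V\<close> on
  \<open>H\<^sup>1\<^sub>0(\<Omega>)\<close>, so \<open>\<K>\<close> is complete (\<open>memory_complete\<close>), its elements are \<open>\<nu>\<close>-integrable in \<open>V\<close>, and states at
  distance zero agree \<open>\<nu>\<close>-almost everywhere. Moreover, a vector of \<open>\<W>\<close> has many representatives and \<open>S t\<close> is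
  linear only up to null vectors. Bounded linear functionals do not see null vectors, so identities in
  \<open>\<W>\<close> are proved after applying them; an integral of a \<open>\<W>\<close>-valued path is then determined by ordinary
  real integrals.
\<close>

section \<open>Square integrable functions vanishing outside \<open>\<Omega>\<close>\<close>

text \<open>The orthogonal projection onto \<open>L2_on \<Omega>\<close>. As the set of its fixed points \<open>L2_on \<Omega>\<close> is a closed subspace and
  contains integrals of functions with values in it; approximations of such a function may be
  projected back into it.\<close>

definition cutoff :: "'a::euclidean_space set \<Rightarrow> ('a, 'b::euclidean_space) L2 \<Rightarrow> ('a, 'b) L2" where
  "cutoff \<Omega> u = abs_L2 (\<lambda>x. indicator \<Omega> x *\<^sub>R rep_L2 u x)"

lemma square_integrable_cutoff:
  assumes "\<Omega> \<in> sets lebesgue"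
  shows "square_integrable (\<lambda>x. indicator \<Omega> x *\<^sub>R rep_L2 u x)"
proof -
  have int: "integrable lebesgue (\<lambda>x. (norm (rep_L2 u x))\<^sup>2)"
    using square_integrable_rep_L2[of u] by (simp add: square_integrable_def)
  have "integrable lebesgue (\<lambda>x. (norm (indicator \<Omega> x *\<^sub>R rep_L2 u x))\<^sup>2)"
    by (rule Bochner_Integration.integrable_bound[OF int]) (use assms in \<open>auto simp: indicator_def\<close>)
  then show ?thesis
    using assms by (simp add: square_integrable_def)
qed

lemma rep_cutoff:
  assumes "\<Omega> \<in> sets lebesgue"
  shows "AE x in lebesgue. rep_L2 (cutoff \<Omega> u) x = indicator \<Omega> x *\<^sub>R rep_L2 u x"
  unfolding cutoff_def by (intro rep_abs_L2 square_integrable_cutoff assms)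

lemma bounded_linear_cutoff:
  assumes "\<Omega> \<in> sets lebesgue"
  shows "bounded_linear (cutoff \<Omega> :: ('a::euclidean_space, 'b::euclidean_space) L2 \<Rightarrow> _)"
proof (rule bounded_linear_intro[where K = 1])
  fix u v :: "('a, 'b) L2" and c :: real
  show "cutoff \<Omega> (u + v) = cutoff \<Omega> u + cutoff \<Omega> v"
  proof (rule L2_eqI)
    show "AE x in lebesgue. rep_L2 (cutoff \<Omega> (u + v)) x = rep_L2 (cutoff \<Omega> u + cutoff \<Omega> v) x"
      using rep_cutoff[OF assms, of "u + v"] rep_cutoff[OF assms, of u] rep_cutoff[OF assms, of v]
        rep_plus_L2[of u v] rep_plus_L2[of "cutoff \<Omega> u" "cutoff \<Omega> v"]
      by eventually_elim (simp add: scaleR_add_right)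
  qed
  show "cutoff \<Omega> (c *\<^sub>R u) = c *\<^sub>R cutoff \<Omega> u"
  proof (rule L2_eqI)
    show "AE x in lebesgue. rep_L2 (cutoff \<Omega> (c *\<^sub>R u)) x = rep_L2 (c *\<^sub>R cutoff \<Omega> u) x"
      using rep_cutoff[OF assms, of "c *\<^sub>R u"] rep_cutoff[OF assms, of u]
        rep_scaleR_L2[of c u] rep_scaleR_L2[of c "cutoff \<Omega> u"]
      by eventually_elim simp
  qed
  have "(norm (cutoff \<Omega> u))\<^sup>2 = (\<integral>x. (norm (indicator \<Omega> x *\<^sub>R rep_L2 u x))\<^sup>2 \<partial>lebesgue)"
    unfolding cutoff_def by (intro norm_abs_L2 square_integrable_cutoff assms)
  also have "\<dots> \<le> (\<integral>x. (norm (rep_L2 u x))\<^sup>2 \<partial>lebesgue)"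
    using square_integrable_cutoff[OF assms, of u] square_integrable_rep_L2[of u]
    by (intro integral_mono) (auto simp: square_integrable_def indicator_def)
  finally show "norm (cutoff \<Omega> u) \<le> norm u * 1"
    by (simp add: norm_L2_eq[symmetric])
qed

lemma L2_on_eq_cutoff:
  assumes "\<Omega> \<in> sets lebesgue"
  shows "L2_on \<Omega> = {u. cutoff \<Omega> u = u}"
proof safe
  fix u :: "('a, 'b) L2" assume "u \<in> L2_on \<Omega>"
  then have "AE x in lebesgue. x \<notin> \<Omega> \<longrightarrow> rep_L2 u x = 0"
    by (simp add: L2_on_def)
  with rep_cutoff[OF assms, of u] have "AE x in lebesgue. rep_L2 (cutoff \<Omega> u) x = rep_L2 u x"
    by eventually_elim (auto simp: indicator_def)
  then show "cutoff \<Omega> u = u"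
    by (rule L2_eqI)
next
  fix u :: "('a, 'b) L2" assume "cutoff \<Omega> u = u"
  with rep_cutoff[OF assms, of u] show "u \<in> L2_on \<Omega>"
    unfolding L2_on_def by (auto elim: eventually_mono)
qed

lemma cutoff_idem:
  assumes "\<Omega> \<in> sets lebesgue"
  shows "cutoff \<Omega> (cutoff \<Omega> u) = cutoff \<Omega> u"
proof -
  have "AE x in lebesgue. x \<notin> \<Omega> \<longrightarrow> rep_L2 (cutoff \<Omega> u) x = 0"
    using rep_cutoff[OF assms, of u] by eventually_elim simp
  then show ?thesis
    using L2_on_eq_cutoff[OF assms] unfolding L2_on_def by blast
qed

lemma subspace_L2_on:
  assumes "\<Omega> \<in> sets lebesgue"
  shows "subspace (L2_on \<Omega> :: ('a::euclidean_space, 'b::euclidean_space) L2 set)"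
proof -
  interpret bounded_linear "cutoff \<Omega> :: ('a, 'b) L2 \<Rightarrow> _"
    by (rule bounded_linear_cutoff[OF assms])
  show ?thesis
    by (auto intro!: subspaceI simp: L2_on_eq_cutoff[OF assms] add scaleR zero)
qed

lemma closed_L2_on:
  assumes "\<Omega> \<in> sets lebesgue"
  shows "closed (L2_on \<Omega> :: ('a::euclidean_space, 'b::euclidean_space) L2 set)"
proof -
  have "continuous_on UNIV (cutoff \<Omega> :: ('a, 'b) L2 \<Rightarrow> _)"
    by (rule linear_continuous_on[OF bounded_linear_cutoff[OF assms]])
  then show ?thesis
    unfolding L2_on_eq_cutoff[OF assms] by (intro closed_Collect_eq) (auto intro: continuous_intros)
qed

lemma integral_in_L2_on:
  fixes f :: "'s \<Rightarrow> ('a::euclidean_space, 'b::euclidean_space) L2"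
  assumes \<Omega>: "\<Omega> \<in> sets lebesgue" and f: "\<And>x. x \<in> space M \<Longrightarrow> f x \<in> L2_on \<Omega>"
  shows "(\<integral>x. f x \<partial>M) \<in> L2_on \<Omega>"
proof (cases "integrable M f")
  case True
  have "cutoff \<Omega> (\<integral>x. f x \<partial>M) = (\<integral>x. cutoff \<Omega> (f x) \<partial>M)"
    by (rule integral_bounded_linear[OF bounded_linear_cutoff[OF \<Omega>] True, symmetric])
  also have "\<dots> = (\<integral>x. f x \<partial>M)"
    by (intro Bochner_Integration.integral_cong refl)
      (use f L2_on_eq_cutoff[OF \<Omega>] in auto)
  finally show ?thesis
    by (simp add: L2_on_eq_cutoff[OF \<Omega>])
next
  case False
  then show ?thesis
    by (simp add: not_integrable_integral_eq subspace_0[OF subspace_L2_on[OF \<Omega>]])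
qed

section \<open>The Poincare inequality on \<open>H\<^sup>1\<^sub>0\<close>\<close>

text \<open>A parabola without sign change, evaluated at its vertex \<open>I / m\<close>; the common core of the Cauchy-Schwarz
  inequalities below.\<close>

lemma discriminant_le:
  fixes m I Q :: real
  assumes nonneg: "\<And>c. 0 \<le> c\<^sup>2 * m - 2 * c * I + Q" and "0 \<le> m"
  shows "I\<^sup>2 \<le> m * Q"
proof (cases "m = 0")
  case True
  have "I = 0"
  proof (rule ccontr)
    assume "I \<noteq> 0"
    then show False
      using nonneg[of "(Q + 1) / (2 * I)"] True by (simp add: field_simps)
  qed
  then show ?thesis
    by (simp add: True)
next
  case False
  then have "0 \<le> m * ((I / m)\<^sup>2 * m - 2 * (I / m) * I + Q)"
    using nonneg[of "I / m"] \<open>0 \<le> m\<close> by (intro mult_nonneg_nonneg) auto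
  also have "\<dots> = m * Q - I\<^sup>2"
    using False by (simp add: field_simps power2_eq_square)
  finally show ?thesis
    by simp
qed

lemma square_integral_le:
  fixes f :: "'a \<Rightarrow> real"
  assumes "finite_measure M" "integrable M f" "integrable M (\<lambda>x. (f x)\<^sup>2)"
  shows "(\<integral>x. f x \<partial>M)\<^sup>2 \<le> measure M (space M) * (\<integral>x. (f x)\<^sup>2 \<partial>M)"
proof (rule discriminant_le)
  interpret finite_measure M by fact
  fix c
  have "0 \<le> (\<integral>x. (c - f x)\<^sup>2 \<partial>M)"
    by simp
  also have "(\<lambda>x. (c - f x)\<^sup>2) = (\<lambda>x. c\<^sup>2 - 2 * c * f x + (f x)\<^sup>2)"
    by (simp add: power2_diff fun_eq_iff algebra_simps)
  also have "(\<integral>x. c\<^sup>2 - 2 * c * f x + (f x)\<^sup>2 \<partial>M) =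
      c\<^sup>2 * measure M (space M) - 2 * c * (\<integral>x. f x \<partial>M) + (\<integral>x. (f x)\<^sup>2 \<partial>M)"
    using assms(2,3) by simp
  finally show "0 \<le> c\<^sup>2 * measure M (space M) - 2 * c * (\<integral>x. f x \<partial>M) + (\<integral>x. (f x)\<^sup>2 \<partial>M)" .
qed simp

lemma test_function_continuous:
  assumes "test_function \<Omega> \<phi>"
  shows "continuous_on UNIV \<phi>" "continuous_on UNIV (gradient \<phi>)" "\<And>x. \<phi> differentiable (at x)"
proof -
  have Ck: "Ck k \<phi>" for k
    using assms by (simp add: test_function_def)
  show "continuous_on UNIV \<phi>"
    using Ck[of 0] by simp
  show "\<phi> differentiable (at x)" for x
    using Ck[of 1] by simp
  have "continuous_on UNIV (\<lambda>x. frechet_derivative \<phi> (at x) b)" if "b \<in> Basis" for b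
    using Ck[of 1] that by simp
  then show "continuous_on UNIV (gradient \<phi>)"
    unfolding gradient_def[abs_def] by (intro continuous_intros)
qed

lemma frechet_derivative_eq_gradient:
  assumes "\<phi> differentiable (at x)"
  shows "frechet_derivative \<phi> (at x) v = gradient \<phi> x \<bullet> v"
proof -
  have lin: "linear (frechet_derivative \<phi> (at x))"
    by (rule linear_frechet_derivative[OF assms])
  have "frechet_derivative \<phi> (at x) v = frechet_derivative \<phi> (at x) (\<Sum>b\<in>Basis. (v \<bullet> b) *\<^sub>R b)"
    by (simp add: euclidean_representation)
  also have "\<dots> = (\<Sum>b\<in>Basis. (v \<bullet> b) * frechet_derivative \<phi> (at x) b)"
    by (simp add: linear_sum[OF lin] linear_cmul[OF lin])
  also have "\<dots> = gradient \<phi> x \<bullet> v"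
    unfolding gradient_def inner_sum_left
    by (intro sum.cong refl) (simp add: inner_commute[of v])
  finally show ?thesis .
qed

lemma gradient_eq_0:
  assumes "test_function \<Omega> \<phi>" "x \<notin> closure {x. \<phi> x \<noteq> 0}"
  shows "gradient \<phi> x = 0"
proof -
  have "(\<phi> has_derivative (\<lambda>_. 0)) (at x)"
  proof (rule has_derivative_transform_within_open[OF has_derivative_const[of 0]])
    show "open (- closure {x. \<phi> x \<noteq> 0})" by (rule open_Compl) simp
    show "x \<in> - closure {x. \<phi> x \<noteq> 0}" using assms(2) by simp
    show "0 = \<phi> y" if "y \<in> - closure {x. \<phi> x \<noteq> 0}" for y
      using that closure_subset[of "{x. \<phi> x \<noteq> 0}"] by auto
  qed
  then have "frechet_derivative \<phi> (at x) = (\<lambda>_. 0)"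
    by (rule frechet_derivative_at[symmetric])
  then show ?thesis
    by (simp add: gradient_def)
qed

lemma square_integrable_compact_support:
  fixes f :: "'a::euclidean_space \<Rightarrow> 'b::euclidean_space"
  assumes "continuous_on UNIV f" "compact K" "\<And>x. x \<notin> K \<Longrightarrow> f x = 0"
  shows "square_integrable f"
proof -
  have "f \<in> borel_measurable borel"
    using assms(1) by (rule borel_measurable_continuous_onI)
  then have [measurable]: "f \<in> borel_measurable lborel" by simp
  have "integrable lborel (\<lambda>x. indicator K x *\<^sub>R (norm (f x))\<^sup>2)"
    using assms(1,2) by (intro borel_integrable_compact continuous_intros) (auto intro: continuous_on_subset)
  also have "(\<lambda>x. indicator K x *\<^sub>R (norm (f x))\<^sup>2) = (\<lambda>x. (norm (f x))\<^sup>2)"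
    using assms(3) by (auto simp: indicator_def fun_eq_iff)
  finally have "integrable lebesgue (\<lambda>x. (norm (f x))\<^sup>2)"
    by (subst integrable_completion) auto
  then show ?thesis
    unfolding square_integrable_def by (simp add: measurable_completion)
qed

lemma test_function_square_integrable:
  assumes "test_function \<Omega> \<phi>"
  shows "square_integrable \<phi>" "square_integrable (gradient \<phi>)"
proof -
  have K: "compact (closure {x. \<phi> x \<noteq> 0})"
    using assms by (simp add: test_function_def)
  show "square_integrable \<phi>"
    using closure_subset[of "{x. \<phi> x \<noteq> 0}"]
    by (intro square_integrable_compact_support[OF test_function_continuous(1)[OF assms] K]) auto
  show "square_integrable (gradient \<phi>)"
    by (intro square_integrable_compact_support[OF test_function_continuous(2)[OF assms] K]
        gradient_eq_0[OF assms])
qed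

text \<open>With \<open>R = 2\<rho>\<close> the point \<open>x + R b\<close> lies outside \<open>\<Omega>\<close> for every \<open>x \<in> \<Omega>\<close> and every unit vector \<open>b\<close>, so that
  \<open>\<phi> x = - \<integral>\<^sub>0\<^sup>R \<partial>\<^sub>b\<phi>(x + s b) ds\<close> and \<open>\<bar>\<phi> x\<bar>\<^sup>2 \<le> R \<integral>\<^sub>0\<^sup>R \<bar>\<partial>\<^sub>b\<phi>(x + s b)\<bar>\<^sup>2 ds\<close>. Integrating over \<open>x\<close> first, translation
  invariance makes the inner integral independent of \<open>s\<close>.\<close>

lemma Poincare_test_function:
  fixes \<Omega> :: "'a::euclidean_space set"
  assumes \<phi>: "test_function \<Omega> \<phi>" and \<Omega>: "\<Omega> \<subseteq> ball 0 \<rho>" and "0 < \<rho>"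
  shows "norm (abs_L2 \<phi>) \<le> 2 * \<rho> * norm (abs_L2 (gradient \<phi>))"
proof -
  define R where "R = 2 * \<rho>"
  have "0 < R" using \<open>0 < \<rho>\<close> by (simp add: R_def)
  obtain b :: 'a where b: "b \<in> Basis"
    using nonempty_Basis by blast
  define g where "g x = gradient \<phi> x \<bullet> b" for x
  have g_cont: "continuous_on UNIV g"
    unfolding g_def by (intro continuous_intros test_function_continuous(2)[OF \<phi>])
  have g_le: "\<bar>g x\<bar> \<le> norm (gradient \<phi> x)" for x
    using Cauchy_Schwarz_ineq2[of "gradient \<phi> x" b] b by (simp add: g_def)
  have \<phi>_0: "\<phi> x = 0" if "x \<notin> \<Omega>" for x
    using \<phi> that closure_subset[of "{x. \<phi> x \<noteq> 0}"] by (auto simp: test_function_def)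
  have line_cont: "continuous_on S (\<lambda>s. g (x + s *\<^sub>R b))" for x S
    by (intro continuous_on_compose2[OF g_cont] continuous_intros) auto
  have fundamental: "((\<lambda>s. g (x + s *\<^sub>R b)) has_integral (\<phi> (x + R *\<^sub>R b) - \<phi> x)) {0..R}" for x
  proof -
    have "((\<lambda>s. \<phi> (x + s *\<^sub>R b)) has_vector_derivative g (x + s *\<^sub>R b)) (at s within {0..R})" for s
    proof -
      have "(\<phi> has_derivative frechet_derivative \<phi> (at (x + s *\<^sub>R b))) (at (x + s *\<^sub>R b))"
        using test_function_continuous(3)[OF \<phi>] frechet_derivative_works by blast
      then have "(\<phi> has_derivative (\<lambda>v. gradient \<phi> (x + s *\<^sub>R b) \<bullet> v)) (at (x + s *\<^sub>R b))"
        unfolding frechet_derivative_eq_gradient[OF test_function_continuous(3)[OF \<phi>], abs_def] by simp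
      moreover have "((\<lambda>s. x + s *\<^sub>R b) has_derivative (\<lambda>h. h *\<^sub>R b)) (at s within {0..R})"
        by (auto intro!: derivative_eq_intros)
      ultimately have "((\<lambda>s. \<phi> (x + s *\<^sub>R b)) has_derivative (\<lambda>h. gradient \<phi> (x + s *\<^sub>R b) \<bullet> (h *\<^sub>R b)))
          (at s within {0..R})"
        by (rule has_derivative_compose[rotated])
      then show ?thesis
        by (simp add: has_vector_derivative_def g_def)
    qed
    from fundamental_theorem_of_calculus[OF _ this] \<open>0 < R\<close> show ?thesis
      by simp
  qed
  have pointwise: "ennreal ((\<phi> x)\<^sup>2) \<le> ennreal R * (\<integral>\<^sup>+s. ennreal ((g (x + s *\<^sub>R b))\<^sup>2) * indicator {0..R} s \<partial>lborel)" for x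
  proof (cases "x \<in> \<Omega>")
    case True
    have "x + R *\<^sub>R b \<notin> \<Omega>"
    proof
      assume "x + R *\<^sub>R b \<in> \<Omega>"
      then have "norm (x + R *\<^sub>R b) < \<rho>" "norm x < \<rho>"
        using True \<Omega> by (auto simp: subset_iff)
      then have "norm (R *\<^sub>R b) < R"
        using norm_triangle_ineq4[of "x + R *\<^sub>R b" x] by (simp add: R_def)
      then show False using b \<open>0 < R\<close> by simp
    qed
    then have \<phi>_eq: "(\<phi> x)\<^sup>2 = (integral {0..R} (\<lambda>s. g (x + s *\<^sub>R b)))\<^sup>2"
      using integral_unique[OF fundamental[of x]] \<phi>_0[of "x + R *\<^sub>R b"] by simp
    have int: "integrable (lebesgue_on {0..R}) (\<lambda>s. g (x + s *\<^sub>R b))"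
      "integrable (lebesgue_on {0..R}) (\<lambda>s. (g (x + s *\<^sub>R b))\<^sup>2)"
      by (intro continuous_imp_integrable_real continuous_intros line_cont)+
    have "(\<phi> x)\<^sup>2 \<le> measure (lebesgue_on {0..R}) (space (lebesgue_on {0..R})) *
        (\<integral>s. (g (x + s *\<^sub>R b))\<^sup>2 \<partial>lebesgue_on {0..R})"
      unfolding \<phi>_eq lebesgue_integral_eq_integral[OF int(1), simplified, symmetric]
      by (intro square_integral_le finite_measure_lebesgue_on int) simp
    also have "measure (lebesgue_on {0..R}) (space (lebesgue_on {0..R})) = R"
      using \<open>0 < R\<close> by (simp add: measure_restrict_space)
    finally have "ennreal ((\<phi> x)\<^sup>2) \<le> ennreal (R * (\<integral>s. (g (x + s *\<^sub>R b))\<^sup>2 \<partial>lebesgue_on {0..R}))"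
      by (rule ennreal_leI)
    also have "\<dots> = ennreal R * ennreal (\<integral>s. (g (x + s *\<^sub>R b))\<^sup>2 \<partial>lebesgue_on {0..R})"
      using \<open>0 < R\<close> by (simp add: ennreal_mult)
    also have "ennreal (\<integral>s. (g (x + s *\<^sub>R b))\<^sup>2 \<partial>lebesgue_on {0..R}) =
        (\<integral>\<^sup>+s. ennreal ((g (x + s *\<^sub>R b))\<^sup>2) \<partial>lebesgue_on {0..R})"
      by (rule nn_integral_eq_integral[OF int(2), symmetric]) simp
    also have "\<dots> = (\<integral>\<^sup>+s. ennreal ((g (x + s *\<^sub>R b))\<^sup>2) * indicator {0..R} s \<partial>lebesgue)"
      by (simp add: nn_integral_restrict_space)
    finally show ?thesis
      by (simp add: nn_integral_completion)
  qed (simp add: \<phi>_0)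
  have [measurable]: "\<phi> \<in> borel_measurable borel" "g \<in> borel_measurable borel"
    "gradient \<phi> \<in> borel_measurable borel"
    using test_function_continuous[OF \<phi>] g_cont by (auto intro: borel_measurable_continuous_onI)
  have shift: "(\<integral>\<^sup>+x. ennreal ((g (x + s *\<^sub>R b))\<^sup>2) \<partial>lborel) = (\<integral>\<^sup>+x. ennreal ((g x)\<^sup>2) \<partial>lborel)" for s
  proof -
    have "(\<integral>\<^sup>+x. ennreal ((g x)\<^sup>2) \<partial>lborel) = (\<integral>\<^sup>+x. ennreal ((g x)\<^sup>2) \<partial>distr lborel borel ((+) (s *\<^sub>R b)))"
      by (simp add: lborel_distr_plus)
    also have "\<dots> = (\<integral>\<^sup>+x. ennreal ((g (x + s *\<^sub>R b))\<^sup>2) \<partial>lborel)"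
      by (subst nn_integral_distr) (simp_all add: add.commute)
    finally show ?thesis ..
  qed
  have "(\<integral>\<^sup>+x. ennreal ((\<phi> x)\<^sup>2) \<partial>lborel) \<le>
      (\<integral>\<^sup>+x. ennreal R * (\<integral>\<^sup>+s. ennreal ((g (x + s *\<^sub>R b))\<^sup>2) * indicator {0..R} s \<partial>lborel) \<partial>lborel)"
    by (intro nn_integral_mono pointwise)
  also have "\<dots> = ennreal R * (\<integral>\<^sup>+x. (\<integral>\<^sup>+s. ennreal ((g (x + s *\<^sub>R b))\<^sup>2) * indicator {0..R} s \<partial>lborel) \<partial>lborel)"
    by (intro nn_integral_cmult) measurable
  also have "(\<integral>\<^sup>+x. (\<integral>\<^sup>+s. ennreal ((g (x + s *\<^sub>R b))\<^sup>2) * indicator {0..R} s \<partial>lborel) \<partial>lborel) =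
      (\<integral>\<^sup>+s. (\<integral>\<^sup>+x. ennreal ((g (x + s *\<^sub>R b))\<^sup>2) * indicator {0..R} s \<partial>lborel) \<partial>lborel)"
    by (rule lborel_pair.Fubini') measurable
  also have "\<dots> = (\<integral>\<^sup>+s. (\<integral>\<^sup>+x. ennreal ((g x)\<^sup>2) \<partial>lborel) * indicator {0..R} s \<partial>lborel)"
    by (subst nn_integral_multc) (auto simp: shift)
  also have "\<dots> = (\<integral>\<^sup>+x. ennreal ((g x)\<^sup>2) \<partial>lborel) * ennreal R"
    using \<open>0 < R\<close> by (simp add: nn_integral_cmult)
  also have "\<dots> \<le> (\<integral>\<^sup>+x. ennreal ((norm (gradient \<phi> x))\<^sup>2) \<partial>lborel) * ennreal R"
    by (intro mult_right_mono nn_integral_mono ennreal_leI) (use power_mono[OF g_le abs_ge_zero, of _ 2] in auto)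
  finally have main: "(\<integral>\<^sup>+x. ennreal ((\<phi> x)\<^sup>2) \<partial>lborel) \<le>
      ennreal R * ((\<integral>\<^sup>+x. ennreal ((norm (gradient \<phi> x))\<^sup>2) \<partial>lborel) * ennreal R)"
    by (simp add: mult_left_mono)
  have norm_eq: "ennreal ((norm (abs_L2 f))\<^sup>2) = (\<integral>\<^sup>+x. ennreal ((norm (f x))\<^sup>2) \<partial>lborel)"
    if "square_integrable f" for f :: "'a \<Rightarrow> 'c::euclidean_space"
    unfolding norm_abs_L2[OF that] using that
    by (subst nn_integral_eq_integral[symmetric]) (auto simp: square_integrable_def nn_integral_completion)
  have "ennreal ((norm (abs_L2 \<phi>))\<^sup>2) \<le> ennreal R * (ennreal ((norm (abs_L2 (gradient \<phi>)))\<^sup>2) * ennreal R)"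
    using main norm_eq[OF test_function_square_integrable(1)[OF \<phi>]]
      norm_eq[OF test_function_square_integrable(2)[OF \<phi>]] by simp
  also have "\<dots> = ennreal ((R * norm (abs_L2 (gradient \<phi>)))\<^sup>2)"
    using \<open>0 < R\<close> by (simp add: ennreal_mult[symmetric] power2_eq_square mult.commute mult.left_commute)
  finally have "(norm (abs_L2 \<phi>))\<^sup>2 \<le> (R * norm (abs_L2 (gradient \<phi>)))\<^sup>2"
    by (simp add: ennreal_le_iff)
  then show ?thesis
    unfolding R_def[symmetric] using \<open>0 < R\<close> by (auto intro: power2_le_imp_le)
qed

lemma test_function_lincomb:
  assumes "test_function \<Omega> \<phi>" "test_function \<Omega> \<psi>"
  shows "test_function \<Omega> (\<lambda>x. a * \<phi> x + b * \<psi> x)"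
    "gradient (\<lambda>x. a * \<phi> x + b * \<psi> x) = (\<lambda>x. a *\<^sub>R gradient \<phi> x + b *\<^sub>R gradient \<psi> x)"
proof -
  have fd: "frechet_derivative (\<lambda>x. a * f x + b * g x) (at x) =
      (\<lambda>v. a * frechet_derivative f (at x) v + b * frechet_derivative g (at x) v)"
    if "f differentiable (at x)" "g differentiable (at x)" for f g :: "'a \<Rightarrow> real" and x
  proof (rule frechet_derivative_at[symmetric])
    have "(f has_derivative frechet_derivative f (at x)) (at x)"
      "(g has_derivative frechet_derivative g (at x)) (at x)"
      using that frechet_derivative_works by blast+
    then show "((\<lambda>x. a * f x + b * g x) has_derivative
        (\<lambda>v. a * frechet_derivative f (at x) v + b * frechet_derivative g (at x) v)) (at x)"
      by (auto intro!: derivative_eq_intros)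
  qed
  have Ck: "Ck k (\<lambda>x. a * f x + b * g x)" if "Ck k f" "Ck k g" for k and f g :: "'a \<Rightarrow> real"
    using that
  proof (induction k arbitrary: f g)
    case 0
    then show ?case by (auto intro!: continuous_intros)
  next
    case (Suc k)
    then show ?case
      by (auto simp: fd intro!: derivative_intros)
  qed
  define K where "K = closure {x. \<phi> x \<noteq> 0} \<union> closure {x. \<psi> x \<noteq> 0}"
  have "compact K" "K \<subseteq> \<Omega>"
    using assms by (auto simp: K_def test_function_def)
  moreover have "closure {x. a * \<phi> x + b * \<psi> x \<noteq> 0} \<subseteq> K"
    unfolding K_def closure_Un[symmetric] by (intro closure_mono) auto
  ultimately show "test_function \<Omega> (\<lambda>x. a * \<phi> x + b * \<psi> x)"
    using assms Ck compact_Int_closed[of K "closure {x. a * \<phi> x + b * \<psi> x \<noteq> 0}"]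
    by (auto simp: test_function_def Int_absorb1)
  show "gradient (\<lambda>x. a * \<phi> x + b * \<psi> x) = (\<lambda>x. a *\<^sub>R gradient \<phi> x + b *\<^sub>R gradient \<psi> x)"
    unfolding gradient_def fd[OF test_function_continuous(3)[OF assms(1)] test_function_continuous(3)[OF assms(2)]]
    by (simp add: scaleR_add_left sum.distrib scaleR_sum_right fun_eq_iff)
qed

lemma test_function_zero:
  fixes \<Omega> :: "'a::euclidean_space set"
  shows "test_function \<Omega> (\<lambda>_. 0)" "gradient (\<lambda>_::'a. 0) = (\<lambda>_. 0)"
proof -
  have fd: "frechet_derivative (\<lambda>_. 0) (at x) = (\<lambda>_. 0)" for x :: 'a
    by (rule frechet_derivative_at[symmetric]) simp
  have "Ck k (\<lambda>_::'a. 0)" for k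
    by (induction k) (auto simp: fd)
  then show "test_function \<Omega> (\<lambda>_. 0)"
    by (simp add: test_function_def)
  show "gradient (\<lambda>_. 0) = (\<lambda>_::'a. 0)"
    by (simp add: gradient_def[abs_def] fd)
qed

lemma subspace_H10: "subspace (H10 \<Omega>)"
proof -
  define D where "D = {(abs_L2 \<phi>, abs_L2 (gradient \<phi>)) | \<phi>. test_function \<Omega> \<phi>}"
  have comb: "a *\<^sub>R x + b *\<^sub>R y \<in> D" if xy: "x \<in> D" "y \<in> D" for a b x y
  proof -
    obtain \<phi> \<psi> where \<phi>: "test_function \<Omega> \<phi>" "x = (abs_L2 \<phi>, abs_L2 (gradient \<phi>))"
      and \<psi>: "test_function \<Omega> \<psi>" "y = (abs_L2 \<psi>, abs_L2 (gradient \<psi>))"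
      using xy unfolding D_def by blast
    have lin: "a *\<^sub>R abs_L2 f + b *\<^sub>R abs_L2 g = abs_L2 (\<lambda>x. a *\<^sub>R f x + b *\<^sub>R g x)"
      if "square_integrable f" "square_integrable g" for f g :: "'a \<Rightarrow> 'c::euclidean_space"
      using abs_L2_add[OF square_integrable_scaleR[OF that(1), of a] square_integrable_scaleR[OF that(2), of b]]
      by (simp add: abs_L2_scaleR that)
    have "a *\<^sub>R x + b *\<^sub>R y =
        (abs_L2 (\<lambda>x. a * \<phi> x + b * \<psi> x), abs_L2 (gradient (\<lambda>x. a * \<phi> x + b * \<psi> x)))"
      using lin[OF test_function_square_integrable(1)[OF \<phi>(1)] test_function_square_integrable(1)[OF \<psi>(1)]]
        lin[OF test_function_square_integrable(2)[OF \<phi>(1)] test_function_square_integrable(2)[OF \<psi>(1)]]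
      by (simp add: \<phi>(2) \<psi>(2) test_function_lincomb(2)[OF \<phi>(1) \<psi>(1)])
    then show ?thesis
      unfolding D_def using test_function_lincomb(1)[OF \<phi>(1) \<psi>(1)] by blast
  qed
  have "0 \<in> D"
    unfolding D_def zero_prod_def zero_L2_def
    by (intro CollectI exI[of _ "\<lambda>_. 0"]) (simp add: test_function_zero)
  then have "subspace (closure D)"
    using comb[of _ _ 1 1] comb[of _ 0 _ 0] by (intro subspace_closure_rational) auto
  then show ?thesis
    by (simp add: H10_def D_def)
qed

lemma H10_subset_L2_on:
  assumes "\<Omega> \<in> sets lebesgue" "v \<in> H10 \<Omega>"
  shows "fst v \<in> L2_on \<Omega>"
proof -
  have "closed {v :: ('a, real) L2 \<times> ('a, 'a) L2. fst v \<in> L2_on \<Omega>}"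
    using continuous_closed_vimage[OF closed_L2_on[OF assms(1)], of fst] by (simp add: vimage_def)
  moreover have "abs_L2 \<phi> \<in> L2_on \<Omega>" if "test_function \<Omega> \<phi>" for \<phi>
  proof -
    have "\<phi> x = 0" if "x \<notin> \<Omega>" for x
      using \<open>test_function \<Omega> \<phi>\<close> that closure_subset[of "{x. \<phi> x \<noteq> 0}"] by (auto simp: test_function_def)
    then show ?thesis
      unfolding L2_on_def using rep_abs_L2[OF test_function_square_integrable(1)[OF that]]
      by (auto elim: eventually_mono)
  qed
  ultimately have "H10 \<Omega> \<subseteq> {v. fst v \<in> L2_on \<Omega>}"
    unfolding H10_def by (intro closure_minimal) auto
  then show ?thesis
    using assms(2) by auto
qed

text \<open>Both sides of the inequality for test functions are continuous in the \<open>H\<^sup>1\<close> norm, hence it passes to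
  the closure.\<close>

lemma Poincare:
  fixes \<Omega> :: "'a::euclidean_space set"
  assumes "bounded \<Omega>"
  obtains c where "0 < c" "\<And>v. v \<in> H10 \<Omega> \<Longrightarrow> norm v \<le> c * norm (snd v)"
proof -
  obtain \<rho> where \<rho>: "0 < \<rho>" "\<Omega> \<subseteq> ball 0 \<rho>"
    using bounded_subset_ballD[OF assms, of 0] by auto
  have "closed {v :: ('a, real) L2 \<times> ('a, 'a) L2. norm (fst v) \<le> 2 * \<rho> * norm (snd v)}"
    by (intro closed_Collect_le continuous_intros)
  then have "H10 \<Omega> \<subseteq> {v. norm (fst v) \<le> 2 * \<rho> * norm (snd v)}"
    unfolding H10_def by (intro closure_minimal) (auto intro: Poincare_test_function[OF _ \<rho>(2,1)])
  then have "norm v \<le> (2 * \<rho> + 1) * norm (snd v)" if "v \<in> H10 \<Omega>" for v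
    using that norm_Pair_le[of "fst v" "snd v"] by (fastforce simp: algebra_simps)
  then show ?thesis
    using \<rho>(1) by (intro that[of "2 * \<rho> + 1"]) auto
qed

section \<open>Bochner integrals in seminormed Hilbert spaces\<close>

abbreviation simple_integrable :: "'s measure \<Rightarrow> ('s \<Rightarrow> 'w::real_vector) \<Rightarrow> bool" where
  "simple_integrable \<equiv> Bochner_Integration.simple_bochner_integrable"

abbreviation simple_integral :: "'s measure \<Rightarrow> ('s \<Rightarrow> 'w::real_vector) \<Rightarrow> 'w" where
  "simple_integral \<equiv> Bochner_Integration.simple_bochner_integral"

text \<open>A vector space \<open>C\<close> of representatives with a positive semidefinite form \<open>B\<close>. The vectors with \<open>N x = 0\<close> are
  not divided out, so everything below respects equality up to null vectors only.\<close>

locale semi_inner_space =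
  fixes C :: "'w::real_vector set" and B :: "'w \<Rightarrow> 'w \<Rightarrow> real"
  assumes subspace_C: "subspace C"
    and B_add_left: "x \<in> C \<Longrightarrow> y \<in> C \<Longrightarrow> z \<in> C \<Longrightarrow> B (x + y) z = B x z + B y z"
    and B_scaleR_left: "x \<in> C \<Longrightarrow> z \<in> C \<Longrightarrow> B (c *\<^sub>R x) z = c * B x z"
    and B_commute: "x \<in> C \<Longrightarrow> y \<in> C \<Longrightarrow> B x y = B y x"
    and B_nonneg: "x \<in> C \<Longrightarrow> 0 \<le> B x x"
begin

definition N :: "'w \<Rightarrow> real" where "N x = sqrt (B x x)"

lemma in_C [simp, intro]:
  "0 \<in> C" "x \<in> C \<Longrightarrow> y \<in> C \<Longrightarrow> x + y \<in> C" "x \<in> C \<Longrightarrow> y \<in> C \<Longrightarrow> x - y \<in> C"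
  "x \<in> C \<Longrightarrow> c *\<^sub>R x \<in> C" "x \<in> C \<Longrightarrow> - x \<in> C"
  using subspace_C
  by (auto intro: subspace_0 subspace_add subspace_diff subspace_scale subspace_neg)

lemma B_diff_left: "x \<in> C \<Longrightarrow> y \<in> C \<Longrightarrow> z \<in> C \<Longrightarrow> B (x - y) z = B x z - B y z"
  using B_add_left[of x "(-1) *\<^sub>R y" z] B_scaleR_left[of y z "-1"] by simp

lemma B_add_right: "x \<in> C \<Longrightarrow> y \<in> C \<Longrightarrow> z \<in> C \<Longrightarrow> B x (y + z) = B x y + B x z"
  by (metis B_add_left B_commute in_C(2))

lemma B_diff_right: "x \<in> C \<Longrightarrow> y \<in> C \<Longrightarrow> z \<in> C \<Longrightarrow> B x (y - z) = B x y - B x z"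
  by (metis B_diff_left B_commute in_C(3))

lemma B_scaleR_right: "x \<in> C \<Longrightarrow> y \<in> C \<Longrightarrow> B x (c *\<^sub>R y) = c * B x y"
  by (metis B_scaleR_left B_commute in_C(4))

lemmas B_bilinear = B_add_left B_diff_left B_scaleR_left B_add_right B_diff_right B_scaleR_right

lemma N_nonneg: "x \<in> C \<Longrightarrow> 0 \<le> N x"
  by (simp add: N_def B_nonneg)

lemma N_power2: "x \<in> C \<Longrightarrow> (N x)\<^sup>2 = B x x"
  by (simp add: N_def B_nonneg)

lemma Cauchy_Schwarz_B:
  assumes "x \<in> C" "y \<in> C"
  shows "\<bar>B x y\<bar> \<le> N x * N y"
proof -
  have "(B x y)\<^sup>2 \<le> B y y * B x x"
  proof (rule discriminant_le[OF _ B_nonneg[OF assms(2)]])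
    fix c
    have "0 \<le> B (x - c *\<^sub>R y) (x - c *\<^sub>R y)"
      using assms by (intro B_nonneg) auto
    also have "\<dots> = c\<^sup>2 * B y y - 2 * c * B x y + B x x"
      using assms by (simp add: B_bilinear B_commute[of y x] algebra_simps power2_eq_square)
    finally show "0 \<le> c\<^sup>2 * B y y - 2 * c * B x y + B x x" .
  qed
  also have "\<dots> = (N x * N y)\<^sup>2"
    using assms by (simp add: power_mult_distrib N_power2)
  finally show ?thesis
    using assms by (simp add: abs_le_square_iff[symmetric] N_nonneg)
qed

lemma N_triangle:
  assumes "x \<in> C" "y \<in> C"
  shows "N (x + y) \<le> N x + N y"
proof (rule power2_le_imp_le)
  have "(N (x + y))\<^sup>2 = (N x)\<^sup>2 + 2 * B x y + (N y)\<^sup>2"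
    using assms by (simp add: N_power2 B_bilinear B_commute[of y x])
  also have "\<dots> \<le> (N x + N y)\<^sup>2"
    using Cauchy_Schwarz_B[OF assms] by (simp add: power2_sum)
  finally show "(N (x + y))\<^sup>2 \<le> (N x + N y)\<^sup>2" .
qed (use assms in \<open>simp add: N_nonneg\<close>)

lemma N_scaleR: "x \<in> C \<Longrightarrow> N (c *\<^sub>R x) = \<bar>c\<bar> * N x"
  by (simp add: N_def B_bilinear real_sqrt_mult flip: mult.assoc power2_eq_square)

lemma N_minus: "x \<in> C \<Longrightarrow> N (- x) = N x"
  using N_scaleR[of x "-1"] by simp

lemma N_minus_commute: "x \<in> C \<Longrightarrow> y \<in> C \<Longrightarrow> N (x - y) = N (y - x)"
  using N_minus[of "x - y"] by simp

lemma N_zero: "N 0 = 0"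
  using N_scaleR[of 0 0] by simp

lemma N_triangle_diff: "x \<in> C \<Longrightarrow> y \<in> C \<Longrightarrow> z \<in> C \<Longrightarrow> N (x - z) \<le> N (x - y) + N (y - z)"
  using N_triangle[of "x - y" "y - z"] by simp

lemma N_diff_le: "x \<in> C \<Longrightarrow> y \<in> C \<Longrightarrow> N (x - y) \<le> N x + N y"
  using N_triangle[of x "- y"] by (simp add: N_minus)

lemma N_diff_bound: "x \<in> C \<Longrightarrow> y \<in> C \<Longrightarrow> \<bar>N x - N y\<bar> \<le> N (x - y)"
  using N_triangle[of "x - y" y] N_triangle[of "y - x" x] by (simp add: N_minus_commute)

lemma N_null_trans: "x \<in> C \<Longrightarrow> y \<in> C \<Longrightarrow> z \<in> C \<Longrightarrow> N (x - y) = 0 \<Longrightarrow> N (y - z) = 0 \<Longrightarrow> N (x - z) = 0"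
  using N_triangle_diff[of x y z] N_nonneg[of "x - z"] by simp

lemma N_null_cong:
  assumes "x \<in> C" "y \<in> C" "N (x - y) = 0"
  shows "N x = N y"
  using N_diff_bound[OF assms(1,2)] assms(3) by simp

lemma N_null_diff_cong:
  assumes "x \<in> C" "y \<in> C" "x' \<in> C" "y' \<in> C" "N (x - x') = 0" "N (y - y') = 0"
  shows "N (x - y) = N (x' - y')"
proof (rule N_null_cong)
  have "N ((x - x') - (y - y')) \<le> N (x - x') + N (y - y')"
    by (intro N_diff_le) (use assms in auto)
  then have "N ((x - x') - (y - y')) = 0"
    using assms N_nonneg[of "(x - x') - (y - y')"] by simp
  moreover have "(x - x') - (y - y') = (x - y) - (x' - y')" by simp
  ultimately show "N ((x - y) - (x' - y')) = 0" by metis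
qed (use assms in auto)

definition bounded_functional :: "('w \<Rightarrow> real) \<Rightarrow> bool" where
  "bounded_functional L \<longleftrightarrow>
     (\<forall>x\<in>C. \<forall>y\<in>C. L (x + y) = L x + L y) \<and> (\<forall>c. \<forall>x\<in>C. L (c *\<^sub>R x) = c * L x) \<and>
     (\<exists>K. \<forall>x\<in>C. \<bar>L x\<bar> \<le> K * N x)"

lemma bounded_functional_B: "y \<in> C \<Longrightarrow> bounded_functional (\<lambda>x. B x y)"
  unfolding bounded_functional_def
  by (intro conjI exI[of _ "N y"]) (use Cauchy_Schwarz_B in \<open>auto simp: B_bilinear mult.commute[of "N y"]\<close>)

lemma bounded_functionalD:
  assumes "bounded_functional L"
  shows "x \<in> C \<Longrightarrow> y \<in> C \<Longrightarrow> L (x + y) = L x + L y" "x \<in> C \<Longrightarrow> L (c *\<^sub>R x) = c * L x"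
    "x \<in> C \<Longrightarrow> y \<in> C \<Longrightarrow> L (x - y) = L x - L y" "L 0 = 0"
    "\<exists>K\<ge>0. \<forall>x\<in>C. \<bar>L x\<bar> \<le> K * N x"
proof -
  show add: "L (x + y) = L x + L y" if "x \<in> C" "y \<in> C" for x y
    using assms that by (simp add: bounded_functional_def)
  show scale: "L (c *\<^sub>R x) = c * L x" if "x \<in> C" for x c
    using assms that by (simp add: bounded_functional_def)
  show "L (x - y) = L x - L y" if "x \<in> C" "y \<in> C" for x y
    using add[of x "(-1) *\<^sub>R y"] scale[of y "-1"] that by simp
  show "L 0 = 0"
    using scale[of 0 0] by simp
  obtain K where K: "\<And>x. x \<in> C \<Longrightarrow> \<bar>L x\<bar> \<le> K * N x"
    using assms unfolding bounded_functional_def by blast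
  have "\<bar>L x\<bar> \<le> \<bar>K\<bar> * N x" if "x \<in> C" for x
    using K[OF that] mult_right_mono[OF abs_ge_self N_nonneg[OF that], of K] by linarith
  then show "\<exists>K\<ge>0. \<forall>x\<in>C. \<bar>L x\<bar> \<le> K * N x"
    by (intro exI[of _ "\<bar>K\<bar>"]) auto
qed

lemma bounded_functional_null:
  assumes "bounded_functional L" "x \<in> C" "y \<in> C" "N (x - y) = 0"
  shows "L x = L y"
proof -
  obtain K where "\<bar>L (x - y)\<bar> \<le> K * N (x - y)"
    using bounded_functionalD(5)[OF assms(1)] assms by blast
  then show ?thesis
    using assms bounded_functionalD(3)[OF assms(1)] by simp
qed

lemma bounded_functional_tendsto:
  assumes "bounded_functional L" "\<And>i. X i \<in> C" "x \<in> C" "((\<lambda>i. N (X i - x)) \<longlongrightarrow> 0) F"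
  shows "((\<lambda>i. L (X i)) \<longlongrightarrow> L x) F"
proof -
  obtain K where K: "\<And>x. x \<in> C \<Longrightarrow> \<bar>L x\<bar> \<le> K * N x"
    using bounded_functionalD(5)[OF assms(1)] by blast
  have "((\<lambda>i. L (X i) - L x) \<longlongrightarrow> 0) F"
  proof (rule Lim_null_comparison)
    show "\<forall>\<^sub>F i in F. norm (L (X i) - L x) \<le> K * N (X i - x)"
      using assms K[of "X _ - x"] by (auto simp: bounded_functionalD(3)[OF assms(1)])
    show "((\<lambda>i. K * N (X i - x)) \<longlongrightarrow> 0) F"
      using tendsto_mult_right_zero[OF assms(4)] by simp
  qed
  then show ?thesis
    by (rule LIM_zero_cancel)
qed

text \<open>Pointwise dominated convergence of simple functions, which is stronger than the convergence in mean
  of \<open>has_bochner_integral_on\<close>: it makes \<open>L \<circ> g\<close> measurable for each bounded functional \<open>L\<close> and \<open>N \<circ> g\<close> measurable.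
  All integrands below have this property.\<close>

definition simple_approx :: "'s measure \<Rightarrow> ('s \<Rightarrow> 'w) \<Rightarrow> (nat \<Rightarrow> 's \<Rightarrow> 'w) \<Rightarrow> bool" where
  "simple_approx M g s \<longleftrightarrow> g \<in> space M \<rightarrow> C \<and>
     (\<forall>n. simple_integrable M (s n) \<and> s n \<in> space M \<rightarrow> C) \<and>
     (\<forall>x\<in>space M. (\<lambda>n. N (g x - s n x)) \<longlonglongrightarrow> 0) \<and>
     (\<exists>b. integrable M b \<and> (\<forall>n. \<forall>x\<in>space M. N (s n x) \<le> b x))"

definition integral_is :: "'s measure \<Rightarrow> ('s \<Rightarrow> 'w) \<Rightarrow> 'w \<Rightarrow> bool" where
  "integral_is M g I \<longleftrightarrow> I \<in> C \<and> (\<exists>s. simple_approx M g s \<and>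
     (\<lambda>n. N (simple_integral M (s n) - I)) \<longlonglongrightarrow> 0)"

lemma sum_in_C: "(\<And>i. i \<in> A \<Longrightarrow> f i \<in> C) \<Longrightarrow> (\<Sum>i\<in>A. f i) \<in> C"
  by (rule subspace_sum[OF subspace_C])

lemma N_sum: "(\<And>i. i \<in> A \<Longrightarrow> f i \<in> C) \<Longrightarrow> N (\<Sum>i\<in>A. f i) \<le> (\<Sum>i\<in>A. N (f i))"
proof (induction A rule: infinite_finite_induct)
  case (insert a A)
  then have "N (f a + sum f A) \<le> N (f a) + N (sum f A)"
    by (intro N_triangle sum_in_C) auto
  with insert show ?case by auto
qed (simp_all add: N_zero)

lemma simple_bochner_integral_in_C:
  "s \<in> space M \<rightarrow> C \<Longrightarrow> simple_integral M s \<in> C"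
  unfolding Bochner_Integration.simple_bochner_integral_def
  by (intro sum_in_C in_C(4)) auto

lemma simple_N:
  assumes "simple_integrable M s" "s \<in> space M \<rightarrow> C"
  shows "simple_integrable M (\<lambda>x. N (s x))"
    "N (simple_integral M s) \<le> (\<integral>x. N (s x) \<partial>M)"
proof -
  show *: "simple_integrable M (\<lambda>x. N (s x))"
    using simple_bochner_integrable_compose2[of "\<lambda>x y. N x" M s s] assms(1) N_zero by simp
  have "N (simple_integral M s) \<le>
      (\<Sum>y\<in>s ` space M. N (measure M {x \<in> space M. s x = y} *\<^sub>R y))"
    unfolding Bochner_Integration.simple_bochner_integral_def using assms(2) by (intro N_sum) auto
  also have "\<dots> = (\<Sum>y\<in>s ` space M. measure M {x \<in> space M. s x = y} *\<^sub>R N y)"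
    using assms(2) by (intro sum.cong) (auto simp: N_scaleR Pi_iff)
  also have "\<dots> = simple_integral M (\<lambda>x. N (s x))"
    using assms(1) by (intro simple_bochner_integral_partition[OF *, symmetric])
      (auto elim: simple_bochner_integrable.cases)
  also have "\<dots> = (\<integral>x. N (s x) \<partial>M)"
    by (rule simple_bochner_integrable_eq_integral[OF *])
  finally show "N (simple_integral M s) \<le> (\<integral>x. N (s x) \<partial>M)" .
qed

lemma simple_functional:
  assumes L: "bounded_functional L"
    and s: "simple_integrable M s" "s \<in> space M \<rightarrow> C"
  shows "simple_integrable M (\<lambda>x. L (s x))"
    "L (simple_integral M s) = (\<integral>x. L (s x) \<partial>M)"
proof -
  show *: "simple_integrable M (\<lambda>x. L (s x))"
    using simple_bochner_integrable_compose2[of "\<lambda>x y. L x" M s s] s(1) bounded_functionalD(4)[OF L] by simp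
  have L_sum: "L (\<Sum>i\<in>A. f i) = (\<Sum>i\<in>A. L (f i))" if "\<And>i. i \<in> A \<Longrightarrow> f i \<in> C" for A and f :: "'w \<Rightarrow> 'w"
    using that
    by (induction A rule: infinite_finite_induct) (auto simp: bounded_functionalD[OF L] sum_in_C)
  have "L (simple_integral M s) =
      (\<Sum>y\<in>s ` space M. L (measure M {x \<in> space M. s x = y} *\<^sub>R y))"
    unfolding Bochner_Integration.simple_bochner_integral_def using s(2) by (intro L_sum) auto
  also have "\<dots> = (\<Sum>y\<in>s ` space M. measure M {x \<in> space M. s x = y} *\<^sub>R L y)"
    using s(2) by (intro sum.cong) (auto simp: bounded_functionalD(2)[OF L] Pi_iff)
  also have "\<dots> = simple_integral M (\<lambda>x. L (s x))"
    using s(1) by (intro simple_bochner_integral_partition[OF *, symmetric])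
      (auto elim: simple_bochner_integrable.cases)
  also have "\<dots> = (\<integral>x. L (s x) \<partial>M)"
    by (rule simple_bochner_integrable_eq_integral[OF *])
  finally show "L (simple_integral M s) = (\<integral>x. L (s x) \<partial>M)" .
qed

lemma simple_diff:
  assumes "simple_integrable M s" "s \<in> space M \<rightarrow> C"
    "simple_integrable M s'" "s' \<in> space M \<rightarrow> C"
  shows "simple_integrable M (\<lambda>x. s x - s' x)" "(\<lambda>x. s x - s' x) \<in> space M \<rightarrow> C"
  using simple_bochner_integrable_compose2[of "\<lambda>x y. x - y" M s s'] assms
  by (simp_all add: Pi_iff)

lemma simple_approx_diff_measurable:
  assumes "simple_approx M g s" "simple_approx M g' s'"
  shows "(\<lambda>x. N (g x - g' x)) \<in> borel_measurable M"
proof (rule borel_measurable_LIMSEQ_real)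
  fix x assume x: "x \<in> space M"
  have in_C: "g x \<in> C" "g' x \<in> C" "s n x \<in> C" "s' n x \<in> C" for n
    using assms x by (auto simp: simple_approx_def)
  show "(\<lambda>n. N (s n x - s' n x)) \<longlonglongrightarrow> N (g x - g' x)"
  proof (rule LIM_zero_cancel, rule Lim_null_comparison)
    have "\<bar>N (s n x - s' n x) - N (g x - g' x)\<bar> \<le> N ((s n x - s' n x) - (g x - g' x))" for n
      using in_C by (intro N_diff_bound) auto
    moreover have "N ((s n x - s' n x) - (g x - g' x)) \<le> N (g x - s n x) + N (g' x - s' n x)" for n
    proof -
      have "N ((g' x - s' n x) - (g x - s n x)) \<le> N (g' x - s' n x) + N (g x - s n x)"
        using in_C by (intro N_diff_le) auto
      moreover have "(g' x - s' n x) - (g x - s n x) = (s n x - s' n x) - (g x - g' x)"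
        by simp
      ultimately show ?thesis by simp
    qed
    ultimately have "\<bar>N (s n x - s' n x) - N (g x - g' x)\<bar> \<le> N (g x - s n x) + N (g' x - s' n x)" for n
      by (rule order_trans)
    then show "\<forall>\<^sub>F n in sequentially. norm (N (s n x - s' n x) - N (g x - g' x)) \<le>
        N (g x - s n x) + N (g' x - s' n x)"
      by simp
    show "(\<lambda>n. N (g x - s n x) + N (g' x - s' n x)) \<longlonglongrightarrow> 0"
      using assms x by (auto simp: simple_approx_def intro!: tendsto_add_zero)
  qed
next
  fix n
  have "simple_integrable M (\<lambda>x. N (s n x - s' n x))"
    using assms by (intro simple_N(1) simple_diff) (auto simp: simple_approx_def)
  then show "(\<lambda>x. N (s n x - s' n x)) \<in> borel_measurable M"
    by (auto elim: simple_bochner_integrable.cases intro: borel_measurable_simple_function)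
qed

lemma simple_approx_const:
  assumes "simple_approx M g s"
  shows "simple_approx M (s n) (\<lambda>_. s n)"
proof -
  have s: "simple_integrable M (s n)" "s n \<in> space M \<rightarrow> C"
    using assms by (auto simp: simple_approx_def)
  have "integrable M (\<lambda>x. N (s n x))"
    using has_bochner_integral_simple_bochner_integrable[OF simple_N(1)[OF s]] by (rule integrable.intros)
  with s show ?thesis
    unfolding simple_approx_def by (intro conjI exI[of _ "\<lambda>x. N (s n x)"]) (auto simp: N_zero)
qed

lemma simple_approx_bound:
  assumes "simple_approx M g s"
  obtains b where "integrable M b" "\<And>n x. x \<in> space M \<Longrightarrow> N (s n x) \<le> b x"
    "\<And>x. x \<in> space M \<Longrightarrow> N (g x) \<le> b x"
proof -
  obtain b where b: "integrable M b" "\<And>n x. x \<in> space M \<Longrightarrow> N (s n x) \<le> b x"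
    using assms by (auto simp: simple_approx_def)
  have "N (g x) \<le> b x" if x: "x \<in> space M" for x
  proof (rule LIMSEQ_le_const)
    show "(\<lambda>n. N (g x - s n x) + b x) \<longlonglongrightarrow> b x"
      using assms x by (auto simp: simple_approx_def intro!: tendsto_eq_intros)
    have "N (g x) \<le> N (g x - s n x) + b x" for n
    proof -
      have "g x \<in> C" "s n x \<in> C"
        using assms x by (auto simp: simple_approx_def Pi_iff)
      then show ?thesis
        using N_triangle[of "g x - s n x" "s n x"] b(2)[OF x, of n] by simp
    qed
    then show "\<exists>K. \<forall>n\<ge>K. N (g x) \<le> N (g x - s n x) + b x" by blast
  qed
  with b show ?thesis using that by blast
qed

lemma simple_approx_integrable_diff:
  assumes s: "simple_approx M g s"
  shows "integrable M (\<lambda>x. N (g x - s n x))" "(\<lambda>n. \<integral>x. N (g x - s n x) \<partial>M) \<longlonglongrightarrow> 0"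
proof -
  obtain b where b: "integrable M b" "\<And>n x. x \<in> space M \<Longrightarrow> N (s n x) \<le> b x"
    "\<And>x. x \<in> space M \<Longrightarrow> N (g x) \<le> b x"
    using simple_approx_bound[OF s] by blast
  have meas: "(\<lambda>x. N (g x - s n x)) \<in> borel_measurable M" for n
    by (rule simple_approx_diff_measurable[OF s simple_approx_const[OF s]])
  have bound: "norm (N (g x - s n x)) \<le> 2 * b x" if "x \<in> space M" for n x
  proof -
    have "g x \<in> C" "s n x \<in> C"
      using s that by (auto simp: simple_approx_def Pi_iff)
    then show ?thesis
      using N_diff_le[of "g x" "s n x"] b(2)[OF that, of n] b(3)[OF that] N_nonneg[of "g x - s n x"]
      by simp
  qed
  have b2: "integrable M (\<lambda>x. 2 * b x)" using b(1) by simp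
  show "integrable M (\<lambda>x. N (g x - s n x))"
    by (intro Bochner_Integration.integrable_bound[OF b2 meas] AE_I2 order_trans[OF bound])
      simp_all
  have "(\<lambda>n. \<integral>x. N (g x - s n x) \<partial>M) \<longlonglongrightarrow> (\<integral>x. 0 \<partial>M)"
    using s bound by (intro integral_dominated_convergence[OF _ meas b2] AE_I2) (auto simp: simple_approx_def)
  then show "(\<lambda>n. \<integral>x. N (g x - s n x) \<partial>M) \<longlonglongrightarrow> 0" by simp
qed

text \<open>The identity \<open>L (\<integral> g) = \<integral> L g\<close> holds for simple functions, and dominated convergence on the real line
  passes it to the limit. Taking \<open>L = B _ y\<close> for all \<open>y\<close>, it determines \<open>I\<close> up to a null vector.\<close>

lemma integral_is_functional:
  assumes L: "bounded_functional L" and I: "integral_is M g I"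
  shows "integrable M (\<lambda>x. L (g x))" "L I = (\<integral>x. L (g x) \<partial>M)"
proof -
  obtain s where s: "simple_approx M g s"
    and lim: "(\<lambda>n. N (simple_integral M (s n) - I)) \<longlonglongrightarrow> 0"
    and "I \<in> C"
    using I by (auto simp: integral_is_def)
  obtain b where b: "integrable M b" "\<And>n x. x \<in> space M \<Longrightarrow> N (s n x) \<le> b x"
    using simple_approx_bound[OF s] by metis
  obtain K where K: "0 \<le> K" "\<And>x. x \<in> C \<Longrightarrow> \<bar>L x\<bar> \<le> K * N x"
    using bounded_functionalD(5)[OF L] by blast
  have s': "simple_integrable M (s n)" "s n \<in> space M \<rightarrow> C" for n
    using s by (auto simp: simple_approx_def)
  have meas: "(\<lambda>x. L (s n x)) \<in> borel_measurable M" for n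
    using simple_functional(1)[OF L s']
    by (auto elim: simple_bochner_integrable.cases intro: borel_measurable_simple_function)
  have conv: "(\<lambda>n. L (s n x)) \<longlonglongrightarrow> L (g x)" if x: "x \<in> space M" for x
  proof (rule bounded_functional_tendsto[OF L])
    show "s n x \<in> C" "g x \<in> C" for n
      using s x by (auto simp: simple_approx_def)
    then have "N (s n x - g x) = N (g x - s n x)" for n
      by (rule N_minus_commute)
    then show "(\<lambda>n. N (s n x - g x)) \<longlonglongrightarrow> 0"
      using s x by (simp add: simple_approx_def)
  qed
  have meas_g: "(\<lambda>x. L (g x)) \<in> borel_measurable M"
    by (rule borel_measurable_LIMSEQ_real[OF conv meas])
  have dom: "AE x in M. norm (L (s n x)) \<le> K * b x" for n
  proof (rule AE_I2)
    fix x assume x: "x \<in> space M"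
    have "\<bar>L (s n x)\<bar> \<le> K * N (s n x)" using s'(2) x by (intro K(2)) auto
    also have "\<dots> \<le> K * b x" by (intro mult_left_mono b(2)[OF x] K(1))
    finally show "norm (L (s n x)) \<le> K * b x" by simp
  qed
  have Kb: "integrable M (\<lambda>x. K * b x)" using b(1) by simp
  show "integrable M (\<lambda>x. L (g x))"
    by (rule integrable_dominated_convergence[OF meas_g meas Kb AE_I2[OF conv] dom])
  have "(\<lambda>n. \<integral>x. L (s n x) \<partial>M) \<longlonglongrightarrow> (\<integral>x. L (g x) \<partial>M)"
    by (rule integral_dominated_convergence[OF meas_g meas Kb AE_I2[OF conv] dom])
  moreover have "(\<lambda>n. \<integral>x. L (s n x) \<partial>M) \<longlonglongrightarrow> L I"
    unfolding simple_functional(2)[OF L s', symmetric]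
    by (rule bounded_functional_tendsto[OF L _ \<open>I \<in> C\<close> lim]) (intro simple_bochner_integral_in_C s')
  ultimately show "L I = (\<integral>x. L (g x) \<partial>M)"
    by (rule LIMSEQ_unique[rotated])
qed

lemma integral_is_imp_has_bochner_integral_on:
  assumes "integral_is M g I"
  shows "has_bochner_integral_on C N M g I"
proof -
  obtain s where s: "simple_approx M g s"
    and lim: "(\<lambda>n. N (simple_integral M (s n) - I)) \<longlonglongrightarrow> 0"
    and "I \<in> C"
    using assms by (auto simp: integral_is_def)
  have eq: "(\<integral>\<^sup>+x. ennreal (N (g x - s n x)) \<partial>M) = ennreal (\<integral>x. N (g x - s n x) \<partial>M)" for n
    using s by (intro nn_integral_eq_integral simple_approx_integrable_diff(1)[OF s])
      (auto simp: simple_approx_def Pi_iff intro!: N_nonneg AE_I2)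
  have "(\<lambda>n. \<integral>\<^sup>+x. ennreal (N (g x - s n x)) \<partial>M) \<longlonglongrightarrow> 0"
    unfolding eq using tendsto_ennrealI[OF simple_approx_integrable_diff(2)[OF s]] by simp
  moreover have "(\<lambda>x. N (g x - s i x)) \<in> borel_measurable M" for i
    by (rule borel_measurable_integrable[OF simple_approx_integrable_diff(1)[OF s]])
  ultimately show ?thesis
    unfolding has_bochner_integral_on_def
    using s lim \<open>I \<in> C\<close> by (intro conjI exI[of _ s]) (auto simp: simple_approx_def)
qed

text \<open>Two approximating sequences are close to each other in mean, since both are close to \<open>g\<close>; hence
  properties of one constructed integral transfer to any other.\<close>

lemma has_bochner_integral_on_unique:
  assumes I: "has_bochner_integral_on C N M g I" and I': "has_bochner_integral_on C N M g I'"
  shows "N (I - I') = 0"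
proof -
  obtain s where s: "\<And>i. simple_integrable M (s i)" "\<And>i. s i \<in> space M \<rightarrow> C"
      "\<And>i. (\<lambda>x. N (g x - s i x)) \<in> borel_measurable M"
      "(\<lambda>i. \<integral>\<^sup>+x. ennreal (N (g x - s i x)) \<partial>M) \<longlonglongrightarrow> 0"
      "(\<lambda>i. N (simple_integral M (s i) - I)) \<longlonglongrightarrow> 0"
    using I unfolding has_bochner_integral_on_def by blast
  obtain s' where s': "\<And>i. simple_integrable M (s' i)" "\<And>i. s' i \<in> space M \<rightarrow> C"
      "\<And>i. (\<lambda>x. N (g x - s' i x)) \<in> borel_measurable M"
      "(\<lambda>i. \<integral>\<^sup>+x. ennreal (N (g x - s' i x)) \<partial>M) \<longlonglongrightarrow> 0"
      "(\<lambda>i. N (simple_integral M (s' i) - I')) \<longlonglongrightarrow> 0"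
    using I' unfolding has_bochner_integral_on_def by blast
  have C: "I \<in> C" "I' \<in> C" "g \<in> space M \<rightarrow> C"
    using I I' by (auto simp: has_bochner_integral_on_def)
  let ?I = "\<lambda>i. simple_integral M (s i)"
  let ?I' = "\<lambda>i. simple_integral M (s' i)"
  have mem: "?I i \<in> C" "?I' i \<in> C" for i
    by (intro simple_bochner_integral_in_C s(2) s'(2))+
  let ?d = "\<lambda>i. (\<integral>\<^sup>+x. ennreal (N (g x - s i x)) \<partial>M) + (\<integral>\<^sup>+x. ennreal (N (g x - s' i x)) \<partial>M)"
  have le: "ennreal (N (?I i - ?I' i)) \<le> ?d i" for i
  proof -
    have *: "simple_integrable M (\<lambda>x. s i x - s' i x)"
      "(\<lambda>x. s i x - s' i x) \<in> space M \<rightarrow> C"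
      using simple_diff[of M "s i" "s' i"] s s' by auto
    have "?I i - ?I' i = simple_integral M (\<lambda>x. s i x - s' i x)"
      by (rule simple_bochner_integral_diff[OF s(1) s'(1), symmetric])
    then have "ennreal (N (?I i - ?I' i)) \<le> ennreal (\<integral>x. N (s i x - s' i x) \<partial>M)"
      using simple_N(2)[OF *] by (simp add: ennreal_leI)
    also have "\<dots> = (\<integral>\<^sup>+x. ennreal (N (s i x - s' i x)) \<partial>M)"
      using has_bochner_integral_simple_bochner_integrable[OF simple_N(1)[OF *]] *(2)
      by (intro nn_integral_eq_integral[symmetric])
        (auto intro: integrable.intros intro!: AE_I2 N_nonneg simp: Pi_iff)
    also have "\<dots> \<le> (\<integral>\<^sup>+x. ennreal (N (g x - s i x)) + ennreal (N (g x - s' i x)) \<partial>M)"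
    proof (rule nn_integral_mono)
      fix x assume x: "x \<in> space M"
      then have xC: "g x \<in> C" "s i x \<in> C" "s' i x \<in> C"
        using C(3) s(2) s'(2) by blast+
      then have "N (s i x - s' i x) \<le> N (g x - s i x) + N (g x - s' i x)"
        using N_triangle_diff[of "s i x" "g x" "s' i x"] by (simp add: N_minus_commute)
      then show "ennreal (N (s i x - s' i x)) \<le> ennreal (N (g x - s i x)) + ennreal (N (g x - s' i x))"
        using xC by (subst ennreal_plus[symmetric]) (auto intro!: N_nonneg ennreal_leI)
    qed
    also have "\<dots> = ?d i"
      by (intro nn_integral_add measurable_compose[OF s(3)] measurable_compose[OF s'(3)]) auto
    finally show ?thesis .
  qed
  have d0: "?d \<longlonglongrightarrow> 0"
    using tendsto_add[OF s(4) s'(4)] by simp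
  have "(\<lambda>i. ennreal (N (?I i - ?I' i))) \<longlonglongrightarrow> 0"
    by (rule tendsto_sandwich[OF _ _ tendsto_const d0]) (simp_all add: le)
  then have *: "(\<lambda>i. N (?I i - ?I' i)) \<longlonglongrightarrow> 0"
    by (intro tendsto_ennrealD) (simp_all add: N_nonneg mem)
  have "(\<lambda>i. N (?I i - I) + (N (?I i - ?I' i) + N (?I' i - I'))) \<longlonglongrightarrow> 0"
    using tendsto_add[OF s(5) tendsto_add[OF * s'(5)]] by simp
  moreover have "N (I - I') \<le> N (?I i - I) + (N (?I i - ?I' i) + N (?I' i - I'))" for i
    using N_triangle_diff[of I "?I i" I'] N_triangle_diff[of "?I i" "?I' i" I'] mem[of i] C
    by (simp add: N_minus_commute)
  ultimately have "N (I - I') \<le> 0"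
    by (intro LIMSEQ_le_const) auto
  then show ?thesis
    using N_nonneg[of "I - I'"] C by simp
qed

text \<open>The norm estimate is \<open>integral_is_functional\<close> for the functional \<open>B _ I\<close>.\<close>

lemma integral_is_N:
  assumes I: "integral_is M g I"
  shows "(\<lambda>x. N (g x)) \<in> borel_measurable M" "integrable M (\<lambda>x. N (g x))" "N I \<le> (\<integral>x. N (g x) \<partial>M)"
proof -
  obtain s where s: "simple_approx M g s" and "I \<in> C"
    using I by (auto simp: integral_is_def)
  have 0: "simple_approx M (\<lambda>_. 0) (\<lambda>_ _. 0)"
    by (auto simp: simple_approx_def N_zero intro!: exI[of _ "\<lambda>_. 0"] simple_bochner_integrable.intros)
  show meas: "(\<lambda>x. N (g x)) \<in> borel_measurable M"
    using simple_approx_diff_measurable[OF s 0] by simp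
  obtain b where b: "integrable M b" "\<And>x. x \<in> space M \<Longrightarrow> N (g x) \<le> b x"
    using simple_approx_bound[OF s] by metis
  have gC: "x \<in> space M \<Longrightarrow> g x \<in> C" for x using s by (auto simp: simple_approx_def)
  show int: "integrable M (\<lambda>x. N (g x))"
  proof (rule Bochner_Integration.integrable_bound[OF b(1) meas], rule AE_I2)
    fix x assume "x \<in> space M"
    then show "norm (N (g x)) \<le> norm (b x)" using b(2)[of x] N_nonneg[OF gC] by simp
  qed
  have "N I * N I = B I I"
    using \<open>I \<in> C\<close> N_power2 by (simp add: power2_eq_square)
  also have "\<dots> = (\<integral>x. B (g x) I \<partial>M)"
    by (rule integral_is_functional(2)[OF bounded_functional_B[OF \<open>I \<in> C\<close>] I])
  also have "\<dots> \<le> (\<integral>x. N (g x) * N I \<partial>M)"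
  proof (rule integral_mono)
    show "B (g x) I \<le> N (g x) * N I" if "x \<in> space M" for x
      using Cauchy_Schwarz_B[OF gC[OF that] \<open>I \<in> C\<close>] by simp
  qed (use int integral_is_functional(1)[OF bounded_functional_B[OF \<open>I \<in> C\<close>] I] in auto)
  also have "\<dots> = (\<integral>x. N (g x) \<partial>M) * N I" by simp
  finally have *: "N I * N I \<le> (\<integral>x. N (g x) \<partial>M) * N I" .
  have pos: "0 \<le> (\<integral>x. N (g x) \<partial>M)" using gC by (intro Bochner_Integration.integral_nonneg N_nonneg)
  show "N I \<le> (\<integral>x. N (g x) \<partial>M)"
  proof (cases "N I = 0")
    case False
    then show ?thesis using * N_nonneg[OF \<open>I \<in> C\<close>] by simp
  qed (use pos in simp)
qed

end

locale semi_hilbert = semi_inner_space +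
  assumes complete: "(\<And>n. X n \<in> C) \<Longrightarrow> (\<And>e. 0 < e \<Longrightarrow> \<exists>K. \<forall>m\<ge>K. \<forall>n\<ge>K. N (X m - X n) < e) \<Longrightarrow>
    \<exists>x\<in>C. (\<lambda>n. N (X n - x)) \<longlonglongrightarrow> 0"
begin

text \<open>The integrals of the approximating simple functions form a Cauchy sequence, because the functions
  converge to \<open>g\<close> in mean.\<close>

lemma ex_integral_is:
  assumes s: "simple_approx M g s"
  shows "\<exists>I. integral_is M g I \<and>
    (\<lambda>n. N (simple_integral M (s n) - I)) \<longlonglongrightarrow> 0"
proof -
  let ?I = "\<lambda>i. simple_integral M (s i)"
  have s': "simple_integrable M (s n)" "s n \<in> space M \<rightarrow> C" "g \<in> space M \<rightarrow> C" for n
    using s by (auto simp: simple_approx_def)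
  have le: "N (?I m - ?I n) \<le> (\<integral>x. N (g x - s m x) \<partial>M) + (\<integral>x. N (g x - s n x) \<partial>M)" for m n
  proof -
    note d = simple_diff[OF s'(1)[of m] s'(2)[of m] s'(1)[of n] s'(2)[of n]]
    have "N (?I m - ?I n) \<le> (\<integral>x. N (s m x - s n x) \<partial>M)"
      unfolding simple_bochner_integral_diff[OF s'(1) s'(1), symmetric] by (rule simple_N(2)[OF d])
    also have "\<dots> \<le> (\<integral>x. N (g x - s m x) + N (g x - s n x) \<partial>M)"
    proof (rule integral_mono)
      show "N (s m x - s n x) \<le> N (g x - s m x) + N (g x - s n x)" if "x \<in> space M" for x
      proof -
        have "g x \<in> C" "s m x \<in> C" "s n x \<in> C"
          using s'(2,3) that by blast+
        then show ?thesis
          using N_triangle_diff[of "s m x" "g x" "s n x"] by (simp add: N_minus_commute)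
      qed
      show "integrable M (\<lambda>x. N (s m x - s n x))"
        using has_bochner_integral_simple_bochner_integrable[OF simple_N(1)[OF d]]
        by (rule integrable.intros)
    qed (intro Bochner_Integration.integrable_add simple_approx_integrable_diff(1)[OF s])
    also have "\<dots> = (\<integral>x. N (g x - s m x) \<partial>M) + (\<integral>x. N (g x - s n x) \<partial>M)"
      by (intro Bochner_Integration.integral_add simple_approx_integrable_diff(1)[OF s])
    finally show ?thesis .
  qed
  have "\<exists>I\<in>C. (\<lambda>n. N (?I n - I)) \<longlonglongrightarrow> 0"
  proof (rule complete)
    show "?I n \<in> C" for n by (intro simple_bochner_integral_in_C s')
    fix e :: real assume "0 < e"
    then obtain K where K: "\<And>n. n \<ge> K \<Longrightarrow> \<bar>\<integral>x. N (g x - s n x) \<partial>M\<bar> < e / 2"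
      using LIMSEQ_D[OF simple_approx_integrable_diff(2)[OF s], of "e / 2"] by auto
    have "N (?I m - ?I n) < e" if "m \<ge> K" "n \<ge> K" for m n
      using le[of m n] K[OF that(1)] K[OF that(2)] by linarith
    then show "\<exists>K. \<forall>m\<ge>K. \<forall>n\<ge>K. N (?I m - ?I n) < e" by blast
  qed
  then show ?thesis
    using s by (auto simp: integral_is_def)
qed

end

section \<open>One-sided continuity and one-sided derivatives\<close>

text \<open>Right continuity at the midpoint of an interval gives a subinterval, strictly inside, on which the
  path stays within \<open>1 / (n + 1)\<close> of its value at the midpoint. A common point of these nested intervals is interior to all of them, hence a
  point of two-sided continuity. The path enters only through the pseudometric \<open>d\<close> between its values.\<close>

lemma right_continuous_imp_continuity_point:
  fixes d :: "real \<Rightarrow> real \<Rightarrow> real"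
  assumes "a < b"
    and sym: "\<And>s t. a \<le> s \<Longrightarrow> a \<le> t \<Longrightarrow> d s t = d t s"
    and tri: "\<And>s t u. a \<le> s \<Longrightarrow> a \<le> t \<Longrightarrow> a \<le> u \<Longrightarrow> d s u \<le> d s t + d t u"
    and right: "\<And>t e. a \<le> t \<Longrightarrow> 0 < e \<Longrightarrow> \<exists>\<delta>>0. \<forall>s\<in>{t..t + \<delta>}. d s t \<le> e"
  obtains c where "a < c" "c < b" "\<And>e. 0 < e \<Longrightarrow> \<exists>\<delta>>0. \<forall>s. \<bar>s - c\<bar> < \<delta> \<longrightarrow> d s c \<le> e"
proof -
  define P :: "nat \<Rightarrow> real \<times> real \<Rightarrow> bool" where "P n x \<longleftrightarrow> a \<le> fst x \<and> fst x < snd x \<and> snd x \<le> b" for n x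
  define Q :: "nat \<Rightarrow> real \<times> real \<Rightarrow> real \<times> real \<Rightarrow> bool" where
    "Q n x y \<longleftrightarrow> fst x < fst y \<and> snd y < snd x \<and> (\<forall>s\<in>{fst y..snd y}. d s (fst y) \<le> 1 / real (Suc n))" for n x y
  have "\<exists>f. \<forall>n. P n (f n) \<and> Q n (f n) (f (Suc n))"
  proof (rule dependent_nat_choice)
    show "\<exists>x. P 0 x"
      using \<open>a < b\<close> by (intro exI[of _ "(a, b)"]) (simp add: P_def)
    fix x n assume x: "P n x"
    define a' where "a' = (fst x + snd x) / 2"
    have a': "fst x < a'" "a' < snd x"
      using x by (auto simp: P_def a'_def)
    obtain \<delta> where \<delta>: "0 < \<delta>" "\<forall>s\<in>{a'..a' + \<delta>}. d s a' \<le> 1 / real (Suc n)"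
      using right[of a' "1 / real (Suc n)"] a' x by (auto simp: P_def)
    define b' where "b' = min (a' + \<delta>) ((a' + snd x) / 2)"
    have "a' < b'" "b' < snd x"
      using a' \<delta>(1) by (auto simp: b'_def min_def)
    then show "\<exists>y. P (Suc n) y \<and> Q n x y"
      using x a' \<delta> by (intro exI[of _ "(a', b')"]) (auto simp: P_def Q_def b'_def)
  qed
  then obtain f where f: "\<And>n. P n (f n)" "\<And>n. Q n (f n) (f (Suc n))"
    by blast
  define l where "l n = fst (f n)" for n
  define u where "u n = snd (f n)" for n
  have l_mono: "l n \<le> l m" if "n \<le> m" for n m
    using lift_Suc_mono_le[of l n m] f(2) that by (auto simp: Q_def l_def intro: less_imp_le)
  have u_mono: "u m \<le> u n" if "n \<le> m" for n m
    using lift_Suc_antimono_le[of u n m] f(2) that by (auto simp: Q_def u_def intro: less_imp_le)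
  have lu: "l n < u m" for n m
  proof -
    have "l n \<le> l (max n m)" by (intro l_mono) simp
    also have "\<dots> < u (max n m)" using f(1) by (simp add: P_def l_def u_def)
    also have "\<dots> \<le> u m" by (intro u_mono) simp
    finally show ?thesis .
  qed
  define c where "c = (SUP n. l n)"
  have bdd: "bdd_above (range l)"
    using lu[of _ 0] by (intro bdd_aboveI[of _ "u 0"]) (auto intro: less_imp_le)
  have c_ge: "l n \<le> c" for n
    unfolding c_def by (rule cSUP_upper[OF _ bdd]) simp
  have c_le: "c \<le> u n" for n
    unfolding c_def by (rule cSUP_least) (auto intro: less_imp_le lu)
  have c: "l n < c" "c < u n" for n
    using c_ge[of "Suc n"] c_le[of "Suc n"] f(2)[of n] by (auto simp: Q_def l_def u_def)
  show ?thesis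
  proof (rule that)
    show "a < c" "c < b"
      using c[of 0] f(1)[of 0] by (auto simp: P_def l_def u_def)
    fix e :: real assume "0 < e"
    then obtain n where n: "1 / real (Suc n) < e / 2"
      using reals_Archimedean[of "e / 2"] by (auto simp: inverse_eq_divide)
    have near: "d s (l (Suc n)) \<le> e / 2" if "l (Suc n) \<le> s" "s \<le> u (Suc n)" for s
    proof -
      have "d s (l (Suc n)) \<le> 1 / real (Suc n)"
        using f(2)[of n] that by (simp add: Q_def l_def u_def)
      then show ?thesis using n by simp
    qed
    define \<delta> where "\<delta> = min (c - l (Suc n)) (u (Suc n) - c)"
    have "0 < \<delta>" using c[of "Suc n"] by (simp add: \<delta>_def)
    moreover have "d s c \<le> e" if "\<bar>s - c\<bar> < \<delta>" for s
    proof -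
      have s: "l (Suc n) \<le> s" "s \<le> u (Suc n)"
        using that by (auto simp: \<delta>_def)
      have ge: "a \<le> l (Suc n)" using f(1)[of "Suc n"] by (simp add: P_def l_def)
      have "d s c \<le> d s (l (Suc n)) + d (l (Suc n)) c"
        using s ge c_ge[of "Suc n"] by (intro tri) auto
      also have "d (l (Suc n)) c = d c (l (Suc n))"
        using ge c_ge[of "Suc n"] by (intro sym) auto
      finally show ?thesis
        using near[OF s] near[of c] c_ge[of "Suc n"] c_le[of "Suc n"] by simp
    qed
    ultimately show "\<exists>\<delta>>0. \<forall>s. \<bar>s - c\<bar> < \<delta> \<longrightarrow> d s c \<le> e" by blast
  qed
qed

text \<open>If \<open>f\<close> exceeded the line of slope \<open>k > 0\<close> through \<open>(a, f a)\<close> at \<open>b\<close>, then at the last point \<open>c\<close> where it does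
  not exceed this line its right derivative would be at least \<open>k\<close>.\<close>

lemma right_derivative_nonpos_imp_le:
  fixes f :: "real \<Rightarrow> real"
  assumes "a \<le> b" and cont: "continuous_on {a..b} f"
    and deriv: "\<And>s. a \<le> s \<Longrightarrow> s < b \<Longrightarrow> \<exists>D\<le>0. ((\<lambda>h. (f (s + h) - f s) / h) \<longlongrightarrow> D) (at_right 0)"
  shows "f b \<le> f a"
proof (rule field_le_epsilon)
  fix e :: real assume "0 < e"
  define k where "k = e / (b - a + 1)"
  have k: "0 < k" "k * (b - a) \<le> e"
    using \<open>0 < e\<close> \<open>a \<le> b\<close> by (simp_all add: k_def field_simps)
  define g where "g s = f s - f a - k * (s - a)" for s
  have g_cont: "continuous_on {a..b} g"
    unfolding g_def by (intro continuous_intros cont)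
  have "g b \<le> 0"
  proof (rule ccontr)
    assume "\<not> g b \<le> 0"
    define Z where "Z = {s \<in> {a..b}. g s \<le> 0}"
    have "closed Z"
      unfolding Z_def using continuous_on_closed_Collect_le[OF g_cont continuous_on_const] by simp
    moreover have "a \<in> Z" using \<open>a \<le> b\<close> by (simp add: Z_def g_def)
    moreover have "bdd_above Z" unfolding Z_def by (rule bdd_aboveI[of _ b]) simp
    ultimately have c: "Sup Z \<in> Z" by (intro closed_contains_Sup) auto
    define c where "c = Sup Z"
    have c': "a \<le> c" "c < b" "g c \<le> 0"
      using c \<open>\<not> g b \<le> 0\<close> unfolding c_def[symmetric] by (auto simp: Z_def less_le)
    have pos: "0 < g s" if "c < s" "s \<le> b" for s
    proof (rule ccontr)
      assume "\<not> 0 < g s"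
      then have "s \<in> Z" using that c' by (simp add: Z_def)
      then have "s \<le> c" unfolding c_def by (rule cSup_upper[OF _ \<open>bdd_above Z\<close>])
      then show False using that by simp
    qed
    obtain D where D: "D \<le> 0" "((\<lambda>h. (f (c + h) - f c) / h) \<longlongrightarrow> D) (at_right 0)"
      using deriv[of c] c' by blast
    have "((\<lambda>h. (f (c + h) - f c) / h - k) \<longlongrightarrow> D - k) (at_right 0)"
      by (intro tendsto_diff D tendsto_const)
    moreover have "\<forall>\<^sub>F h in at_right 0. 0 \<le> (f (c + h) - f c) / h - k"
      unfolding eventually_at_right_field
    proof (intro exI[of _ "b - c"] conjI allI impI)
      fix h assume h: "0 < h" "h < b - c"
      have "(f (c + h) - f c) / h - k = (g (c + h) - g c) / h"
        using h by (simp add: g_def field_simps)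
      then show "0 \<le> (f (c + h) - f c) / h - k"
        using pos[of "c + h"] h c' by simp
    qed (use c' in simp)
    ultimately have "0 \<le> D - k"
      by (intro tendsto_lowerbound) auto
    with D(1) k(1) show False by simp
  qed
  then show "f b \<le> f a + e"
    using k(2) by (simp add: g_def)
qed

text \<open>Rounding down to the grid of mesh \<open>1 / (n + 1)\<close>. Nonnegative numbers stay nonnegative, so semigroup
  operators may be evaluated at rounded times; on bounded intervals only finitely many values occur.\<close>

definition disc :: "nat \<Rightarrow> real \<Rightarrow> real" where
  "disc n s = of_int \<lfloor>real (Suc n) * s\<rfloor> / real (Suc n)"

lemma disc_bounds:
  shows "0 \<le> s \<Longrightarrow> 0 \<le> disc n s" "disc n s \<le> s" "\<bar>disc n s - s\<bar> \<le> 1 / real (Suc n)"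
proof -
  show "0 \<le> s \<Longrightarrow> 0 \<le> disc n s" by (simp add: disc_def)
  have "real_of_int \<lfloor>real (Suc n) * s\<rfloor> \<le> real (Suc n) * s" by linarith
  then show le: "disc n s \<le> s" by (simp add: disc_def field_simps)
  have "real (Suc n) * s - 1 \<le> real_of_int \<lfloor>real (Suc n) * s\<rfloor>" by linarith
  then have "(real (Suc n) * s - 1) / real (Suc n) \<le> disc n s"
    unfolding disc_def by (rule divide_right_mono) simp
  then have "s - 1 / real (Suc n) \<le> disc n s"
    by (simp add: diff_divide_distrib)
  then show "\<bar>disc n s - s\<bar> \<le> 1 / real (Suc n)" using le by simp
qed

lemma disc_tendsto: "(\<lambda>n. disc n s) \<longlonglongrightarrow> s"
proof (rule LIM_zero_cancel, rule Lim_null_comparison)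
  show "\<forall>\<^sub>F n in sequentially. norm (disc n s - s) \<le> 1 / real (Suc n)"
    using disc_bounds(3) by simp
  show "(\<lambda>n. 1 / real (Suc n)) \<longlonglongrightarrow> 0"
    using LIMSEQ_inverse_real_of_nat by (simp add: inverse_eq_divide)
qed

lemma disc_measurable [measurable]: "disc n \<in> borel_measurable borel"
  unfolding disc_def[abs_def] by measurable

lemma finite_disc_image: "finite (disc n ` {a..b})"
proof (rule finite_subset)
  show "disc n ` {a..b} \<subseteq> (\<lambda>i. of_int i / real (Suc n)) ` {\<lfloor>real (Suc n) * a\<rfloor>..\<lfloor>real (Suc n) * b\<rfloor>}"
    unfolding disc_def by (auto intro!: imageI floor_mono mult_left_mono simp del: of_nat_Suc)
qed simp

lemma measurable_ident_interval: "(\<lambda>s. s) \<in> borel_measurable (lebesgue_on {a..b::real})"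
  by (intro measurable_restrict_space1) (simp add: measurable_completion)

lemma finite_measure_interval: "finite_measure (lebesgue_on {a..b::real})"
  by (rule finite_measure_lebesgue_on) simp

lemma simple_bochner_integrable_finite_measure:
  assumes "finite_measure M" "simple_function M f"
  shows "simple_integrable M f"
proof -
  interpret finite_measure M by fact
  show ?thesis using assms(2) by (intro simple_bochner_integrable.intros) auto
qed

lemma simple_function_disc: "simple_function (lebesgue_on {a..b}) (\<lambda>s. disc n (t - s))"
proof (rule simple_function_borel_measurable)
  have "(\<lambda>s. disc n (t - s)) \<in> borel_measurable borel" by measurable
  then show "(\<lambda>s. disc n (t - s)) \<in> borel_measurable (lebesgue_on {a..b})"
    by (intro measurable_restrict_space1) (simp add: measurable_completion)
  show "finite ((\<lambda>s. disc n (t - s)) ` space (lebesgue_on {a..b}))"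
    by (rule finite_subset[OF _ finite_disc_image[of n "t - b" "t - a"]]) auto
qed

lemma simple_function_lebesgue_on_subset:
  assumes "simple_function (lebesgue_on A) f" "B \<subseteq> A"
  shows "simple_function (lebesgue_on B) f"
  using assms by (auto simp: simple_function_eq_measurable
      intro: finite_subset[OF image_mono] measurable_restrict_mono)

lemma integrable_subinterval_lebesgue:
  fixes f :: "real \<Rightarrow> real"
  assumes "integrable (lebesgue_on {0..T}) f" "t \<le> T"
  shows "integrable (lebesgue_on {0..t}) f"
proof -
  have "set_integrable lebesgue {0..T} f"
    using assms(1) by (simp add: set_integrable_def integrable_restrict_space)
  then have "set_integrable lebesgue {0..t} f"
    by (rule set_integrable_subset) (use assms(2) in auto)
  then show ?thesis
    by (simp add: set_integrable_def integrable_restrict_space)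
qed

section \<open>Strongly continuous semigroups modulo null vectors\<close>

locale C0_semigroup = semi_hilbert C B
  for C :: "'w::real_vector set" and B +
  fixes S :: "real \<Rightarrow> 'w \<Rightarrow> 'w"
  assumes C0: "C0_semigroup_on C N S"
begin

lemma S_in_C [simp, intro]: "0 \<le> t \<Longrightarrow> x \<in> C \<Longrightarrow> S t x \<in> C"
  using C0 by (simp add: C0_semigroup_on_def)

lemma S_lincomb:
  "0 \<le> t \<Longrightarrow> x \<in> C \<Longrightarrow> y \<in> C \<Longrightarrow> N (S t (a *\<^sub>R x + b *\<^sub>R y) - (a *\<^sub>R S t x + b *\<^sub>R S t y)) = 0"
  using C0 by (simp add: C0_semigroup_on_def)

lemma S_bounded:
  assumes "0 \<le> t"
  obtains K where "0 \<le> K" "\<And>x. x \<in> C \<Longrightarrow> N (S t x) \<le> K * N x"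
proof -
  have "\<exists>K. \<forall>x\<in>C. N (S t x) \<le> K * N x"
    using C0 assms by (simp add: C0_semigroup_on_def)
  then obtain K where K: "\<And>x. x \<in> C \<Longrightarrow> N (S t x) \<le> K * N x"
    by auto
  have "N (S t x) \<le> \<bar>K\<bar> * N x" if "x \<in> C" for x
    using K[OF that] mult_right_mono[OF abs_ge_self N_nonneg[OF that], of K] by linarith
  then show ?thesis by (intro that[of "\<bar>K\<bar>"]) auto
qed

lemma S_0: "x \<in> C \<Longrightarrow> N (S 0 x - x) = 0"
  using C0 by (simp add: C0_semigroup_on_def)

lemma S_plus: "0 \<le> s \<Longrightarrow> 0 \<le> t \<Longrightarrow> x \<in> C \<Longrightarrow> N (S (s + t) x - S s (S t x)) = 0"
  using C0 by (simp add: C0_semigroup_on_def)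

lemma S_right_continuous_0: "x \<in> C \<Longrightarrow> ((\<lambda>t. N (S t x - x)) \<longlongrightarrow> 0) (at_right 0)"
  using C0 by (simp add: C0_semigroup_on_def)

lemma null_weakI:
  assumes "x \<in> C" "y \<in> C" "\<And>z. z \<in> C \<Longrightarrow> B x z = B y z"
  shows "N (x - y) = 0"
proof -
  have "B (x - y) (x - y) = 0"
    using assms by (simp add: B_diff_left)
  then show ?thesis by (simp add: N_def)
qed

text \<open>Linearity of \<open>S t\<close> up to null vectors becomes linearity of \<open>L \<circ> S t\<close>. In particular
  \<open>integral_is_functional\<close> applies to \<open>L \<circ> S t\<close>, which moves \<open>S t\<close> under the integral sign without an adjoint.\<close>

lemma bounded_functional_S:
  assumes L: "bounded_functional L" and t: "0 \<le> t"
  shows "bounded_functional (\<lambda>x. L (S t x))"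
proof -
  have lin: "L (S t (a *\<^sub>R x + b *\<^sub>R y)) = a * L (S t x) + b * L (S t y)" if "x \<in> C" "y \<in> C" for a b x y
    using bounded_functional_null[OF L _ _ S_lincomb[OF t that, of a b]] t that
    by (simp add: bounded_functionalD[OF L])
  obtain K where K: "0 \<le> K" "\<And>x. x \<in> C \<Longrightarrow> N (S t x) \<le> K * N x"
    using S_bounded[OF t] by blast
  obtain K' where K': "0 \<le> K'" "\<And>x. x \<in> C \<Longrightarrow> \<bar>L x\<bar> \<le> K' * N x"
    using bounded_functionalD(5)[OF L] by blast
  have "\<bar>L (S t x)\<bar> \<le> K' * K * N x" if "x \<in> C" for x
  proof -
    have "\<bar>L (S t x)\<bar> \<le> K' * N (S t x)" using t that by (intro K'(2)) auto
    also have "\<dots> \<le> K' * (K * N x)" by (intro mult_left_mono K(2) K'(1) that)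
    finally show ?thesis by (simp add: mult.assoc)
  qed
  then show ?thesis
    unfolding bounded_functional_def
    using lin[of _ _ 1 1] lin[of _ 0 _ 0] by (intro conjI exI[of _ "K' * K"]) auto
qed

lemmas functional_B_S = bounded_functional_S[OF bounded_functional_B]

lemma S_diff_le:
  assumes "0 \<le> t" "\<And>x. x \<in> C \<Longrightarrow> N (S t x) \<le> K * N x" "x \<in> C" "y \<in> C"
  shows "N (S t x - S t y) \<le> K * N (x - y)"
proof -
  have "N (S t x - S t y) = N (S t (x - y))"
  proof (rule N_null_cong)
    show "N (S t x - S t y - S t (x - y)) = 0"
    proof (rule null_weakI)
      fix z assume z: "z \<in> C"
      show "B (S t x - S t y) z = B (S t (x - y)) z"
        using bounded_functionalD(3)[OF functional_B_S[OF z assms(1)] assms(3,4)] assms(1,3,4) z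
        by (simp add: B_diff_left)
    qed (use assms(1,3,4) in auto)
  qed (use assms(1,3,4) in auto)
  also have "\<dots> \<le> K * N (x - y)" using assms(3,4) by (intro assms(2)) auto
  finally show ?thesis .
qed

lemma orbit_diff_le:
  assumes "0 \<le> t" "0 \<le> s" "0 \<le> u" "\<And>x. x \<in> C \<Longrightarrow> N (S t x) \<le> K * N x" "x \<in> C"
  shows "N (S (t + s) x - S (t + u) x) \<le> K * N (S s x - S u x)"
proof -
  have "N (S (t + s) x - S (t + u) x) = N (S t (S s x) - S t (S u x))"
    by (rule N_null_diff_cong) (use assms(1,2,3,5) S_plus in auto)
  also have "\<dots> \<le> K * N (S s x - S u x)"
    by (rule S_diff_le[OF assms(1,4)]) (use assms(1,2,3,5) in auto)
  finally show ?thesis .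
qed

lemma orbit_right:
  assumes x: "x \<in> C" and "0 \<le> t" "0 < e"
  shows "\<exists>\<delta>>0. \<forall>s\<in>{t..t + \<delta>}. N (S s x - S t x) \<le> e"
proof -
  obtain K where K: "0 \<le> K" "\<And>x. x \<in> C \<Longrightarrow> N (S t x) \<le> K * N x"
    using S_bounded[OF \<open>0 \<le> t\<close>] by blast
  have "\<forall>\<^sub>F h in at_right 0. \<bar>N (S h x - x)\<bar> < e / (K + 1)"
    using tendstoD[OF S_right_continuous_0[OF x], of "e / (K + 1)"] K \<open>0 < e\<close> by simp
  then obtain \<delta> where \<delta>: "0 < \<delta>" "\<And>h. 0 < h \<Longrightarrow> h < \<delta> \<Longrightarrow> \<bar>N (S h x - x)\<bar> < e / (K + 1)"
    unfolding eventually_at_right_field by blast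
  have "N (S s x - S t x) \<le> e" if s: "t \<le> s" "s \<le> t + \<delta> / 2" for s
  proof (cases "s = t")
    case True
    then show ?thesis using \<open>0 < e\<close> by (simp add: N_zero)
  next
    case False
    have "N (S s x - S t x) \<le> K * N (S (s - t) x - S 0 x)"
      using orbit_diff_le[of t "s - t" 0 K x] s assms K by simp
    also have "N (S (s - t) x - S 0 x) = N (S (s - t) x - x)"
      using s x S_0[OF x] by (intro N_null_diff_cong) (auto simp: N_zero)
    also have "K * N (S (s - t) x - x) \<le> K * (e / (K + 1))"
      using \<delta>(1) \<delta>(2)[of "s - t"] s False K(1) by (intro mult_left_mono) auto
    also have "\<dots> \<le> e" using K(1) \<open>0 < e\<close> by (simp add: field_simps)
    finally show ?thesis .
  qed
  then show ?thesis using \<delta>(1) by (intro exI[of _ "\<delta> / 2"]) auto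
qed

text \<open>The operators \<open>S s\<close> are bounded one by one, not uniformly in \<open>s\<close>, so left continuity does not follow
  directly from right continuity. The orbit, being right continuous, has a point \<open>c < t\<close> of two-sided
  continuity, and the single operator \<open>S (t - c)\<close> transports continuity from \<open>c\<close> to \<open>t\<close>.\<close>

lemma orbit_continuous:
  assumes x: "x \<in> C" and t: "0 \<le> t"
  shows "((\<lambda>s. N (S s x - S t x)) \<longlongrightarrow> 0) (at t within {0..})"
proof -
  have "\<exists>\<delta>>0. \<forall>s\<ge>0. \<bar>s - t\<bar> < \<delta> \<longrightarrow> N (S s x - S t x) \<le> e" if "0 < e" for e
    using that
  proof (cases "t = 0")
    case True
    obtain \<delta> where "0 < \<delta>" "\<forall>s\<in>{0..0 + \<delta>}. N (S s x - S 0 x) \<le> e"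
      using orbit_right[OF x _ \<open>0 < e\<close>, of 0] by auto
    then show ?thesis unfolding True by (intro exI[of _ \<delta>]) auto
  next
    case False
    then have "0 < t" using t by simp
    obtain c where c: "0 < c" "c < t"
      "\<And>e. 0 < e \<Longrightarrow> \<exists>\<delta>>0. \<forall>s. \<bar>s - c\<bar> < \<delta> \<longrightarrow> N (S s x - S c x) \<le> e"
    proof (rule right_continuous_imp_continuity_point[OF \<open>0 < t\<close>, of "\<lambda>s t. N (S s x - S t x)"])
      show "N (S s x - S u x) = N (S u x - S s x)" if "0 \<le> s" "0 \<le> u" for s u
        using x that by (intro N_minus_commute) auto
      show "N (S s x - S v x) \<le> N (S s x - S u x) + N (S u x - S v x)" if "0 \<le> s" "0 \<le> u" "0 \<le> v" for s u v
        using x that by (intro N_triangle_diff) auto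
    qed (use orbit_right[OF x] in blast)+
    obtain K where K: "0 \<le> K" "\<And>x. x \<in> C \<Longrightarrow> N (S (t - c) x) \<le> K * N x"
      using S_bounded[of "t - c"] c by auto
    obtain \<delta> where \<delta>: "0 < \<delta>" "\<And>s. \<bar>s - c\<bar> < \<delta> \<Longrightarrow> N (S s x - S c x) \<le> e / (K + 1)"
      using c(3)[of "e / (K + 1)"] \<open>0 < e\<close> K(1) by auto
    have "N (S s x - S t x) \<le> e" if s: "\<bar>s - t\<bar> < min \<delta> c" for s
    proof -
      have "N (S s x - S t x) \<le> K * N (S (s - (t - c)) x - S c x)"
        using orbit_diff_le[of "t - c" "s - (t - c)" c K x] c s K x by (simp add: abs_less_iff)
      also have "\<dots> \<le> K * (e / (K + 1))"
        using s by (intro mult_left_mono \<delta>(2) K(1)) (simp add: algebra_simps)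
      also have "\<dots> \<le> e" using K(1) \<open>0 < e\<close> by (simp add: field_simps)
      finally show ?thesis .
    qed
    then show ?thesis using \<delta>(1) c(1) by (intro exI[of _ "min \<delta> c"]) auto
  qed
  note * = this
  show ?thesis
  proof (rule tendstoI)
    fix e :: real assume "0 < e"
    then obtain \<delta> where "0 < \<delta>" "\<And>s. s \<ge> 0 \<Longrightarrow> \<bar>s - t\<bar> < \<delta> \<Longrightarrow> N (S s x - S t x) \<le> e / 2"
      using *[of "e / 2"] by auto
    moreover have "0 \<le> N (S s x - S t x)" if "s \<ge> 0" for s
      using x t that by (intro N_nonneg) auto
    ultimately show "\<forall>\<^sub>F s in at t within {0..}. dist (N (S s x - S t x)) 0 < e"
      using \<open>0 < e\<close> unfolding eventually_at by (fastforce simp: dist_real_def intro!: exI[of _ \<delta>])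
  qed
qed

lemma orbit_disc:
  assumes x: "x \<in> C" and t: "0 \<le> t"
  shows "(\<lambda>n. N (S (disc n t) x - S t x)) \<longlonglongrightarrow> 0"
proof -
  have "((\<lambda>s. N (S s x - S t x)) \<longlongrightarrow> N (S t x - S t x)) (at t within {0..})"
    using orbit_continuous[OF x t] by (simp add: N_zero)
  then have "continuous (at t within {0..}) (\<lambda>s. N (S s x - S t x))"
    by (simp add: continuous_within)
  then have "(\<lambda>n. N (S (disc n t) x - S t x)) \<longlonglongrightarrow> N (S t x - S t x)"
    by (rule continuous_within_tendsto_compose'[OF _ _ disc_tendsto]) (use disc_bounds(1) t in auto)
  then show ?thesis by (simp add: N_zero)
qed

lemma orbit_functional_continuous:
  assumes L: "bounded_functional L" and x: "x \<in> C"
  shows "continuous_on {0..} (\<lambda>s. L (S s x))"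
  unfolding continuous_on_def
proof
  fix t :: real assume t: "t \<in> {0..}"
  obtain K where K: "\<And>x. x \<in> C \<Longrightarrow> \<bar>L x\<bar> \<le> K * N x"
    using bounded_functionalD(5)[OF L] by blast
  show "((\<lambda>s. L (S s x)) \<longlongrightarrow> L (S t x)) (at t within {0..})"
  proof (rule LIM_zero_cancel, rule Lim_null_comparison)
    show "((\<lambda>s. K * N (S s x - S t x)) \<longlongrightarrow> 0) (at t within {0..})"
      using tendsto_mult_right_zero[OF orbit_continuous[OF x, of t]] t by simp
    have "norm (L (S s x) - L (S t x)) \<le> K * N (S s x - S t x)" if "0 \<le> s" for s
      using K[of "S s x - S t x"] that t x by (simp add: bounded_functionalD(3)[OF L])
    then show "\<forall>\<^sub>F s in at t within {0..}. norm (L (S s x) - L (S t x)) \<le> K * N (S s x - S t x)"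
      by (auto simp: eventually_at_filter)
  qed
qed

lemma orbit_N_continuous:
  assumes x: "x \<in> C"
  shows "continuous_on {0..} (\<lambda>s. N (S s x))"
  unfolding continuous_on_def
proof
  fix t :: real assume t: "t \<in> {0..}"
  show "((\<lambda>s. N (S s x)) \<longlongrightarrow> N (S t x)) (at t within {0..})"
  proof (rule LIM_zero_cancel, rule Lim_null_comparison)
    show "((\<lambda>s. N (S s x - S t x)) \<longlongrightarrow> 0) (at t within {0..})"
      using orbit_continuous[OF x, of t] t by simp
    show "\<forall>\<^sub>F s in at t within {0..}. norm (N (S s x) - N (S t x)) \<le> N (S s x - S t x)"
      using N_diff_bound x t by (auto simp: eventually_at_filter)
  qed
qed

text \<open>The reversed orbit \<open>s \<mapsto> S (\<tau> - s) x\<close> is treated, as this is the form of the Duhamel integrand.\<close>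

lemma orbit_simple_approx:
  assumes x: "x \<in> C" and \<tau>: "0 \<le> \<tau>"
  shows "simple_approx (lebesgue_on {0..\<tau>}) (\<lambda>s. S (\<tau> - s) x) (\<lambda>n s. S (disc n (\<tau> - s)) x)"
  unfolding simple_approx_def
proof (intro conjI ballI allI)
  show "(\<lambda>s. S (\<tau> - s) x) \<in> space (lebesgue_on {0..\<tau>}) \<rightarrow> C"
    using x by auto
  fix n
  show "simple_integrable (lebesgue_on {0..\<tau>}) (\<lambda>s. S (disc n (\<tau> - s)) x)"
    by (intro simple_bochner_integrable_finite_measure finite_measure_interval
        simple_function_compose1[OF simple_function_disc])
  show "(\<lambda>s. S (disc n (\<tau> - s)) x) \<in> space (lebesgue_on {0..\<tau>}) \<rightarrow> C"
    using x disc_bounds(1) by auto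
next
  fix s assume "s \<in> space (lebesgue_on {0..\<tau>})"
  then have s: "0 \<le> \<tau> - s" by simp
  have "(\<lambda>n. N (S (disc n (\<tau> - s)) x - S (\<tau> - s) x)) \<longlonglongrightarrow> 0"
    by (rule orbit_disc[OF x s])
  then show "(\<lambda>n. N (S (\<tau> - s) x - S (disc n (\<tau> - s)) x)) \<longlonglongrightarrow> 0"
    using x s disc_bounds(1) by (subst N_minus_commute) auto
next
  have "compact ((\<lambda>s. N (S s x)) ` {0..\<tau>})"
    by (intro compact_continuous_image continuous_on_subset[OF orbit_N_continuous[OF x]]) auto
  then have "bounded ((\<lambda>s. N (S s x)) ` {0..\<tau>})"
    by (rule compact_imp_bounded)
  then obtain b where "\<forall>s\<in>{0..\<tau>}. \<bar>N (S s x)\<bar> \<le> b"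
    unfolding bounded_iff by auto
  then have b: "N (S s x) \<le> b" if "s \<in> {0..\<tau>}" for s
    using that abs_le_D1 by blast
  interpret finite_measure "lebesgue_on {0..\<tau>}"
    by (rule finite_measure_interval)
  show "\<exists>b. integrable (lebesgue_on {0..\<tau>}) b \<and>
      (\<forall>n. \<forall>s\<in>space (lebesgue_on {0..\<tau>}). N (S (disc n (\<tau> - s)) x) \<le> b s)"
  proof (intro exI[of _ "\<lambda>_. b"] conjI allI ballI b)
    fix n s assume "s \<in> space (lebesgue_on {0..\<tau>})"
    then show "disc n (\<tau> - s) \<in> {0..\<tau>}"
      using disc_bounds(1)[of "\<tau> - s" n] disc_bounds(2)[of n "\<tau> - s"] by auto
  qed simp
qed

lemma orbit_integral_functional:
  assumes x: "x \<in> C" and \<tau>: "0 \<le> \<tau>"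
    and I: "integral_is (lebesgue_on {0..\<tau>}) (\<lambda>s. S (\<tau> - s) x) I" and L: "bounded_functional L"
  shows "L I = integral {0..\<tau>} (\<lambda>s. L (S s x))"
proof -
  have cont: "continuous_on {0..\<tau>} (\<lambda>s. L (S (\<tau> - s) x))"
    by (rule continuous_on_compose2[OF orbit_functional_continuous[OF L x]])
      (auto intro!: continuous_intros)
  have "L I = (\<integral>s. L (S (\<tau> - s) x) \<partial>lebesgue_on {0..\<tau>})"
    by (rule integral_is_functional(2)[OF L I])
  also have "\<dots> = integral {0..\<tau>} (\<lambda>s. L (S (\<tau> - s) x))"
    by (intro lebesgue_integral_eq_integral continuous_imp_integrable_real cont) simp
  also have "\<dots> = integral {0..\<tau>} (\<lambda>s. L (S s x))"
  proof (rule integral_unique)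
    have "continuous_on {0..\<tau>} (\<lambda>s. L (S s x))"
      by (rule continuous_on_subset[OF orbit_functional_continuous[OF L x]]) auto
    then have "((\<lambda>s. L (S s x)) has_integral integral {0..\<tau>} (\<lambda>s. L (S s x))) (cbox 0 \<tau>)"
      by (simp add: integrable_integral integrable_continuous_interval)
    from has_integral_affinity[OF this, of "-1" \<tau>] \<tau>
    show "((\<lambda>s. L (S (\<tau> - s) x)) has_integral integral {0..\<tau>} (\<lambda>s. L (S s x))) {0..\<tau>}"
      by simp
  qed
  finally show ?thesis .
qed

lemma generator_invariant:
  assumes xy: "(x, y) \<in> generator_on C N S" and t: "0 \<le> t"
  shows "(S t x, S t y) \<in> generator_on C N S"
proof -
  have C: "x \<in> C" "y \<in> C" and lim: "((\<lambda>h. N ((S h x - x) /\<^sub>R h - y)) \<longlongrightarrow> 0) (at_right 0)"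
    using xy by (auto simp: generator_on_def)
  obtain K where K: "0 \<le> K" "\<And>x. x \<in> C \<Longrightarrow> N (S t x) \<le> K * N x"
    using S_bounded[OF t] by blast
  have le: "N ((S h (S t x) - S t x) /\<^sub>R h - S t y) \<le> K * N ((S h x - x) /\<^sub>R h - y)" if "0 < h" for h
  proof -
    have "N ((S h (S t x) - S t x) /\<^sub>R h - S t y) = N (S t ((S h x - x) /\<^sub>R h - y))"
    proof (rule N_null_cong, rule_tac [3] null_weakI)
      fix z assume z: "z \<in> C"
      have "B (S h (S t x)) z = B (S (h + t) x) z"
        using S_plus[of h t x] C t that z
        by (intro bounded_functional_null[OF bounded_functional_B[OF z]]) (auto simp: N_minus_commute)
      also have "\<dots> = B (S t (S h x)) z"
        using S_plus[of t h x] C t that z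
        by (intro bounded_functional_null[OF bounded_functional_B[OF z]]) (auto simp: add.commute)
      finally show "B ((S h (S t x) - S t x) /\<^sub>R h - S t y) z = B (S t ((S h x - x) /\<^sub>R h - y)) z"
        using bounded_functionalD(2,3)[OF functional_B_S[OF z t]] C t z that
        by (simp add: B_bilinear)
    qed (use C t that in auto)
    also have "\<dots> \<le> K * N ((S h x - x) /\<^sub>R h - y)"
      using C that by (intro K) auto
    finally show ?thesis .
  qed
  have "((\<lambda>h. N ((S h (S t x) - S t x) /\<^sub>R h - S t y)) \<longlongrightarrow> 0) (at_right 0)"
  proof (rule Lim_null_comparison)
    show "((\<lambda>h. K * N ((S h x - x) /\<^sub>R h - y)) \<longlongrightarrow> 0) (at_right 0)"
      using tendsto_mult_right_zero[OF lim] by simp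
    show "\<forall>\<^sub>F h in at_right 0. norm (N ((S h (S t x) - S t x) /\<^sub>R h - S t y)) \<le> K * N ((S h x - x) /\<^sub>R h - y)"
      unfolding eventually_at_right_field
      using le C t by (intro exI[of _ 1]) (auto simp: N_nonneg)
  qed
  then show ?thesis
    using C t by (auto simp: generator_on_def)
qed

lemma average_le:
  fixes \<phi> :: "real \<Rightarrow> real"
  assumes "0 < h" "continuous_on {a..a + h} \<phi>" "\<And>s. a \<le> s \<Longrightarrow> s \<le> a + h \<Longrightarrow> \<bar>\<phi> s - c\<bar> \<le> e"
  shows "\<bar>integral {a..a + h} \<phi> / h - c\<bar> \<le> e"
proof -
  have "norm (integral {a..a + h} (\<lambda>s. \<phi> s - c)) \<le> e * (a + h - a)"
    using assms by (intro integral_bound continuous_intros) auto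
  moreover have "integral {a..a + h} (\<lambda>s. \<phi> s - c) = integral {a..a + h} \<phi> - h * c"
    using assms by (subst integral_diff) (auto intro: integrable_continuous_interval)
  ultimately have "\<bar>integral {a..a + h} \<phi> - h * c\<bar> \<le> e * h" by simp
  then have "\<bar>integral {a..a + h} \<phi> - h * c\<bar> / h \<le> e"
    using \<open>0 < h\<close> by (simp add: field_simps)
  moreover have "integral {a..a + h} \<phi> / h - c = (integral {a..a + h} \<phi> - h * c) / h"
    using \<open>0 < h\<close> by (simp add: field_simps)
  ultimately show ?thesis
    using \<open>0 < h\<close> by simp
qed

text \<open>Uniform in \<open>z\<close>, and thus a statement about the averages of the orbit itself via \<open>N_le_weakI\<close>.\<close>

lemma orbit_average:
  assumes x: "x \<in> C" and t: "0 \<le> t" and "0 < e"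
  obtains \<delta> where "0 < \<delta>" "\<And>h z. 0 < h \<Longrightarrow> h < \<delta> \<Longrightarrow> z \<in> C \<Longrightarrow>
    \<bar>integral {t..t + h} (\<lambda>s. B (S s x) z) / h - B (S t x) z\<bar> \<le> e * N z"
proof -
  obtain \<delta> where \<delta>: "0 < \<delta>" "\<And>s. t \<le> s \<Longrightarrow> s \<le> t + \<delta> \<Longrightarrow> N (S s x - S t x) \<le> e"
    using orbit_right[OF x t \<open>0 < e\<close>] by auto
  show ?thesis
  proof (rule that[OF \<delta>(1)])
    fix h z assume h: "0 < h" "h < \<delta>" and z: "z \<in> C"
    show "\<bar>integral {t..t + h} (\<lambda>s. B (S s x) z) / h - B (S t x) z\<bar> \<le> e * N z"
    proof (rule average_le[OF h(1)])
      show "continuous_on {t..t + h} (\<lambda>s. B (S s x) z)"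
        by (rule continuous_on_subset[OF orbit_functional_continuous[OF bounded_functional_B[OF z] x]])
          (use t in auto)
      fix s assume s: "t \<le> s" "s \<le> t + h"
      have "\<bar>B (S s x) z - B (S t x) z\<bar> \<le> N (S s x - S t x) * N z"
        using Cauchy_Schwarz_B[of "S s x - S t x" z] s t x z by (simp add: B_diff_left)
      also have "\<dots> \<le> e * N z"
        using \<delta>(2)[of s] s h z by (intro mult_right_mono N_nonneg) auto
      finally show "\<bar>B (S s x) z - B (S t x) z\<bar> \<le> e * N z" .
    qed
  qed
qed

lemma N_le_weakI:
  assumes "v \<in> C" "0 \<le> e" "\<And>z. z \<in> C \<Longrightarrow> \<bar>B v z\<bar> \<le> e * N z"
  shows "N v \<le> e"
proof (cases "N v = 0")
  case False
  have "N v * N v \<le> e * N v"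
    using assms(3)[OF assms(1)] N_power2[OF assms(1)] by (simp add: power2_eq_square)
  then show ?thesis
    using False N_nonneg[OF assms(1)] by simp
qed (use assms(2) in simp)

text \<open>\<open>S h I - I = \<integral>\<^sub>\<tau>\<^bsup>\<tau> + h\<^esup> S s x ds - \<integral>\<^sub>0\<^sup>h S s x ds\<close>, and the averages of the orbit over these short intervals
  tend to \<open>S \<tau> x\<close> and \<open>x\<close>.\<close>

lemma orbit_integral_in_generator:
  assumes x: "x \<in> C" and \<tau>: "0 \<le> \<tau>"
    and I: "integral_is (lebesgue_on {0..\<tau>}) (\<lambda>s. S (\<tau> - s) x) I"
  shows "(I, S \<tau> x - x) \<in> generator_on C N S"
proof -
  have IC: "I \<in> C" using I by (simp add: integral_is_def)
  have weak: "B ((S h I - I) /\<^sub>R h - (S \<tau> x - x)) z =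
      (integral {\<tau>..\<tau> + h} (\<lambda>s. B (S s x) z) / h - B (S \<tau> x) z) -
      (integral {0..0 + h} (\<lambda>s. B (S s x) z) / h - B (S 0 x) z)"
    if h: "0 < h" and z: "z \<in> C" for h z
  proof -
    define \<phi> where "\<phi> s = B (S s x) z" for s
    have cont: "continuous_on {a..b} \<phi>" if "0 \<le> a" for a b
      unfolding \<phi>_def
      by (rule continuous_on_subset[OF orbit_functional_continuous[OF bounded_functional_B[OF z] x]])
        (use that in auto)
    have "B (S h I) z = integral {0..\<tau>} (\<lambda>s. B (S h (S s x)) z)"
      by (rule orbit_integral_functional[OF x \<tau> I functional_B_S[OF z]]) (use h in simp)
    also have "\<dots> = integral {0..\<tau>} (\<phi> \<circ> (\<lambda>s. s + h))"
    proof (rule integral_cong)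
      fix s assume s: "s \<in> {0..\<tau>}"
      then have "B (S h (S s x)) z = B (S (h + s) x) z"
        using S_plus[of h s x] x h z
        by (intro bounded_functional_null[OF bounded_functional_B[OF z]]) (auto simp: N_minus_commute)
      then show "B (S h (S s x)) z = (\<phi> \<circ> (\<lambda>s. s + h)) s"
        by (simp add: \<phi>_def add.commute)
    qed
    also have "\<dots> = integral {0 + h..\<tau> + h} \<phi>"
      by (rule integral_shift) (use cont h in auto)
    finally have "B (S h I) z = integral {h..\<tau> + h} \<phi>" by simp
    moreover have "integral {0..h} \<phi> + integral {h..\<tau> + h} \<phi> = integral {0..\<tau> + h} \<phi>"
      "integral {0..\<tau>} \<phi> + integral {\<tau>..\<tau> + h} \<phi> = integral {0..\<tau> + h} \<phi>"
      using h \<tau> by (auto intro!: Henstock_Kurzweil_Integration.integral_combine integrable_continuous_interval cont)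
    moreover have "B I z = integral {0..\<tau>} \<phi>"
      unfolding \<phi>_def by (rule orbit_integral_functional[OF x \<tau> I bounded_functional_B[OF z]])
    moreover have "B (S 0 x) z = B x z"
      using S_0[OF x] x z by (intro bounded_functional_null[OF bounded_functional_B[OF z]]) auto
    ultimately have "B (S h I) z - B I z = integral {\<tau>..\<tau> + h} \<phi> - integral {0..0 + h} \<phi>"
      and "B (S 0 x) z = B x z"
      by simp_all
    moreover have "B ((S h I - I) /\<^sub>R h - (S \<tau> x - x)) z = (B (S h I) z - B I z) / h - (B (S \<tau> x) z - B x z)"
      using IC x z h \<tau> by (simp add: B_bilinear divide_inverse mult.commute)
    ultimately show ?thesis
      unfolding \<phi>_def by (simp add: diff_divide_distrib)
  qed
  have "((\<lambda>h. N ((S h I - I) /\<^sub>R h - (S \<tau> x - x))) \<longlongrightarrow> 0) (at_right 0)"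
  proof (rule tendstoI)
    fix e :: real assume "0 < e"
    then have "0 < e / 4" by simp
    obtain \<delta> where \<delta>: "0 < \<delta>" "\<And>h z. 0 < h \<Longrightarrow> h < \<delta> \<Longrightarrow> z \<in> C \<Longrightarrow>
        \<bar>integral {\<tau>..\<tau> + h} (\<lambda>s. B (S s x) z) / h - B (S \<tau> x) z\<bar> \<le> e / 4 * N z"
      using orbit_average[OF x \<tau> \<open>0 < e / 4\<close>] by blast
    obtain \<delta>' where \<delta>': "0 < \<delta>'" "\<And>h z. 0 < h \<Longrightarrow> h < \<delta>' \<Longrightarrow> z \<in> C \<Longrightarrow>
        \<bar>integral {0..0 + h} (\<lambda>s. B (S s x) z) / h - B (S 0 x) z\<bar> \<le> e / 4 * N z"
      using orbit_average[OF x order_refl \<open>0 < e / 4\<close>] by blast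
    have "N ((S h I - I) /\<^sub>R h - (S \<tau> x - x)) \<le> e / 2" if h: "0 < h" "h < min \<delta> \<delta>'" for h
    proof (rule N_le_weakI)
      fix z assume z: "z \<in> C"
      show "\<bar>B ((S h I - I) /\<^sub>R h - (S \<tau> x - x)) z\<bar> \<le> e / 2 * N z"
      proof -
        have "\<bar>integral {\<tau>..\<tau> + h} (\<lambda>s. B (S s x) z) / h - B (S \<tau> x) z\<bar> \<le> e / 4 * N z"
          "\<bar>integral {0..0 + h} (\<lambda>s. B (S s x) z) / h - B (S 0 x) z\<bar> \<le> e / 4 * N z"
          using \<delta>(2)[of h z] \<delta>'(2)[of h z] h z by auto
        moreover have "e / 2 * N z = e / 4 * N z + e / 4 * N z" by simp
        ultimately show ?thesis
          unfolding weak[OF h(1) z] by linarith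
      qed
    qed (use IC x \<tau> h \<open>0 < e\<close> in auto)
    moreover have "0 \<le> N ((S h I - I) /\<^sub>R h - (S \<tau> x - x))" if "0 < h" for h
      using IC x \<tau> that by (intro N_nonneg) auto
    ultimately have "dist (N ((S h I - I) /\<^sub>R h - (S \<tau> x - x))) 0 < e" if "0 < h" "h < min \<delta> \<delta>'" for h
      using that \<open>0 < e\<close> by (smt (verit) dist_real_def field_sum_of_halves)
    then show "\<forall>\<^sub>F h in at_right 0. dist (N ((S h I - I) /\<^sub>R h - (S \<tau> x - x))) 0 < e"
      unfolding eventually_at_right_field using \<delta>(1) \<delta>'(1)
      by (intro exI[of _ "min \<delta> \<delta>'"]) auto
  qed
  then show ?thesis
    using IC x \<tau> by (auto simp: generator_on_def)
qed

lemma generator_scaleR: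
  assumes xy: "(x, y) \<in> generator_on C N S"
  shows "(c *\<^sub>R x, c *\<^sub>R y) \<in> generator_on C N S"
proof -
  have C: "x \<in> C" "y \<in> C" and lim: "((\<lambda>h. N ((S h x - x) /\<^sub>R h - y)) \<longlongrightarrow> 0) (at_right 0)"
    using xy by (auto simp: generator_on_def)
  have eq: "N ((S h (c *\<^sub>R x) - c *\<^sub>R x) /\<^sub>R h - c *\<^sub>R y) = \<bar>c\<bar> * N ((S h x - x) /\<^sub>R h - y)" if "0 < h" for h
  proof -
    have "N ((S h (c *\<^sub>R x) - c *\<^sub>R x) /\<^sub>R h - c *\<^sub>R y) = N (c *\<^sub>R ((S h x - x) /\<^sub>R h - y))"
    proof (rule N_null_cong, rule_tac [3] null_weakI)
      fix z assume z: "z \<in> C"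
      show "B ((S h (c *\<^sub>R x) - c *\<^sub>R x) /\<^sub>R h - c *\<^sub>R y) z = B (c *\<^sub>R ((S h x - x) /\<^sub>R h - y)) z"
        using bounded_functionalD(2)[OF functional_B_S[OF z, of h]] C z that
        by (simp add: B_bilinear algebra_simps)
    qed (use C that in auto)
    then show ?thesis using C that by (simp add: N_scaleR)
  qed
  have "((\<lambda>h. \<bar>c\<bar> * N ((S h x - x) /\<^sub>R h - y)) \<longlongrightarrow> 0) (at_right 0)"
    using tendsto_mult_right_zero[OF lim] by simp
  then have "((\<lambda>h. N ((S h (c *\<^sub>R x) - c *\<^sub>R x) /\<^sub>R h - c *\<^sub>R y)) \<longlongrightarrow> 0) (at_right 0)"
    by (rule Lim_transform_eventually) (auto simp: eventually_at_filter eq)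
  then show ?thesis
    using C by (auto simp: generator_on_def)
qed

text \<open>Averages of the orbit over \<open>[0, h]\<close> lie in the domain and tend to \<open>x\<close>.\<close>

lemma generator_dense:
  assumes x: "x \<in> C" and "0 < e"
  obtains y v where "(y, v) \<in> generator_on C N S" "N (y - x) < e"
proof -
  have "0 < e / 2" using \<open>0 < e\<close> by simp
  obtain \<delta> where \<delta>: "0 < \<delta>" "\<And>h z. 0 < h \<Longrightarrow> h < \<delta> \<Longrightarrow> z \<in> C \<Longrightarrow>
      \<bar>integral {0..0 + h} (\<lambda>s. B (S s x) z) / h - B (S 0 x) z\<bar> \<le> e / 2 * N z"
    using orbit_average[OF x order_refl \<open>0 < e / 2\<close>] by blast
  define h where "h = \<delta> / 2"
  have h: "0 < h" "h < \<delta>" using \<delta>(1) by (auto simp: h_def)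
  obtain I where I: "integral_is (lebesgue_on {0..h}) (\<lambda>s. S (h - s) x) I"
    using ex_integral_is[OF orbit_simple_approx[OF x, of h]] h by auto
  then have IC: "I \<in> C" by (simp add: integral_is_def)
  have "N (I /\<^sub>R h - x) \<le> e / 2"
  proof (rule N_le_weakI)
    fix z assume z: "z \<in> C"
    have "B (S 0 x) z = B x z"
      using S_0[OF x] x z by (intro bounded_functional_null[OF bounded_functional_B[OF z]]) auto
    then have "B (I /\<^sub>R h - x) z = integral {0..0 + h} (\<lambda>s. B (S s x) z) / h - B (S 0 x) z"
      using orbit_integral_functional[OF x _ I bounded_functional_B[OF z]] h IC x z
      by (simp add: B_bilinear divide_inverse)
    then show "\<bar>B (I /\<^sub>R h - x) z\<bar> \<le> e / 2 * N z"
      using \<delta>(2)[OF h z] by simp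
  qed (use IC x h \<open>0 < e\<close> in auto)
  then show ?thesis
    using generator_scaleR[OF orbit_integral_in_generator[OF x _ I], of "inverse h"] h \<open>0 < e\<close>
    by (intro that) auto
qed

end

section \<open>Contractivity and Duhamel integrals\<close>

locale dissipative_semigroup = C0_semigroup C B S
  for C :: "'w::real_vector set" and B and S +
  assumes dissipative: "(x, y) \<in> generator_on C N S \<Longrightarrow> B x y \<le> 0"
begin

text \<open>The orbit stays in the domain, and \<open>(N (S s x))\<^sup>2\<close> has the right derivative \<open>2 B v z \<le> 0\<close> with
  \<open>z = S s x\<close> and \<open>v = S s y\<close>.\<close>

lemma generator_orbit_N_le:
  assumes xy: "(x, y) \<in> generator_on C N S" and t: "0 \<le> t"
  shows "N (S t x) \<le> N x"
proof -
  have x: "x \<in> C" using xy by (simp add: generator_on_def)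
  have "(N (S t x))\<^sup>2 \<le> (N (S 0 x))\<^sup>2"
  proof (rule right_derivative_nonpos_imp_le[OF t, of "\<lambda>s. (N (S s x))\<^sup>2"])
    show "continuous_on {0..t} (\<lambda>s. (N (S s x))\<^sup>2)"
      by (intro continuous_intros continuous_on_subset[OF orbit_N_continuous[OF x]]) auto
    fix s assume s: "0 \<le> s" "s < t"
    define z where "z = S s x"
    define v where "v = S s y"
    have zv: "(z, v) \<in> generator_on C N S"
      unfolding z_def v_def by (rule generator_invariant[OF xy s(1)])
    then have C: "z \<in> C" "v \<in> C" and lim: "((\<lambda>h. N ((S h z - z) /\<^sub>R h - v)) \<longlongrightarrow> 0) (at_right 0)"
      by (auto simp: generator_on_def)
    have eq: "(B ((S h z - z) /\<^sub>R h) (S h z - z) + 2 * B ((S h z - z) /\<^sub>R h) z)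
        = ((N (S (s + h) x))\<^sup>2 - (N (S s x))\<^sup>2) / h" if "0 < h" for h
    proof -
      have "N (S (s + h) x) = N (S h z)"
        unfolding z_def using S_plus[of h s x] s x that by (intro N_null_cong) (auto simp: add.commute)
      then have "((N (S (s + h) x))\<^sup>2 - (N (S s x))\<^sup>2) / h = (B (S h z) (S h z) - B z z) / h"
        using C that by (simp add: N_power2 flip: z_def)
      also have "\<dots> = B ((S h z - z) /\<^sub>R h) (S h z - z) + 2 * B ((S h z - z) /\<^sub>R h) z"
        using C that by (simp add: B_bilinear B_commute[of z "S h z"] divide_inverse algebra_simps)
      finally show ?thesis ..
    qed
    have cross: "((\<lambda>h. B ((S h z - z) /\<^sub>R h) (S h z - z)) \<longlongrightarrow> 0) (at_right 0)"
    proof (rule Lim_null_comparison)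
      show "((\<lambda>h. (N ((S h z - z) /\<^sub>R h - v) + N v) * N (S h z - z)) \<longlongrightarrow> 0) (at_right 0)"
        using tendsto_mult[OF tendsto_add[OF lim tendsto_const] S_right_continuous_0[OF C(1)], of "N v"] by simp
      have "\<bar>B ((S h z - z) /\<^sub>R h) (S h z - z)\<bar> \<le> (N ((S h z - z) /\<^sub>R h - v) + N v) * N (S h z - z)"
        if "0 < h" for h
      proof -
        have "\<bar>B ((S h z - z) /\<^sub>R h) (S h z - z)\<bar> \<le> N ((S h z - z) /\<^sub>R h) * N (S h z - z)"
          using C that by (intro Cauchy_Schwarz_B) auto
        also have "\<dots> \<le> (N ((S h z - z) /\<^sub>R h - v) + N v) * N (S h z - z)"
          using N_triangle[of "(S h z - z) /\<^sub>R h - v" v] C that by (intro mult_right_mono N_nonneg) auto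
        finally show ?thesis .
      qed
      then show "\<forall>\<^sub>F h in at_right 0. norm (B ((S h z - z) /\<^sub>R h) (S h z - z)) \<le>
          (N ((S h z - z) /\<^sub>R h - v) + N v) * N (S h z - z)"
        by (auto simp: eventually_at_filter)
    qed
    have "((\<lambda>h. B ((S h z - z) /\<^sub>R h - v) z) \<longlongrightarrow> 0) (at_right 0)"
    proof (rule Lim_null_comparison)
      show "((\<lambda>h. N ((S h z - z) /\<^sub>R h - v) * N z) \<longlongrightarrow> 0) (at_right 0)"
        using tendsto_mult_left_zero[OF lim] by simp
      have "\<bar>B ((S h z - z) /\<^sub>R h - v) z\<bar> \<le> N ((S h z - z) /\<^sub>R h - v) * N z" if "0 < h" for h
        using C that by (intro Cauchy_Schwarz_B) auto
      then show "\<forall>\<^sub>F h in at_right 0. norm (B ((S h z - z) /\<^sub>R h - v) z) \<le> N ((S h z - z) /\<^sub>R h - v) * N z"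
        by (auto simp: eventually_at_filter)
    qed
    from tendsto_add[OF this tendsto_const[of "B v z"]]
    have "((\<lambda>h. B ((S h z - z) /\<^sub>R h - v) z + B v z) \<longlongrightarrow> B v z) (at_right 0)"
      by simp
    then have "((\<lambda>h. B ((S h z - z) /\<^sub>R h) z) \<longlongrightarrow> B v z) (at_right 0)"
    proof (rule Lim_transform_eventually)
      have "B ((S h z - z) /\<^sub>R h - v) z + B v z = B ((S h z - z) /\<^sub>R h) z" if "0 < h" for h
        using C that by (simp add: B_diff_left)
      then show "\<forall>\<^sub>F h in at_right 0. B ((S h z - z) /\<^sub>R h - v) z + B v z = B ((S h z - z) /\<^sub>R h) z"
        by (auto simp: eventually_at_filter)
    qed
    then have "((\<lambda>h. B ((S h z - z) /\<^sub>R h) (S h z - z) + 2 * B ((S h z - z) /\<^sub>R h) z) \<longlongrightarrow> 0 + 2 * B v z) (at_right 0)"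
      by (intro tendsto_add tendsto_mult tendsto_const cross)
    then have "((\<lambda>h. ((N (S (s + h) x))\<^sup>2 - (N (S s x))\<^sup>2) / h) \<longlongrightarrow> 0 + 2 * B v z) (at_right 0)"
      by (rule Lim_transform_eventually) (auto simp: eventually_at_filter eq)
    moreover have "2 * B v z \<le> 0"
      using dissipative[OF zv] C B_commute[of z v] by simp
    ultimately show "\<exists>D\<le>0. ((\<lambda>h. ((N (S (s + h) x))\<^sup>2 - (N (S s x))\<^sup>2) / h) \<longlongrightarrow> D) (at_right 0)"
      by (intro exI[of _ "2 * B v z"]) simp
  qed
  also have "N (S 0 x) = N x"
    using S_0[OF x] x by (intro N_null_cong) auto
  finally show ?thesis
    using x by (auto intro: power2_le_imp_le N_nonneg)
qed

lemma S_contraction: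
  assumes x: "x \<in> C" and t: "0 \<le> t"
  shows "N (S t x) \<le> N x"
proof (rule field_le_epsilon)
  fix e :: real assume "0 < e"
  obtain K where K: "0 \<le> K" "\<And>x. x \<in> C \<Longrightarrow> N (S t x) \<le> K * N x"
    using S_bounded[OF t] by blast
  have pos: "0 < e / (K + 1)" using \<open>0 < e\<close> K(1) by simp
  obtain y v where yv: "(y, v) \<in> generator_on C N S" and near: "N (y - x) < e / (K + 1)"
    using generator_dense[OF x pos] by blast
  have y: "y \<in> C" using yv by (simp add: generator_on_def)
  have "N (S t x) \<le> N (S t x - S t y) + N (S t y)"
    using N_triangle[of "S t x - S t y" "S t y"] x y t by simp
  also have "N (S t x - S t y) \<le> K * N (x - y)"
    by (rule S_diff_le[OF t K(2) x y])
  also have "N (S t y) \<le> N y"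
    by (rule generator_orbit_N_le[OF yv t])
  also have "N y \<le> N (y - x) + N x"
    using N_triangle[of "y - x" x] x y by simp
  finally have "N (S t x) \<le> (K + 1) * N (y - x) + N x"
    using N_minus_commute[OF x y] by (simp add: algebra_simps)
  also have "(K + 1) * N (y - x) \<le> e"
    using near K(1) by (simp add: field_simps)
  finally show "N (S t x) \<le> N x + e" by simp
qed

lemma S_contraction_diff: "0 \<le> t \<Longrightarrow> x \<in> C \<Longrightarrow> y \<in> C \<Longrightarrow> N (S t x - S t y) \<le> N (x - y)"
  using S_diff_le[of t 1 x y] S_contraction[of _ t] by (metis mult_1)

text \<open>The Duhamel integrand, extended by zero beyond \<open>t\<close>: all integrands then live on the same interval
  \<open>[0, T]\<close>, where they can be compared for different \<open>t\<close>.\<close>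

definition duhamel :: "(real \<Rightarrow> 'w) \<Rightarrow> real \<Rightarrow> real \<Rightarrow> 'w" where
  "duhamel F t s = (if s \<le> t then S (t - s) (F s) else 0)"

text \<open>Rounding the time and approximating the source make the integrand simple. Contractivity keeps the
  error of the source under control and provides the dominating function.\<close>

lemma duhamel_simple_approx:
  assumes F: "simple_approx (lebesgue_on {0..T}) F Fs" and t: "0 \<le> t" "t \<le> T"
  shows "simple_approx (lebesgue_on {0..T}) (duhamel F t)
    (\<lambda>n s. if s \<le> t then S (disc n (t - s)) (Fs n s) else 0)"
  unfolding simple_approx_def
proof (intro conjI ballI allI)
  have FC: "F s \<in> C" if "s \<in> {0..T}" for s
    using F that by (auto simp: simple_approx_def)
  have FsC: "Fs n s \<in> C" if "s \<in> {0..T}" for n s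
    using F that by (auto simp: simple_approx_def Pi_iff)
  show "duhamel F t \<in> space (lebesgue_on {0..T}) \<rightarrow> C"
    using FC by (auto simp: duhamel_def)
  fix n
  have "simple_function (lebesgue_on {0..T}) (Fs n)"
    using F by (auto simp: simple_approx_def elim: simple_bochner_integrable.cases)
  then have "simple_function (lebesgue_on {0..T}) (\<lambda>s. S (disc n (t - s)) (Fs n s))"
    by (rule simple_function_compose2[OF simple_function_disc])
  moreover have "{s \<in> space (lebesgue_on {0..T}). s \<le> t} \<in> sets (lebesgue_on {0..T})"
  proof -
    have "{s \<in> space (lebesgue_on {0..T}). s \<le> t} = {0..min T t}" by auto
    then show ?thesis by (simp add: sets_restrict_space_iff)
  qed
  ultimately have "simple_function (lebesgue_on {0..T}) (\<lambda>s. if s \<le> t then S (disc n (t - s)) (Fs n s) else 0)"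
    by (intro simple_function_If simple_function_const)
  then show "simple_integrable (lebesgue_on {0..T})
      (\<lambda>s. if s \<le> t then S (disc n (t - s)) (Fs n s) else 0)"
    by (intro simple_bochner_integrable_finite_measure finite_measure_interval)
  show "(\<lambda>s. if s \<le> t then S (disc n (t - s)) (Fs n s) else 0) \<in> space (lebesgue_on {0..T}) \<rightarrow> C"
    using FsC disc_bounds(1) by auto
next
  fix s assume s: "s \<in> space (lebesgue_on {0..T})"
  have FC: "F s \<in> C" "\<And>n. Fs n s \<in> C" and lim: "(\<lambda>n. N (F s - Fs n s)) \<longlonglongrightarrow> 0"
    using F s by (auto simp: simple_approx_def Pi_iff)
  show "(\<lambda>n. N (duhamel F t s - (if s \<le> t then S (disc n (t - s)) (Fs n s) else 0))) \<longlonglongrightarrow> 0"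
  proof (cases "s \<le> t")
    case True
    then have ts: "0 \<le> t - s" "\<And>n. 0 \<le> disc n (t - s)" using disc_bounds(1) by auto
    have "(\<lambda>n. N (S (t - s) (F s) - S (disc n (t - s)) (Fs n s))) \<longlonglongrightarrow> 0"
    proof (rule Lim_null_comparison)
      show "(\<lambda>n. N (S (disc n (t - s)) (F s) - S (t - s) (F s)) + N (F s - Fs n s)) \<longlonglongrightarrow> 0"
        using tendsto_add[OF orbit_disc[OF FC(1) ts(1)] lim] by simp
      have "N (S (t - s) (F s) - S (disc n (t - s)) (Fs n s)) \<le>
          N (S (disc n (t - s)) (F s) - S (t - s) (F s)) + N (F s - Fs n s)" for n
        using N_triangle_diff[of "S (t - s) (F s)" "S (disc n (t - s)) (F s)" "S (disc n (t - s)) (Fs n s)"]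
          S_contraction_diff[OF ts(2)[of n] FC(1) FC(2)[of n]] FC ts
        by (simp add: N_minus_commute[of "S (t - s) (F s)" "S (disc n (t - s)) (F s)"])
      then show "\<forall>\<^sub>F n in sequentially. norm (N (S (t - s) (F s) - S (disc n (t - s)) (Fs n s))) \<le>
          N (S (disc n (t - s)) (F s) - S (t - s) (F s)) + N (F s - Fs n s)"
        using FC ts by (simp add: N_nonneg)
    qed
    then show ?thesis using True by (simp add: duhamel_def)
  qed (simp add: duhamel_def N_zero)
next
  obtain b where b: "integrable (lebesgue_on {0..T}) b" "\<And>n s. s \<in> {0..T} \<Longrightarrow> N (Fs n s) \<le> b s"
    using F by (auto simp: simple_approx_def)
  have FsC: "Fs n s \<in> C" if "s \<in> {0..T}" for n s
    using F that by (auto simp: simple_approx_def Pi_iff)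
  have "N (if s \<le> t then S (disc n (t - s)) (Fs n s) else 0) \<le> b s" if s: "s \<in> {0..T}" for n s
    using S_contraction[OF FsC[OF s, of n], of "disc n (t - s)"] disc_bounds(1)[of "t - s" n] b(2)[OF s, of n]
      N_nonneg[OF FsC[OF s, of n]]
    by (auto simp: N_zero)
  then show "\<exists>b. integrable (lebesgue_on {0..T}) b \<and> (\<forall>n. \<forall>s\<in>space (lebesgue_on {0..T}).
      N (if s \<le> t then S (disc n (t - s)) (Fs n s) else 0) \<le> b s)"
    using b(1) by (intro exI[of _ b]) auto
qed

lemma simple_approx_subinterval:
  fixes t T :: real
  assumes "simple_approx (lebesgue_on {0..T}) g s" "t \<le> T" "\<And>r. r \<in> {0..t} \<Longrightarrow> g r = g' r"
  shows "simple_approx (lebesgue_on {0..t}) g' s"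
  unfolding simple_approx_def
proof (intro conjI allI ballI)
  fix n
  show "simple_integrable (lebesgue_on {0..t}) (s n)"
  proof (rule simple_bochner_integrable_finite_measure[OF finite_measure_interval])
    have "simple_function (lebesgue_on {0..T}) (s n)"
      using assms(1) by (auto simp: simple_approx_def elim: simple_bochner_integrable.cases)
    then show "simple_function (lebesgue_on {0..t}) (s n)"
      by (rule simple_function_lebesgue_on_subset) (use assms(2) in simp)
  qed
  show "s n \<in> space (lebesgue_on {0..t}) \<rightarrow> C"
    using assms(1,2) by (auto simp: simple_approx_def Pi_iff)
next
  show "g' \<in> space (lebesgue_on {0..t}) \<rightarrow> C"
    using assms(1,2) by (auto simp: simple_approx_def Pi_iff assms(3)[symmetric])
  show "(\<lambda>n. N (g' x - s n x)) \<longlonglongrightarrow> 0" if "x \<in> space (lebesgue_on {0..t})" for x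
    using assms(1,2) that by (auto simp: simple_approx_def assms(3)[symmetric])
  obtain b where b: "integrable (lebesgue_on {0..T}) b" "\<And>n r. r \<in> {0..T} \<Longrightarrow> N (s n r) \<le> b r"
    using assms(1) by (auto simp: simple_approx_def)
  have "integrable (lebesgue_on {0..t}) b"
    using b(1) by (rule integrable_subinterval_lebesgue) (use assms(2) in simp)
  then show "\<exists>b. integrable (lebesgue_on {0..t}) b \<and> (\<forall>n. \<forall>x\<in>space (lebesgue_on {0..t}). N (s n x) \<le> b x)"
    using b(2) assms(2) by (intro exI[of _ b]) auto
qed

lemma ex_duhamel_integral:
  assumes F: "simple_approx (lebesgue_on {0..T}) F Fs" and t: "0 \<le> t" "t \<le> T"
  shows "\<exists>I. integral_is (lebesgue_on {0..t}) (\<lambda>s. S (t - s) (F s)) I"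
proof -
  have "simple_approx (lebesgue_on {0..t}) (\<lambda>s. S (t - s) (F s))
      (\<lambda>n s. if s \<le> t then S (disc n (t - s)) (Fs n s) else 0)"
    by (rule simple_approx_subinterval[OF duhamel_simple_approx[OF F t] t(2)]) (simp add: duhamel_def)
  then show ?thesis
    using ex_integral_is by blast
qed

lemma duhamel_functional:
  assumes I: "integral_is (lebesgue_on {0..t}) (\<lambda>s. S (t - s) (F s)) I" and t: "0 \<le> t" "t \<le> T"
    and L: "bounded_functional L"
  shows "L I = (\<integral>s. L (duhamel F t s) \<partial>lebesgue_on {0..T})"
proof -
  have "L I = (\<integral>s. L (S (t - s) (F s)) \<partial>lebesgue_on {0..t})"
    by (rule integral_is_functional(2)[OF L I])
  also have "\<dots> = (\<integral>s. indicator {0..t} s *\<^sub>R L (S (t - s) (F s)) \<partial>lebesgue)"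
    by (rule integral_restrict_space) simp
  also have "\<dots> = (\<integral>s. indicator {0..T} s *\<^sub>R L (duhamel F t s) \<partial>lebesgue)"
    using t bounded_functionalD(4)[OF L]
    by (intro Bochner_Integration.integral_cong) (auto simp: indicator_def duhamel_def)
  also have "\<dots> = (\<integral>s. L (duhamel F t s) \<partial>lebesgue_on {0..T})"
    by (rule integral_restrict_space[symmetric]) simp
  finally show ?thesis .
qed

lemma duhamel_N_le:
  assumes F: "simple_approx (lebesgue_on {0..T}) F Fs" and t: "0 \<le> t" "t \<le> T"
    and I: "integral_is (lebesgue_on {0..t}) (\<lambda>s. S (t - s) (F s)) I"
  shows "N I \<le> (\<integral>s. N (F s) \<partial>lebesgue_on {0..T})"
proof -
  have FC: "F s \<in> C" if "s \<in> {0..T}" for s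
    using F that by (auto simp: simple_approx_def)
  have intF: "integrable (lebesgue_on {0..T}) (\<lambda>s. N (F s))"
    using ex_integral_is[OF F] integral_is_N(2) by blast
  have intFt: "integrable (lebesgue_on {0..t}) (\<lambda>s. N (F s))"
    using intF by (rule integrable_subinterval_lebesgue) (use t in simp)
  have "N I \<le> (\<integral>s. N (S (t - s) (F s)) \<partial>lebesgue_on {0..t})"
    by (rule integral_is_N(3)[OF I])
  also have "\<dots> \<le> (\<integral>s. N (F s) \<partial>lebesgue_on {0..t})"
    using FC t by (intro integral_mono integral_is_N(2)[OF I] intFt S_contraction) auto
  also have "\<dots> = (\<integral>s. indicator {0..t} s *\<^sub>R N (F s) \<partial>lebesgue)"
    by (rule integral_restrict_space) simp
  also have "\<dots> \<le> (\<integral>s. indicator {0..T} s *\<^sub>R N (F s) \<partial>lebesgue)"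
    using intF intFt FC t
    by (intro integral_mono) (auto simp: integrable_restrict_space indicator_def N_nonneg)
  also have "\<dots> = (\<integral>s. N (F s) \<partial>lebesgue_on {0..T})"
    by (rule integral_restrict_space[symmetric]) simp
  finally show ?thesis .
qed

text \<open>For \<open>u \<rightarrow> t\<close> the extended integrands converge pointwise except at \<open>s = t\<close>, dominated by \<open>2 N (F s)\<close>.\<close>

lemma duhamel_continuous:
  assumes F: "simple_approx (lebesgue_on {0..T}) F Fs"
    and I: "\<And>t. 0 \<le> t \<Longrightarrow> t \<le> T \<Longrightarrow> integral_is (lebesgue_on {0..t}) (\<lambda>s. S (t - s) (F s)) (I t)"
    and t: "0 \<le> t" "t \<le> T"
  shows "((\<lambda>u. N (I u - I t)) \<longlongrightarrow> 0) (at t within {0..T})"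
  unfolding tendsto_at_iff_sequentially
proof (intro allI impI)
  fix X assume X: "\<forall>i. X i \<in> {0..T} - {t}" "X \<longlonglongrightarrow> t"
  have FC: "F s \<in> C" if "s \<in> {0..T}" for s
    using F that by (auto simp: simple_approx_def)
  have IC: "I u \<in> C" if "0 \<le> u" "u \<le> T" for u
    using I[OF that] by (simp add: integral_is_def)
  have dC: "duhamel F u s \<in> C" if "s \<in> {0..T}" for u s
    using FC[OF that] by (auto simp: duhamel_def)
  have intF: "integrable (lebesgue_on {0..T}) (\<lambda>s. 2 * N (F s))"
    using ex_integral_is[OF F] integral_is_N(2) by (intro integrable_mult_right) blast
  have meas: "(\<lambda>s. N (duhamel F (X i) s - duhamel F t s)) \<in> borel_measurable (lebesgue_on {0..T})" for i
    using X(1) t by (intro simple_approx_diff_measurable[OF duhamel_simple_approx[OF F] duhamel_simple_approx[OF F]]) auto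
  have bound: "norm (N (duhamel F (X i) s - duhamel F t s)) \<le> 2 * N (F s)" if s: "s \<in> {0..T}" for i s
  proof -
    have "N (duhamel F u s) \<le> N (F s)" for u
      using S_contraction[OF FC[OF s]] N_nonneg[OF FC[OF s]] by (auto simp: duhamel_def N_zero)
    then have "N (duhamel F (X i) s) + N (duhamel F t s) \<le> 2 * N (F s)"
      by (metis add_mono mult_2)
    then show ?thesis
      using N_diff_le[OF dC[OF s, of "X i"] dC[OF s, of t]] N_nonneg[of "duhamel F (X i) s - duhamel F t s"] dC[OF s]
      by simp
  qed
  have lim: "(\<lambda>i. N (duhamel F (X i) s - duhamel F t s)) \<longlonglongrightarrow> 0" if s: "s \<in> {0..T}" "s \<noteq> t" for s
  proof (cases "s < t")
    case True
    have c: "((\<lambda>u. N (S u (F s) - S (t - s) (F s))) \<longlongrightarrow> N (S (t - s) (F s) - S (t - s) (F s))) (at (t - s) within {0..})"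
      using orbit_continuous[OF FC[OF s(1)], of "t - s"] True by (simp add: N_zero)
    have ev: "\<forall>\<^sub>F i in sequentially. s < X i"
      using order_tendstoD(1)[OF X(2) True] .
    have "(\<lambda>i. N (S (max 0 (X i - s)) (F s) - S (t - s) (F s))) \<longlonglongrightarrow> N (S (t - s) (F s) - S (t - s) (F s))"
    proof (rule continuous_within_tendsto_compose'[of "t - s" "{0..}" "\<lambda>u. N (S u (F s) - S (t - s) (F s))"])
      show "continuous (at (t - s) within {0..}) (\<lambda>u. N (S u (F s) - S (t - s) (F s)))"
        using c by (simp add: continuous_within)
      have "(\<lambda>i. max 0 (X i - s)) \<longlonglongrightarrow> max 0 (t - s)"
        by (intro tendsto_intros X(2))
      then show "(\<lambda>i. max 0 (X i - s)) \<longlonglongrightarrow> t - s" using True by simp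
    qed simp
    then have "(\<lambda>i. N (S (max 0 (X i - s)) (F s) - S (t - s) (F s))) \<longlonglongrightarrow> 0"
      by (simp add: N_zero)
    then show ?thesis
    proof (rule Lim_transform_eventually)
      show "\<forall>\<^sub>F i in sequentially. N (S (max 0 (X i - s)) (F s) - S (t - s) (F s)) =
          N (duhamel F (X i) s - duhamel F t s)"
        using ev by eventually_elim (use True in \<open>simp add: duhamel_def max_def\<close>)
    qed
  next
    case False
    then have "t < s" using s(2) by simp
    then have "\<forall>\<^sub>F i in sequentially. X i < s"
      by (rule order_tendstoD(2)[OF X(2)])
    then show ?thesis
      using \<open>t < s\<close> by (intro tendsto_eventually) (auto simp: duhamel_def N_zero elim!: eventually_mono)
  qed
  have AE_lim: "AE s in lebesgue_on {0..T}. (\<lambda>i. N (duhamel F (X i) s - duhamel F t s)) \<longlonglongrightarrow> 0"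
  proof (rule AE_I')
    show "{t} \<in> null_sets (lebesgue_on {0..T})"
      using t by (simp add: null_sets_restrict_space)
    show "{s \<in> space (lebesgue_on {0..T}). \<not> (\<lambda>i. N (duhamel F (X i) s - duhamel F t s)) \<longlonglongrightarrow> 0} \<subseteq> {t}"
      using lim by auto
  qed
  have "(\<lambda>i. \<integral>s. N (duhamel F (X i) s - duhamel F t s) \<partial>lebesgue_on {0..T}) \<longlonglongrightarrow> (\<integral>s. 0 \<partial>lebesgue_on {0..T})"
    by (rule integral_dominated_convergence[OF _ meas intF AE_lim]) (use bound in \<open>auto intro!: AE_I2\<close>)
  then have L: "(\<lambda>i. \<integral>s. N (duhamel F (X i) s - duhamel F t s) \<partial>lebesgue_on {0..T}) \<longlonglongrightarrow> 0"
    by simp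
  have le: "N (I (X i) - I t) \<le> (\<integral>s. N (duhamel F (X i) s - duhamel F t s) \<partial>lebesgue_on {0..T})" for i
  proof (rule N_le_weakI)
    have Xi: "0 \<le> X i" "X i \<le> T" using X(1) by auto
    show "I (X i) - I t \<in> C" using IC Xi t by auto
    show "0 \<le> (\<integral>s. N (duhamel F (X i) s - duhamel F t s) \<partial>lebesgue_on {0..T})"
      using dC by (intro Bochner_Integration.integral_nonneg N_nonneg) auto
    fix z assume z: "z \<in> C"
    note L = bounded_functional_B[OF z]
    have int: "integrable (lebesgue_on {0..T}) (\<lambda>s. B (duhamel F u s) z)" if u: "0 \<le> u" "u \<le> T" for u
      using ex_integral_is[OF duhamel_simple_approx[OF F u]] integral_is_functional(1)[OF L] by blast
    have intN: "integrable (lebesgue_on {0..T}) (\<lambda>s. N (duhamel F (X i) s - duhamel F t s))"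
      using bound by (intro Bochner_Integration.integrable_bound[OF intF meas] AE_I2 order_trans[OF bound]) auto
    have "B (I (X i) - I t) z = (\<integral>s. B (duhamel F (X i) s) z - B (duhamel F t s) z \<partial>lebesgue_on {0..T})"
      using duhamel_functional[OF I[OF Xi] Xi L] duhamel_functional[OF I[OF t] t L] int[OF Xi] int[OF t] IC[OF Xi] IC[OF t] z
      by (simp add: B_diff_left)
    also have "\<bar>\<dots>\<bar> \<le> (\<integral>s. N (duhamel F (X i) s - duhamel F t s) * N z \<partial>lebesgue_on {0..T})"
      unfolding real_norm_def[symmetric]
    proof (rule Bochner_Integration.integral_norm_bound_integral)
      fix s assume "s \<in> space (lebesgue_on {0..T})"
      then show "norm (B (duhamel F (X i) s) z - B (duhamel F t s) z) \<le> N (duhamel F (X i) s - duhamel F t s) * N z"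
        using Cauchy_Schwarz_B[of "duhamel F (X i) s - duhamel F t s" z] dC z by (simp add: B_diff_left)
    qed (use int[OF Xi] int[OF t] intN in auto)
    also have "\<dots> = (\<integral>s. N (duhamel F (X i) s - duhamel F t s) \<partial>lebesgue_on {0..T}) * N z"
      by (rule integral_mult_left_zero)
    finally show "\<bar>B (I (X i) - I t) z\<bar> \<le> (\<integral>s. N (duhamel F (X i) s - duhamel F t s) \<partial>lebesgue_on {0..T}) * N z" .
  qed
  have "(\<lambda>i. N (I (X i) - I t)) \<longlonglongrightarrow> 0"
  proof (rule Lim_null_comparison[OF _ L])
    show "\<forall>\<^sub>F i in sequentially. norm (N (I (X i) - I t)) \<le> (\<integral>s. N (duhamel F (X i) s - duhamel F t s) \<partial>lebesgue_on {0..T})"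
    proof (intro always_eventually allI)
      fix i
      have "0 \<le> N (I (X i) - I t)"
        using IC[of "X i"] IC[OF t] X(1) by (intro N_nonneg in_C(3)) auto
      then show "norm (N (I (X i) - I t)) \<le> (\<integral>s. N (duhamel F (X i) s - duhamel F t s) \<partial>lebesgue_on {0..T})"
        using le[of i] by simp
    qed
  qed
  then show "((\<lambda>u. N (I u - I t)) \<circ> X) \<longlonglongrightarrow> 0"
    by (simp add: comp_def)
qed

end

section \<open>The bilinear forms\<close>

lemma bounded_bilinear_matrix_vector: "bounded_bilinear (\<lambda>(A::real^'d^'d) x. A *v x)"
  unfolding bilinear_conv_bounded_bilinear[symmetric] bilinear_def
  by (auto intro!: linearI simp: matrix_vector_mult_add_rdistrib matrix_vector_right_distrib
      scaleR_matrix_vector_assoc[symmetric] matrix_vector_mult_scaleR)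

text \<open>Normalizing both arguments turns the sum of squares into a product. For the forms, the
  sum of squares comes from integrating a pointwise inequality \<open>a * b \<le> a\<^sup>2 + b\<^sup>2\<close>.\<close>

lemma bounded_bilinear_of_quadratic_bound:
  fixes f :: "'v::real_normed_vector \<Rightarrow> 'v \<Rightarrow> real"
  assumes add: "\<And>x y z. f (x + y) z = f x z + f y z" "\<And>x y z. f x (y + z) = f x y + f x z"
    and scale: "\<And>c x y. f (c *\<^sub>R x) y = c * f x y" "\<And>c x y. f x (c *\<^sub>R y) = c * f x y"
    and bound: "\<And>x y. \<bar>f x y\<bar> \<le> K * ((norm x)\<^sup>2 + (norm y)\<^sup>2)"
  shows "bounded_bilinear f"
proof (unfold_locales)
  show "\<exists>K. \<forall>a b. norm (f a b) \<le> norm a * norm b * K"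
  proof (intro exI allI)
    fix a b
    show "norm (f a b) \<le> norm a * norm b * (2 * K)"
    proof (cases "a = 0 \<or> b = 0")
      case True
      then show ?thesis using scale(1)[of 0 a b] scale(2)[of a 0 b] by auto
    next
      case False
      have "f a b = norm a * norm b * f (a /\<^sub>R norm a) (b /\<^sub>R norm b)"
        using False by (simp add: scale field_simps)
      then have "norm (f a b) = norm a * norm b * \<bar>f (a /\<^sub>R norm a) (b /\<^sub>R norm b)\<bar>"
        by (simp add: abs_mult)
      also have "\<dots> \<le> norm a * norm b * (2 * K)"
        using bound[of "a /\<^sub>R norm a" "b /\<^sub>R norm b"] False by (intro mult_left_mono) auto
      finally show ?thesis .
    qed
  qed
qed (simp_all add: add scale)

text \<open>The forms are bounded bilinear on all pairs of \<open>L\<^sup>2\<close> functions, since their coefficients are bounded;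
  this makes \<open>r \<mapsto> form \<Omega> A (\<zeta> r) (\<xi> r)\<close> measurable and lets the forms commute with Bochner integrals.\<close>

lemma form_bounds:
  fixes \<Omega> :: "(real ^ 'd) set"
  assumes \<Omega>: "\<Omega> \<in> sets lebesgue" and A: "symmetric_Linfty \<Omega> A"
  shows form_integrable: "integrable (lebesgue_on \<Omega>) (\<lambda>x. (A x *v rep_L2 (snd w) x) \<bullet> rep_L2 (snd v) x)"
    and bounded_bilinear_form: "bounded_bilinear (form \<Omega> A)"
proof -
  have [measurable]: "A \<in> borel_measurable (lebesgue_on \<Omega>)"
    using A by (simp add: symmetric_Linfty_def)
  have rep[measurable]: "rep_L2 u \<in> borel_measurable (lebesgue_on \<Omega>)" for u :: "(real^'d, real^'d) L2"
    by (intro measurable_restrict_space1 borel_measurable_rep_L2)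
  obtain M where M: "AE x in lebesgue_on \<Omega>. norm (A x) \<le> M"
    using A by (auto simp: symmetric_Linfty_def)
  obtain c where c: "0 \<le> c" "\<And>B (x::real^'d). norm ((B::real^'d^'d) *v x) \<le> norm B * norm x * c"
    using bounded_bilinear.nonneg_bounded[OF bounded_bilinear_matrix_vector] by blast
  have cont: "continuous_on UNIV (\<lambda>p. ((fst p :: real^'d^'d) *v fst (snd p)) \<bullet> snd (snd p))"
    by (intro continuous_intros bounded_bilinear.continuous_on[OF bounded_bilinear_matrix_vector])
  have meas: "(\<lambda>x. (A x *v rep_L2 u x) \<bullet> rep_L2 v x) \<in> borel_measurable (lebesgue_on \<Omega>)"
    for u v :: "(real^'d, real^'d) L2"
    using measurable_compose[OF _ borel_measurable_continuous_onI[OF cont],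
        of "\<lambda>x. (A x, rep_L2 u x, rep_L2 v x)" "lebesgue_on \<Omega>"] by simp
  have sq: "integrable (lebesgue_on \<Omega>) (\<lambda>x. (norm (rep_L2 u x))\<^sup>2)"
    "(\<integral>x. (norm (rep_L2 u x))\<^sup>2 \<partial>lebesgue_on \<Omega>) \<le> (norm u)\<^sup>2" for u :: "(real^'d, real^'d) L2"
  proof -
    have i: "integrable lebesgue (\<lambda>x. (norm (rep_L2 u x))\<^sup>2)"
      using square_integrable_rep_L2[of u] by (simp add: square_integrable_def)
    have i': "integrable lebesgue (\<lambda>x. indicator \<Omega> x * (norm (rep_L2 u x))\<^sup>2)"
      using integrable_mult_indicator[OF \<Omega> i] by simp
    then show "integrable (lebesgue_on \<Omega>) (\<lambda>x. (norm (rep_L2 u x))\<^sup>2)"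
      using \<Omega> by (simp add: integrable_restrict_space)
    show "(\<integral>x. (norm (rep_L2 u x))\<^sup>2 \<partial>lebesgue_on \<Omega>) \<le> (norm u)\<^sup>2"
      unfolding norm_L2_eq using \<Omega> i i'
      by (simp add: integral_restrict_space) (intro integral_mono, auto simp: indicator_def)
  qed
  define K where "K = c * \<bar>M\<bar>"
  have bound: "AE x in lebesgue_on \<Omega>. \<bar>(A x *v rep_L2 u x) \<bullet> rep_L2 v x\<bar> \<le>
      K * ((norm (rep_L2 u x))\<^sup>2 + (norm (rep_L2 v x))\<^sup>2)" for u v :: "(real^'d, real^'d) L2"
    using M
  proof eventually_elim
    fix x assume Mx: "norm (A x) \<le> M"
    let ?a = "norm (rep_L2 u x)" and ?b = "norm (rep_L2 v x)"
    have "\<bar>(A x *v rep_L2 u x) \<bullet> rep_L2 v x\<bar> \<le> norm (A x *v rep_L2 u x) * ?b"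
      by (rule Cauchy_Schwarz_ineq2)
    also have "\<dots> \<le> (norm (A x) * ?a * c) * ?b"
      by (intro mult_right_mono c(2)) simp
    also have "\<dots> \<le> (\<bar>M\<bar> * ?a * c) * ?b"
      using Mx c(1) by (intro mult_right_mono) auto
    also have "\<dots> = K * (?a * ?b)" by (simp add: K_def)
    also have "\<dots> \<le> K * (?a\<^sup>2 + ?b\<^sup>2)"
    proof (rule mult_left_mono)
      have "0 \<le> ?a * ?b" by simp
      then show "?a * ?b \<le> ?a\<^sup>2 + ?b\<^sup>2" using sum_squares_bound[of ?a ?b] by linarith
      show "0 \<le> K" using c(1) by (simp add: K_def)
    qed
    finally show "\<bar>(A x *v rep_L2 u x) \<bullet> rep_L2 v x\<bar> \<le> K * (?a\<^sup>2 + ?b\<^sup>2)" .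
  qed
  have dom: "integrable (lebesgue_on \<Omega>) (\<lambda>x. K * ((norm (rep_L2 u x))\<^sup>2 + (norm (rep_L2 v x))\<^sup>2))"
    for u v :: "(real^'d, real^'d) L2"
    by (intro integrable_mult_right Bochner_Integration.integrable_add sq)
  have int: "integrable (lebesgue_on \<Omega>) (\<lambda>x. (A x *v rep_L2 u x) \<bullet> rep_L2 v x)"
    for u v :: "(real^'d, real^'d) L2"
  proof (rule Bochner_Integration.integrable_bound[OF dom[of u v] meas])
    show "AE x in lebesgue_on \<Omega>. norm ((A x *v rep_L2 u x) \<bullet> rep_L2 v x) \<le>
        norm (K * ((norm (rep_L2 u x))\<^sup>2 + (norm (rep_L2 v x))\<^sup>2))"
      using bound[of u v] by eventually_elim simp
  qed
  then show "integrable (lebesgue_on \<Omega>) (\<lambda>x. (A x *v rep_L2 (snd w) x) \<bullet> rep_L2 (snd v) x)" .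
  have AE_on: "AE x in lebesgue_on \<Omega>. P x" if "AE x in lebesgue. P x" for P
    using that \<Omega> by (subst AE_restrict_space_iff) (auto elim: eventually_mono)
  show "bounded_bilinear (form \<Omega> A)"
  proof (rule bounded_bilinear_of_quadratic_bound)
    fix x y z :: "'d V" and r :: real
    show "form \<Omega> A (x + y) z = form \<Omega> A x z + form \<Omega> A y z"
      unfolding form_def Bochner_Integration.integral_add[OF int int, symmetric]
    proof (rule integral_cong_AE)
      show "AE xa in lebesgue_on \<Omega>. (A xa *v rep_L2 (snd (x + y)) xa) \<bullet> rep_L2 (snd z) xa =
          (A xa *v rep_L2 (snd x) xa) \<bullet> rep_L2 (snd z) xa + (A xa *v rep_L2 (snd y) xa) \<bullet> rep_L2 (snd z) xa"
        using AE_on[OF rep_plus_L2[of "snd x" "snd y"]]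
        by eventually_elim (simp add: matrix_vector_right_distrib inner_add_left)
    qed (intro meas borel_measurable_add)+
    show "form \<Omega> A x (y + z) = form \<Omega> A x y + form \<Omega> A x z"
      unfolding form_def Bochner_Integration.integral_add[OF int int, symmetric]
    proof (rule integral_cong_AE)
      show "AE xa in lebesgue_on \<Omega>. (A xa *v rep_L2 (snd x) xa) \<bullet> rep_L2 (snd (y + z)) xa =
          (A xa *v rep_L2 (snd x) xa) \<bullet> rep_L2 (snd y) xa + (A xa *v rep_L2 (snd x) xa) \<bullet> rep_L2 (snd z) xa"
        using AE_on[OF rep_plus_L2[of "snd y" "snd z"]]
        by eventually_elim (simp add: inner_add_right)
    qed (intro meas borel_measurable_add)+
    show "form \<Omega> A (r *\<^sub>R x) y = r * form \<Omega> A x y"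
      unfolding form_def integral_mult_right_zero[symmetric]
    proof (rule integral_cong_AE)
      show "AE xa in lebesgue_on \<Omega>. (A xa *v rep_L2 (snd (r *\<^sub>R x)) xa) \<bullet> rep_L2 (snd y) xa =
          r * ((A xa *v rep_L2 (snd x) xa) \<bullet> rep_L2 (snd y) xa)"
        using AE_on[OF rep_scaleR_L2[of r "snd x"]]
        by eventually_elim (simp add: matrix_vector_mult_scaleR)
    qed (intro meas borel_measurable_times borel_measurable_const)+
    show "form \<Omega> A x (r *\<^sub>R y) = r * form \<Omega> A x y"
      unfolding form_def integral_mult_right_zero[symmetric]
    proof (rule integral_cong_AE)
      show "AE xa in lebesgue_on \<Omega>. (A xa *v rep_L2 (snd x) xa) \<bullet> rep_L2 (snd (r *\<^sub>R y)) xa =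
          r * ((A xa *v rep_L2 (snd x) xa) \<bullet> rep_L2 (snd y) xa)"
        using AE_on[OF rep_scaleR_L2[of r "snd y"]]
        by eventually_elim simp
    qed (intro meas borel_measurable_times borel_measurable_const)+
    have "\<bar>form \<Omega> A x y\<bar> \<le> (\<integral>xa. K * ((norm (rep_L2 (snd x) xa))\<^sup>2 + (norm (rep_L2 (snd y) xa))\<^sup>2) \<partial>lebesgue_on \<Omega>)"
      unfolding form_def
      by (rule order_trans[OF integral_abs_bound integral_mono_AE[OF integrable_abs[OF int] dom bound]])
    also have "\<dots> = K * ((\<integral>xa. (norm (rep_L2 (snd x) xa))\<^sup>2 \<partial>lebesgue_on \<Omega>) + (\<integral>xa. (norm (rep_L2 (snd y) xa))\<^sup>2 \<partial>lebesgue_on \<Omega>))"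
      using sq(1) by (simp add: Bochner_Integration.integral_add)
    also have "\<dots> \<le> K * ((norm (snd x))\<^sup>2 + (norm (snd y))\<^sup>2)"
      using c(1) by (intro mult_left_mono add_mono sq(2)) (simp add: K_def)
    also have "\<dots> \<le> K * ((norm x)\<^sup>2 + (norm y)\<^sup>2)"
      using c(1) norm_snd_le[of "snd x" "fst x"] norm_snd_le[of "snd y" "fst y"]
      by (intro mult_left_mono add_mono power_mono) (simp_all add: K_def)
    finally show "\<bar>form \<Omega> A x y\<bar> \<le> K * ((norm x)\<^sup>2 + (norm y)\<^sup>2)" .
  qed
qed

lemma form_commute:
  fixes \<Omega> :: "(real ^ 'd) set"
  assumes \<Omega>: "\<Omega> \<in> sets lebesgue" and A: "symmetric_Linfty \<Omega> A"
  shows "form \<Omega> A w v = form \<Omega> A v w"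
  unfolding form_def
proof (rule integral_cong_AE)
  have "AE x in lebesgue_on \<Omega>. transpose (A x) = A x"
    using A by (simp add: symmetric_Linfty_def)
  then show "AE x in lebesgue_on \<Omega>. (A x *v rep_L2 (snd w) x) \<bullet> rep_L2 (snd v) x =
      (A x *v rep_L2 (snd v) x) \<bullet> rep_L2 (snd w) x"
  proof eventually_elim
    fix x assume "transpose (A x) = A x"
    then have "(A x *v a) \<bullet> b = a \<bullet> (A x *v b)" for a b
      using dot_lmul_matrix[of a "A x" b] vector_transpose_matrix[of a "A x"] by simp
    then show "(A x *v rep_L2 (snd w) x) \<bullet> rep_L2 (snd v) x = (A x *v rep_L2 (snd v) x) \<bullet> rep_L2 (snd w) x"
      by (simp add: inner_commute)
  qed
qed (intro borel_measurable_integrable form_integrable[OF assms])+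

lemma form_nonneg:
  assumes "AE x in lebesgue_on \<Omega>. \<forall>\<xi>. 0 \<le> (A x *v \<xi>) \<bullet> \<xi>"
  shows "0 \<le> form \<Omega> A v v"
  unfolding form_def using assms by (intro integral_nonneg_AE) (auto elim: eventually_mono)

section \<open>Completeness of square integrable Banach-valued functions\<close>

text \<open>The Riesz-Fischer argument: a rapidly converging subsequence converges almost everywhere, and
  Fatou's lemma identifies its limit. The limit is redefined where it leaves \<open>Z\<close>, so that it takes
  values in \<open>Z\<close> everywhere.\<close>

lemma square_integrable_Cauchy_limit:
  fixes f :: "nat \<Rightarrow> 's \<Rightarrow> 'e::{banach, second_countable_topology}"
  assumes meas[measurable]: "\<And>n. f n \<in> borel_measurable M"
    and Z: "closed Z" "0 \<in> Z" "\<And>n x. x \<in> space M \<Longrightarrow> f n x \<in> Z"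
    and Cauchy: "\<And>e. 0 < e \<Longrightarrow> \<exists>K. \<forall>m\<ge>K. \<forall>n\<ge>K. (\<integral>\<^sup>+x. ennreal ((norm (f m x - f n x))\<^sup>2) \<partial>M) \<le> ennreal e"
  shows "\<exists>g\<in>borel_measurable M. (\<forall>x\<in>space M. g x \<in> Z) \<and>
    (\<forall>e>0. \<exists>K. \<forall>n\<ge>K. (\<integral>\<^sup>+x. ennreal ((norm (f n x - g x))\<^sup>2) \<partial>M) \<le> ennreal e)"
proof -
  have "\<exists>K. \<forall>m\<ge>K. \<forall>n\<ge>K. (\<integral>\<^sup>+x. ennreal ((norm (f m x - f n x))\<^sup>2) \<partial>M) \<le> ennreal ((1/8)^k)" for k :: nat
    by (rule Cauchy) simp
  then obtain K where K: "\<And>k m n. K k \<le> m \<Longrightarrow> K k \<le> n \<Longrightarrow>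
      (\<integral>\<^sup>+x. ennreal ((norm (f m x - f n x))\<^sup>2) \<partial>M) \<le> ennreal ((1/8)^k)"
    by metis
  define r where "r k = (\<Sum>i\<le>k. K i) + k" for k
  have K_le: "K k \<le> r k" for k
    using member_le_sum[of k "{..k}" K] by (simp add: r_def)
  have r_mono: "r k \<le> r (Suc k)" for k by (simp add: r_def)
  have k_le: "k \<le> r k" for k by (simp add: r_def)
  define d where "d k x = f (r (Suc k)) x - f (r k) x" for k x
  have [measurable]: "d k \<in> borel_measurable M" for k
    unfolding d_def by measurable
  \<comment> \<open>The weights \<open>4\<^sup>k\<close> are summable against \<open>8\<^bsup>-k\<^esup>\<close>, and a finite weighted sum forces
    \<open>norm (d k x)\<close> to decay like \<open>2\<^bsup>-k\<^esup>\<close>.\<close>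
  have d_int: "(\<integral>\<^sup>+x. ennreal (4^k * (norm (d k x))\<^sup>2) \<partial>M) \<le> ennreal ((1/2)^k)" for k
  proof -
    have "(\<integral>\<^sup>+x. ennreal (4^k * (norm (d k x))\<^sup>2) \<partial>M) = ennreal (4^k) * (\<integral>\<^sup>+x. ennreal ((norm (d k x))\<^sup>2) \<partial>M)"
      by (subst nn_integral_cmult[symmetric]) (auto simp: ennreal_mult)
    also have "\<dots> \<le> ennreal (4^k) * ennreal ((1/8)^k)"
      unfolding d_def using K_le[of k] r_mono[of k] by (intro mult_left_mono K) auto
    also have "\<dots> = ennreal ((1/2)^k)"
      by (simp add: ennreal_mult[symmetric] power_mult_distrib[symmetric])
    finally show ?thesis .
  qed
  have pow4: "(4::real)^k = (2^k)\<^sup>2" for k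
    by (simp add: power2_eq_square flip: power_mult_distrib)
  have term_le: "F k \<le> (\<Sum>k. F k)" for F :: "nat \<Rightarrow> ennreal" and k
    using sum_le_suminf[of F "{k}"] by simp
  have "(\<integral>\<^sup>+x. (\<Sum>k. ennreal (4^k * (norm (d k x))\<^sup>2)) \<partial>M) = (\<Sum>k. \<integral>\<^sup>+x. ennreal (4^k * (norm (d k x))\<^sup>2) \<partial>M)"
    by (intro nn_integral_suminf) measurable
  also have "\<dots> \<le> (\<Sum>k. ennreal ((1/2)^k))"
    by (intro suminf_le d_int) auto
  also have "\<dots> = ennreal (\<Sum>k. (1/2)^k)"
    by (intro suminf_ennreal2) (auto simp: summable_geometric)
  also have "\<dots> < \<infinity>" by simp
  finally have "AE x in M. (\<Sum>k. ennreal (4^k * (norm (d k x))\<^sup>2)) \<noteq> \<infinity>"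
    by (intro nn_integral_PInf_AE) auto
  then have conv: "AE x in M. convergent (\<lambda>k. f (r k) x)"
  proof eventually_elim
    fix x assume fin: "(\<Sum>k. ennreal (4^k * (norm (d k x))\<^sup>2)) \<noteq> \<infinity>"
    moreover have "\<exists>c\<ge>0. s = ennreal c" if "s \<noteq> \<infinity>" for s
      using that by (cases s) auto
    ultimately obtain c where c: "(\<Sum>k. ennreal (4^k * (norm (d k x))\<^sup>2)) = ennreal c" "0 \<le> c"
      by blast
    have "norm (d k x) \<le> sqrt c * (1/2)^k" for k
    proof -
      have "ennreal (4^k * (norm (d k x))\<^sup>2) \<le> (\<Sum>k. ennreal (4^k * (norm (d k x))\<^sup>2))"
        by (rule term_le)
      then have "4^k * (norm (d k x))\<^sup>2 \<le> c"
        unfolding c(1) using c(2) by (simp add: ennreal_le_iff)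
      then have "(2^k * norm (d k x))\<^sup>2 \<le> c"
        by (simp only: pow4 power_mult_distrib)
      then have "2^k * norm (d k x) \<le> sqrt c"
        by (rule real_le_rsqrt)
      then show ?thesis
        by (simp add: field_simps power_one_over)
    qed
    moreover have "summable (\<lambda>k. sqrt c * (1/2)^k)"
      by (intro summable_mult summable_geometric) simp
    ultimately have "summable (\<lambda>k. d k x)"
      by (rule summable_comparison_test'[rotated])
    then have "convergent (\<lambda>n. \<Sum>k<n. d k x)"
      by (simp add: summable_iff_convergent)
    then have "convergent (\<lambda>n. (\<Sum>k<n. d k x) + f (r 0) x)"
      by (rule convergent_add[OF _ convergent_const])
    then show "convergent (\<lambda>n. f (r n) x)"
      unfolding d_def sum_lessThan_telescope[of "\<lambda>n. f (r n) x"] by simp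
  qed
  define F where "F x = lim (\<lambda>k. f (r k) x)" for x
  define g where "g x = (if F x \<in> Z then F x else 0)" for x
  have [measurable]: "F \<in> borel_measurable M"
    unfolding F_def by measurable
  have [measurable]: "Z \<in> sets borel"
    using Z(1) by (rule borel_closed)
  have g_meas[measurable]: "g \<in> borel_measurable M"
    unfolding g_def by measurable
  have g_lim: "AE x in M. (\<lambda>k. f (r k) x) \<longlonglongrightarrow> g x"
  proof (rule AE_mp[OF conv], rule AE_I2, rule impI)
    fix x assume x: "x \<in> space M" and "convergent (\<lambda>k. f (r k) x)"
    then have lim: "(\<lambda>k. f (r k) x) \<longlonglongrightarrow> F x"
      by (simp add: F_def convergent_LIMSEQ_iff)
    have "F x \<in> Z"
      by (rule closed_sequentially[OF Z(1) _ lim]) (rule Z(3)[OF x])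
    with lim show "(\<lambda>k. f (r k) x) \<longlonglongrightarrow> g x"
      by (simp add: g_def)
  qed
  show ?thesis
  proof (intro bexI[OF _ g_meas] conjI ballI allI impI)
    fix x assume x: "x \<in> space M"
    show "g x \<in> Z"
      using Z(2) by (simp add: g_def)
  next
    fix e :: real assume "0 < e"
    then obtain K' where K': "\<And>m n. m \<ge> K' \<Longrightarrow> n \<ge> K' \<Longrightarrow> (\<integral>\<^sup>+x. ennreal ((norm (f m x - f n x))\<^sup>2) \<partial>M) \<le> ennreal e"
      using Cauchy by blast
    have "(\<integral>\<^sup>+x. ennreal ((norm (f n x - g x))\<^sup>2) \<partial>M) \<le> ennreal e" if n: "n \<ge> K'" for n
    proof -
      have "(\<integral>\<^sup>+x. ennreal ((norm (f n x - g x))\<^sup>2) \<partial>M) =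
          (\<integral>\<^sup>+x. liminf (\<lambda>k. ennreal ((norm (f n x - f (r k) x))\<^sup>2)) \<partial>M)"
      proof (rule nn_integral_cong_AE)
        show "AE x in M. ennreal ((norm (f n x - g x))\<^sup>2) = liminf (\<lambda>k. ennreal ((norm (f n x - f (r k) x))\<^sup>2))"
          using g_lim
        proof eventually_elim
          fix x assume "(\<lambda>k. f (r k) x) \<longlonglongrightarrow> g x"
          then have "(\<lambda>k. ennreal ((norm (f n x - f (r k) x))\<^sup>2)) \<longlonglongrightarrow> ennreal ((norm (f n x - g x))\<^sup>2)"
            by (intro tendsto_intros tendsto_ennrealI)
          then show "ennreal ((norm (f n x - g x))\<^sup>2) = liminf (\<lambda>k. ennreal ((norm (f n x - f (r k) x))\<^sup>2))"
            by (intro lim_imp_Liminf[symmetric]) auto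
        qed
      qed
      also have "\<dots> \<le> liminf (\<lambda>k. \<integral>\<^sup>+x. ennreal ((norm (f n x - f (r k) x))\<^sup>2) \<partial>M)"
        by (rule nn_integral_liminf) measurable
      also have "\<dots> \<le> liminf (\<lambda>k::nat. ennreal e)"
      proof (intro Liminf_mono eventually_sequentiallyI)
        fix k assume "K' \<le> k"
        then show "(\<integral>\<^sup>+x. ennreal ((norm (f n x - f (r k) x))\<^sup>2) \<partial>M) \<le> ennreal e"
          using k_le[of k] n by (intro K') auto
      qed
      also have "\<dots> = ennreal e" by (simp add: Liminf_const)
      finally show ?thesis .
    qed
    then show "\<exists>K. \<forall>n\<ge>K. (\<integral>\<^sup>+x. ennreal ((norm (f n x - g x))\<^sup>2) \<partial>M) \<le> ennreal e" by blast
  qed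
qed

section \<open>The extended state space\<close>

locale memory_problem =
  fixes \<Omega> :: "(real ^ 'd) set" and A0 A1 :: "real ^ 'd \<Rightarrow> real ^ 'd ^ 'd"
    and \<nu> :: "real measure" and \<beta> :: real
  assumes open_\<Omega>: "open \<Omega>" and bounded_\<Omega>: "bounded \<Omega>"
    and A1: "symmetric_Linfty \<Omega> A1"
    and A1_psd: "AE x in lebesgue_on \<Omega>. \<forall>\<xi>. 0 \<le> (A1 x *v \<xi>) \<bullet> \<xi>"
    and \<nu>_borel: "sets \<nu> = sets (restrict_space borel {0..})"
    and \<nu>_finite: "emeasure \<nu> {0..} < \<infinity>"
    and a0_nonneg: "\<And>v. v \<in> H10 \<Omega> \<Longrightarrow> 0 \<le> form \<Omega> A0 v v"
    and \<beta>: "0 < \<beta>"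
    and a1_coercive: "\<And>v. v \<in> H10 \<Omega> \<Longrightarrow> \<beta> * (norm (snd v))\<^sup>2 \<le> form \<Omega> A1 v v"
begin

abbreviation "W \<equiv> state_space \<Omega> A1 \<nu>"
abbreviation "\<K> \<equiv> memory_space \<Omega> A1 \<nu>"
abbreviation "wnorm \<equiv> state_norm \<Omega> A1 \<nu>"

lemma sets_\<Omega>: "\<Omega> \<in> sets lebesgue"
  using open_\<Omega> by (simp add: borel_open)

lemma space_\<nu>: "space \<nu> = {0..}"
  using sets_eq_imp_space_eq[OF \<nu>_borel] by (simp add: space_restrict_space)

sublocale \<nu>: finite_measure \<nu>
  by (rule finite_measureI) (use \<nu>_finite space_\<nu> in auto)

abbreviation "a1 \<equiv> form \<Omega> A1"

lemmas a1_bilinear = bounded_bilinear_form[OF sets_\<Omega> A1]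
lemmas a1_simps = bounded_bilinear.add_left[OF a1_bilinear] bounded_bilinear.add_right[OF a1_bilinear]
  bounded_bilinear.scaleR_left[OF a1_bilinear] bounded_bilinear.scaleR_right[OF a1_bilinear]
  bounded_bilinear.diff_left[OF a1_bilinear] bounded_bilinear.diff_right[OF a1_bilinear]
lemmas a1_commute = form_commute[OF sets_\<Omega> A1]
lemmas a1_nonneg = form_nonneg[OF A1_psd]

lemma a1_upper: obtains K where "0 < K" "\<And>w v :: 'd V. \<bar>a1 w v\<bar> \<le> K * ((norm w)\<^sup>2 + (norm v)\<^sup>2)"
    "\<And>v :: 'd V. a1 v v \<le> K * (norm v)\<^sup>2"
proof -
  obtain K where K: "0 < K" "\<And>w v. norm (a1 w v) \<le> norm w * norm v * K"
    using bounded_bilinear.pos_bounded[OF a1_bilinear] by blast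
  show ?thesis
  proof (rule that[OF K(1)])
    fix w v :: "'d V"
    have "0 \<le> norm w * norm v" by simp
    then have "norm w * norm v \<le> (norm w)\<^sup>2 + (norm v)\<^sup>2"
      using sum_squares_bound[of "norm w" "norm v"] by linarith
    then have "K * (norm w * norm v) \<le> K * ((norm w)\<^sup>2 + (norm v)\<^sup>2)"
      using K(1) by (intro mult_left_mono) auto
    then show "\<bar>a1 w v\<bar> \<le> K * ((norm w)\<^sup>2 + (norm v)\<^sup>2)"
      using K(2)[of w v] by (simp add: ac_simps)
    show "a1 v v \<le> K * (norm v)\<^sup>2"
      using K(2)[of v v] by (simp add: power2_eq_square ac_simps)
  qed
qed

text \<open>Coercivity bounds the gradient seminorm only; Poincare's inequality supplies the rest of the norm
  of \<open>V\<close>. Thus the norm of \<open>\<K>\<close> is equivalent to that of \<open>L\<^sup>2(\<nu>; V)\<close>.\<close>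

lemma a1_lower: obtains c where "0 < c" "\<And>v. v \<in> H10 \<Omega> \<Longrightarrow> (norm v)\<^sup>2 \<le> c * a1 v v"
proof -
  obtain p where p: "0 < p" "\<And>v. v \<in> H10 \<Omega> \<Longrightarrow> norm v \<le> p * norm (snd v)"
    using Poincare[OF bounded_\<Omega>] by blast
  have "(norm v)\<^sup>2 \<le> (p\<^sup>2 / \<beta>) * a1 v v" if v: "v \<in> H10 \<Omega>" for v
  proof -
    have "(norm v)\<^sup>2 \<le> (p * norm (snd v))\<^sup>2"
      by (intro power_mono p(2) v) simp
    also have "\<dots> = p\<^sup>2 / \<beta> * (\<beta> * (norm (snd v))\<^sup>2)"
      using \<beta> by (simp add: power_mult_distrib)
    also have "\<dots> \<le> p\<^sup>2 / \<beta> * a1 v v"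
      using \<beta> by (intro mult_left_mono a1_coercive v) auto
    finally show ?thesis .
  qed
  then show ?thesis using p(1) \<beta> by (intro that[of "p\<^sup>2 / \<beta>"]) auto
qed

lemma measurable_ident_\<nu>: "(\<lambda>r. r) \<in> borel_measurable \<nu>"
  using measurable_restrict_space1[of "\<lambda>r. r" borel borel "{0..}"]
  by (simp add: measurable_cong_sets[OF \<nu>_borel refl])

lemma measurable_a1:
  assumes "\<zeta> \<in> borel_measurable \<nu>" "\<xi> \<in> borel_measurable \<nu>"
  shows "(\<lambda>r. a1 (\<zeta> r) (\<xi> r)) \<in> borel_measurable \<nu>"
proof -
  have "continuous_on UNIV (\<lambda>p. a1 (fst p) (snd p))"
    by (intro bounded_bilinear.continuous_on[OF a1_bilinear] continuous_intros)
  then have "(\<lambda>p. a1 (fst p) (snd p)) \<in> borel_measurable borel"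
    by (rule borel_measurable_continuous_onI)
  from measurable_compose[OF borel_measurable_Pair[OF assms] this] show ?thesis by simp
qed

lemma memory_spaceD:
  assumes "\<zeta> \<in> \<K>"
  shows "\<zeta> \<in> borel_measurable \<nu>" "\<And>r. 0 \<le> r \<Longrightarrow> \<zeta> r \<in> H10 \<Omega>"
    "integrable \<nu> (\<lambda>r. a1 (\<zeta> r) (\<zeta> r))" "integrable \<nu> (\<lambda>r. (norm (\<zeta> r))\<^sup>2)"
    "integrable \<nu> (\<lambda>r. norm (\<zeta> r))" "integrable \<nu> \<zeta>"
proof -
  show meas[measurable]: "\<zeta> \<in> borel_measurable \<nu>"
    using assms by (simp add: memory_space_def)
  show H10: "\<zeta> r \<in> H10 \<Omega>" if "0 \<le> r" for r
    using assms that by (auto simp: memory_space_def space_\<nu>)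
  show int: "integrable \<nu> (\<lambda>r. a1 (\<zeta> r) (\<zeta> r))"
    using assms by (simp add: memory_space_def)
  obtain c where c: "0 < c" "\<And>v. v \<in> H10 \<Omega> \<Longrightarrow> (norm v)\<^sup>2 \<le> c * a1 v v"
    using a1_lower by blast
  have "integrable \<nu> (\<lambda>r. c * a1 (\<zeta> r) (\<zeta> r))"
    using int by simp
  then show sq: "integrable \<nu> (\<lambda>r. (norm (\<zeta> r))\<^sup>2)"
  proof (rule Bochner_Integration.integrable_bound)
    show "AE r in \<nu>. norm ((norm (\<zeta> r))\<^sup>2) \<le> norm (c * a1 (\<zeta> r) (\<zeta> r))"
    proof (rule AE_I2)
      fix r assume "r \<in> space \<nu>"
      then show "norm ((norm (\<zeta> r))\<^sup>2) \<le> norm (c * a1 (\<zeta> r) (\<zeta> r))"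
        using order_trans[OF c(2)[OF H10[of r]] abs_ge_self] by (simp add: space_\<nu>)
    qed
  qed measurable
  have "integrable \<nu> (\<lambda>r. 1 + (norm (\<zeta> r))\<^sup>2)"
    using sq by simp
  then show "integrable \<nu> (\<lambda>r. norm (\<zeta> r))"
  proof (rule Bochner_Integration.integrable_bound)
    have "norm (\<zeta> r) \<le> 1 + (norm (\<zeta> r))\<^sup>2" for r
      using sum_squares_bound[of 1 "norm (\<zeta> r)"] norm_ge_zero[of "\<zeta> r"]
      unfolding power_one mult_1_right by linarith
    then show "AE r in \<nu>. norm (norm (\<zeta> r)) \<le> norm (1 + (norm (\<zeta> r))\<^sup>2)"
      by (auto intro!: AE_I2)
  qed measurable
  then show "integrable \<nu> \<zeta>"
    by (rule integrable_norm_cancel) measurable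
qed

lemma memory_a1_integrable:
  assumes "\<zeta> \<in> \<K>" "\<xi> \<in> \<K>"
  shows "integrable \<nu> (\<lambda>r. a1 (\<zeta> r) (\<xi> r))"
proof -
  obtain K where K: "0 < K" "\<And>w v. \<bar>a1 w v\<bar> \<le> K * ((norm w)\<^sup>2 + (norm v)\<^sup>2)"
    using a1_upper by metis
  have "integrable \<nu> (\<lambda>r. K * ((norm (\<zeta> r))\<^sup>2 + (norm (\<xi> r))\<^sup>2))"
    using memory_spaceD(4)[OF assms(1)] memory_spaceD(4)[OF assms(2)] by simp
  then show ?thesis
  proof (rule Bochner_Integration.integrable_bound)
    show "(\<lambda>r. a1 (\<zeta> r) (\<xi> r)) \<in> borel_measurable \<nu>"
      by (intro measurable_a1 memory_spaceD(1) assms)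
    show "AE r in \<nu>. norm (a1 (\<zeta> r) (\<xi> r)) \<le> norm (K * ((norm (\<zeta> r))\<^sup>2 + (norm (\<xi> r))\<^sup>2))"
      using K by (auto intro!: AE_I2)
  qed
qed

lemma subspace_memory_space: "subspace (\<K>)"
proof (rule subspaceI)
  note sub = subspace_H10[of \<Omega>]
  have a1_0: "a1 0 0 = 0" by (rule bounded_bilinear.zero_left[OF a1_bilinear])
  show "0 \<in> \<K>"
    using subspace_0[OF sub] by (simp add: memory_space_def zero_fun_def a1_0)
  fix \<zeta> \<xi> assume m: "\<zeta> \<in> \<K>" "\<xi> \<in> \<K>"
  have "integrable \<nu> (\<lambda>r. a1 (\<zeta> r) (\<zeta> r) + a1 (\<zeta> r) (\<xi> r) + (a1 (\<xi> r) (\<zeta> r) + a1 (\<xi> r) (\<xi> r)))"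
    by (intro Bochner_Integration.integrable_add memory_a1_integrable m)
  then show "\<zeta> + \<xi> \<in> \<K>"
    using m subspace_add[OF sub] by (auto simp: memory_space_def plus_fun_def a1_simps algebra_simps)
next
  note sub = subspace_H10[of \<Omega>]
  fix c \<zeta> assume m: "\<zeta> \<in> \<K>"
  then show "c *\<^sub>R \<zeta> \<in> \<K>"
    using subspace_scale[OF sub] by (auto simp: memory_space_def scaleR_fun_def a1_simps)
qed

text \<open>The polar form of the square of \<open>wnorm\<close>.\<close>

definition state_inner :: "'d state \<Rightarrow> 'd state \<Rightarrow> real" where
  "state_inner x y = fst x \<bullet> fst y + (\<integral>r. a1 (snd x r) (snd y r) \<partial>\<nu>)"

lemma sqrt_state_inner: "sqrt (state_inner x x) = wnorm x"
proof -
  have "0 \<le> (\<integral>r. a1 (snd x r) (snd x r) \<partial>\<nu>)"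
    by (simp add: a1_nonneg)
  then show ?thesis
    by (simp add: state_inner_def state_norm_def memory_norm_def power2_norm_eq_inner)
qed

lemma state_spaceD:
  assumes "x \<in> W"
  shows "fst x \<in> L2_on \<Omega>" "snd x \<in> \<K>"
  using assms by (auto simp: state_space_def)

text \<open>Transported from \<open>L\<^sup>2(\<nu>; V)\<close> by the equivalence of the norms; the closed set of values is
  \<open>H10 \<Omega>\<close>.\<close>

lemma memory_complete:
  assumes X: "\<And>n. X n \<in> \<K>"
    and Cauchy: "\<And>e. 0 < e \<Longrightarrow> \<exists>K. \<forall>m\<ge>K. \<forall>n\<ge>K. (\<integral>r. a1 ((X m - X n) r) ((X m - X n) r) \<partial>\<nu>) \<le> e"
  obtains \<zeta> where "\<zeta> \<in> \<K>"
    "(\<lambda>n. \<integral>r. a1 ((X n - \<zeta>) r) ((X n - \<zeta>) r) \<partial>\<nu>) \<longlonglongrightarrow> 0"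
proof -
  note sub = subspace_memory_space
  obtain c where c: "0 < c" "\<And>v. v \<in> H10 \<Omega> \<Longrightarrow> (norm v)\<^sup>2 \<le> c * a1 v v"
    using a1_lower by blast
  obtain C where C: "0 < C" "\<And>v. a1 v v \<le> C * (norm v)\<^sup>2"
    using a1_upper by metis
  have upper: "(\<integral>\<^sup>+r. ennreal ((norm (\<xi> r))\<^sup>2) \<partial>\<nu>) \<le> ennreal (c * (\<integral>r. a1 (\<xi> r) (\<xi> r) \<partial>\<nu>))"
    if \<xi>: "\<xi> \<in> \<K>" for \<xi>
  proof -
    have "(\<integral>\<^sup>+r. ennreal ((norm (\<xi> r))\<^sup>2) \<partial>\<nu>) \<le> (\<integral>\<^sup>+r. ennreal (c * a1 (\<xi> r) (\<xi> r)) \<partial>\<nu>)"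
      using c(2) memory_spaceD(2)[OF \<xi>] by (intro nn_integral_mono ennreal_leI) (simp add: space_\<nu>)
    also have "\<dots> = ennreal (\<integral>r. c * a1 (\<xi> r) (\<xi> r) \<partial>\<nu>)"
      using memory_spaceD(3)[OF \<xi>] c(1) a1_nonneg by (intro nn_integral_eq_integral) auto
    finally show ?thesis by simp
  qed
  have Cauchy_V: "\<exists>K. \<forall>m\<ge>K. \<forall>n\<ge>K. (\<integral>\<^sup>+r. ennreal ((norm (X m r - X n r))\<^sup>2) \<partial>\<nu>) \<le> ennreal e" if e: "0 < e" for e
  proof -
    have "0 < e / c" using e c(1) by simp
    then obtain K where K: "\<And>m n. m \<ge> K \<Longrightarrow> n \<ge> K \<Longrightarrow> (\<integral>r. a1 ((X m - X n) r) ((X m - X n) r) \<partial>\<nu>) \<le> e / c"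
      using Cauchy by blast
    have "(\<integral>\<^sup>+r. ennreal ((norm (X m r - X n r))\<^sup>2) \<partial>\<nu>) \<le> ennreal e" if "m \<ge> K" "n \<ge> K" for m n
    proof -
      have "(\<integral>\<^sup>+r. ennreal ((norm ((X m - X n) r))\<^sup>2) \<partial>\<nu>) \<le> ennreal (c * (\<integral>r. a1 ((X m - X n) r) ((X m - X n) r) \<partial>\<nu>))"
        by (intro upper subspace_diff[OF sub] X)
      also have "\<dots> \<le> ennreal e"
        using K[OF that] c(1) by (intro ennreal_leI) (simp add: field_simps)
      finally show ?thesis by simp
    qed
    then show ?thesis by blast
  qed
  have H10: "closed (H10 \<Omega>)" "0 \<in> H10 \<Omega>" "\<And>n r. r \<in> space \<nu> \<Longrightarrow> X n r \<in> H10 \<Omega>"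
    using subspace_0[OF subspace_H10] memory_spaceD(2)[OF X] by (auto simp: H10_def space_\<nu>)
  obtain \<zeta> where \<zeta>: "\<zeta> \<in> borel_measurable \<nu>" "\<And>r. r \<in> space \<nu> \<Longrightarrow> \<zeta> r \<in> H10 \<Omega>"
    "\<And>e. 0 < e \<Longrightarrow> \<exists>K. \<forall>n\<ge>K. (\<integral>\<^sup>+r. ennreal ((norm (X n r - \<zeta> r))\<^sup>2) \<partial>\<nu>) \<le> ennreal e"
    using square_integrable_Cauchy_limit[OF memory_spaceD(1)[OF X] H10 Cauchy_V] by blast
  have lower: "(\<integral>\<^sup>+r. ennreal (a1 (\<xi> r) (\<xi> r)) \<partial>\<nu>) \<le> ennreal C * (\<integral>\<^sup>+r. ennreal ((norm (\<xi> r))\<^sup>2) \<partial>\<nu>)"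
    if [measurable]: "\<xi> \<in> borel_measurable \<nu>" for \<xi>
  proof -
    have "(\<integral>\<^sup>+r. ennreal (a1 (\<xi> r) (\<xi> r)) \<partial>\<nu>) \<le> (\<integral>\<^sup>+r. ennreal (C * (norm (\<xi> r))\<^sup>2) \<partial>\<nu>)"
      by (intro nn_integral_mono ennreal_leI C(2))
    also have "\<dots> = (\<integral>\<^sup>+r. ennreal C * ennreal ((norm (\<xi> r))\<^sup>2) \<partial>\<nu>)"
      using C(1) by (simp add: ennreal_mult')
    also have "\<dots> = ennreal C * (\<integral>\<^sup>+r. ennreal ((norm (\<xi> r))\<^sup>2) \<partial>\<nu>)"
      by (rule nn_integral_cmult) measurable
    finally show ?thesis .
  qed
  have diff_meas: "(\<lambda>r. X n r - \<zeta> r) \<in> borel_measurable \<nu>" for n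
    by (intro borel_measurable_diff memory_spaceD(1) X \<zeta>(1))
  have small: "\<exists>K. \<forall>n\<ge>K. (\<integral>\<^sup>+r. ennreal (a1 (X n r - \<zeta> r) (X n r - \<zeta> r)) \<partial>\<nu>) \<le> ennreal e" if e: "0 < e" for e
  proof -
    have "0 < e / C" using e C(1) by simp
    then obtain K where K: "\<And>n. n \<ge> K \<Longrightarrow> (\<integral>\<^sup>+r. ennreal ((norm (X n r - \<zeta> r))\<^sup>2) \<partial>\<nu>) \<le> ennreal (e / C)"
      using \<zeta>(3) by blast
    have "(\<integral>\<^sup>+r. ennreal (a1 (X n r - \<zeta> r) (X n r - \<zeta> r)) \<partial>\<nu>) \<le> ennreal e" if "n \<ge> K" for n
    proof -
      have "(\<integral>\<^sup>+r. ennreal (a1 (X n r - \<zeta> r) (X n r - \<zeta> r)) \<partial>\<nu>) \<le> ennreal C * ennreal (e / C)"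
        by (rule order_trans[OF lower[OF diff_meas] mult_left_mono[OF K[OF that]]]) simp
      also have "\<dots> = ennreal e" using C(1) e by (simp add: ennreal_mult[symmetric])
      finally show ?thesis .
    qed
    then show ?thesis by blast
  qed
  have diff: "(\<lambda>r. X n r - \<zeta> r) \<in> \<K>"
    if "(\<integral>\<^sup>+r. ennreal (a1 (X n r - \<zeta> r) (X n r - \<zeta> r)) \<partial>\<nu>) \<le> ennreal e" for n e
  proof -
    have "integrable \<nu> (\<lambda>r. a1 (X n r - \<zeta> r) (X n r - \<zeta> r))"
    proof (rule integrableI_nonneg)
      show "(\<integral>\<^sup>+r. ennreal (a1 (X n r - \<zeta> r) (X n r - \<zeta> r)) \<partial>\<nu>) < \<infinity>"
        using le_less_trans[OF that ennreal_less_top] by simp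
    qed (use diff_meas measurable_a1 a1_nonneg in auto)
    moreover have "X n r - \<zeta> r \<in> H10 \<Omega>" if "r \<in> space \<nu>" for r
      by (intro subspace_diff[OF subspace_H10] H10(3) \<zeta>(2) that)
    ultimately show ?thesis
      using diff_meas by (simp add: memory_space_def)
  qed
  have \<zeta>_mem: "\<zeta> \<in> \<K>"
  proof -
    obtain K where "(\<integral>\<^sup>+r. ennreal (a1 (X K r - \<zeta> r) (X K r - \<zeta> r)) \<partial>\<nu>) \<le> ennreal 1"
      using small[of 1] by auto
    from subspace_diff[OF sub X[of K] diff[OF this]] show ?thesis
      by (simp add: fun_diff_def)
  qed
  show ?thesis
  proof (rule that[OF \<zeta>_mem], rule LIMSEQ_I)
    fix e :: real assume "0 < e"
    then obtain K where K: "\<And>n. n \<ge> K \<Longrightarrow> (\<integral>\<^sup>+r. ennreal (a1 (X n r - \<zeta> r) (X n r - \<zeta> r)) \<partial>\<nu>) \<le> ennreal (e / 2)"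
      using small[of "e / 2"] by auto
    have "norm ((\<integral>r. a1 ((X n - \<zeta>) r) ((X n - \<zeta>) r) \<partial>\<nu>) - 0) < e" if n: "n \<ge> K" for n
    proof -
      have "ennreal (\<integral>r. a1 ((X n - \<zeta>) r) ((X n - \<zeta>) r) \<partial>\<nu>) \<le> ennreal (e / 2)"
        using K[OF n] memory_spaceD(3)[OF diff[OF K[OF n]]] a1_nonneg
        by (subst nn_integral_eq_integral[symmetric]) auto
      then have "(\<integral>r. a1 ((X n - \<zeta>) r) ((X n - \<zeta>) r) \<partial>\<nu>) \<le> e / 2"
        using \<open>0 < e\<close> by (simp add: ennreal_le_iff)
      moreover have "0 \<le> (\<integral>r. a1 ((X n - \<zeta>) r) ((X n - \<zeta>) r) \<partial>\<nu>)"
        by (simp add: a1_nonneg)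
      ultimately show ?thesis using \<open>0 < e\<close> by simp
    qed
    then show "\<exists>K. \<forall>n\<ge>K. norm ((\<integral>r. a1 ((X n - \<zeta>) r) ((X n - \<zeta>) r) \<partial>\<nu>) - 0) < e" by blast
  qed
qed

sublocale state: semi_inner_space W state_inner
proof
  show "subspace (W)"
    unfolding state_space_def by (intro subspace_Times subspace_L2_on sets_\<Omega> subspace_memory_space)
  fix x y z :: "'d state" and c :: real
  assume x: "x \<in> W"
  note mx = memory_a1_integrable[OF state_spaceD(2)[OF x]]
  show "0 \<le> state_inner x x"
    by (simp add: state_inner_def a1_nonneg)
  show "state_inner x y = state_inner y x"
    by (simp add: state_inner_def inner_commute a1_commute)
  show "state_inner (c *\<^sub>R x) z = c * state_inner x z"
    by (simp add: state_inner_def scaleR_fun_def a1_simps algebra_simps)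
  assume y: "y \<in> W" and z: "z \<in> W"
  show "state_inner (x + y) z = state_inner x z + state_inner y z"
    using memory_a1_integrable[OF state_spaceD(2)[OF x] state_spaceD(2)[OF z]]
      memory_a1_integrable[OF state_spaceD(2)[OF y] state_spaceD(2)[OF z]]
    by (simp add: state_inner_def a1_simps inner_add_left)
qed

lemma state_N_eq: "state.N = wnorm"
  by (simp add: fun_eq_iff state.N_def sqrt_state_inner)

lemma state_norm_power2:
  "(wnorm x)\<^sup>2 = (norm (fst x))\<^sup>2 + (\<integral>r. a1 (snd x r) (snd x r) \<partial>\<nu>)"
  by (simp add: state_norm_def memory_norm_def a1_nonneg)

lemma norm_fst_le_state_norm: "norm (fst x) \<le> wnorm x"
  by (simp add: state_norm_def real_le_rsqrt)

sublocale state: semi_hilbert W state_inner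
proof
  fix X :: "nat \<Rightarrow> 'd state"
  assume X: "\<And>n. X n \<in> W"
    and Cauchy: "\<And>e. 0 < e \<Longrightarrow> \<exists>K. \<forall>m\<ge>K. \<forall>n\<ge>K. state.N (X m - X n) < e"
  have "Cauchy (\<lambda>n. fst (X n))"
  proof (rule metric_CauchyI)
    fix e :: real assume "0 < e"
    then obtain K where K: "\<forall>m\<ge>K. \<forall>n\<ge>K. state.N (X m - X n) < e" using Cauchy by blast
    have "dist (fst (X m)) (fst (X n)) < e" if "m \<ge> K" "n \<ge> K" for m n
      using K that norm_fst_le_state_norm[of "X m - X n"] by (fastforce simp: state_N_eq dist_norm)
    then show "\<exists>K. \<forall>m\<ge>K. \<forall>n\<ge>K. dist (fst (X m)) (fst (X n)) < e" by blast
  qed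
  then obtain u where u: "(\<lambda>n. fst (X n)) \<longlonglongrightarrow> u"
    using Cauchy_convergent convergentD by blast
  have "u \<in> L2_on \<Omega>"
    by (rule closed_sequentially[OF closed_L2_on[OF sets_\<Omega>] _ u]) (rule state_spaceD(1)[OF X])
  have memC: "\<exists>K. \<forall>m\<ge>K. \<forall>n\<ge>K. (\<integral>r. a1 ((snd (X m) - snd (X n)) r) ((snd (X m) - snd (X n)) r) \<partial>\<nu>) \<le> e" if e: "0 < e" for e
  proof -
    obtain K where K: "\<forall>m\<ge>K. \<forall>n\<ge>K. state.N (X m - X n) < sqrt e" using Cauchy[of "sqrt e"] e by auto
    have "(\<integral>r. a1 ((snd (X m) - snd (X n)) r) ((snd (X m) - snd (X n)) r) \<partial>\<nu>) \<le> e" if "m \<ge> K" "n \<ge> K" for m n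
    proof -
      have "(\<integral>r. a1 ((snd (X m) - snd (X n)) r) ((snd (X m) - snd (X n)) r) \<partial>\<nu>) \<le> (wnorm (X m - X n))\<^sup>2"
        by (simp add: state_norm_power2)
      also have "\<dots> \<le> (sqrt e)\<^sup>2"
        using K that by (intro power_mono) (auto simp: state_N_eq less_imp_le state_norm_def)
      finally show ?thesis using \<open>0 < e\<close> by simp
    qed
    then show ?thesis by blast
  qed
  obtain \<zeta> where \<zeta>: "\<zeta> \<in> \<K>"
    "(\<lambda>n. \<integral>r. a1 ((snd (X n) - \<zeta>) r) ((snd (X n) - \<zeta>) r) \<partial>\<nu>) \<longlonglongrightarrow> 0"
    using memory_complete[OF state_spaceD(2)[OF X] memC] by blast
  have "(\<lambda>n. sqrt ((norm (fst (X n) - u))\<^sup>2 + (\<integral>r. a1 ((snd (X n) - \<zeta>) r) ((snd (X n) - \<zeta>) r) \<partial>\<nu>))) \<longlonglongrightarrow> sqrt (0\<^sup>2 + 0)"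
    by (intro tendsto_real_sqrt tendsto_add tendsto_power \<zeta>(2) tendsto_norm_zero LIM_zero u)
  moreover have "state.N (X n - (u, \<zeta>)) = sqrt ((norm (fst (X n) - u))\<^sup>2 + (\<integral>r. a1 ((snd (X n) - \<zeta>) r) ((snd (X n) - \<zeta>) r) \<partial>\<nu>))" for n
    by (simp add: state.N_def state_inner_def power2_norm_eq_inner)
  ultimately have "(\<lambda>n. state.N (X n - (u, \<zeta>))) \<longlonglongrightarrow> 0"
    by simp
  then show "\<exists>x\<in>W. (\<lambda>n. state.N (X n - x)) \<longlonglongrightarrow> 0"
    using \<open>u \<in> L2_on \<Omega>\<close> \<zeta>(1) by (intro bexI[of _ "(u, \<zeta>)"]) (auto simp: state_space_def)
qed

end

text \<open>\<open>f\<close> minus the indefinite integral of \<open>q\<close> has vanishing right derivative, so neither it nor its negative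
  can increase.\<close>

lemma right_derivative_eq_imp_integral:
  fixes f q :: "real \<Rightarrow> real"
  assumes "a \<le> b" and f: "continuous_on {a..b} f" and q: "continuous_on {a..b} q"
    and deriv: "\<And>s. a \<le> s \<Longrightarrow> s < b \<Longrightarrow> ((\<lambda>h. (f (s + h) - f s) / h) \<longlongrightarrow> q s) (at_right 0)"
  shows "f b - f a = integral {a..b} q"
proof -
  define Q where "Q s = integral {a..s} q" for s
  have Q: "(Q has_real_derivative q s) (at s within {a..b})" if "s \<in> {a..b}" for s
    unfolding Q_def by (rule integral_has_real_derivative[OF q that])
  have Q_cont: "continuous_on {a..b} Q"
    by (rule DERIV_continuous_on[OF Q])
  have Q_right: "((\<lambda>h. (Q (s + h) - Q s) / h) \<longlongrightarrow> q s) (at_right 0)" if s: "a \<le> s" "s < b" for s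
  proof -
    have "(Q has_real_derivative q s) (at s within {s..b})"
      by (rule has_field_derivative_subset[OF Q]) (use s in auto)
    then have "((\<lambda>y. (Q y - Q s) / (y - s)) \<longlongrightarrow> q s) (at_right s)"
      using s by (simp add: has_field_derivative_iff at_within_Icc_at_right)
    then show ?thesis
      by (subst (asm) filterlim_at_right_to_0) (simp add: add.commute)
  qed
  define g where "g s = f s - Q s" for s
  have g_right: "((\<lambda>h. (g (s + h) - g s) / h) \<longlongrightarrow> 0) (at_right 0)" if s: "a \<le> s" "s < b" for s
  proof -
    have "((\<lambda>h. (f (s + h) - f s) / h - (Q (s + h) - Q s) / h) \<longlongrightarrow> q s - q s) (at_right 0)"
      by (intro tendsto_diff deriv Q_right s)
    moreover have "(\<lambda>h. (f (s + h) - f s) / h - (Q (s + h) - Q s) / h) = (\<lambda>h. (g (s + h) - g s) / h)"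
      by (simp add: g_def fun_eq_iff diff_divide_distrib)
    ultimately show ?thesis by simp
  qed
  have "g b \<le> g a"
    by (rule right_derivative_nonpos_imp_le[OF \<open>a \<le> b\<close>])
      (auto simp: g_def intro!: continuous_intros f Q_cont exI[of _ 0] g_right[unfolded g_def])
  moreover have "- g b \<le> - g a"
  proof (rule right_derivative_nonpos_imp_le[OF \<open>a \<le> b\<close>, of "\<lambda>s. - g s"])
    show "continuous_on {a..b} (\<lambda>s. - g s)"
      unfolding g_def by (intro continuous_intros f Q_cont)
    fix s assume s: "a \<le> s" "s < b"
    have "((\<lambda>h. - ((g (s + h) - g s) / h)) \<longlongrightarrow> - 0) (at_right 0)"
      by (intro tendsto_minus g_right s)
    moreover have "(\<lambda>h. - ((g (s + h) - g s) / h)) = (\<lambda>h. (- g (s + h) - - g s) / h)"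
      by (simp add: fun_eq_iff minus_divide_left)
    ultimately show "\<exists>D\<le>0. ((\<lambda>h. (- g (s + h) - - g s) / h) \<longlongrightarrow> D) (at_right 0)"
      by (intro exI[of _ 0]) simp
  qed
  ultimately show ?thesis
    by (simp add: g_def Q_def)
qed

section \<open>Dissipativity and functionals of the memory\<close>

context memory_problem
begin

text \<open>Null vectors vanish \<open>\<nu>\<close>-almost everywhere, because \<open>a1\<close> is definite on \<open>H10 \<Omega>\<close>.\<close>

lemma state_null_iff:
  assumes x: "x \<in> W" and y: "y \<in> W"
  shows "wnorm (x - y) = 0 \<longleftrightarrow> state_eq \<nu> x y"
proof
  have xy: "x - y \<in> W" using x y by auto
  have nonneg: "0 \<le> (\<integral>r. a1 (snd (x - y) r) (snd (x - y) r) \<partial>\<nu>)"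
    by (simp add: a1_nonneg)
  assume "wnorm (x - y) = 0"
  then have "(norm (fst (x - y)))\<^sup>2 + (\<integral>r. a1 (snd (x - y) r) (snd (x - y) r) \<partial>\<nu>) = 0"
    using state_norm_power2[of "x - y"] by simp
  then have 0: "norm (fst (x - y)) = 0" "(\<integral>r. a1 (snd (x - y) r) (snd (x - y) r) \<partial>\<nu>) = 0"
    using nonneg by (simp_all only: add_nonneg_eq_0_iff zero_le_power2 power2_eq_iff_nonneg) auto
  have "AE r in \<nu>. a1 (snd (x - y) r) (snd (x - y) r) = 0"
    using 0(2) integral_nonneg_eq_0_iff_AE[OF memory_spaceD(3)[OF state_spaceD(2)[OF xy]]] a1_nonneg by simp
  moreover obtain c where c: "0 < c" "\<And>v. v \<in> H10 \<Omega> \<Longrightarrow> (norm v)\<^sup>2 \<le> c * a1 v v"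
    using a1_lower by blast
  ultimately have "AE r in \<nu>. snd x r = snd y r"
  proof (elim AE_mp, intro AE_I2 impI)
    fix r assume "r \<in> space \<nu>" "a1 (snd (x - y) r) (snd (x - y) r) = 0"
    then show "snd x r = snd y r"
      using c(2)[of "snd (x - y) r"] memory_spaceD(2)[OF state_spaceD(2)[OF xy], of r] by (simp add: space_\<nu>)
  qed
  then show "state_eq \<nu> x y"
    using 0(1) by (simp add: state_eq_def)
next
  assume eq: "state_eq \<nu> x y"
  have "(\<integral>r. a1 (snd (x - y) r) (snd (x - y) r) \<partial>\<nu>) = 0"
  proof (rule integral_eq_zero_AE)
    show "AE r in \<nu>. a1 (snd (x - y) r) (snd (x - y) r) = 0"
      using eq unfolding state_eq_def
      by (auto elim!: eventually_mono simp: bounded_bilinear.zero_left[OF a1_bilinear])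
  qed
  then show "wnorm (x - y) = 0"
    using state_norm_power2[of "x - y"] eq by (simp add: state_eq_def)
qed

text \<open>The definition of \<open>dual_is\<close> is applied with the test function \<open>v = w\<close>; then
  \<open>\<integral> a1 w (\<zeta> r) d\<nu> = a1 w (J \<zeta>)\<close> cancels, and \<open>r \<ge> 0\<close> on the space of \<open>\<nu>\<close> gives the sign.\<close>

lemma memory_generator_dissipative:
  assumes "(x, y) \<in> memory_generator \<Omega> A0 A1 \<nu>"
  shows "state_inner x y \<le> 0"
proof -
  obtain w \<zeta> h \<eta> where xy: "x = (fst w, \<zeta>)" "y = (h, \<eta>)" and w: "w \<in> H10 \<Omega>"
    and \<zeta>: "\<zeta> \<in> \<K>" and \<eta>: "\<eta> \<in> \<K>"
    and h: "dual_is \<Omega> (\<lambda>v. - form \<Omega> A0 w v - form \<Omega> A1 (memory_integral \<nu> \<zeta>) v) h"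
    and eq: "AE r in \<nu>. \<eta> r = w - r *\<^sub>R \<zeta> r"
    using assms unfolding memory_generator_def by blast
  have J: "(\<integral>r. a1 w (\<zeta> r) \<partial>\<nu>) = a1 (memory_integral \<nu> \<zeta>) w"
    unfolding memory_integral_def a1_commute[of _ w]
    by (rule integral_bounded_linear[OF bounded_bilinear.bounded_linear_right[OF a1_bilinear] memory_spaceD(6)[OF \<zeta>]])
  have int_w: "integrable \<nu> (\<lambda>r. a1 w (\<zeta> r))"
    by (rule integrable_bounded_linear[OF bounded_bilinear.bounded_linear_right[OF a1_bilinear] memory_spaceD(6)[OF \<zeta>]])
  have "AE r in \<nu>. a1 (\<zeta> r) (\<eta> r) \<le> a1 w (\<zeta> r)"
    using eq
  proof (elim AE_mp, intro AE_I2 impI)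
    fix r assume r: "r \<in> space \<nu>" and "\<eta> r = w - r *\<^sub>R \<zeta> r"
    then have "a1 (\<zeta> r) (\<eta> r) = a1 w (\<zeta> r) - r * a1 (\<zeta> r) (\<zeta> r)"
      by (simp add: a1_simps a1_commute[of "\<zeta> r" w])
    moreover have "0 \<le> r * a1 (\<zeta> r) (\<zeta> r)"
      using r by (intro mult_nonneg_nonneg a1_nonneg) (simp add: space_\<nu>)
    ultimately show "a1 (\<zeta> r) (\<eta> r) \<le> a1 w (\<zeta> r)" by linarith
  qed
  then have "(\<integral>r. a1 (\<zeta> r) (\<eta> r) \<partial>\<nu>) \<le> a1 (memory_integral \<nu> \<zeta>) w"
    unfolding J[symmetric] by (intro integral_mono_AE memory_a1_integrable \<zeta> \<eta> int_w)
  moreover have "fst w \<bullet> h = - form \<Omega> A0 w w - a1 (memory_integral \<nu> \<zeta>) w"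
    using h w by (simp add: dual_is_def inner_commute)
  ultimately show ?thesis
    using a0_nonneg[OF w] by (simp add: xy state_inner_def)
qed

text \<open>The memory tested with a weight \<open>g\<close> on the relaxation rates and with \<open>h \<in> H\<close>. A vector of \<open>\<K>\<close>
  determines its values only almost everywhere, but these functionals are well defined and bounded.\<close>

definition memory_functional :: "(real \<Rightarrow> real) \<Rightarrow> 'd H \<Rightarrow> 'd state \<Rightarrow> real" where
  "memory_functional g h x = (\<integral>r. g r * (fst (snd x r) \<bullet> h) \<partial>\<nu>)"

lemma memory_L1_bound:
  obtains K where "0 \<le> K" "\<And>x. x \<in> W \<Longrightarrow> (\<integral>r. norm (snd x r) \<partial>\<nu>) \<le> K * wnorm x"
proof -
  obtain c where c: "0 < c" "\<And>v. v \<in> H10 \<Omega> \<Longrightarrow> (norm v)\<^sup>2 \<le> c * a1 v v"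
    using a1_lower by blast
  define m where "m = measure \<nu> (space \<nu>)"
  have "(\<integral>r. norm (snd x r) \<partial>\<nu>) \<le> sqrt (m * c) * wnorm x" if x: "x \<in> W" for x
  proof (rule power2_le_imp_le)
    note mem = memory_spaceD[OF state_spaceD(2)[OF x]]
    have "(\<integral>r. norm (snd x r) \<partial>\<nu>)\<^sup>2 \<le> m * (\<integral>r. (norm (snd x r))\<^sup>2 \<partial>\<nu>)"
      unfolding m_def by (intro square_integral_le \<nu>.finite_measure_axioms mem)
    also have "\<dots> \<le> m * (\<integral>r. c * a1 (snd x r) (snd x r) \<partial>\<nu>)"
    proof (intro mult_left_mono integral_mono)
      show "integrable \<nu> (\<lambda>r. c * a1 (snd x r) (snd x r))" using mem(3) by simp
      show "(norm (snd x r))\<^sup>2 \<le> c * a1 (snd x r) (snd x r)" if "r \<in> space \<nu>" for r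
        using that by (intro c(2) mem(2)) (simp add: space_\<nu>)
    qed (use mem(4) in \<open>simp_all add: m_def\<close>)
    also have "\<dots> = (m * c) * (\<integral>r. a1 (snd x r) (snd x r) \<partial>\<nu>)" by simp
    also have "\<dots> \<le> (m * c) * (wnorm x)\<^sup>2"
      using c(1) by (intro mult_left_mono) (simp_all add: state_norm_power2 m_def)
    also have "\<dots> = (sqrt (m * c) * wnorm x)\<^sup>2"
      using c(1) by (simp add: power_mult_distrib m_def)
    finally show "(\<integral>r. norm (snd x r) \<partial>\<nu>)\<^sup>2 \<le> (sqrt (m * c) * wnorm x)\<^sup>2" .
    show "0 \<le> sqrt (m * c) * wnorm x"
      using c(1) by (simp add: m_def state_norm_def)
  qed
  then show ?thesis using c(1) by (intro that[of "sqrt (m * c)"]) (auto simp: m_def)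
qed

lemma measurable_fst_inner:
  assumes "\<zeta> \<in> borel_measurable \<nu>"
  shows "(\<lambda>r. fst (\<zeta> r :: 'd V) \<bullet> h) \<in> borel_measurable \<nu>"
proof -
  have "(\<lambda>v :: 'd V. fst v \<bullet> h) \<in> borel_measurable borel"
    by (intro borel_measurable_continuous_onI continuous_intros)
  from measurable_compose[OF assms this] show ?thesis by simp
qed

lemma memory_functional_integrable:
  assumes g: "g \<in> borel_measurable \<nu>" "\<forall>r\<ge>0. \<bar>g r\<bar> \<le> G" and x: "x \<in> W"
  shows "integrable \<nu> (\<lambda>r. g r * (fst (snd x r) \<bullet> h))"
    "\<bar>memory_functional g h x\<bar> \<le> G * norm h * (\<integral>r. norm (snd x r) \<partial>\<nu>)"
proof -
  note mem = memory_spaceD[OF state_spaceD(2)[OF x]]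
  have int: "integrable \<nu> (\<lambda>r. G * norm h * norm (snd x r))"
    using mem(5) by simp
  have le: "norm (g r * (fst (snd x r) \<bullet> h)) \<le> G * norm h * norm (snd x r)" if r: "r \<in> space \<nu>" for r
  proof -
    have "\<bar>fst (snd x r) \<bullet> h\<bar> \<le> norm (fst (snd x r)) * norm h"
      by (rule Cauchy_Schwarz_ineq2)
    also have "\<dots> \<le> norm (snd x r) * norm h"
      using norm_fst_le[of "fst (snd x r)" "snd (snd x r)"] by (intro mult_right_mono) simp_all
    finally have "\<bar>g r\<bar> * \<bar>fst (snd x r) \<bullet> h\<bar> \<le> G * (norm (snd x r) * norm h)"
      using g(2) r by (intro mult_mono) (auto simp: space_\<nu> intro: order_trans[OF abs_ge_zero])
    then show ?thesis by (simp add: abs_mult ac_simps)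
  qed
  show i: "integrable \<nu> (\<lambda>r. g r * (fst (snd x r) \<bullet> h))"
  proof (rule Bochner_Integration.integrable_bound[OF int])
    show "(\<lambda>r. g r * (fst (snd x r) \<bullet> h)) \<in> borel_measurable \<nu>"
      by (intro borel_measurable_times g(1) measurable_fst_inner mem(1))
    show "AE r in \<nu>. norm (g r * (fst (snd x r) \<bullet> h)) \<le> norm (G * norm h * norm (snd x r))"
      by (intro AE_I2 order_trans[OF le]) simp_all
  qed
  have "\<bar>memory_functional g h x\<bar> \<le> (\<integral>r. G * norm h * norm (snd x r) \<partial>\<nu>)"
    unfolding memory_functional_def real_norm_def[symmetric]
    by (rule Bochner_Integration.integral_norm_bound_integral[OF i int le])
  then show "\<bar>memory_functional g h x\<bar> \<le> G * norm h * (\<integral>r. norm (snd x r) \<partial>\<nu>)"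
    by simp
qed

text \<open>The constant is uniform in \<open>g\<close>, \<open>h\<close> and \<open>x\<close>; the limits below vary weight and state at the same time.\<close>

lemma memory_functional_bound:
  obtains K where "0 \<le> K" "\<And>g G h x. g \<in> borel_measurable \<nu> \<Longrightarrow> \<forall>r\<ge>0. \<bar>g r\<bar> \<le> G \<Longrightarrow>
    x \<in> W \<Longrightarrow> \<bar>memory_functional g h x\<bar> \<le> G * norm h * K * wnorm x"
proof -
  obtain K where K: "0 \<le> K" "\<And>x. x \<in> W \<Longrightarrow> (\<integral>r. norm (snd x r) \<partial>\<nu>) \<le> K * wnorm x"
    using memory_L1_bound by blast
  show ?thesis
  proof (rule that[OF K(1)])
    fix g :: "real \<Rightarrow> real" and G h x assume g: "g \<in> borel_measurable \<nu>" "\<forall>r\<ge>0. \<bar>g r\<bar> \<le> G"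
      and x: "x \<in> W"
    have "0 \<le> G" using g(2) abs_ge_zero order_trans by blast
    have "\<bar>memory_functional g h x\<bar> \<le> G * norm h * (\<integral>r. norm (snd x r) \<partial>\<nu>)"
      by (rule memory_functional_integrable(2)[OF g x])
    also have "\<dots> \<le> G * norm h * (K * wnorm x)"
      using \<open>0 \<le> G\<close> by (intro mult_left_mono K(2) x) simp
    finally show "\<bar>memory_functional g h x\<bar> \<le> G * norm h * K * wnorm x"
      by (simp add: mult.assoc)
  qed
qed

lemma bounded_functional_memory:
  assumes g: "g \<in> borel_measurable \<nu>" "\<forall>r\<ge>0. \<bar>g r\<bar> \<le> G"
  shows "state.bounded_functional (memory_functional g h)"
  unfolding state.bounded_functional_def
proof (intro conjI ballI allI)
  note int = memory_functional_integrable(1)[OF g]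
  fix x assume x: "x \<in> W"
  show "memory_functional g h (c *\<^sub>R x) = c * memory_functional g h x" for c
    by (simp add: memory_functional_def scaleR_fun_def mult.left_commute[of _ c])
  fix y assume y: "y \<in> W"
  show "memory_functional g h (x + y) = memory_functional g h x + memory_functional g h y"
    using int[OF x] int[OF y] by (simp add: memory_functional_def inner_add_left distrib_left)
next
  show "\<exists>K. \<forall>x\<in>W. \<bar>memory_functional g h x\<bar> \<le> K * state.N x"
    unfolding state_N_eq using memory_functional_bound g by metis
qed

lemma bounded_functional_fst: "state.bounded_functional (\<lambda>x. fst x \<bullet> h)"
  unfolding state.bounded_functional_def state_N_eq
proof (intro conjI ballI allI exI[of _ "norm h"])
  fix x :: "'d state"
  have "\<bar>fst x \<bullet> h\<bar> \<le> norm (fst x) * norm h" by (rule Cauchy_Schwarz_ineq2)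
  also have "\<dots> \<le> norm h * wnorm x"
    using mult_right_mono[OF norm_fst_le_state_norm[of x] norm_ge_zero[of h]] by (simp add: mult.commute)
  finally show "\<bar>fst x \<bullet> h\<bar> \<le> norm h * wnorm x" .
qed (simp_all add: inner_add_left)

lemma memory_functional_diff:
  assumes "g \<in> borel_measurable \<nu>" "\<forall>r\<ge>0. \<bar>g r\<bar> \<le> G"
    "g' \<in> borel_measurable \<nu>" "\<forall>r\<ge>0. \<bar>g' r\<bar> \<le> G'" "x \<in> W"
  shows "memory_functional (\<lambda>r. g r - g' r) h x = memory_functional g h x - memory_functional g' h x"
  using memory_functional_integrable(1)[OF assms(1,2,5)] memory_functional_integrable(1)[OF assms(3,4,5)]
  by (simp add: memory_functional_def left_diff_distrib)

end

section \<open>The memory identity along orbits\<close>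

text \<open>The weight \<open>e\<^bsup>-r\<tau>\<^esup>\<close> restricted to a set of rates. The set will be bounded, so that the weight depends
  smoothly on \<open>\<tau>\<close>, uniformly in \<open>r\<close>. For \<open>\<tau> = 0\<close> it is the indicator of \<open>A\<close>.\<close>

definition decay :: "real set \<Rightarrow> real \<Rightarrow> real \<Rightarrow> real" where
  "decay A \<tau> r = indicator A r * exp (- r * \<tau>)"

lemma decay_bounds:
  assumes A: "A \<subseteq> {0..R}" and "0 \<le> R"
  shows "0 \<le> \<tau> \<Longrightarrow> 0 \<le> decay A \<tau> r \<and> decay A \<tau> r \<le> 1"
    and "0 \<le> \<tau> \<Longrightarrow> 0 \<le> \<delta> \<Longrightarrow> \<bar>decay A \<tau> r - decay A (\<tau> + \<delta>) r\<bar> \<le> R * \<delta>"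
    and "0 \<le> \<tau> \<Longrightarrow> 0 < \<delta> \<Longrightarrow> R * \<delta> \<le> 1 \<Longrightarrow>
      \<bar>(decay A \<tau> r - decay A (\<tau> + \<delta>) r) / \<delta> - r * decay A (\<tau> + \<delta>) r\<bar> \<le> R\<^sup>2 * \<delta>"
proof -
  show "0 \<le> decay A \<tau> r \<and> decay A \<tau> r \<le> 1" if "0 \<le> \<tau>" for \<tau>
    using A that by (auto simp: decay_def indicator_def)
  have r: "0 \<le> r \<and> r \<le> R" if "r \<in> A" using A that by auto
  show "\<bar>decay A \<tau> r - decay A (\<tau> + \<delta>) r\<bar> \<le> R * \<delta>" if "0 \<le> \<tau>" "0 \<le> \<delta>" for \<tau> \<delta>
  proof (cases "r \<in> A")
    case True
    have "1 - exp (- r * \<delta>) \<le> r * \<delta>"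
      using exp_ge_add_one_self[of "- r * \<delta>"] by simp
    also have "\<dots> \<le> R * \<delta>" using r[OF True] that by (intro mult_right_mono) auto
    finally have le: "1 - exp (- r * \<delta>) \<le> R * \<delta>" .
    have "exp (- r * \<delta>) \<le> 1" using r[OF True] that by simp
    then have nonneg: "0 \<le> 1 - exp (- r * \<delta>)" by simp
    have "exp (- r * \<tau>) \<le> 1" using r[OF True] that by simp
    have "decay A \<tau> r - decay A (\<tau> + \<delta>) r = exp (- r * \<tau>) * (1 - exp (- r * \<delta>))"
      using True by (simp add: decay_def algebra_simps flip: exp_add)
    also have "\<bar>\<dots>\<bar> \<le> 1 * (1 - exp (- r * \<delta>))"
      using nonneg \<open>exp (- r * \<tau>) \<le> 1\<close> by (simp only: abs_mult abs_of_nonneg exp_ge_zero) (intro mult_right_mono)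
    finally show ?thesis using le by simp
  next
    case False
    then show ?thesis using that \<open>0 \<le> R\<close> by (simp add: decay_def)
  qed
  show "\<bar>(decay A \<tau> r - decay A (\<tau> + \<delta>) r) / \<delta> - r * decay A (\<tau> + \<delta>) r\<bar> \<le> R\<^sup>2 * \<delta>"
    if "0 \<le> \<tau>" "0 < \<delta>" "R * \<delta> \<le> 1" for \<tau> \<delta>
  proof (cases "r \<in> A")
    case True
    define x where "x = r * \<delta>"
    have "r * \<delta> \<le> R * \<delta>" using r[OF True] that by (intro mult_right_mono) auto
    then have "x \<le> 1" using that(3) unfolding x_def by linarith
    moreover have "0 \<le> x" using r[OF True] that by (simp add: x_def)
    ultimately have x: "0 \<le> x" "x \<le> 1" by simp_all
    have e: "0 \<le> exp x - 1 - x" "exp x - 1 - x \<le> x\<^sup>2"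
      using exp_bound[OF x] exp_ge_add_one_self[of x] by linarith+
    have "exp (- r * (\<tau> + \<delta>)) \<le> 1" using r[OF True] that by simp
    have "(decay A \<tau> r - decay A (\<tau> + \<delta>) r) / \<delta> - r * decay A (\<tau> + \<delta>) r = exp (- r * (\<tau> + \<delta>)) * ((exp x - 1 - x) / \<delta>)"
    proof -
      have "exp (- r * \<tau>) = exp (- r * (\<tau> + \<delta>)) * exp x"
        by (simp add: x_def algebra_simps flip: exp_add)
      then show ?thesis using True that by (simp add: decay_def x_def field_simps)
    qed
    also have "\<bar>\<dots>\<bar> \<le> 1 * (x\<^sup>2 / \<delta>)"
      unfolding abs_mult using e that \<open>exp (- r * (\<tau> + \<delta>)) \<le> 1\<close>
      by (intro mult_mono) (auto intro: divide_right_mono)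
    also have "\<dots> = r\<^sup>2 * \<delta>" using that by (simp add: x_def power2_eq_square)
    also have "\<dots> \<le> R\<^sup>2 * \<delta>" using r[OF True] that by (intro mult_right_mono power_mono) auto
    finally show ?thesis .
  next
    case False
    then show ?thesis using that by (simp add: decay_def)
  qed
qed

locale memory_semigroup = memory_problem \<Omega> A0 A1 \<nu> \<beta>
  for \<Omega> :: "(real ^ 'd) set" and A0 A1 \<nu> \<beta> +
  fixes S :: "real \<Rightarrow> 'd state \<Rightarrow> 'd state"
  assumes S_C0: "C0_semigroup_on (W) (wnorm) S"
    and S_generator:
      "generator_on (W) (wnorm) S = memory_generator \<Omega> A0 A1 \<nu>"
begin

sublocale flow: dissipative_semigroup W state_inner S
proof
  show "C0_semigroup_on (W) state.N S"
    unfolding state_N_eq by (rule S_C0)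
  show "state_inner x y \<le> 0" if "(x, y) \<in> generator_on (W) state.N S" for x y
    using that memory_generator_dissipative unfolding state_N_eq S_generator by blast
qed

lemma decay_measurable:
  assumes "A \<in> sets \<nu>"
  shows "decay A \<tau> \<in> borel_measurable \<nu>"
proof -
  have "(\<lambda>r. exp (- r * \<tau>)) \<in> borel_measurable borel" by measurable
  then have "(\<lambda>r. exp (- r * \<tau>)) \<in> borel_measurable (restrict_space borel {0..})"
    by (rule measurable_restrict_space1)
  then have "(\<lambda>r. exp (- r * \<tau>)) \<in> borel_measurable \<nu>"
    by (simp add: measurable_cong_sets[OF \<nu>_borel refl])
  then show ?thesis
    unfolding decay_def[abs_def] using assms by measurable
qed

definition kernel :: "real set \<Rightarrow> real \<Rightarrow> real" where
  "kernel A \<tau> = (\<integral>r. decay A \<tau> r \<partial>\<nu>)"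

context
  fixes A :: "real set" and R :: real
  assumes A: "A \<subseteq> {0..R}" "A \<in> sets \<nu>" and R: "0 \<le> R"
begin

lemmas decay_simps = decay_bounds[OF A(1) R]

lemma decay_le_1: "0 \<le> \<tau> \<Longrightarrow> \<forall>r\<ge>0. \<bar>decay A \<tau> r\<bar> \<le> 1"
  using decay_simps(1) by (auto simp: abs_le_iff intro: order_trans)

lemma bounded_functional_decay: "0 \<le> \<tau> \<Longrightarrow> state.bounded_functional (memory_functional (decay A \<tau>) h)"
  by (rule bounded_functional_memory[OF decay_measurable[OF A(2)] decay_le_1])

lemma decay_integrable: "0 \<le> \<tau> \<Longrightarrow> integrable \<nu> (decay A \<tau>)"
  using decay_simps(1) by (intro \<nu>.integrable_const_bound[of _ 1] decay_measurable A AE_I2) (auto simp: abs_le_iff)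

lemma kernel_bounded: "0 \<le> \<tau> \<Longrightarrow> \<bar>kernel A \<tau>\<bar> \<le> measure \<nu> (space \<nu>)"
proof -
  assume \<tau>: "0 \<le> \<tau>"
  have "0 \<le> kernel A \<tau>"
    unfolding kernel_def using decay_simps(1)[OF \<tau>] by (intro Bochner_Integration.integral_nonneg) auto
  moreover have "kernel A \<tau> \<le> (\<integral>r. 1 \<partial>\<nu>)"
    unfolding kernel_def using decay_simps(1)[OF \<tau>] by (intro integral_mono decay_integrable \<tau>) auto
  ultimately show ?thesis by simp
qed

lemma kernel_continuous: "continuous_on {0..} (kernel A)"
proof -
  have le: "\<bar>kernel A \<tau> - kernel A (\<tau> + \<delta>)\<bar> \<le> R * \<delta> * measure \<nu> (space \<nu>)" if "0 \<le> \<tau>" "0 \<le> \<delta>" for \<tau> \<delta>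
  proof -
    have "kernel A \<tau> - kernel A (\<tau> + \<delta>) = (\<integral>r. decay A \<tau> r - decay A (\<tau> + \<delta>) r \<partial>\<nu>)"
      unfolding kernel_def using that by (simp add: decay_integrable)
    also have "\<bar>\<dots>\<bar> \<le> (\<integral>r. R * \<delta> \<partial>\<nu>)"
      unfolding real_norm_def[symmetric]
      by (rule Bochner_Integration.integral_norm_bound_integral) (use that decay_simps(2) decay_integrable in auto)
    finally show ?thesis by (simp add: ac_simps)
  qed
  have "(R * measure \<nu> (space \<nu>))-lipschitz_on {0..} (kernel A)"
  proof (rule lipschitz_onI)
    fix x y :: real assume "x \<in> {0..}" "y \<in> {0..}"
    then show "dist (kernel A x) (kernel A y) \<le> R * measure \<nu> (space \<nu>) * dist x y"
      using le[of x "y - x"] le[of y "x - y"]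
      by (cases "x \<le> y") (auto simp: dist_real_def abs_minus_commute ac_simps)
  qed (use R in simp)
  then show ?thesis by (rule lipschitz_on_continuous_on)
qed

text \<open>The product rule. Differentiating the state gives the tested \<open>\<eta> = w - r \<zeta>\<close>, differentiating the weight
  gives the tested \<open>r \<zeta>\<close>; the sum no longer contains the memory and equals
  \<open>kernel A \<tau>\<close> times the tested \<open>w\<close>.\<close>

lemma orbit_memory_right_derivative:
  assumes zv: "(z, v) \<in> memory_generator \<Omega> A0 A1 \<nu>" and \<tau>: "0 < \<tau>"
  shows "((\<lambda>\<delta>. (memory_functional (decay A (\<tau> - \<delta>)) h (S \<delta> z) - memory_functional (decay A \<tau>) h z) / \<delta>)
    \<longlongrightarrow> kernel A \<tau> * (fst z \<bullet> h)) (at_right 0)"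
proof -
  have gen: "(z, v) \<in> generator_on W wnorm S" using zv by (simp add: S_generator)
  then have C: "z \<in> W" "v \<in> W" and lim: "((\<lambda>\<delta>. wnorm ((S \<delta> z - z) /\<^sub>R \<delta> - v)) \<longlongrightarrow> 0) (at_right 0)"
    by (auto simp: generator_on_def)
  obtain K where K: "0 \<le> K" "\<And>g G h x. g \<in> borel_measurable \<nu> \<Longrightarrow> \<forall>r\<ge>0. \<bar>g r\<bar> \<le> G \<Longrightarrow>
    x \<in> W \<Longrightarrow> \<bar>memory_functional g h x\<bar> \<le> G * norm h * K * wnorm x"
    using memory_functional_bound by blast
  note [measurable] = decay_measurable[OF A(2)]
  note [measurable] = measurable_ident_\<nu>
  have bR: "\<forall>r\<ge>0. \<bar>r * decay A \<tau> r\<bar> \<le> R"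
  proof (intro allI impI)
    fix r :: real assume "0 \<le> r"
    show "\<bar>r * decay A \<tau> r\<bar> \<le> R"
    proof (cases "r \<in> A")
      case True
      then have "r \<le> R" using A(1) by auto
      have "\<bar>r * decay A \<tau> r\<bar> = r * decay A \<tau> r"
        using \<open>0 \<le> r\<close> decay_simps(1)[of \<tau> r] \<tau> by simp
      also have "\<dots> \<le> R * 1"
        using \<open>0 \<le> r\<close> \<open>r \<le> R\<close> decay_simps(1)[of \<tau> r] \<tau> by (intro mult_mono) auto
      finally show ?thesis by simp
    qed (use R in \<open>simp add: decay_def\<close>)
  qed
  have limit: "memory_functional (decay A \<tau>) h v + memory_functional (\<lambda>r. r * decay A \<tau> r) h z = kernel A \<tau> * (fst z \<bullet> h)"
  proof -
    obtain w where w: "fst z = fst w" "AE r in \<nu>. snd v r = w - r *\<^sub>R snd z r"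
      using zv unfolding memory_generator_def by auto
    have "memory_functional (decay A \<tau>) h v + memory_functional (\<lambda>r. r * decay A \<tau> r) h z =
        (\<integral>r. decay A \<tau> r * (fst (snd v r) \<bullet> h) + r * decay A \<tau> r * (fst (snd z r) \<bullet> h) \<partial>\<nu>)"
      unfolding memory_functional_def using \<tau>
      by (intro Bochner_Integration.integral_add[symmetric] memory_functional_integrable(1)[OF _ decay_le_1 C(2)]
          memory_functional_integrable(1)[OF _ bR C(1)]) auto
    also have "\<dots> = (\<integral>r. decay A \<tau> r * (fst w \<bullet> h) \<partial>\<nu>)"
    proof (rule integral_cong_AE)
      show "(\<lambda>r. decay A \<tau> r * (fst (snd v r) \<bullet> h) + r * decay A \<tau> r * (fst (snd z r) \<bullet> h)) \<in> borel_measurable \<nu>"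
        by (intro borel_measurable_add borel_measurable_times measurable_ident_\<nu> decay_measurable A(2) measurable_fst_inner
            memory_spaceD(1) state_spaceD(2) C)
      show "AE r in \<nu>. decay A \<tau> r * (fst (snd v r) \<bullet> h) + r * decay A \<tau> r * (fst (snd z r) \<bullet> h) =
          decay A \<tau> r * (fst w \<bullet> h)"
        using w(2)
      proof eventually_elim
        fix r assume "snd v r = w - r *\<^sub>R snd z r"
        then have "fst (snd v r) \<bullet> h + r * (fst (snd z r) \<bullet> h) = fst w \<bullet> h"
          by (simp add: inner_diff_left)
        then have "decay A \<tau> r * (fst (snd v r) \<bullet> h + r * (fst (snd z r) \<bullet> h)) = decay A \<tau> r * (fst w \<bullet> h)"
          by simp
        then show "decay A \<tau> r * (fst (snd v r) \<bullet> h) + r * decay A \<tau> r * (fst (snd z r) \<bullet> h) =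
            decay A \<tau> r * (fst w \<bullet> h)"
          by (simp add: distrib_left ac_simps)
      qed
    qed measurable
    finally show ?thesis by (simp add: kernel_def w(1))
  qed
  define c where "c = norm h * K"
  have "0 \<le> c" using K(1) by (simp add: c_def)
  define \<delta>0 where "\<delta>0 = min \<tau> (1 / (R + 1))"
  have \<delta>0: "0 < \<delta>0" using \<tau> R by (simp add: \<delta>0_def)
  \<comment> \<open>The error splits into the error of the difference quotient of the state, the change of
    the weight on \<open>v\<close>, and the error of the difference quotient of the weight on \<open>z\<close>.\<close>
  have err: "\<bar>(memory_functional (decay A (\<tau> - \<delta>)) h (S \<delta> z) - memory_functional (decay A \<tau>) h z) / \<delta> - kernel A \<tau> * (fst z \<bullet> h)\<bar> \<le>
      c * wnorm ((S \<delta> z - z) /\<^sub>R \<delta> - v) + R * \<delta> * c * wnorm v + R\<^sup>2 * \<delta> * c * wnorm z" if \<delta>: "0 < \<delta>" "\<delta> < \<delta>0" for \<delta>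
  proof -
    have \<delta>': "0 \<le> \<tau> - \<delta>" "R * \<delta> \<le> 1"
    proof -
      show "0 \<le> \<tau> - \<delta>" using \<delta> by (simp add: \<delta>0_def)
      have "R * \<delta> \<le> (R + 1) * \<delta>0" using \<delta> R by (intro mult_mono) auto
      also have "\<dots> \<le> (R + 1) * (1 / (R + 1))" using R by (intro mult_left_mono) (auto simp: \<delta>0_def)
      finally show "R * \<delta> \<le> 1" using R by simp
    qed
    let ?g = "decay A (\<tau> - \<delta>)" and ?e = "decay A \<tau>"
    define y where "y = (S \<delta> z - z) /\<^sub>R \<delta> - v"
    have SC: "S \<delta> z \<in> W" using \<delta> C by auto
    have yC: "y \<in> W" unfolding y_def using SC C by auto
    have \<tau>0: "0 \<le> \<tau>" using \<tau> by simp
    note L = bounded_functional_decay[OF \<delta>'(1)]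
    have gdiff: "\<forall>r\<ge>0. \<bar>?g r - ?e r\<bar> \<le> R * \<delta>"
    proof (intro allI impI)
      fix r :: real
      show "\<bar>?g r - ?e r\<bar> \<le> R * \<delta>"
        using decay_simps(2)[OF \<delta>'(1), of \<delta> r] \<delta> by simp
    qed
    have gquot: "\<forall>r\<ge>0. \<bar>(?g r - ?e r) / \<delta> - r * ?e r\<bar> \<le> R\<^sup>2 * \<delta>"
    proof (intro allI impI)
      fix r :: real
      show "\<bar>(?g r - ?e r) / \<delta> - r * ?e r\<bar> \<le> R\<^sup>2 * \<delta>"
        using decay_simps(3)[OF \<delta>'(1) \<delta>(1) \<delta>'(2), of r] by (simp only: diff_add_cancel)
    qed
    have gdiv: "\<forall>r\<ge>0. \<bar>(?g r - ?e r) / \<delta>\<bar> \<le> R"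
    proof (intro allI impI)
      fix r :: real assume "0 \<le> r"
      then have "\<bar>?g r - ?e r\<bar> / \<delta> \<le> R * \<delta> / \<delta>"
        using gdiff \<delta>(1) by (intro divide_right_mono) auto
      then show "\<bar>(?g r - ?e r) / \<delta>\<bar> \<le> R"
        using \<delta>(1) by simp
    qed
    have e1: "memory_functional ?g h (S \<delta> z) - memory_functional ?g h z = \<delta> * memory_functional ?g h y + \<delta> * memory_functional ?g h v"
    proof -
      have "memory_functional ?g h y = inverse \<delta> * (memory_functional ?g h (S \<delta> z) - memory_functional ?g h z) - memory_functional ?g h v"
        using SC C unfolding y_def by (simp add: state.bounded_functionalD(2,3)[OF L])
      then show ?thesis using \<delta>(1) by (simp add: field_simps)
    qed
    have e2: "memory_functional (\<lambda>r. ?g r - ?e r) h x = memory_functional ?g h x - memory_functional ?e h x" if "x \<in> W" for x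
      by (rule memory_functional_diff[OF _ decay_le_1[OF \<delta>'(1)] _ decay_le_1[OF \<tau>0] that]) measurable
    have e3: "memory_functional (\<lambda>r. (?g r - ?e r) / \<delta> - r * ?e r) h z = memory_functional (\<lambda>r. (?g r - ?e r) / \<delta>) h z - memory_functional (\<lambda>r. r * ?e r) h z"
      by (rule memory_functional_diff[OF _ gdiv _ bR C(1)]) measurable
    have e4: "memory_functional (\<lambda>r. (?g r - ?e r) / \<delta>) h z = memory_functional (\<lambda>r. ?g r - ?e r) h z / \<delta>"
      by (simp add: memory_functional_def)
    have "(memory_functional ?g h (S \<delta> z) - memory_functional ?e h z) / \<delta> - kernel A \<tau> * (fst z \<bullet> h) =
        memory_functional ?g h y + memory_functional (\<lambda>r. ?g r - ?e r) h v + memory_functional (\<lambda>r. (?g r - ?e r) / \<delta> - r * ?e r) h z"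
      unfolding limit[symmetric] e3 e4 e2[OF C(1)] e2[OF C(2)] using e1 \<delta>(1) by (simp add: field_simps)
    moreover have "\<bar>memory_functional ?g h y\<bar> \<le> 1 * norm h * K * wnorm y"
      by (rule K(2)[OF decay_measurable[OF A(2)] decay_le_1[OF \<delta>'(1)] yC])
    moreover have "\<bar>memory_functional (\<lambda>r. ?g r - ?e r) h v\<bar> \<le> R * \<delta> * norm h * K * wnorm v"
      by (rule K(2)[OF _ gdiff C(2)]) measurable
    moreover have "\<bar>memory_functional (\<lambda>r. (?g r - ?e r) / \<delta> - r * ?e r) h z\<bar> \<le> R\<^sup>2 * \<delta> * norm h * K * wnorm z"
      by (rule K(2)[OF _ gquot C(1)]) measurable
    ultimately show ?thesis
      by (simp add: c_def y_def[symmetric] mult.assoc)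
  qed
  have "((\<lambda>\<delta>. (memory_functional (decay A (\<tau> - \<delta>)) h (S \<delta> z) - memory_functional (decay A \<tau>) h z) / \<delta> - kernel A \<tau> * (fst z \<bullet> h)) \<longlongrightarrow> 0) (at_right 0)"
  proof (rule Lim_null_comparison)
    show "\<forall>\<^sub>F \<delta> in at_right 0. norm ((memory_functional (decay A (\<tau> - \<delta>)) h (S \<delta> z) - memory_functional (decay A \<tau>) h z) / \<delta> - kernel A \<tau> * (fst z \<bullet> h))
        \<le> c * wnorm ((S \<delta> z - z) /\<^sub>R \<delta> - v) + R * \<delta> * c * wnorm v + R\<^sup>2 * \<delta> * c * wnorm z"
      unfolding eventually_at_right_field using err \<delta>0 by (intro exI[of _ \<delta>0]) simp
    have "((\<lambda>\<delta>. c * wnorm ((S \<delta> z - z) /\<^sub>R \<delta> - v) + R * \<delta> * c * wnorm v + R\<^sup>2 * \<delta> * c * wnorm z)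
        \<longlongrightarrow> c * 0 + R * 0 * c * wnorm v + R\<^sup>2 * 0 * c * wnorm z) (at_right 0)"
      by (intro tendsto_intros lim)
    then show "((\<lambda>\<delta>. c * wnorm ((S \<delta> z - z) /\<^sub>R \<delta> - v) + R * \<delta> * c * wnorm v + R\<^sup>2 * \<delta> * c * wnorm z)
        \<longlongrightarrow> 0) (at_right 0)" by simp
  qed
  then show ?thesis by (rule LIM_zero_cancel)
qed

text \<open>The defect in the tested memory identity at time \<open>t\<close>, including the contribution of the initial memory.
  Extending the identity by density needs general initial memories even though the mild solutions
  start with zero memory.\<close>

definition memory_defect :: "real \<Rightarrow> 'd H \<Rightarrow> 'd state \<Rightarrow> real" where
  "memory_defect t h x = memory_functional (decay A 0) h (S t x) - memory_functional (decay A t) h x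
     - integral {0..t} (\<lambda>s. kernel A (t - s) * (fst (S s x) \<bullet> h))"

lemma kernel_shift_continuous:
  assumes x: "x \<in> W" 
  shows "continuous_on {0..t} (\<lambda>s. kernel A (t - s) * (fst (S s x) \<bullet> h))"
proof (intro continuous_on_mult)
  show "continuous_on {0..t} (\<lambda>s. kernel A (t - s))"
    by (rule continuous_on_compose2[OF kernel_continuous]) (auto intro!: continuous_intros)
  show "continuous_on {0..t} (\<lambda>s. fst (S s x) \<bullet> h)"
    by (rule continuous_on_subset[OF flow.orbit_functional_continuous[OF bounded_functional_fst x]]) auto
qed

text \<open>The function \<open>s \<mapsto> memory_functional (decay A (t - s)) h (S s x)\<close> interpolates between the second term at
  \<open>s = 0\<close> and the first one at \<open>s = t\<close>.\<close>

lemma memory_defect_generator: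
  assumes xy: "(x, y) \<in> memory_generator \<Omega> A0 A1 \<nu>" and t: "0 \<le> t"
  shows "memory_defect t h x = 0"
proof -
  have gen: "(x, y) \<in> generator_on W state.N S" using xy by (simp add: S_generator state_N_eq)
  then have x: "x \<in> W" by (simp add: generator_on_def)
  have inv: "(S s x, S s y) \<in> memory_generator \<Omega> A0 A1 \<nu>" if "0 \<le> s" for s
    using flow.generator_invariant[OF gen that] by (simp add: S_generator state_N_eq)
  define \<psi> where "\<psi> s = memory_functional (decay A (t - s)) h (S s x)" for s
  obtain K where K: "0 \<le> K" "\<And>g G h x. g \<in> borel_measurable \<nu> \<Longrightarrow> \<forall>r\<ge>0. \<bar>g r\<bar> \<le> G \<Longrightarrow>
    x \<in> W \<Longrightarrow> \<bar>memory_functional g h x\<bar> \<le> G * norm h * K * wnorm x"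
    using memory_functional_bound by blast
  have bdiff: "\<forall>r\<ge>0. \<bar>decay A \<sigma> r - decay A \<sigma>' r\<bar> \<le> R * \<bar>\<sigma> - \<sigma>'\<bar>" if "0 \<le> \<sigma>" "0 \<le> \<sigma>'" for \<sigma> \<sigma>'
    using decay_simps(2)[of \<sigma> "\<sigma>' - \<sigma>"] decay_simps(2)[of \<sigma>' "\<sigma> - \<sigma>'"] that
    by (cases "\<sigma> \<le> \<sigma>'") (auto simp: abs_minus_commute)
  have "continuous_on {0..t} \<psi>"
    unfolding continuous_on_def
  proof
    fix s assume s: "s \<in> {0..t}"
    have lim: "((\<lambda>s'. state.N (S s' x - S s x)) \<longlongrightarrow> 0) (at s within {0..t})"
      by (rule tendsto_within_subset[OF flow.orbit_continuous[OF x]]) (use s in auto)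
    show "(\<psi> \<longlongrightarrow> \<psi> s) (at s within {0..t})"
    proof (rule LIM_zero_cancel, rule Lim_null_comparison)
      have "norm (\<psi> s' - \<psi> s) \<le> norm h * K * wnorm (S s' x - S s x) + R * \<bar>s' - s\<bar> * (norm h * K * wnorm (S s x))"
        if s': "s' \<in> {0..t}" for s'
      proof -
        have ts: "0 \<le> t - s" "0 \<le> t - s'" using s s' by auto
        have C: "S s x \<in> W" "S s' x \<in> W" using x s s' by auto
        note L = bounded_functional_decay[OF ts(2)]
        have "\<psi> s' - \<psi> s = memory_functional (decay A (t - s')) h (S s' x - S s x) +
            memory_functional (\<lambda>r. decay A (t - s') r - decay A (t - s) r) h (S s x)"
          unfolding \<psi>_def memory_functional_diff[OF decay_measurable[OF A(2)] decay_le_1[OF ts(2)] decay_measurable[OF A(2)] decay_le_1[OF ts(1)] C(1)]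
          using C by (simp add: state.bounded_functionalD(3)[OF L])
        moreover have "\<bar>memory_functional (decay A (t - s')) h (S s' x - S s x)\<bar> \<le> 1 * norm h * K * wnorm (S s' x - S s x)"
          using C by (intro K(2) decay_measurable[OF A(2)] decay_le_1[OF ts(2)]) auto
        moreover have "\<bar>memory_functional (\<lambda>r. decay A (t - s') r - decay A (t - s) r) h (S s x)\<bar> \<le>
            R * \<bar>(t - s') - (t - s)\<bar> * norm h * K * wnorm (S s x)"
          by (intro K(2) borel_measurable_diff decay_measurable[OF A(2)] bdiff ts C)
        ultimately show ?thesis
          by (simp add: abs_minus_commute mult.assoc)
      qed
      then show "\<forall>\<^sub>F s' in at s within {0..t}. norm (\<psi> s' - \<psi> s) \<le>
          norm h * K * wnorm (S s' x - S s x) + R * \<bar>s' - s\<bar> * (norm h * K * wnorm (S s x))"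
        by (auto simp: eventually_at_filter)
      have "((\<lambda>s'. norm h * K * wnorm (S s' x - S s x) + R * \<bar>s' - s\<bar> * (norm h * K * wnorm (S s x)))
          \<longlongrightarrow> norm h * K * 0 + R * \<bar>s - s\<bar> * (norm h * K * wnorm (S s x))) (at s within {0..t})"
        by (intro tendsto_intros lim[unfolded state_N_eq])
      then show "((\<lambda>s'. norm h * K * wnorm (S s' x - S s x) + R * \<bar>s' - s\<bar> * (norm h * K * wnorm (S s x))) \<longlongrightarrow> 0) (at s within {0..t})"
        by simp
    qed
  qed
  moreover have "((\<lambda>\<delta>. (\<psi> (s + \<delta>) - \<psi> s) / \<delta>) \<longlongrightarrow> kernel A (t - s) * (fst (S s x) \<bullet> h)) (at_right 0)"
    if s: "0 \<le> s" "s < t" for s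
  proof (rule Lim_transform_eventually[OF orbit_memory_right_derivative[OF inv[OF s(1)]]])
    show "0 < t - s" using s by simp
    have "(memory_functional (decay A (t - s - \<delta>)) h (S \<delta> (S s x)) - memory_functional (decay A (t - s)) h (S s x)) / \<delta> =
        (\<psi> (s + \<delta>) - \<psi> s) / \<delta>" if \<delta>: "0 < \<delta>" "\<delta> < t - s" for \<delta>
    proof -
      have "memory_functional (decay A (t - s - \<delta>)) h (S \<delta> (S s x)) = memory_functional (decay A (t - s - \<delta>)) h (S (\<delta> + s) x)"
        using flow.S_plus[of \<delta> s x] x s \<delta>
        by (intro state.bounded_functional_null[OF bounded_functional_decay])
          (auto simp: state.N_minus_commute)
      then show ?thesis by (simp add: \<psi>_def algebra_simps)
    qed
    then show "\<forall>\<^sub>F \<delta> in at_right 0. (memory_functional (decay A (t - s - \<delta>)) h (S \<delta> (S s x)) -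
        memory_functional (decay A (t - s)) h (S s x)) / \<delta> = (\<psi> (s + \<delta>) - \<psi> s) / \<delta>"
      unfolding eventually_at_right_field using s by (intro exI[of _ "t - s"]) simp
  qed
  ultimately have "\<psi> t - \<psi> 0 = integral {0..t} (\<lambda>s. kernel A (t - s) * (fst (S s x) \<bullet> h))"
    by (intro right_derivative_eq_imp_integral t kernel_shift_continuous x)
  moreover have "memory_functional (decay A t) h (S 0 x) = memory_functional (decay A t) h x"
    using flow.S_0[OF x] x t
    by (intro state.bounded_functional_null[OF bounded_functional_decay]) auto
  ultimately show ?thesis
    by (simp add: memory_defect_def \<psi>_def)
qed

text \<open>The defect is Lipschitz continuous in the initial state, because \<open>S\<close> is contractive, and vanishes on a dense
  set.\<close>

lemma memory_defect_eq_0: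
  assumes x: "x \<in> W" and t: "0 \<le> t"
  shows "memory_defect t h x = 0"
proof -
  obtain K where K: "0 \<le> K" "\<And>g G h x. g \<in> borel_measurable \<nu> \<Longrightarrow> \<forall>r\<ge>0. \<bar>g r\<bar> \<le> G \<Longrightarrow>
    x \<in> W \<Longrightarrow> \<bar>memory_functional g h x\<bar> \<le> G * norm h * K * wnorm x"
    using memory_functional_bound by blast
  define c where "c = norm h * K + norm h * K + measure \<nu> (space \<nu>) * norm h * t"
  have "0 \<le> c" using K(1) t by (simp add: c_def)
  have le: "\<bar>memory_defect t h x\<bar> \<le> c * wnorm (x - z)" if zv: "(z, v) \<in> memory_generator \<Omega> A0 A1 \<nu>" for z v
  proof -
    have z: "z \<in> W" using zv unfolding S_generator[symmetric] by (simp add: generator_on_def)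
    note L0 = bounded_functional_decay[OF order_refl]
    note Lt = bounded_functional_decay[OF t]
    have contr: "wnorm (S s x - S s z) \<le> wnorm (x - z)" if "0 \<le> s" for s
      using flow.S_contraction_diff[OF that x z] by (simp add: state_N_eq)
    have "\<bar>memory_functional (decay A 0) h (S t x) - memory_functional (decay A 0) h (S t z)\<bar> =
        \<bar>memory_functional (decay A 0) h (S t x - S t z)\<bar>"
      using x z t by (simp add: state.bounded_functionalD(3)[OF L0])
    also have "\<dots> \<le> 1 * norm h * K * wnorm (S t x - S t z)"
      using x z t by (intro K(2) decay_measurable[OF A(2)] decay_le_1) auto
    also have "\<dots> \<le> 1 * norm h * K * wnorm (x - z)"
      using K(1) by (intro mult_left_mono contr t) auto
    finally have 1: "\<bar>memory_functional (decay A 0) h (S t x) - memory_functional (decay A 0) h (S t z)\<bar> \<le> norm h * K * wnorm (x - z)"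
      by simp
    have "\<bar>memory_functional (decay A t) h x - memory_functional (decay A t) h z\<bar> = \<bar>memory_functional (decay A t) h (x - z)\<bar>"
      using x z by (simp add: state.bounded_functionalD(3)[OF Lt])
    also have "\<dots> \<le> 1 * norm h * K * wnorm (x - z)"
      using x z t by (intro K(2) decay_measurable[OF A(2)] decay_le_1) auto
    finally have 2: "\<bar>memory_functional (decay A t) h x - memory_functional (decay A t) h z\<bar> \<le> norm h * K * wnorm (x - z)"
      by simp
    let ?q = "\<lambda>x s. kernel A (t - s) * (fst (S s x) \<bullet> h)"
    have "integral {0..t} (?q x) - integral {0..t} (?q z) = integral {0..t} (\<lambda>s. ?q x s - ?q z s)"
      by (intro Henstock_Kurzweil_Integration.integral_diff[symmetric] integrable_continuous_interval kernel_shift_continuous x z)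
    also have "norm \<dots> \<le> measure \<nu> (space \<nu>) * norm h * wnorm (x - z) * (t - 0)"
    proof (rule integral_bound[OF t])
      show "continuous_on {0..t} (\<lambda>s. ?q x s - ?q z s)"
        by (intro continuous_intros kernel_shift_continuous x z)
      fix s assume s: "s \<in> {0..t}"
      have "\<bar>fst (S s x - S s z) \<bullet> h\<bar> \<le> norm (fst (S s x - S s z)) * norm h"
        by (rule Cauchy_Schwarz_ineq2)
      also have "\<dots> \<le> wnorm (x - z) * norm h"
        using contr[of s] norm_fst_le_state_norm[of "S s x - S s z"] s by (intro mult_right_mono) auto
      finally have "\<bar>kernel A (t - s)\<bar> * \<bar>fst (S s x - S s z) \<bullet> h\<bar> \<le> measure \<nu> (space \<nu>) * (wnorm (x - z) * norm h)"
        using kernel_bounded[of "t - s"] s by (intro mult_mono) auto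
      moreover have "?q x s - ?q z s = kernel A (t - s) * (fst (S s x - S s z) \<bullet> h)"
        by (simp add: inner_diff_left right_diff_distrib)
      ultimately show "norm (?q x s - ?q z s) \<le> measure \<nu> (space \<nu>) * norm h * wnorm (x - z)"
        by (simp only: real_norm_def abs_mult) (simp only: ac_simps)
    qed
    finally have 3: "\<bar>integral {0..t} (?q x) - integral {0..t} (?q z)\<bar> \<le> measure \<nu> (space \<nu>) * norm h * t * wnorm (x - z)"
      by (simp add: ac_simps)
    have "memory_defect t h x = memory_defect t h x - memory_defect t h z"
      by (simp add: memory_defect_generator[OF zv t])
    then have "\<bar>memory_defect t h x\<bar> \<le> norm h * K * wnorm (x - z) + norm h * K * wnorm (x - z) +
        measure \<nu> (space \<nu>) * norm h * t * wnorm (x - z)"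
      using 1 2 3 unfolding memory_defect_def by linarith
    then show ?thesis by (simp add: c_def algebra_simps)
  qed
  have "\<bar>memory_defect t h x\<bar> \<le> 0"
  proof (rule field_le_epsilon)
    fix e :: real assume "0 < e"
    then have pos: "0 < e / (c + 1)" using \<open>0 \<le> c\<close> by simp
    obtain z v where zv: "(z, v) \<in> generator_on W state.N S" and near: "state.N (z - x) < e / (c + 1)"
      using flow.generator_dense[OF x pos] by blast
    have z: "z \<in> W" using zv by (simp add: generator_on_def)
    have "\<bar>memory_defect t h x\<bar> \<le> c * wnorm (x - z)"
      using zv by (intro le) (simp add: S_generator state_N_eq)
    also have "wnorm (x - z) = state.N (z - x)"
      using state.N_minus_commute[OF x z] by (simp add: state_N_eq)
    also have "c * state.N (z - x) \<le> c * (e / (c + 1))"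
      using near \<open>0 \<le> c\<close> by (intro mult_left_mono) auto
    also have "\<dots> \<le> e" using \<open>0 \<le> c\<close> \<open>0 < e\<close> by (simp add: field_simps)
    finally show "\<bar>memory_defect t h x\<bar> \<le> 0 + e" by simp
  qed
  then show ?thesis by simp
qed

end

end

section \<open>The memory identity for Duhamel integrals\<close>

lemma continuous_imp_integrable_interval:
  fixes f :: "real \<Rightarrow> 'e::{banach, second_countable_topology}"
  assumes f: "continuous_on {a..b} f"
  shows "integrable (lebesgue_on {a..b}) f"
proof -
  interpret finite_measure "lebesgue_on {a..b}" by (rule finite_measure_interval)
  have "bounded (f ` {a..b})"
    by (intro compact_imp_bounded compact_continuous_image f compact_Icc)
  then obtain c where "\<forall>x\<in>{a..b}. norm (f x) \<le> c"
    unfolding bounded_iff by auto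
  then show ?thesis
    by (intro integrable_const_bound[of _ c] continuous_imp_measurable_on_sets_lebesgue f AE_I2) auto
qed

context memory_semigroup
begin

text \<open>The simple functions that approximate \<open>f\<close> in \<open>L2\<close> need not vanish outside \<open>\<Omega>\<close>; \<open>cutoff\<close> moves them into the
  state space and leaves their limit unchanged.\<close>

lemma source_approx:
  assumes f: "f \<in> L1_data \<Omega> T"
  shows "\<exists>Fs. state.simple_approx (lebesgue_on {0..T}) (\<lambda>s. (f s, 0)) Fs"
proof -
  let ?M = "lebesgue_on {0..T}"
  have int: "integrable ?M f" and f_in: "\<And>s. s \<in> {0..T} \<Longrightarrow> f s \<in> L2_on \<Omega>"
    using f by (auto simp: L1_data_def)
  obtain F where F: "\<And>i. simple_function ?M (F i)" "\<And>s. s \<in> {0..T} \<Longrightarrow> (\<lambda>i. F i s) \<longlonglongrightarrow> f s"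
    "\<And>i s. s \<in> {0..T} \<Longrightarrow> norm (F i s) \<le> 2 * norm (f s)"
    using borel_measurable_implies_sequence_metric[OF borel_measurable_integrable[OF int], of 0] by fastforce
  let ?P = "cutoff \<Omega> :: 'd H \<Rightarrow> 'd H"
  note P = bounded_linear_cutoff[OF sets_\<Omega>, where 'b = real]
  obtain K where K: "0 < K" "\<And>u. norm (?P u) \<le> norm u * K"
    using bounded_linear.pos_bounded[OF P] by blast
  have P_in: "?P u \<in> L2_on \<Omega>" for u
    using cutoff_idem[OF sets_\<Omega>] by (simp add: L2_on_eq_cutoff[OF sets_\<Omega>])
  have zero_mem: "0 \<in> \<K>"
    by (rule subspace_0[OF subspace_memory_space])
  have N_pair: "state.N (u, 0) = norm u" for u
    by (simp add: state.N_def state_inner_def bounded_bilinear.zero_left[OF a1_bilinear] norm_eq_sqrt_inner)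
  have "state.simple_approx ?M (\<lambda>s. (f s, 0)) (\<lambda>i s. (?P (F i s), 0))"
    unfolding state.simple_approx_def
  proof (intro conjI allI ballI)
    show "(\<lambda>s. (f s, 0)) \<in> space ?M \<rightarrow> W"
      using f_in zero_mem by (auto simp: state_space_def)
    show "simple_integrable ?M (\<lambda>s. (?P (F i s), 0 :: real \<Rightarrow> 'd V))" for i
      by (intro simple_bochner_integrable_finite_measure finite_measure_interval
          simple_function_compose1[OF F(1), of "\<lambda>u. (?P u, 0)"])
    show "(\<lambda>s. (?P (F i s), 0)) \<in> space ?M \<rightarrow> W" for i
      using P_in zero_mem by (auto simp: state_space_def)
    fix s assume s: "s \<in> space ?M"
    have "(\<lambda>i. ?P (F i s)) \<longlonglongrightarrow> ?P (f s)"
      using s by (intro bounded_linear.tendsto[OF P] F(2)) simp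
    also have "?P (f s) = f s"
      using f_in[of s] s by (simp add: L2_on_eq_cutoff[OF sets_\<Omega>])
    finally have "(\<lambda>i. norm (f s - ?P (F i s))) \<longlonglongrightarrow> norm (f s - f s)"
      by (intro tendsto_intros)
    moreover have "state.N ((f s, 0) - (?P (F i s), 0)) = norm (f s - ?P (F i s))" for i
      using N_pair[of "f s - ?P (F i s)"] by simp
    ultimately show "(\<lambda>i. state.N ((f s, 0) - (?P (F i s), 0))) \<longlonglongrightarrow> 0" by simp
  next
    have "integrable ?M (\<lambda>s. 2 * norm (f s) * K)" using int by simp
    moreover have "state.N (?P (F i s), 0) \<le> 2 * norm (f s) * K" if "s \<in> {0..T}" for i s
    proof -
      have "norm (?P (F i s)) \<le> norm (F i s) * K" by (rule K(2))
      also have "\<dots> \<le> 2 * norm (f s) * K" using K(1) by (intro mult_right_mono F(3) that) simp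
      finally show ?thesis by (simp add: N_pair)
    qed
    ultimately show "\<exists>b. integrable ?M b \<and> (\<forall>i. \<forall>s\<in>space ?M. state.N (?P (F i s), 0) \<le> b s)"
      by (intro exI[of _ "\<lambda>s. 2 * norm (f s) * K"]) auto
  qed
  then show ?thesis by blast
qed

lemma N_pair_zero: "wnorm (u, 0) = norm u"
  by (simp add: state_norm_def memory_norm_def bounded_bilinear.zero_left[OF a1_bilinear])

lemma pair_zero_in_state_space: "u \<in> L2_on \<Omega> \<Longrightarrow> (u, 0) \<in> W"
  using subspace_0[OF subspace_memory_space] by (simp add: state_space_def)

lemma kernel_measurable:
  assumes "A \<subseteq> {0..R}" "A \<in> sets \<nu>" "0 \<le> R"
  shows "(\<lambda>\<sigma>. kernel A (t - \<sigma>)) \<in> borel_measurable (lebesgue_on {0..t})"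
  by (intro continuous_imp_measurable_on_sets_lebesgue continuous_on_compose2[OF kernel_continuous[OF assms]] continuous_intros) auto

lemma orbit_memory_identity:
  assumes A: "A \<subseteq> {0..R}" "A \<in> sets \<nu>" "0 \<le> R" and u: "u \<in> L2_on \<Omega>" and t: "0 \<le> t"
  shows "memory_functional (decay A 0) h (S t (u, 0)) = integral {0..t} (\<lambda>s. kernel A (t - s) * (fst (S s (u, 0)) \<bullet> h))"
  using memory_defect_eq_0[OF A pair_zero_in_state_space[OF u] t, of h]
  by (simp add: memory_defect_def[OF A] memory_functional_def)

lemma restrict_interval_integral:
  fixes q :: "real \<Rightarrow> real"
  assumes "a \<le> s"
  shows "(\<integral>\<sigma>. (if s \<le> \<sigma> then q \<sigma> else 0) \<partial>lebesgue_on {a..b}) = (\<integral>\<sigma>. q \<sigma> \<partial>lebesgue_on {s..b})"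
proof -
  have "(\<integral>\<sigma>. (if s \<le> \<sigma> then q \<sigma> else 0) \<partial>lebesgue_on {a..b}) =
      (\<integral>\<sigma>. indicator {a..b} \<sigma> *\<^sub>R (if s \<le> \<sigma> then q \<sigma> else 0) \<partial>lebesgue)"
    by (rule integral_restrict_space) simp
  also have "\<dots> = (\<integral>\<sigma>. indicator {s..b} \<sigma> *\<^sub>R q \<sigma> \<partial>lebesgue)"
    using assms by (intro Bochner_Integration.integral_cong) (auto simp: indicator_def)
  also have "\<dots> = (\<integral>\<sigma>. q \<sigma> \<partial>lebesgue_on {s..b})"
    by (rule integral_restrict_space[symmetric]) simp
  finally show ?thesis .
qed

text \<open>Joint measurability, as required by Fubini's theorem, is inherited from the jointly simple
  approximations by rounded times and simple sources.\<close>

lemma duhamel_product_measurable: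
  assumes F: "state.simple_approx (lebesgue_on {0..T}) F Fs" and t: "0 \<le> t" "t \<le> T"
  shows "(\<lambda>p. fst (flow.duhamel F (snd p) (fst p)) \<bullet> h) \<in> borel_measurable (lebesgue_on {0..t} \<Otimes>\<^sub>M lebesgue_on {0..t})"
proof (rule borel_measurable_LIMSEQ_real)
  let ?M = "lebesgue_on {0..t}"
  let ?G = "\<lambda>n p. fst (if fst p \<le> snd p then S (disc n (snd p - fst p)) (Fs n (fst p)) else 0) \<bullet> h"
  have [measurable]: "fst \<in> borel_measurable (?M \<Otimes>\<^sub>M ?M)"
    by (rule measurable_compose[OF measurable_fst measurable_ident_interval])
  have [measurable]: "snd \<in> borel_measurable (?M \<Otimes>\<^sub>M ?M)"
    by (rule measurable_compose[OF measurable_snd measurable_ident_interval])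
  show "?G n \<in> borel_measurable (?M \<Otimes>\<^sub>M ?M)" for n
  proof -
    have "simple_function (lebesgue_on {0..T}) (Fs n)"
      using F by (auto simp: state.simple_approx_def elim: simple_bochner_integrable.cases)
    then have "simple_function ?M (Fs n)"
      by (rule simple_function_lebesgue_on_subset) (use t in simp)
    then have Fs: "finite (Fs n ` {0..t})" "Fs n \<in> measurable ?M (count_space UNIV)"
      by (auto simp: simple_function_eq_measurable)
    have 1: "simple_function (?M \<Otimes>\<^sub>M ?M) (\<lambda>p. Fs n (fst p))"
      unfolding simple_function_eq_measurable
    proof
      show "finite ((\<lambda>p. Fs n (fst p)) ` space (?M \<Otimes>\<^sub>M ?M))"
        by (rule finite_subset[OF _ Fs(1)]) (auto simp: space_pair_measure)
      show "(\<lambda>p. Fs n (fst p)) \<in> measurable (?M \<Otimes>\<^sub>M ?M) (count_space UNIV)"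
        by (rule measurable_compose[OF measurable_fst Fs(2)])
    qed
    have 2: "simple_function (?M \<Otimes>\<^sub>M ?M) (\<lambda>p. disc n (snd p - fst p))"
    proof (rule simple_function_borel_measurable)
      show "(\<lambda>p. disc n (snd p - fst p)) \<in> borel_measurable (?M \<Otimes>\<^sub>M ?M)" by measurable
      show "finite ((\<lambda>p. disc n (snd p - fst p)) ` space (?M \<Otimes>\<^sub>M ?M))"
        by (rule finite_subset[OF _ finite_disc_image[of n "- t" t]]) (auto simp: space_pair_measure)
    qed
    have "simple_function (?M \<Otimes>\<^sub>M ?M) (\<lambda>p. fst (S (disc n (snd p - fst p)) (Fs n (fst p))) \<bullet> h)"
      by (rule simple_function_compose2[OF 2 1])
    then have [measurable]: "(\<lambda>p. fst (S (disc n (snd p - fst p)) (Fs n (fst p))) \<bullet> h) \<in> borel_measurable (?M \<Otimes>\<^sub>M ?M)"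
      by (rule borel_measurable_simple_function)
    have "?G n = (\<lambda>p. if fst p \<le> snd p then fst (S (disc n (snd p - fst p)) (Fs n (fst p))) \<bullet> h else 0)"
      by auto
    also have "\<dots> \<in> borel_measurable (?M \<Otimes>\<^sub>M ?M)" by measurable
    finally show ?thesis .
  qed
  fix p assume p: "p \<in> space (?M \<Otimes>\<^sub>M ?M)"
  then have p': "fst p \<in> {0..T}" "0 \<le> snd p" "snd p \<le> T"
    using t by (auto simp: space_pair_measure)
  note d = flow.duhamel_simple_approx[OF F p'(2,3)]
  show "(\<lambda>n. ?G n p) \<longlonglongrightarrow> fst (flow.duhamel F (snd p) (fst p)) \<bullet> h"
  proof (rule state.bounded_functional_tendsto[OF bounded_functional_fst])
    show C: "(if fst p \<le> snd p then S (disc n (snd p - fst p)) (Fs n (fst p)) else 0) \<in> W"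
      "flow.duhamel F (snd p) (fst p) \<in> W" for n
      using d p'(1) unfolding state.simple_approx_def Pi_iff by auto
    have "(\<lambda>n. state.N (flow.duhamel F (snd p) (fst p) - (if fst p \<le> snd p then S (disc n (snd p - fst p)) (Fs n (fst p)) else 0))) \<longlonglongrightarrow> 0"
      using d p'(1) unfolding state.simple_approx_def by auto
    then show "(\<lambda>n. state.N ((if fst p \<le> snd p then S (disc n (snd p - fst p)) (Fs n (fst p)) else 0) - flow.duhamel F (snd p) (fst p))) \<longlonglongrightarrow> 0"
      using state.N_minus_commute[OF C(2) C(1)] by simp
  qed
qed

text \<open>\<open>G s \<sigma>\<close> is the contribution to \<open>kernel A (t - \<sigma>) * (u \<sigma> \<bullet> h)\<close> of the source at time \<open>s\<close>. Integrated over \<open>\<sigma>\<close> it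
  is the tested memory at time \<open>t\<close> that this source leaves, by the identity along orbits started at time
  \<open>s\<close>; integrated over \<open>s\<close> it is the tested Duhamel integral at time \<open>\<sigma>\<close>.\<close>

lemma duhamel_memory_identity:
  assumes A: "A \<subseteq> {0..R}" "A \<in> sets \<nu>" "0 \<le> R" and f: "f \<in> L1_data \<Omega> T"
    and I: "\<And>\<sigma>. 0 \<le> \<sigma> \<Longrightarrow> \<sigma> \<le> T \<Longrightarrow> state.integral_is (lebesgue_on {0..\<sigma>}) (\<lambda>s. S (\<sigma> - s) (f s, 0)) (I \<sigma>)"
    and t: "0 \<le> t" "t \<le> T"
  shows "memory_functional (decay A 0) h (I t) = (\<integral>\<sigma>. kernel A (t - \<sigma>) * (fst (I \<sigma>) \<bullet> h) \<partial>lebesgue_on {0..t})"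
proof -
  let ?M = "lebesgue_on {0..t}"
  define F where "F s = (f s, 0 :: real \<Rightarrow> 'd V)" for s
  obtain Fs where "state.simple_approx (lebesgue_on {0..T}) (\<lambda>s. (f s, 0)) Fs"
    using source_approx[OF f] by blast
  then have F: "state.simple_approx (lebesgue_on {0..T}) F Fs"
    by (simp add: F_def[abs_def])
  define G where "G s \<sigma> = kernel A (t - \<sigma>) * (fst (flow.duhamel F \<sigma> s) \<bullet> h)" for s \<sigma>
  interpret M: finite_measure ?M by (rule finite_measure_interval)
  interpret pair_sigma_finite ?M ?M ..
  have f_in: "f s \<in> L2_on \<Omega>" if "s \<in> {0..t}" for s
    using f that t by (auto simp: L1_data_def)
  have FC: "F s \<in> W" if "s \<in> {0..t}" for s
    using f_in[OF that] by (simp add: F_def pair_zero_in_state_space)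
  have G_meas: "case_prod G \<in> borel_measurable (?M \<Otimes>\<^sub>M ?M)"
  proof -
    have "(\<lambda>p. kernel A (t - snd p)) \<in> borel_measurable (?M \<Otimes>\<^sub>M ?M)"
      by (rule measurable_compose[OF measurable_snd kernel_measurable[OF A]])
    then have "(\<lambda>p. kernel A (t - snd p) * (fst (flow.duhamel F (snd p) (fst p)) \<bullet> h)) \<in> borel_measurable (?M \<Otimes>\<^sub>M ?M)"
      by (intro borel_measurable_times duhamel_product_measurable[OF F t])
    then show ?thesis by (simp add: G_def split_beta')
  qed
  define c where "c = measure \<nu> (space \<nu>) * norm h"
  have "integrable (lebesgue_on {0..T}) (\<lambda>s. norm (f s))"
    using f unfolding L1_data_def by (intro integrable_norm) simp
  then have int_f: "integrable ?M (\<lambda>s. c * norm (f s))"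
    by (intro integrable_mult_right) (rule integrable_subinterval_lebesgue[OF _ t(2)])
  have G_le: "norm (G s \<sigma>) \<le> c * norm (f s)" if s: "s \<in> {0..t}" and \<sigma>: "\<sigma> \<in> {0..t}" for s \<sigma>
  proof -
    have "norm (fst (flow.duhamel F \<sigma> s)) \<le> norm (f s)"
    proof (cases "s \<le> \<sigma>")
      case True
      have "norm (fst (S (\<sigma> - s) (F s))) \<le> wnorm (S (\<sigma> - s) (F s))"
        by (rule norm_fst_le_state_norm)
      also have "\<dots> \<le> wnorm (F s)"
        using flow.S_contraction[OF FC[OF s], of "\<sigma> - s"] True by (simp add: state_N_eq)
      finally show ?thesis using True by (simp add: flow.duhamel_def F_def N_pair_zero)
    qed (simp add: flow.duhamel_def)
    then have "\<bar>fst (flow.duhamel F \<sigma> s) \<bullet> h\<bar> \<le> norm (f s) * norm h"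
      by (rule order_trans[OF Cauchy_Schwarz_ineq2 mult_right_mono[OF _ norm_ge_zero]])
    then have "\<bar>kernel A (t - \<sigma>)\<bar> * \<bar>fst (flow.duhamel F \<sigma> s) \<bullet> h\<bar> \<le> measure \<nu> (space \<nu>) * (norm (f s) * norm h)"
      using kernel_bounded[OF A, of "t - \<sigma>"] \<sigma> by (intro mult_mono) auto
    then show ?thesis by (simp add: G_def abs_mult c_def ac_simps)
  qed
  have G_int: "integrable (?M \<Otimes>\<^sub>M ?M) (case_prod G)"
  proof (rule Bochner_Integration.integrable_bound[OF _ G_meas])
    show "integrable (?M \<Otimes>\<^sub>M ?M) (\<lambda>p. c * norm (f (fst p)))"
    proof (rule Fubini_integrable)
      show "(\<lambda>p. c * norm (f (fst p))) \<in> borel_measurable (?M \<Otimes>\<^sub>M ?M)"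
        by (rule measurable_compose[OF measurable_fst borel_measurable_integrable[OF int_f]])
      show "integrable ?M (\<lambda>s. \<integral>\<sigma>. norm (c * norm (f (fst (s, \<sigma>)))) \<partial>?M)"
        using integrable_norm[OF int_f] by simp
      show "AE s in ?M. integrable ?M (\<lambda>\<sigma>. c * norm (f (fst (s, \<sigma>))))" by simp
    qed
    show "AE p in ?M \<Otimes>\<^sub>M ?M. norm (case_prod G p) \<le> norm (c * norm (f (fst p)))"
    proof (rule AE_I2)
      fix p assume "p \<in> space (?M \<Otimes>\<^sub>M ?M)"
      then show "norm (case_prod G p) \<le> norm (c * norm (f (fst p)))"
        using order_trans[OF G_le[of "fst p" "snd p"] abs_ge_self] by (auto simp: space_pair_measure split_beta')
    qed
  qed
  have Lb: "state.bounded_functional (memory_functional (decay A 0) h)"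
    by (rule bounded_functional_decay[OF A order_refl])
  have inner: "memory_functional (decay A 0) h (S (t - s) (f s, 0)) = (\<integral>\<sigma>. G s \<sigma> \<partial>?M)" if s: "s \<in> {0..t}" for s
  proof -
    define p where "p \<sigma> = kernel A (t - s - \<sigma>) * (fst (S \<sigma> (F s)) \<bullet> h)" for \<sigma>
    have p_cont: "continuous_on {0..t - s} p"
      unfolding p_def by (rule kernel_shift_continuous[OF A FC[OF s]])
    have "memory_functional (decay A 0) h (S (t - s) (f s, 0)) = integral {0..t - s} p"
      unfolding p_def F_def using s by (intro orbit_memory_identity[OF A f_in]) auto
    also have "\<dots> = integral {0..t - s} ((\<lambda>\<sigma>. p (\<sigma> - s)) \<circ> (\<lambda>\<sigma>. \<sigma> + s))"
      by (simp add: comp_def)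
    also have "\<dots> = integral {0 + s..t - s + s} (\<lambda>\<sigma>. p (\<sigma> - s))"
      by (rule integral_shift) (auto intro!: continuous_on_compose2[OF p_cont] continuous_intros)
    also have "\<dots> = integral {s..t} (\<lambda>\<sigma>. p (\<sigma> - s))" by simp
    also have "\<dots> = (\<integral>\<sigma>. p (\<sigma> - s) \<partial>lebesgue_on {s..t})"
      by (intro lebesgue_integral_eq_integral[symmetric] continuous_imp_integrable_real)
        (auto intro!: continuous_on_compose2[OF p_cont] continuous_intros)
    also have "\<dots> = (\<integral>\<sigma>. (if s \<le> \<sigma> then p (\<sigma> - s) else 0) \<partial>?M)"
      by (rule restrict_interval_integral[symmetric]) (use s in simp)
    also have "\<dots> = (\<integral>\<sigma>. G s \<sigma> \<partial>?M)"
      by (intro Bochner_Integration.integral_cong) (auto simp: G_def p_def flow.duhamel_def)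
    finally show ?thesis .
  qed
  have outer: "(\<integral>s. G s \<sigma> \<partial>?M) = kernel A (t - \<sigma>) * (fst (I \<sigma>) \<bullet> h)" if \<sigma>: "\<sigma> \<in> {0..t}" for \<sigma>
  proof -
    have "fst (I \<sigma>) \<bullet> h = (\<integral>s. fst (flow.duhamel F \<sigma> s) \<bullet> h \<partial>?M)"
      by (rule flow.duhamel_functional[OF _ _ _ bounded_functional_fst])
        (use I[of \<sigma>] \<sigma> t in \<open>auto simp: F_def\<close>)
    then show ?thesis by (simp add: G_def)
  qed
  have "memory_functional (decay A 0) h (I t) = (\<integral>s. memory_functional (decay A 0) h (S (t - s) (f s, 0)) \<partial>?M)"
    by (rule state.integral_is_functional(2)[OF Lb I[OF t]])
  also have "\<dots> = (\<integral>s. (\<integral>\<sigma>. G s \<sigma> \<partial>?M) \<partial>?M)"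
    by (intro Bochner_Integration.integral_cong refl) (simp add: inner)
  also have "\<dots> = (\<integral>\<sigma>. (\<integral>s. G s \<sigma> \<partial>?M) \<partial>?M)"
    by (rule Fubini_integral[OF G_int, symmetric])
  also have "\<dots> = (\<integral>\<sigma>. kernel A (t - \<sigma>) * (fst (I \<sigma>) \<bullet> h) \<partial>?M)"
    by (intro Bochner_Integration.integral_cong refl) (simp add: outer)
  finally show ?thesis .
qed

section \<open>The memory response in \<open>\<H>\<^sub>\<nu>\<close>\<close>

lemma memory_response_weak:
  assumes A: "A \<subseteq> {0..R}" "A \<in> sets \<nu>" "0 \<le> R" and t: "0 \<le> t" and u: "continuous_on {0..t} u"
  shows "(\<integral>r. decay A 0 r * (memory_response u t r \<bullet> h) \<partial>\<nu>) = (\<integral>s. kernel A (t - s) * (u s \<bullet> h) \<partial>lebesgue_on {0..t})"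
proof -
  let ?M = "lebesgue_on {0..t}"
  interpret M: finite_measure ?M by (rule finite_measure_interval)
  interpret pair_sigma_finite \<nu> ?M ..
  have uh: "continuous_on {0..t} (\<lambda>s. u s \<bullet> h)"
    by (intro continuous_intros u)
  have uh_meas: "(\<lambda>s. u s \<bullet> h) \<in> borel_measurable ?M"
    by (intro continuous_imp_measurable_on_sets_lebesgue uh) simp
  have [measurable]: "fst \<in> borel_measurable (\<nu> \<Otimes>\<^sub>M ?M)"
    by (rule measurable_compose[OF measurable_fst measurable_ident_\<nu>])
  have [measurable]: "snd \<in> borel_measurable (\<nu> \<Otimes>\<^sub>M ?M)"
    by (rule measurable_compose[OF measurable_snd measurable_ident_interval])
  have [measurable]: "(\<lambda>p. u (snd p) \<bullet> h) \<in> borel_measurable (\<nu> \<Otimes>\<^sub>M ?M)"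
    by (rule measurable_compose[OF measurable_snd uh_meas])
  have "(\<lambda>r. indicator A r :: real) \<in> borel_measurable \<nu>"
    using A(2) by measurable
  then have [measurable]: "(\<lambda>p. indicator A (fst p) :: real) \<in> borel_measurable (\<nu> \<Otimes>\<^sub>M ?M)"
    by (rule measurable_compose[OF measurable_fst])
  define G where "G r s = decay A (t - s) r * (u s \<bullet> h)" for r s
  have G_meas: "case_prod G \<in> borel_measurable (\<nu> \<Otimes>\<^sub>M ?M)"
    unfolding G_def decay_def split_beta' by measurable
  obtain b where b: "\<And>s. s \<in> {0..t} \<Longrightarrow> norm (u s \<bullet> h) \<le> b"
    using compact_imp_bounded[OF compact_continuous_image[OF uh compact_Icc]] unfolding bounded_iff by fastforce
  have G_int: "integrable (\<nu> \<Otimes>\<^sub>M ?M) (case_prod G)"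
  proof (rule Bochner_Integration.integrable_bound[OF _ G_meas])
    show "integrable (\<nu> \<Otimes>\<^sub>M ?M) (\<lambda>p. b)"
      by (rule Fubini_integrable) auto
    show "AE p in \<nu> \<Otimes>\<^sub>M ?M. norm (case_prod G p) \<le> norm b"
    proof (rule AE_I2)
      fix p assume p: "p \<in> space (\<nu> \<Otimes>\<^sub>M ?M)"
      then have s: "snd p \<in> {0..t}" by (auto simp: space_pair_measure)
      have "\<bar>decay A (t - snd p) (fst p)\<bar> * \<bar>u (snd p) \<bullet> h\<bar> \<le> 1 * b"
        using decay_bounds(1)[OF A(1,3), of "t - snd p" "fst p"] s b[OF s]
        by (intro mult_mono) (auto simp: abs_le_iff)
      then show "norm (case_prod G p) \<le> norm b"
        by (simp add: G_def split_beta' abs_mult)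
    qed
  qed
  have inner: "decay A 0 r * (memory_response u t r \<bullet> h) = (\<integral>s. G r s \<partial>?M)" for r
  proof -
    have "integrable ?M (\<lambda>s. exp (- r * (t - s)) *\<^sub>R u s)"
      by (intro continuous_imp_integrable_interval continuous_intros u)
    then have "memory_response u t r \<bullet> h = (\<integral>s. (exp (- r * (t - s)) *\<^sub>R u s) \<bullet> h \<partial>?M)"
      unfolding memory_response_def by (rule integral_inner_left[symmetric])
    then have "decay A 0 r * (memory_response u t r \<bullet> h) = (\<integral>s. indicator A r * (exp (- r * (t - s)) * (u s \<bullet> h)) \<partial>?M)"
      by (simp add: decay_def)
    also have "\<dots> = (\<integral>s. G r s \<partial>?M)"
      by (simp add: G_def decay_def mult.assoc)
    finally show ?thesis .
  qed
  have "(\<integral>r. decay A 0 r * (memory_response u t r \<bullet> h) \<partial>\<nu>) = (\<integral>r. (\<integral>s. G r s \<partial>?M) \<partial>\<nu>)"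
    by (simp only: inner)
  also have "\<dots> = (\<integral>s. (\<integral>r. G r s \<partial>\<nu>) \<partial>?M)"
    by (rule Fubini_integral[OF G_int, symmetric])
  also have "\<dots> = (\<integral>s. kernel A (t - s) * (u s \<bullet> h) \<partial>?M)"
    by (simp add: G_def kernel_def)
  finally show ?thesis .
qed

lemma memory_response_in_H_nu:
  assumes t: "0 \<le> t" and u: "continuous_on {0..t} u" "\<And>s. s \<in> {0..t} \<Longrightarrow> u s \<in> L2_on \<Omega>"
  shows "memory_response u t \<in> H_nu \<Omega> \<nu>"
proof -
  let ?M = "lebesgue_on {0..t}"
  interpret M: finite_measure ?M by (rule finite_measure_interval)
  have u_meas: "u \<in> borel_measurable ?M"
    by (intro continuous_imp_measurable_on_sets_lebesgue u) simp
  have [measurable]: "fst \<in> borel_measurable (\<nu> \<Otimes>\<^sub>M ?M)"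
    by (rule measurable_compose[OF measurable_fst measurable_ident_\<nu>])
  have [measurable]: "snd \<in> borel_measurable (\<nu> \<Otimes>\<^sub>M ?M)"
    by (rule measurable_compose[OF measurable_snd measurable_ident_interval])
  have [measurable]: "(\<lambda>p. u (snd p)) \<in> borel_measurable (\<nu> \<Otimes>\<^sub>M ?M)"
    by (rule measurable_compose[OF measurable_snd u_meas])
  have meas: "memory_response u t \<in> borel_measurable \<nu>"
    unfolding memory_response_def[abs_def]
    by (rule M.borel_measurable_lebesgue_integral) (simp add: split_beta')
  obtain b where b: "\<And>s. s \<in> {0..t} \<Longrightarrow> norm (u s) \<le> b"
    using compact_imp_bounded[OF compact_continuous_image[OF u(1) compact_Icc]] unfolding bounded_iff by fastforce
  have "norm (u 0) \<le> b" using b[of 0] t by simp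
  then have b0: "0 \<le> b" by (rule order_trans[OF norm_ge_zero])
  have le: "norm (memory_response u t r) \<le> b * t" if r: "0 \<le> r" for r
  proof -
    have "norm (memory_response u t r) \<le> (\<integral>s. b \<partial>?M)"
      unfolding memory_response_def
    proof (rule Bochner_Integration.integral_norm_bound_integral)
      show "integrable ?M (\<lambda>s. exp (- r * (t - s)) *\<^sub>R u s)"
        by (intro continuous_imp_integrable_interval continuous_intros u)
      fix s assume "s \<in> space ?M"
      then have s: "s \<in> {0..t}" by simp
      have "exp (- r * (t - s)) * norm (u s) \<le> 1 * b"
        using r s b[OF s] by (intro mult_mono) auto
      then show "norm (exp (- r * (t - s)) *\<^sub>R u s) \<le> b" by simp
    qed simp
    then show ?thesis using t by (simp add: measure_restrict_space mult.commute)
  qed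
  have "memory_response u t r \<in> L2_on \<Omega>" for r
    unfolding memory_response_def
    by (intro integral_in_L2_on[OF sets_\<Omega>] subspace_scale[OF subspace_L2_on[OF sets_\<Omega>]] u(2)) simp
  moreover have "integrable \<nu> (\<lambda>r. (norm (memory_response u t r))\<^sup>2)"
  proof (rule \<nu>.integrable_const_bound[of _ "(b * t)\<^sup>2"])
    show "AE r in \<nu>. norm ((norm (memory_response u t r))\<^sup>2) \<le> (b * t)\<^sup>2"
      using le by (intro AE_I2) (auto simp: space_\<nu> intro!: power_mono)
    show "(\<lambda>r. (norm (memory_response u t r))\<^sup>2) \<in> borel_measurable \<nu>"
      using meas by measurable
  qed
  ultimately show ?thesis
    using meas by (simp add: H_nu_def)
qed

lemma state_memory_in_H_nu:
  assumes x: "x \<in> W"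
  shows "(\<lambda>r. fst (snd x r)) \<in> H_nu \<Omega> \<nu>"
proof -
  note mem = memory_spaceD[OF state_spaceD(2)[OF x]]
  have "(\<lambda>v :: 'd V. fst v) \<in> borel_measurable borel"
    by (intro borel_measurable_continuous_onI continuous_intros)
  then have meas: "(\<lambda>r. fst (snd x r)) \<in> borel_measurable \<nu>"
    using measurable_compose[OF mem(1)] by blast
  have "integrable \<nu> (\<lambda>r. (norm (fst (snd x r)))\<^sup>2)"
  proof (rule Bochner_Integration.integrable_bound[OF mem(4)])
    show "(\<lambda>r. (norm (fst (snd x r)))\<^sup>2) \<in> borel_measurable \<nu>"
      using meas by measurable
    have "norm (fst (snd x r)) \<le> norm (snd x r)" for r
      using norm_fst_le[of "fst (snd x r)" "snd (snd x r)"] by simp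
    then show "AE r in \<nu>. norm ((norm (fst (snd x r)))\<^sup>2) \<le> norm ((norm (snd x r))\<^sup>2)"
      by (intro AE_I2) (simp add: power_mono)
  qed
  then show ?thesis
    using meas H10_subset_L2_on[OF sets_\<Omega> mem(2)] by (simp add: H_nu_def space_\<nu>)
qed

lemma H_nu_integrable:
  assumes "z \<in> H_nu \<Omega> \<nu>"
  shows "integrable \<nu> z"
proof (rule integrable_norm_cancel)
  have "integrable \<nu> (\<lambda>r. 1 + (norm (z r))\<^sup>2)"
    using assms by (simp add: H_nu_def)
  then show "integrable \<nu> (\<lambda>r. norm (z r))"
  proof (rule Bochner_Integration.integrable_bound)
    show "(\<lambda>r. norm (z r)) \<in> borel_measurable \<nu>"
    proof -
      have [measurable]: "z \<in> borel_measurable \<nu>" using assms by (simp add: H_nu_def)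
      show ?thesis by measurable
    qed
    have "norm (z r) \<le> 1 + (norm (z r))\<^sup>2" for r
      using sum_squares_bound[of 1 "norm (z r)"] norm_ge_zero[of "z r"]
      unfolding power_one mult_1_right by linarith
    then show "AE r in \<nu>. norm (norm (z r)) \<le> norm (1 + (norm (z r))\<^sup>2)"
      by (auto intro!: AE_I2)
  qed
qed (use assms in \<open>simp add: H_nu_def\<close>)

text \<open>Bounded sets of rates suffice: on \<open>{0..n}\<close> all set integrals of the difference vanish, and the
  half-line is exhausted by these intervals.\<close>

lemma H_nu_eqI:
  assumes y: "y \<in> H_nu \<Omega> \<nu>" and z: "z \<in> H_nu \<Omega> \<nu>"
    and weak: "\<And>A R h. A \<subseteq> {0..R} \<Longrightarrow> A \<in> sets \<nu> \<Longrightarrow> 0 \<le> R \<Longrightarrow>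
      (\<integral>r. decay A 0 r * (y r \<bullet> h) \<partial>\<nu>) = (\<integral>r. decay A 0 r * (z r \<bullet> h) \<partial>\<nu>)"
  shows "H_nu_eq \<Omega> \<nu> y z"
proof -
  define d where "d r = y r - z r" for r
  have d_int: "integrable \<nu> d"
    unfolding d_def by (intro Bochner_Integration.integrable_diff H_nu_integrable y z)
  have d_ind: "integrable \<nu> (\<lambda>r. indicator A r *\<^sub>R d r)" if "A \<in> sets \<nu>" for A
    by (rule integrable_mult_indicator[OF that d_int])
  have int0: "(\<integral>r. indicator A r *\<^sub>R d r \<partial>\<nu>) = 0" if A: "A \<subseteq> {0..R}" "A \<in> sets \<nu>" "0 \<le> R" for A R
  proof -
    have "(\<integral>r. indicator A r *\<^sub>R d r \<partial>\<nu>) \<bullet> h = 0" for h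
    proof -
      have i: "integrable \<nu> (\<lambda>r. decay A 0 r * (w r \<bullet> h))" if "w \<in> H_nu \<Omega> \<nu>" for w
        using integrable_inner_left[OF integrable_mult_indicator[OF A(2) H_nu_integrable[OF that]], of h]
        by (simp add: decay_def)
      have "(\<integral>r. indicator A r *\<^sub>R d r \<partial>\<nu>) \<bullet> h = (\<integral>r. (indicator A r *\<^sub>R d r) \<bullet> h \<partial>\<nu>)"
        by (rule integral_inner_left[symmetric]) (rule d_ind[OF A(2)])
      also have "\<dots> = (\<integral>r. decay A 0 r * (y r \<bullet> h) - decay A 0 r * (z r \<bullet> h) \<partial>\<nu>)"
        by (simp add: decay_def d_def inner_diff_left right_diff_distrib)
      also have "\<dots> = 0"
        using weak[OF A, of h] i[OF y] i[OF z] by simp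
      finally show ?thesis .
    qed
    then show ?thesis using inner_eq_zero_iff by blast
  qed
  have "AE r in \<nu>. r \<le> real n \<longrightarrow> d r = 0" for n :: nat
  proof -
    have box: "{0..real n} \<in> sets \<nu>"
      unfolding \<nu>_borel by (auto simp: sets_restrict_space_iff)
    have "AE r in \<nu>. indicator {0..real n} r *\<^sub>R d r = 0"
    proof (rule \<nu>.density_zero[OF d_ind[OF box]])
      fix A assume A: "A \<in> sets \<nu>"
      have "set_lebesgue_integral \<nu> A (\<lambda>r. indicator {0..real n} r *\<^sub>R d r) = (\<integral>r. indicator (A \<inter> {0..real n}) r *\<^sub>R d r \<partial>\<nu>)"
        unfolding set_lebesgue_integral_def by (simp add: indicator_inter_arith)
      also have "\<dots> = 0"
        using A box by (intro int0[of _ "real n"]) auto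
      finally show "set_lebesgue_integral \<nu> A (\<lambda>r. indicator {0..real n} r *\<^sub>R d r) = 0" .
    qed
    then show ?thesis
    proof (rule AE_mp, intro AE_I2 impI)
      fix r assume "r \<in> space \<nu>" "indicator {0..real n} r *\<^sub>R d r = 0" "r \<le> real n"
      then show "d r = 0" by (simp add: space_\<nu> indicator_def)
    qed
  qed
  then have "AE r in \<nu>. \<forall>n::nat. r \<le> real n \<longrightarrow> d r = 0"
    by (intro AE_all_countable[THEN iffD2] allI)
  then have "AE r in \<nu>. y r = z r"
  proof (rule AE_mp, intro AE_I2 impI)
    fix r assume "\<forall>n::nat. r \<le> real n \<longrightarrow> d r = 0"
    then show "y r = z r"
      using real_arch_simple[of r] by (auto simp: d_def)
  qed
  then show ?thesis
    using y z by (simp add: H_nu_eq_def)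
qed

section \<open>Mild solutions\<close>

lemma has_bochner_integral_on_eq:
  assumes "has_bochner_integral_on (W) (wnorm) M g I"
    and "state.integral_is M g J"
  shows "wnorm (I - J) = 0"
  using state.has_bochner_integral_on_unique[of M g I J] state.integral_is_imp_has_bochner_integral_on[OF assms(2)]
    assms(1) by (simp add: state_N_eq)

lemma ex_duhamel_family:
  assumes "f \<in> L1_data \<Omega> T"
  obtains I where "\<forall>t\<in>{0..T}. state.integral_is (lebesgue_on {0..t}) (\<lambda>s. S (t - s) (f s, 0)) (I t)"
proof -
  obtain Fs where Fs: "state.simple_approx (lebesgue_on {0..T}) (\<lambda>s. (f s, 0)) Fs"
    using source_approx[OF assms] by blast
  have "\<forall>t\<in>{0..T}. \<exists>I. state.integral_is (lebesgue_on {0..t}) (\<lambda>s. S (t - s) (f s, 0)) I"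
    using flow.ex_duhamel_integral[OF Fs] by simp
  from bchoice[OF this] show ?thesis using that by blast
qed

lemma state_eq_iff_N: "x \<in> W \<Longrightarrow> y \<in> W \<Longrightarrow> state_eq \<nu> x y \<longleftrightarrow> state.N (x - y) = 0"
  using state_null_iff by (simp add: state_N_eq)

text \<open>The integrals in the definition may be replaced by one chosen family \<open>I\<close>, by uniqueness of integrals up to
  null vectors.\<close>

lemma mild_solution_iff:
  assumes u0: "u0 \<in> L2_on \<Omega>"
    and I: "\<forall>t\<in>{0..T}. state.integral_is (lebesgue_on {0..t}) (\<lambda>s. S (t - s) (f s, 0)) (I t)"
  shows "mild_solution \<Omega> A1 \<nu> S T u0 f X \<longleftrightarrow>
    (\<forall>t\<in>{0..T}. X t \<in> W \<and> state.N (X t - (S t (u0, 0) + I t)) = 0)"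
proof -
  have one: "(\<exists>J. has_bochner_integral_on (W) (wnorm) (lebesgue_on {0..t})
      (\<lambda>s. S (t - s) (f s, 0)) J \<and> state_eq \<nu> x (S t (u0, 0) + J)) \<longleftrightarrow> state.N (x - (S t (u0, 0) + I t)) = 0"
    if t: "t \<in> {0..T}" and x: "x \<in> W" for t x
  proof
    have It: "I t \<in> W" and S0: "S t (u0, 0) \<in> W"
      using I t pair_zero_in_state_space[OF u0] by (auto simp: state.integral_is_def)
    {
      assume "\<exists>J. has_bochner_integral_on (W) (wnorm) (lebesgue_on {0..t})
        (\<lambda>s. S (t - s) (f s, 0)) J \<and> state_eq \<nu> x (S t (u0, 0) + J)"
      then obtain J where J: "has_bochner_integral_on (W) (wnorm) (lebesgue_on {0..t})
        (\<lambda>s. S (t - s) (f s, 0)) J" "state_eq \<nu> x (S t (u0, 0) + J)" by blast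
      have JC: "J \<in> W" using J(1) by (simp add: has_bochner_integral_on_def)
      have "state.N (J - I t) = 0"
        using has_bochner_integral_on_eq[OF J(1) bspec[OF I t]] by (simp add: state_N_eq)
      then have "state.N ((S t (u0, 0) + J) - (S t (u0, 0) + I t)) = 0" by simp
      moreover have "state.N (x - (S t (u0, 0) + J)) = 0"
        using J(2) x S0 JC state_eq_iff_N[of x "S t (u0, 0) + J"] by auto
      ultimately show "state.N (x - (S t (u0, 0) + I t)) = 0"
        using x S0 JC It state.N_null_trans[of x "S t (u0, 0) + J" "S t (u0, 0) + I t"] by auto
    }
    assume "state.N (x - (S t (u0, 0) + I t)) = 0"
    then have "state_eq \<nu> x (S t (u0, 0) + I t)"
      using x S0 It state_eq_iff_N[of x "S t (u0, 0) + I t"] by auto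
    moreover have "has_bochner_integral_on (W) (wnorm) (lebesgue_on {0..t})
        (\<lambda>s. S (t - s) (f s, 0)) (I t)"
      using state.integral_is_imp_has_bochner_integral_on[OF bspec[OF I t]] by (simp add: state_N_eq)
    ultimately show "\<exists>J. has_bochner_integral_on (W) (wnorm) (lebesgue_on {0..t})
        (\<lambda>s. S (t - s) (f s, 0)) J \<and> state_eq \<nu> x (S t (u0, 0) + J)" by blast
  qed
  show ?thesis
    unfolding mild_solution_def using one by blast
qed

context
  fixes T :: real and u0 :: "'d H" and f :: "real \<Rightarrow> 'd H"
  assumes T: "0 < T" and u0: "u0 \<in> L2_on \<Omega>" and f: "f \<in> L1_data \<Omega> T"
begin

lemma ex_mild_solution: "\<exists>X. mild_solution \<Omega> A1 \<nu> S T u0 f X"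
proof -
  obtain I where I: "\<forall>t\<in>{0..T}. state.integral_is (lebesgue_on {0..t}) (\<lambda>s. S (t - s) (f s, 0)) (I t)"
    using ex_duhamel_family[OF f] by blast
  have "I t \<in> W" if "t \<in> {0..T}" for t
    using I that by (simp add: state.integral_is_def)
  then have "mild_solution \<Omega> A1 \<nu> S T u0 f (\<lambda>t. S t (u0, 0) + I t)"
    unfolding mild_solution_iff[OF u0 I] using pair_zero_in_state_space[OF u0] by (auto simp: state.N_zero)
  then show ?thesis by blast
qed

lemma mild_solution_unique:
  assumes X: "mild_solution \<Omega> A1 \<nu> S T u0 f X" and Y: "mild_solution \<Omega> A1 \<nu> S T u0 f Y" and t: "t \<in> {0..T}"
  shows "state_eq \<nu> (X t) (Y t)"
proof -
  obtain I where I: "\<forall>t\<in>{0..T}. state.integral_is (lebesgue_on {0..t}) (\<lambda>s. S (t - s) (f s, 0)) (I t)"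
    using ex_duhamel_family[OF f] by blast
  have "I t \<in> W"
    using I t by (simp add: state.integral_is_def)
  then have U: "S t (u0, 0) + I t \<in> W"
    using pair_zero_in_state_space[OF u0] t by auto
  have XY: "X t \<in> W" "Y t \<in> W"
    "state.N (X t - (S t (u0, 0) + I t)) = 0" "state.N (Y t - (S t (u0, 0) + I t)) = 0"
    using X Y t unfolding mild_solution_iff[OF u0 I] by blast+
  have "state.N (X t - Y t) = 0"
    using state.N_null_trans[OF XY(1) U XY(2) XY(3)] XY(4) state.N_minus_commute[OF XY(2) U] by simp
  then show ?thesis
    using state_eq_iff_N[OF XY(1,2)] by simp
qed

lemma mild_solution_memory_graph:
  assumes X: "mild_solution \<Omega> A1 \<nu> S T u0 f X"
  shows "X \<in> memory_graph_space \<Omega> A1 \<nu> T" "memory_graph_norm \<Omega> A1 \<nu> T X \<le> norm u0 + L1_norm T f"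
proof -
  obtain I where I: "\<forall>t\<in>{0..T}. state.integral_is (lebesgue_on {0..t}) (\<lambda>s. S (t - s) (f s, 0)) (I t)"
    using ex_duhamel_family[OF f] by blast
  obtain Fs where Fs: "state.simple_approx (lebesgue_on {0..T}) (\<lambda>s. (f s, 0)) Fs"
    using source_approx[OF f] by blast
  note x0 = pair_zero_in_state_space[OF u0]
  define U where "U t = S t (u0, 0) + I t" for t
  have IC: "I t \<in> W" if "t \<in> {0..T}" for t
    using I that by (simp add: state.integral_is_def)
  have UC: "U t \<in> W" if "t \<in> {0..T}" for t
    using IC[OF that] x0 that by (auto simp: U_def)
  have XC: "X t \<in> W" and XU: "state.N (X t - U t) = 0" if "t \<in> {0..T}" for t
    using X that unfolding mild_solution_iff[OF u0 I] U_def by blast+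
  have cont: "((\<lambda>s. wnorm (X s - X t)) \<longlongrightarrow> 0) (at t within {0..T})" if t: "t \<in> {0..T}" for t
  proof (rule Lim_null_comparison)
    have "((\<lambda>s. state.N (S s (u0, 0) - S t (u0, 0))) \<longlongrightarrow> 0) (at t within {0..T})"
      by (rule tendsto_within_subset[OF flow.orbit_continuous[OF x0]]) (use t in auto)
    moreover have "((\<lambda>s. state.N (I s - I t)) \<longlongrightarrow> 0) (at t within {0..T})"
      by (rule flow.duhamel_continuous[OF Fs]) (use I t in auto)
    ultimately show "((\<lambda>s. state.N (S s (u0, 0) - S t (u0, 0)) + state.N (I s - I t)) \<longlongrightarrow> 0) (at t within {0..T})"
      by (rule tendsto_add_zero)
    have "norm (wnorm (X s - X t)) \<le> state.N (S s (u0, 0) - S t (u0, 0)) + state.N (I s - I t)"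
      if s: "s \<in> {0..T}" for s
    proof -
      have "wnorm (X s - X t) = state.N (U s - U t)"
        using state.N_null_diff_cong[OF XC[OF s] XC[OF t] UC[OF s] UC[OF t] XU[OF s] XU[OF t]]
        by (simp add: state_N_eq)
      also have "U s - U t = (S s (u0, 0) - S t (u0, 0)) + (I s - I t)" by (simp add: U_def)
      also have "state.N \<dots> \<le> state.N (S s (u0, 0) - S t (u0, 0)) + state.N (I s - I t)"
        by (intro state.N_triangle state.in_C IC flow.S_in_C x0) (use s t in auto)
      finally show ?thesis
        by (simp add: state_norm_def)
    qed
    then show "\<forall>\<^sub>F s in at t within {0..T}. norm (wnorm (X s - X t)) \<le>
        state.N (S s (u0, 0) - S t (u0, 0)) + state.N (I s - I t)"
      by (auto simp: eventually_at_filter)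
  qed
  have u_cont: "continuous_on {0..T} (\<lambda>s. fst (X s))"
    unfolding continuous_on_def
  proof
    fix t assume t: "t \<in> {0..T}"
    show "((\<lambda>s. fst (X s)) \<longlongrightarrow> fst (X t)) (at t within {0..T})"
    proof (rule LIM_zero_cancel, rule Lim_null_comparison[OF _ cont[OF t]])
      show "\<forall>\<^sub>F s in at t within {0..T}. norm (fst (X s) - fst (X t)) \<le> wnorm (X s - X t)"
        using norm_fst_le_state_norm[of "X _ - X t"] by simp
    qed
  qed
  have graph: "H_nu_eq \<Omega> \<nu> (\<lambda>r. fst (snd (X t) r)) (memory_response (\<lambda>s. fst (X s)) t)" if t: "t \<in> {0..T}" for t
  proof (rule H_nu_eqI)
    have ut: "continuous_on {0..t} (\<lambda>s. fst (X s))"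
      by (rule continuous_on_subset[OF u_cont]) (use t in auto)
    show "(\<lambda>r. fst (snd (X t) r)) \<in> H_nu \<Omega> \<nu>"
      by (rule state_memory_in_H_nu[OF XC[OF t]])
    show "memory_response (\<lambda>s. fst (X s)) t \<in> H_nu \<Omega> \<nu>"
      by (rule memory_response_in_H_nu[OF _ ut]) (use t XC state_spaceD(1) in auto)
    fix A R h assume A: "A \<subseteq> {0..R}" "A \<in> sets \<nu>" "0 \<le> (R :: real)"
    let ?M = "lebesgue_on {0..t}"
    have Lb: "state.bounded_functional (memory_functional (decay A 0) h)"
      by (rule bounded_functional_decay[OF A order_refl])
    have S_cont: "continuous_on {0..t} (\<lambda>s. kernel A (t - s) * (fst (S s (u0, 0)) \<bullet> h))"
      by (rule kernel_shift_continuous[OF A x0])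
    have X_cont: "continuous_on {0..t} (\<lambda>s. kernel A (t - s) * (fst (X s) \<bullet> h))"
      by (intro continuous_on_mult continuous_on_inner continuous_on_const ut
          continuous_on_compose2[OF kernel_continuous[OF A]] continuous_intros) auto
    have split: "fst (X s) \<bullet> h = fst (S s (u0, 0)) \<bullet> h + fst (I s) \<bullet> h" if s: "s \<in> {0..T}" for s
      using state.bounded_functional_null[OF bounded_functional_fst XC[OF s] UC[OF s] XU[OF s], of h]
      by (simp add: U_def inner_add_left)
    have I_int: "integrable ?M (\<lambda>s. kernel A (t - s) * (fst (I s) \<bullet> h))"
    proof -
      have "integrable ?M (\<lambda>s. kernel A (t - s) * (fst (X s) \<bullet> h) - kernel A (t - s) * (fst (S s (u0, 0)) \<bullet> h))"
        by (intro Bochner_Integration.integrable_diff continuous_imp_integrable_real X_cont S_cont)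
      moreover have "kernel A (t - s) * (fst (X s) \<bullet> h) - kernel A (t - s) * (fst (S s (u0, 0)) \<bullet> h) = kernel A (t - s) * (fst (I s) \<bullet> h)"
        if "s \<in> space ?M" for s
        using split[of s] that t by (simp add: algebra_simps)
      ultimately show ?thesis
        by (rule Bochner_Integration.integrable_cong[OF refl, THEN iffD1, rotated])
    qed
    have "(\<integral>r. decay A 0 r * (fst (snd (X t) r) \<bullet> h) \<partial>\<nu>) = memory_functional (decay A 0) h (X t)"
      by (simp add: memory_functional_def)
    also have "\<dots> = memory_functional (decay A 0) h (U t)"
      by (rule state.bounded_functional_null[OF Lb XC[OF t] UC[OF t] XU[OF t]])
    also have "\<dots> = memory_functional (decay A 0) h (S t (u0, 0)) + memory_functional (decay A 0) h (I t)"
      unfolding U_def using t x0 IC by (intro state.bounded_functionalD(1)[OF Lb]) auto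
    also have "memory_functional (decay A 0) h (S t (u0, 0)) = (\<integral>s. kernel A (t - s) * (fst (S s (u0, 0)) \<bullet> h) \<partial>?M)"
      using orbit_memory_identity[OF A u0, of t h] t
      by (simp add: lebesgue_integral_eq_integral[OF continuous_imp_integrable_real[OF S_cont]])
    also have "memory_functional (decay A 0) h (I t) = (\<integral>s. kernel A (t - s) * (fst (I s) \<bullet> h) \<partial>?M)"
      by (rule duhamel_memory_identity[OF A f]) (use I t in auto)
    also have "(\<integral>s. kernel A (t - s) * (fst (S s (u0, 0)) \<bullet> h) \<partial>?M) + (\<integral>s. kernel A (t - s) * (fst (I s) \<bullet> h) \<partial>?M) =
        (\<integral>s. kernel A (t - s) * (fst (S s (u0, 0)) \<bullet> h) + kernel A (t - s) * (fst (I s) \<bullet> h) \<partial>?M)"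
      by (intro Bochner_Integration.integral_add[symmetric] continuous_imp_integrable_real S_cont I_int)
    also have "\<dots> = (\<integral>s. kernel A (t - s) * (fst (X s) \<bullet> h) \<partial>?M)"
      using split t by (intro Bochner_Integration.integral_cong refl) (simp add: distrib_left)
    also have "\<dots> = (\<integral>r. decay A 0 r * (memory_response (\<lambda>s. fst (X s)) t r \<bullet> h) \<partial>\<nu>)"
      by (rule memory_response_weak[OF A _ ut, symmetric]) (use t in simp)
    finally show "(\<integral>r. decay A 0 r * (fst (snd (X t) r) \<bullet> h) \<partial>\<nu>) =
        (\<integral>r. decay A 0 r * (memory_response (\<lambda>s. fst (X s)) t r \<bullet> h) \<partial>\<nu>)" .
  qed
  show "X \<in> memory_graph_space \<Omega> A1 \<nu> T"
    unfolding memory_graph_space_def continuous_paths_def using XC cont graph by blast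
  show "memory_graph_norm \<Omega> A1 \<nu> T X \<le> norm u0 + L1_norm T f"
    unfolding memory_graph_norm_def
  proof (rule cSUP_least)
    show "{0..T} \<noteq> {}" using T by simp
    fix t assume t: "t \<in> {0..T}"
    have "wnorm (X t) = state.N (U t)"
      using state.N_null_cong[OF XC[OF t] UC[OF t] XU[OF t]] by (simp add: state_N_eq)
    also have "\<dots> \<le> state.N (S t (u0, 0)) + state.N (I t)"
      unfolding U_def by (rule state.N_triangle) (use t IC x0 in auto)
    also have "state.N (S t (u0, 0)) \<le> norm u0"
      using flow.S_contraction[OF x0, of t] t by (simp add: state_N_eq N_pair_zero)
    also have "state.N (I t) \<le> L1_norm T f"
      using flow.duhamel_N_le[OF Fs _ _ bspec[OF I t]] t by (simp add: state_N_eq N_pair_zero L1_norm_def)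
    finally show "wnorm (X t) \<le> norm u0 + L1_norm T f" by simp
  qed
qed

end

text \<open>All three Duhamel integrals are compared after
  applying the functionals \<open>state_inner _ z\<close>, where linearity of \<open>S\<close> and of the real integral is exact.\<close>

lemma mild_solution_diff:
  assumes u01: "u01 \<in> L2_on \<Omega>" and u02: "u02 \<in> L2_on \<Omega>"
    and f1: "f1 \<in> L1_data \<Omega> T" and f2: "f2 \<in> L1_data \<Omega> T"
    and X1: "mild_solution \<Omega> A1 \<nu> S T u01 f1 X1" and X2: "mild_solution \<Omega> A1 \<nu> S T u02 f2 X2"
  shows "u01 - u02 \<in> L2_on \<Omega>" "(\<lambda>t. f1 t - f2 t) \<in> L1_data \<Omega> T"
    "mild_solution \<Omega> A1 \<nu> S T (u01 - u02) (\<lambda>t. f1 t - f2 t) (\<lambda>t. X1 t - X2 t)"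
proof -
  note sub = subspace_diff[OF subspace_L2_on[OF sets_\<Omega>]]
  show u0: "u01 - u02 \<in> L2_on \<Omega>" by (rule sub[OF u01 u02])
  show f: "(\<lambda>t. f1 t - f2 t) \<in> L1_data \<Omega> T"
    using f1 f2 sub by (auto simp: L1_data_def)
  obtain I1 where I1: "\<forall>t\<in>{0..T}. state.integral_is (lebesgue_on {0..t}) (\<lambda>s. S (t - s) (f1 s, 0)) (I1 t)"
    using ex_duhamel_family[OF f1] by blast
  obtain I2 where I2: "\<forall>t\<in>{0..T}. state.integral_is (lebesgue_on {0..t}) (\<lambda>s. S (t - s) (f2 s, 0)) (I2 t)"
    using ex_duhamel_family[OF f2] by blast
  obtain I where I: "\<forall>t\<in>{0..T}. state.integral_is (lebesgue_on {0..t}) (\<lambda>s. S (t - s) (f1 s - f2 s, 0)) (I t)"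
    using ex_duhamel_family[OF f] by blast
  note x1 = pair_zero_in_state_space[OF u01] and x2 = pair_zero_in_state_space[OF u02]
    and x = pair_zero_in_state_space[OF u0]
  have "X1 t - X2 t \<in> W \<and> state.N ((X1 t - X2 t) - (S t (u01 - u02, 0) + I t)) = 0"
    if t: "t \<in> {0..T}" for t
  proof
    have t': "0 \<le> t" "t \<le> T" using t by auto
    note IC = bspec[OF I1 t] bspec[OF I2 t] bspec[OF I t]
    have C: "I1 t \<in> W" "I2 t \<in> W" "I t \<in> W"
      using IC by (auto simp: state.integral_is_def)
    have SC: "S t (u01, 0) \<in> W" "S t (u02, 0) \<in> W"
      "S t (u01 - u02, 0) \<in> W"
      using x1 x2 x t' by auto
    have XC: "X1 t \<in> W" "X2 t \<in> W"
      and XN: "state.N (X1 t - (S t (u01, 0) + I1 t)) = 0" "state.N (X2 t - (S t (u02, 0) + I2 t)) = 0"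
      using X1 X2 t unfolding mild_solution_iff[OF u01 I1] mild_solution_iff[OF u02 I2] by blast+
    show "X1 t - X2 t \<in> W" using XC by auto
    show "state.N ((X1 t - X2 t) - (S t (u01 - u02, 0) + I t)) = 0"
    proof (rule flow.null_weakI)
      fix z assume z: "z \<in> W"
      note L = state.bounded_functional_B[OF z]
      have S_diff: "state_inner (S \<tau> (a - b, 0)) z = state_inner (S \<tau> (a, 0)) z - state_inner (S \<tau> (b, 0)) z"
        if "0 \<le> \<tau>" "a \<in> L2_on \<Omega>" "b \<in> L2_on \<Omega>" for \<tau> a b
        using state.bounded_functionalD(3)[OF flow.functional_B_S[OF z that(1)]
            pair_zero_in_state_space[OF that(2)] pair_zero_in_state_space[OF that(3)]] by simp
      have "state_inner (I t) z = (\<integral>s. state_inner (S (t - s) (f1 s - f2 s, 0)) z \<partial>lebesgue_on {0..t})"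
        by (rule state.integral_is_functional(2)[OF L IC(3)])
      also have "\<dots> = (\<integral>s. state_inner (S (t - s) (f1 s, 0)) z - state_inner (S (t - s) (f2 s, 0)) z \<partial>lebesgue_on {0..t})"
        using f1 f2 t' by (intro Bochner_Integration.integral_cong refl S_diff) (auto simp: L1_data_def)
      also have "\<dots> = state_inner (I1 t) z - state_inner (I2 t) z"
        using state.integral_is_functional[OF L IC(1)] state.integral_is_functional[OF L IC(2)] by simp
      finally have I_eq: "state_inner (I t) z = state_inner (I1 t) z - state_inner (I2 t) z" .
      have "state_inner (X1 t) z = state_inner (S t (u01, 0) + I1 t) z"
        by (rule state.bounded_functional_null[OF L _ _ XN(1)]) (use XC SC C in auto)
      moreover have "state_inner (X2 t) z = state_inner (S t (u02, 0) + I2 t) z"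
        by (rule state.bounded_functional_null[OF L _ _ XN(2)]) (use XC SC C in auto)
      ultimately show "state_inner (X1 t - X2 t) z = state_inner (S t (u01 - u02, 0) + I t) z"
        using XC SC C z I_eq S_diff[OF t'(1) u01 u02] by (simp add: state.B_bilinear)
    qed (use XC SC C in auto)
  qed
  then show "mild_solution \<Omega> A1 \<nu> S T (u01 - u02) (\<lambda>t. f1 t - f2 t) (\<lambda>t. X1 t - X2 t)"
    unfolding mild_solution_iff[OF u0 I] by blast
qed

end

section \<open>Well-posedness in the memory graph space\<close>

theorem corollary3p5:
  fixes \<Omega> :: "(real ^ 'd) set"
    and A0 A1 :: "real ^ 'd \<Rightarrow> real ^ 'd ^ 'd"
    and \<nu> :: "real measure"
    and T \<beta> :: real
    and S :: "real \<Rightarrow> 'd state \<Rightarrow> 'd state"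
  assumes dim: "CARD('d) \<in> {1, 2, 3}"
    and \<Omega>: "bounded_Lipschitz_domain \<Omega>"
    and T: "0 < T"
    and A0: "symmetric_Linfty \<Omega> A0"
    and A1: "symmetric_Linfty \<Omega> A1"
    and A1_psd: "AE x in lebesgue_on \<Omega>. \<forall>\<xi>. 0 \<le> (A1 x *v \<xi>) \<bullet> \<xi>"
    and \<nu>_borel: "sets \<nu> = sets (restrict_space borel {0..})"
    and \<nu>_mass: "0 < emeasure \<nu> {0..}" "emeasure \<nu> {0..} < \<infinity>"
    and a0_bounded: "\<exists>C. \<forall>w\<in>H10 \<Omega>. \<forall>v\<in>H10 \<Omega>. \<bar>form \<Omega> A0 w v\<bar> \<le> C * norm w * norm v"
    and a1_bounded: "\<exists>C. \<forall>w\<in>H10 \<Omega>. \<forall>v\<in>H10 \<Omega>. \<bar>form \<Omega> A1 w v\<bar> \<le> C * norm w * norm v"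
    and a0_nonneg: "\<forall>v\<in>H10 \<Omega>. 0 \<le> form \<Omega> A0 v v"
    and \<beta>: "0 < \<beta>"
    and a1_coercive: "\<forall>v\<in>H10 \<Omega>. \<beta> * (norm (snd v))\<^sup>2 \<le> form \<Omega> A1 v v"
    and S_semigroup: "C0_semigroup_on (state_space \<Omega> A1 \<nu>) (state_norm \<Omega> A1 \<nu>) S"
    and S_generator:
      "generator_on (state_space \<Omega> A1 \<nu>) (state_norm \<Omega> A1 \<nu>) S = memory_generator \<Omega> A0 A1 \<nu>"
  shows
    "(\<forall>u0\<in>L2_on \<Omega>. \<forall>f\<in>L1_data \<Omega> T.
        (\<exists>X. mild_solution \<Omega> A1 \<nu> S T u0 f X) \<and>
        (\<forall>X Y. mild_solution \<Omega> A1 \<nu> S T u0 f X \<longrightarrow> mild_solution \<Omega> A1 \<nu> S T u0 f Y \<longrightarrow>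
           (\<forall>t\<in>{0..T}. state_eq \<nu> (X t) (Y t))) \<and>
        (\<forall>X. mild_solution \<Omega> A1 \<nu> S T u0 f X \<longrightarrow>
           X \<in> memory_graph_space \<Omega> A1 \<nu> T \<and>
           memory_graph_norm \<Omega> A1 \<nu> T X \<le> norm u0 + L1_norm T f)) \<and>
     (\<forall>u01\<in>L2_on \<Omega>. \<forall>u02\<in>L2_on \<Omega>. \<forall>f1\<in>L1_data \<Omega> T. \<forall>f2\<in>L1_data \<Omega> T. \<forall>X1 X2.
        mild_solution \<Omega> A1 \<nu> S T u01 f1 X1 \<longrightarrow> mild_solution \<Omega> A1 \<nu> S T u02 f2 X2 \<longrightarrow>
        (\<lambda>t. X1 t - X2 t) \<in> memory_graph_space \<Omega> A1 \<nu> T \<and>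
        memory_graph_norm \<Omega> A1 \<nu> T (\<lambda>t. X1 t - X2 t)
          \<le> norm (u01 - u02) + L1_norm T (\<lambda>t. f1 t - f2 t))"
proof -
  interpret memory_semigroup \<Omega> A0 A1 \<nu> \<beta> S
  proof
    show "open \<Omega>" "bounded \<Omega>"
      using \<Omega> by (auto simp: bounded_Lipschitz_domain_def)
  qed (use assms in auto)
  show ?thesis
  proof (intro conjI ballI allI impI)
    fix u0 :: "'d H" and f :: "real \<Rightarrow> 'd H" assume data: "u0 \<in> L2_on \<Omega>" "f \<in> L1_data \<Omega> T"
    show "\<exists>X. mild_solution \<Omega> A1 \<nu> S T u0 f X"
      by (rule ex_mild_solution[OF T data])
    show "state_eq \<nu> (X t) (Y t)"
      if "mild_solution \<Omega> A1 \<nu> S T u0 f X" "mild_solution \<Omega> A1 \<nu> S T u0 f Y" "t \<in> {0..T}" for X Y t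
      by (rule mild_solution_unique[OF T data that])
    show "X \<in> memory_graph_space \<Omega> A1 \<nu> T" "memory_graph_norm \<Omega> A1 \<nu> T X \<le> norm u0 + L1_norm T f"
      if "mild_solution \<Omega> A1 \<nu> S T u0 f X" for X
      using mild_solution_memory_graph[OF T data that] by blast+
  next
    fix u01 u02 :: "'d H" and f1 f2 :: "real \<Rightarrow> 'd H" and X1 X2
    assume "u01 \<in> L2_on \<Omega>" "u02 \<in> L2_on \<Omega>" "f1 \<in> L1_data \<Omega> T" "f2 \<in> L1_data \<Omega> T"
      "mild_solution \<Omega> A1 \<nu> S T u01 f1 X1" "mild_solution \<Omega> A1 \<nu> S T u02 f2 X2"
    from mild_solution_memory_graph[OF T mild_solution_diff[OF this]]
    show "(\<lambda>t. X1 t - X2 t) \<in> memory_graph_space \<Omega> A1 \<nu> T"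
      "memory_graph_norm \<Omega> A1 \<nu> T (\<lambda>t. X1 t - X2 t) \<le> norm (u01 - u02) + L1_norm T (\<lambda>t. f1 t - f2 t)"
      by blast+
  qed
qed

end
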